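(* Let $d\ge2$, let $\Omega\subset\mathbb R^d$ be a bounded region with smooth boundary, let $A,V,\sigma$ satisfy the standing assumptions in the context, and suppose $\sigma<0$ on $\partial\Omega$. Let $\lambda_j^{\mathscr R_-}$ be the $j$-th eigenvalue of the magnetic Schrödinger operator $H_{A,V}^{\mathscr R}$ with Robin boundary condition, and suppose $0<\lambda_1^{\mathscr R_-}<\lambda_2^{\mathscr R_-}\le\lambda_3^{\mathscr R_-}\le\cdots$. Then for any $k\in\mathbb N$, $$\sum_{j=1}^k\lambda_j^{\mathscr R_-}\le \mathcal C_{d,k}(\Omega)+k^2\frac{\|A\|_{L^2(\Omega)}^2}{\mathrm{Vol}(\Omega)}+k\frac{\|V\|_{L^1(\Omega)}}{\mathrm{Vol}(\Omega)}.$$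
   Context: $\mathbb N=\{1,2,3,\dots\}$. $H_{A,V}^{\mathscr R}=(D_x-A)^2+V$, $D_x=\frac1i\nabla_x$, is the operator on $L^2(\Omega)$ with Robin boundary condition $(\nabla-iA)u\cdot\mathbf n=-\sigma u$ on $\partial\Omega$ ($\mathbf n$ the outer normal), defined by closing the quadratic form $$q[u]=\|(\nabla-iA)u\|_{L^2(\Omega)}^2+\langle Vu,u\rangle_{L^2(\Omega)}+\int_{\partial\Omega}\sigma(x)|u(x)|^2\,dS$$ on $\{u\in L^2(\Omega):(\nabla-iA)u\in L^2(\Omega)^d,\ V^{1/2}u\in L^2(\Omega)\}$, $dS$ the surface measure. Standing assumptions: $A:\Omega\to\mathbb R^d$ is in $L^2_{\rm loc}(\Omega)^d$; $V:\Omega\to\mathbb R$, $0\le V\in L^1_{\rm loc}(\Omega)$; $\sigma\in L^\infty(\partial\Omega)$ is real valued; $(H_{A,V}^{\mathscr R}+1)^{-1}$ is compact on $L^2(\Omega)$. Eigenvalues are enumerated in nondecreasing order, repeated according to multiplicity. $\omega_d$ denotes the volume of the unit ball of $\mathbb R^d$, and $$\mathcal C_{d,k}(\Omega)=\frac{d}{d+2}(2\pi)^2\left(\omega_d\,\mathrm{Vol}(\Omega)\right)^{-2/d}k^{1+2/d}.$$ Norms may take the value $+\infty$. *)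

theory Defs
  imports "HOL-Analysis.Analysis" "HOL-Library.Extended_Nat"
begin

primrec Ck :: "nat \<Rightarrow> ('a::real_normed_vector \<Rightarrow> 'b::real_normed_vector) \<Rightarrow> bool" where
  "Ck 0 f \<longleftrightarrow> continuous_on UNIV f"
| "Ck (Suc k) f \<longleftrightarrow> (\<forall>x. f differentiable (at x)) \<and> (\<forall>v. Ck k (\<lambda>x. frechet_derivative f (at x) v))"

definition smooth :: "('a::real_normed_vector \<Rightarrow> 'b::real_normed_vector) \<Rightarrow> bool" where
  "smooth f \<longleftrightarrow> (\<forall>k. Ck k f)"

text \<open>Near each boundary point the domain lies on one side of the graph of a smooth function of
  \<open>d - 1\<close> of the coordinates, up to the choice and the orientation of the remaining coordinate
  axis. A function of the \<open>d - 1\<close> coordinates other than \<open>i\<close> is a function on the whole space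
  that ignores the \<open>i\<close>-th one.\<close>

definition smooth_boundary :: "(real^'n) set \<Rightarrow> bool" where
  "smooth_boundary \<Omega> \<longleftrightarrow>
     (\<forall>p\<in>frontier \<Omega>. \<exists>r>0. \<exists>i. \<exists>s\<in>{1, -1}. \<exists>\<gamma>::real^'n \<Rightarrow> real.
        smooth \<gamma> \<and> (\<forall>x y. (\<forall>j. j \<noteq> i \<longrightarrow> x $ j = y $ j) \<longrightarrow> \<gamma> x = \<gamma> y) \<and>
        \<Omega> \<inter> ball p r = {x \<in> ball p r. s * x $ i > \<gamma> x})"

text \<open>Hausdorff measure of integer dimension \<open>s \<ge> 1\<close>, normalised so that it agrees with the
  Lebesgue measure in dimension \<open>s\<close>; on the Borel sets the outer measure is a measure by
  Caratheodory's criterion. The sets of a cover are required to be bounded because \<open>diameter\<close>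
  has no meaning on unbounded sets.\<close>

definition hausdorff_content :: "nat \<Rightarrow> real \<Rightarrow> 'a::metric_space set \<Rightarrow> ennreal" where
  "hausdorff_content s \<delta> E =
     (INF C\<in>{C::nat \<Rightarrow> 'a set. E \<subseteq> (\<Union>n. C n) \<and> (\<forall>n. bounded (C n) \<and> diameter (C n) \<le> \<delta>)}.
        \<Sum>n. ennreal (unit_ball_vol (real s) * (diameter (C n) / 2) ^ s))"

definition hausdorff_outer :: "nat \<Rightarrow> 'a::metric_space set \<Rightarrow> ennreal" where
  "hausdorff_outer s E = (SUP \<delta>\<in>{0<..}. hausdorff_content s \<delta> E)"

definition hausdorff_measure :: "nat \<Rightarrow> 'a::metric_space measure" where
  "hausdorff_measure s = measure_of UNIV (sets borel) (hausdorff_outer s)"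

definition surface_measure :: "(real^'n) set \<Rightarrow> (real^'n) measure" where
  "surface_measure \<Omega> = restrict_space (hausdorff_measure (CARD('n) - 1)) (frontier \<Omega>)"

definition L2_normsq :: "'a measure \<Rightarrow> ('a \<Rightarrow> 'b::real_normed_vector) \<Rightarrow> ennreal" where
  "L2_normsq M f = (\<integral>\<^sup>+x. ennreal ((norm (f x))\<^sup>2) \<partial>M)"

definition L1_norm :: "'a measure \<Rightarrow> ('a \<Rightarrow> 'b::real_normed_vector) \<Rightarrow> ennreal" where
  "L1_norm M f = (\<integral>\<^sup>+x. ennreal (norm (f x)) \<partial>M)"

definition L2 :: "'a measure \<Rightarrow> ('a \<Rightarrow> 'b::euclidean_space) set" where
  "L2 M = {f \<in> borel_measurable M. L2_normsq M f < \<infinity>}"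

definition L2_inner :: "'a measure \<Rightarrow> ('a \<Rightarrow> complex) \<Rightarrow> ('a \<Rightarrow> complex) \<Rightarrow> complex" where
  "L2_inner M f g = (LINT x|M. f x * cnj (g x))"

definition L2_tendsto ::
  "'a measure \<Rightarrow> (nat \<Rightarrow> 'a \<Rightarrow> complex) \<Rightarrow> ('a \<Rightarrow> complex) \<Rightarrow> bool" where
  "L2_tendsto M f g \<longleftrightarrow> (\<lambda>n. L2_normsq M (\<lambda>x. f n x - g x)) \<longlonglongrightarrow> 0"

definition L1_loc :: "'a::euclidean_space set \<Rightarrow> ('a \<Rightarrow> 'b::euclidean_space) set" where
  "L1_loc \<Omega> = {f \<in> borel_measurable (lebesgue_on \<Omega>).
      \<forall>K. compact K \<and> K \<subseteq> \<Omega> \<longrightarrow> L1_norm (lebesgue_on K) f < \<infinity>}"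

definition L2_loc :: "'a::euclidean_space set \<Rightarrow> ('a \<Rightarrow> 'b::euclidean_space) set" where
  "L2_loc \<Omega> = {f \<in> borel_measurable (lebesgue_on \<Omega>).
      \<forall>K. compact K \<and> K \<subseteq> \<Omega> \<longrightarrow> L2_normsq (lebesgue_on K) f < \<infinity>}"

definition L_infty :: "'a measure \<Rightarrow> ('a \<Rightarrow> real) set" where
  "L_infty M = {f \<in> borel_measurable M. \<exists>C. AE x in M. \<bar>f x\<bar> \<le> C}"

text \<open>Complex dimension of a linear space of functions, functions equal almost everywhere being
  identified.\<close>

definition L2_dim :: "'a measure \<Rightarrow> ('a \<Rightarrow> complex) set \<Rightarrow> enat" where
  "L2_dim M E = Sup {enat m |m. \<exists>u::nat \<Rightarrow> 'a \<Rightarrow> complex. (\<forall>j<m. u j \<in> E) \<and>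
     (\<forall>c. (AE x in M. (\<Sum>j<m. c j * u j x) = 0) \<longrightarrow> (\<forall>j<m. c j = 0))}"

definition partial_deriv :: "'n \<Rightarrow> (real^'n \<Rightarrow> real) \<Rightarrow> real^'n \<Rightarrow> real" where
  "partial_deriv j \<phi> x = frechet_derivative \<phi> (at x) (axis j 1)"

definition test_functions :: "(real^'n) set \<Rightarrow> (real^'n \<Rightarrow> real) set" where
  "test_functions \<Omega> =
     {\<phi>. smooth \<phi> \<and> compact (closure {x. \<phi> x \<noteq> 0}) \<and> closure {x. \<phi> x \<noteq> 0} \<subseteq> \<Omega>}"

definition has_weak_gradient ::
  "(real^'n) set \<Rightarrow> (real^'n \<Rightarrow> 'b::euclidean_space) \<Rightarrow> (real^'n \<Rightarrow> 'b^'n) \<Rightarrow> bool" where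
  "has_weak_gradient \<Omega> u g \<longleftrightarrow> u \<in> L1_loc \<Omega> \<and> g \<in> L1_loc \<Omega> \<and>
     (\<forall>\<phi>\<in>test_functions \<Omega>. \<forall>j.
        (LINT x|lebesgue_on \<Omega>. partial_deriv j \<phi> x *\<^sub>R u x)
        = - (LINT x|lebesgue_on \<Omega>. \<phi> x *\<^sub>R g x $ j))"

text \<open>\<open>(\<nabla> - iA) u = g\<close> in the sense of distributions, written as \<open>\<nabla>u = g + iAu\<close>.\<close>

definition has_magnetic_gradient ::
  "(real^'n) set \<Rightarrow> (real^'n \<Rightarrow> real^'n) \<Rightarrow> (real^'n \<Rightarrow> complex) \<Rightarrow> (real^'n \<Rightarrow> complex^'n) \<Rightarrow> bool"
  where
  "has_magnetic_gradient \<Omega> A u g \<longleftrightarrow>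
     has_weak_gradient \<Omega> u (\<lambda>x. \<chi> j. g x $ j + \<i> * complex_of_real (A x $ j) * u x)"

definition magnetic_gradient ::
  "(real^'n) set \<Rightarrow> (real^'n \<Rightarrow> real^'n) \<Rightarrow> (real^'n \<Rightarrow> complex) \<Rightarrow> real^'n \<Rightarrow> complex^'n" where
  "magnetic_gradient \<Omega> A u = (SOME g. g \<in> L2 (lebesgue_on \<Omega>) \<and> has_magnetic_gradient \<Omega> A u g)"

text \<open>The trace on the boundary of a function \<open>w\<close> in the Sobolev space \<open>W\<^sup>1\<^sup>,\<^sup>1(\<Omega>)\<close>: the limit in
  \<open>L\<^sup>1(\<partial>\<Omega>)\<close> of the restrictions of smooth functions that converge to \<open>w\<close> in \<open>W\<^sup>1\<^sup>,\<^sup>1(\<Omega>)\<close>.\<close>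

definition has_trace ::
  "(real^'n) set \<Rightarrow> (real^'n \<Rightarrow> real) \<Rightarrow> (real^'n \<Rightarrow> real) \<Rightarrow> bool" where
  "has_trace \<Omega> w \<tau> \<longleftrightarrow>
     integrable (lebesgue_on \<Omega>) w \<and> integrable (surface_measure \<Omega>) \<tau> \<and>
     (\<exists>g. has_weak_gradient \<Omega> w g \<and> integrable (lebesgue_on \<Omega>) g \<and>
       (\<exists>\<phi>. (\<forall>n. smooth (\<phi> n)) \<and>
         (\<lambda>n. L1_norm (lebesgue_on \<Omega>) (\<lambda>x. \<phi> n x - w x)) \<longlonglongrightarrow> 0 \<and>
         (\<lambda>n. L1_norm (lebesgue_on \<Omega>) (\<lambda>x. (\<chi> j. partial_deriv j (\<phi> n) x) - g x)) \<longlonglongrightarrow> 0 \<and>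
         (\<lambda>n. L1_norm (surface_measure \<Omega>) (\<lambda>x. \<phi> n x - \<tau> x)) \<longlonglongrightarrow> 0))"

definition boundary_trace :: "(real^'n) set \<Rightarrow> (real^'n \<Rightarrow> real) \<Rightarrow> real^'n \<Rightarrow> real" where
  "boundary_trace \<Omega> w = (SOME \<tau>. has_trace \<Omega> w \<tau>)"

definition robin_domain ::
  "(real^'n) set \<Rightarrow> (real^'n \<Rightarrow> real^'n) \<Rightarrow> (real^'n \<Rightarrow> real) \<Rightarrow> (real^'n \<Rightarrow> complex) set" where
  "robin_domain \<Omega> A V = {u \<in> L2 (lebesgue_on \<Omega>).
     (\<exists>g \<in> L2 (lebesgue_on \<Omega>). has_magnetic_gradient \<Omega> A u g) \<and>
     (\<lambda>x. complex_of_real (sqrt (V x)) * u x) \<in> L2 (lebesgue_on \<Omega>)}"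

text \<open>A function \<open>u\<close> in the form domain need not have a trace itself, as \<open>A\<close> is only locally square
  integrable. But \<open>|u|\<^sup>2\<close> is in \<open>W\<^sup>1\<^sup>,\<^sup>1(\<Omega>)\<close>, with gradient \<open>2 Re (cnj u (\<nabla> - iA) u)\<close>, so that
  \<open>|u|\<^sup>2\<close> has a trace; this is the square of the trace of \<open>|u|\<close>, which is in \<open>H\<^sup>1(\<Omega>)\<close>, and the
  squared modulus of the trace of \<open>u\<close> whenever \<open>u\<close> is in \<open>H\<^sup>1(\<Omega>)\<close>.\<close>

definition robin_form ::
  "(real^'n) set \<Rightarrow> (real^'n \<Rightarrow> real^'n) \<Rightarrow> (real^'n \<Rightarrow> real) \<Rightarrow> (real^'n \<Rightarrow> real)
     \<Rightarrow> (real^'n \<Rightarrow> complex) \<Rightarrow> real" where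
  "robin_form \<Omega> A V \<sigma> u =
     (LINT x|lebesgue_on \<Omega>. (norm (magnetic_gradient \<Omega> A u x))\<^sup>2)
     + (LINT x|lebesgue_on \<Omega>. V x * (cmod (u x))\<^sup>2)
     + (LINT x|surface_measure \<Omega>. \<sigma> x * boundary_trace \<Omega> (\<lambda>y. (cmod (u y))\<^sup>2) x)"

text \<open>The sesquilinear form, linear in its first argument, of a quadratic form.\<close>

definition polar_form ::
  "(('a \<Rightarrow> complex) \<Rightarrow> real) \<Rightarrow> ('a \<Rightarrow> complex) \<Rightarrow> ('a \<Rightarrow> complex) \<Rightarrow> complex" where
  "polar_form q u v =
     (complex_of_real (q (\<lambda>x. u x + v x)) - complex_of_real (q (\<lambda>x. u x - v x))
      + \<i> * complex_of_real (q (\<lambda>x. u x + \<i> * v x))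
      - \<i> * complex_of_real (q (\<lambda>x. u x - \<i> * v x))) / 4"

text \<open>The graph of the operator \<open>T\<close> of the closure \<open>q'\<close> of a quadratic form \<open>q\<close> with domain \<open>D\<close>
  that is bounded below: \<open>T u = f\<close> iff \<open>u\<close> is in the domain of \<open>q'\<close> and \<open>q'(u, v) = \<langle>f, v\<rangle>\<close> for
  all \<open>v\<close> in the form core \<open>D\<close>. Here \<open>u\<close> is in the domain of \<open>q'\<close> iff it is the limit of a
  sequence in \<open>D\<close> that is Cauchy for \<open>q\<close>, and then \<open>q'(u, v)\<close> is the limit of the values at the
  sequence.\<close>

definition form_operator ::
  "'a measure \<Rightarrow> ('a \<Rightarrow> complex) set \<Rightarrow> (('a \<Rightarrow> complex) \<Rightarrow> real)
     \<Rightarrow> ('a \<Rightarrow> complex) \<Rightarrow> ('a \<Rightarrow> complex) \<Rightarrow> bool" where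
  "form_operator M D q u f \<longleftrightarrow> u \<in> L2 M \<and> f \<in> L2 M \<and>
     (\<exists>w::nat \<Rightarrow> 'a \<Rightarrow> complex. (\<forall>n. w n \<in> D) \<and> L2_tendsto M w u \<and>
        (\<forall>e>0. \<exists>N. \<forall>m\<ge>N. \<forall>n\<ge>N. \<bar>q (\<lambda>x. w m x - w n x)\<bar> < e) \<and>
        (\<forall>v\<in>D. (\<lambda>n. polar_form q (w n) v) \<longlonglongrightarrow> L2_inner M f v))"

definition robin_operator ::
  "(real^'n) set \<Rightarrow> (real^'n \<Rightarrow> real^'n) \<Rightarrow> (real^'n \<Rightarrow> real) \<Rightarrow> (real^'n \<Rightarrow> real)
     \<Rightarrow> (real^'n \<Rightarrow> complex) \<Rightarrow> (real^'n \<Rightarrow> complex) \<Rightarrow> bool" where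
  "robin_operator \<Omega> A V \<sigma> =
     form_operator (lebesgue_on \<Omega>) (robin_domain \<Omega> A V) (robin_form \<Omega> A V \<sigma>)"

text \<open>\<open>T + 1\<close> is a bijection from the domain of \<open>T\<close> onto \<open>L\<^sup>2\<close>, and its inverse is compact;
  \<open>T u (f - u)\<close> says that \<open>(T + 1) u = f\<close>.\<close>

definition compact_resolvent ::
  "'a measure \<Rightarrow> (('a \<Rightarrow> complex) \<Rightarrow> ('a \<Rightarrow> complex) \<Rightarrow> bool) \<Rightarrow> bool" where
  "compact_resolvent M T \<longleftrightarrow>
     (\<forall>f\<in>L2 M. \<exists>u. T u (\<lambda>x. f x - u x)) \<and>
     (\<forall>u. T u (\<lambda>x. - u x) \<longrightarrow> (AE x in M. u x = 0)) \<and>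
     (\<forall>f u. (\<forall>n::nat. f n \<in> L2 M \<and> T (u n) (\<lambda>x. f n x - u n x)) \<and>
            (\<exists>C::real. \<forall>n. L2_normsq M (f n) \<le> ennreal C) \<longrightarrow>
        (\<exists>r w. strict_mono r \<and> w \<in> L2 M \<and> L2_tendsto M (\<lambda>n. u (r n)) w))"

definition eigenspace ::
  "(('a \<Rightarrow> complex) \<Rightarrow> ('a \<Rightarrow> complex) \<Rightarrow> bool) \<Rightarrow> real \<Rightarrow> ('a \<Rightarrow> complex) set" where
  "eigenspace T \<mu> = {u. T u (\<lambda>x. complex_of_real \<mu> * u x)}"

text \<open>\<open>lam 1 \<le> lam 2 \<le> \<dots>\<close> are the eigenvalues repeated according to multiplicity; \<open>lam 0\<close> is
  irrelevant.\<close>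

definition eigenvalue_enumeration ::
  "'a measure \<Rightarrow> (('a \<Rightarrow> complex) \<Rightarrow> ('a \<Rightarrow> complex) \<Rightarrow> bool) \<Rightarrow> (nat \<Rightarrow> real) \<Rightarrow> bool" where
  "eigenvalue_enumeration M T lam \<longleftrightarrow>
     (\<forall>j\<ge>1. lam j \<le> lam (Suc j)) \<and>
     (\<forall>\<mu>. finite {j. 1 \<le> j \<and> lam j = \<mu>} \<and>
          L2_dim M (eigenspace T \<mu>) = enat (card {j. 1 \<le> j \<and> lam j = \<mu>}))"

definition kroeger_const :: "(real^'n) set \<Rightarrow> nat \<Rightarrow> real" where
  "kroeger_const \<Omega> k =
     (let d = real CARD('n) in
        d / (d + 2) * (2 * pi)\<^sup>2 * (unit_ball_vol d * measure lebesgue \<Omega>) powr (- 2 / d)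
        * real k powr (1 + 2 / d))"

end

theory Submission
  imports Defs "HOL-Probability.Probability" "HOL-Library.Function_Algebras"
begin

text \<open>
  The proof is Kroeger's averaging argument, with plane waves as trial functions. A plane wave
  \<open>e x = exp (\<i> (\<xi> \<bullet> x))\<close> is smooth and bounded, so it lies in the form domain. Its magnetic gradient
  has norm \<open>\<bar>\<xi> - A\<bar>\<close>, and the trace of \<open>\<bar>e\<bar>\<^sup>2 = 1\<close> is \<open>1\<close>, so that the boundary term is negative
  and the form at \<open>e\<close> is at most \<open>\<integral> \<bar>\<xi> - A\<bar>\<^sup>2 + \<integral> V\<close> (lemma \<open>plane_wave\<close>). The spectral theorem
  bounds the form at \<open>e\<close> from below by \<open>\<Sum>j\<le>k. lam j * p j + lam (k + 1) * (Vol - \<Sum>j\<le>k. p j)\<close>,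
  where \<open>p j\<close> is the squared modulus of the Fourier transform of the \<open>j\<close>-th eigenfunction at \<open>\<xi>\<close>
  (\<open>eigenvalue_inequality\<close>). Integrate over a ball in \<open>\<xi>\<close>: each \<open>p j\<close> contributes at most
  \<open>(2 pi) ^ d\<close> (\<open>fourier_bessel_ball\<close>), and the term linear in \<open>\<xi>\<close> vanishes by symmetry. The
  radius for which \<open>Vol\<close> times the volume of the ball is \<open>k (2 pi) ^ d\<close> eliminates \<open>lam (k + 1)\<close>
  and leaves the bound, even with \<open>k\<close> in place of \<open>k\<^sup>2\<close> (\<open>eigenvalue_sum_bound\<close>). If \<open>A\<close> is not
  square integrable or \<open>V\<close> not integrable, the right-hand side is infinite.

  Most of the text justifies the use of the spectral theorem. The form has to be closed and bounded
  below, so the boundary integral of \<open>\<bar>u\<bar>\<^sup>2\<close> has to be controlled. For \<open>u\<close> in the form domain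
  \<open>\<bar>u\<bar>\<^sup>2\<close> has the integrable weak gradient \<open>2 Re (cnj u (\<nabla> - iA) u)\<close> (\<open>wgrad_square\<close>);
  functions with integrable weak gradient are limits of functions smooth up to the boundary
  (\<open>wgrad_approximable\<close>); and for the latter the boundary integral is bounded by the norm of
  \<open>W\<^sup>1\<^sup>,\<^sup>1\<close> (\<open>trace_inequality\<close>), because in a boundary chart the surface measure is at most a
  constant times the Lebesgue measure of the projection (\<open>hausdorff_outer_le_slab\<close>).
\<close>

abbreviation (input) tends_to :: "(nat \<Rightarrow> 'a::topological_space) \<Rightarrow> 'a \<Rightarrow> bool" ("((_)/ ~~> (_))" [60, 60] 60)
  where "X ~~> L \<equiv> X \<longlonglongrightarrow> L"

abbreviation (input) "cof \<equiv> complex_of_real"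
abbreviation (input) "bmeas \<equiv> borel_measurable"
abbreviation (input) "integ \<equiv> integrable lborel"
abbreviation (input) "pderv \<equiv> partial_deriv"
abbreviation (input) "fderv \<equiv> frechet_derivative"

lemma Ck_Suc_D: "Ck (Suc k) f ==> Ck k f"
proof (induction k arbitrary: f)
 case 0
 then show ?case
  by (auto intro!: differentiable_imp_continuous_on simp: differentiable_on_def differentiable_at_withinI)
next
 case (Suc k)
 have "Ck k (%x. fderv f (at x) v)" for v
  using Suc.prems Suc.IH by auto
 then show ?case using Suc.prems by auto
qed

lemma Ck_SucI:
 assumes "!!x. (f has_derivative f' x) (at x)" "!!v. Ck k (%x. f' x v)"
 shows "Ck (Suc k) f"
proof -
 have "fderv f (at x)=f' x" for x
  using assms(1) frechet_derivative_at by metis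
 then show ?thesis using assms by (auto simp: differentiable_def)
qed

lemma Ck_const: "Ck k (%x. c)"
proof (induction k arbitrary: c)
 case (Suc k)
 show ?case by (rule Ck_SucI[where f'="%_ _. 0"]) (auto simp: Suc)
qed auto

lemma Ck_add: "Ck k f ==> Ck k g ==> Ck k (%x. f x+g x)"
proof (induction k arbitrary: f g)
 case (Suc k)
 show ?case
  by (rule Ck_SucI[where f'="%x v. fderv f (at x) v+fderv g (at x) v"])
   (use Suc in "auto intro!: has_derivative_add simp: frechet_derivative_works[symmetric]")
qed (auto intro: continuous_on_add)

lemma Ck_bounded_bilinear:
 assumes bb: "bounded_bilinear p"
 shows "Ck k f ==> Ck k g ==> Ck k (%x. p (f x) (g x))"
proof (induction k arbitrary: f g)
 case 0
 then show ?case using bounded_bilinear.continuous_on[OF bb] by auto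
next
 case (Suc k)
 note D = bounded_bilinear.FDERIV[OF bb]
 have fg: "Ck k f" "Ck k g" using Suc.prems Ck_Suc_D by blast+
 show ?case
  by (rule Ck_SucI[where f'="%x v. p (f x) (frechet_derivative g (at x) v)
    + p (frechet_derivative f (at x) v) (g x)"])
   (use Suc fg in "auto intro!: Ck_add D simp: frechet_derivative_works[symmetric]")
qed

lemmas Ck_mult = Ck_bounded_bilinear[OF bounded_bilinear_mult]

lemma Ck_linear:
 assumes "bounded_linear L"
 shows "Ck k L"
proof (cases k)
 case (Suc m)
 then show ?thesis
  using Ck_SucI[of L "%_. L" m] bounded_linear_imp_has_derivative[OF assms] Ck_const by metis
qed (use assms linear_continuous_on in auto)

lemma Ck_compose:
 fixes g :: "real => real"
 shows "Ck k f ==> Ck k g ==> Ck k (%x. g (f x))"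
proof (induction k arbitrary: f g)
 case 0
 then show ?case by (auto intro: continuous_on_compose2)
next
 case (Suc k)
 let ?g' = "%t. fderv g (at t) 1"
 have lin: "fderv g (at t) r=r * ?g' t" for t r
 proof -
  have "linear (fderv g (at t))"
   using Suc.prems(2) linear_frechet_derivative by auto
  from linear_scale[OF this, of r 1] show ?thesis by simp
 qed
 show ?case
 proof (rule Ck_SucI[where f'="%x v. fderv g (at (f x)) (fderv f (at x) v)"])
  show "((%x. g (f x)) has_derivative
   (%v. frechet_derivative g (at (f x)) (frechet_derivative f (at x) v))) (at x)" for x
   using diff_chain_at[of f _ x g] Suc.prems
   by (auto simp: frechet_derivative_works o_def)
  show "Ck k (%x. fderv g (at (f x)) (fderv f (at x) v))" for v
   unfolding lin[of _ "fderv f (at _) v"]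
   using Suc.prems Suc.IH[OF Ck_Suc_D[OF Suc.prems(1)], of ?g'] by (intro Ck_mult) auto
 qed
qed

lemma Ck_compose_affine:
 assumes "bounded_linear L"
 shows "Ck k g ==> Ck k (%x. g (L x+c))"
proof (induction k arbitrary: g)
 case 0
 then show ?case
  using linear_continuous_on[OF assms]
  by (auto intro!: continuous_on_compose2[of UNIV g] continuous_on_add)
next
 case (Suc k)
 show ?case
 proof (rule Ck_SucI[where f'="%x v. fderv g (at (L x+c)) (L v)"])
  show "((%x. g (L x+c)) has_derivative (%v. fderv g (at (L x+c)) (L v))) (at x)" for x
  proof -
   have "((%x. L x+c) has_derivative L) (at x)"
    using has_derivative_add[OF bounded_linear_imp_has_derivative[OF assms] has_derivative_const]
    by fastforce
   from diff_chain_at[OF this, of g] show ?thesis using Suc.prems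
    by (auto simp: frechet_derivative_works o_def)
  qed
  show "Ck k (%x. fderv g (at (L x+c)) (L v))" for v
   using Suc by auto
 qed
qed

lemma smooth_const: "smooth (%x. c)" by (simp add: smooth_def Ck_const)
lemma smooth_add: "smooth f ==> smooth g ==> smooth (%x. f x+g x)"
 by (simp add: smooth_def Ck_add)
lemma smooth_mult:
 fixes f :: "'a::real_normed_vector => real"
 shows "smooth f ==> smooth g ==> smooth (%x. f x * g x)"
 by (simp add: smooth_def Ck_mult)
lemma smooth_differentiable: "smooth f ==> f differentiable (at x)"
 by (auto simp: smooth_def dest: spec[of _ "Suc 0"])
lemma smooth_continuous_deriv: "smooth f ==> continuous_on UNIV (%x. fderv f (at x) v)"
 unfolding smooth_def by (metis Ck.simps)
lemma smooth_deriv: "smooth f ==> smooth (%x. fderv f (at x) v)"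
 unfolding smooth_def by (metis Ck.simps(2))
lemma smooth_continuous: "smooth f ==> continuous_on UNIV f"
 unfolding smooth_def by (metis Ck.simps(1))

definition exp_germ :: "nat => real => real" where
 "exp_germ m t=(if t > 0 then inverse t ^ m * exp (- inverse t) else 0)"

lemma exp_germ_tendsto: "((%t. exp_germ m t) \<longlongrightarrow> 0) (at 0)"
proof -
 have "((%t::real. inverse t ^ m * exp (- inverse t)) \<longlongrightarrow> 0) (at_right 0)"
  by (subst filterlim_at_right_to_top)
   (use tendsto_power_div_exp_0[of m] in "simp add: exp_minus divide_inverse")
 then have r: "((%t. exp_germ m t) \<longlongrightarrow> 0) (at_right 0)"
  by (rule Lim_transform_eventually)
   (auto simp: exp_germ_def eventually_at_filter)
 have l: "((%t. exp_germ m t) \<longlongrightarrow> 0) (at_left 0)"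
  by (rule Lim_transform_eventually[OF tendsto_const])
   (auto simp: exp_germ_def eventually_at_filter)
 show ?thesis using r l filterlim_at_split by blast
qed

lemma exp_germ_has_real_derivative:
 "(exp_germ m has_real_derivative (exp_germ (m+2) t - real m * exp_germ (Suc m) t)) (at t)"
proof -
 consider "t > 0" | "t < 0" | "t=0" by linarith
 then show ?thesis
 proof cases
  case 1
  have "((%t. inverse t ^ m * exp (- inverse t)) has_real_derivative
   (exp_germ (m + 2) t - real m * exp_germ (Suc m) t)) (at t)"
   using 1 apply (auto intro!: derivative_eq_intros simp: exp_germ_def)
   apply (cases m) by (auto simp: field_simps power2_eq_square)
  then show ?thesis
   using has_field_derivative_transform_within_open[of _ _ t "{0<..}" "exp_germ m"] 1
   by (auto simp: exp_germ_def)
 next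
  case 2
  have "((%t. 0) has_real_derivative (exp_germ (m+2) t - real m * exp_germ (Suc m) t)) (at t)"
   using 2 by (auto simp: exp_germ_def)
  then show ?thesis
   by (rule has_field_derivative_transform_within_open[of _ _ t "{..<0}"])
    (use 2 in "auto simp: exp_germ_def")
 next
  case 3
  have "((%h. exp_germ m h / h) \<longlongrightarrow> 0) (at 0)"
   by (rule Lim_transform_eventually[OF exp_germ_tendsto[of "Suc m"]])
    (auto simp: exp_germ_def field_simps eventually_at_filter)
  then show ?thesis unfolding 3 by (simp add: has_field_derivative_def[symmetric] DERIV_def exp_germ_def)
 qed
qed

lemma Ck_exp_germ: "Ck k (exp_germ m)"
proof (induction k arbitrary: m)
 case 0
 show ?case
  using continuous_at_imp_continuous_on[of UNIV "exp_germ m"] DERIV_isCont[OF exp_germ_has_real_derivative] by simp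
next
 case (Suc k)
 show ?case
  by (rule Ck_SucI[where f'="%t v. (exp_germ (m+2) t+(- real m) * exp_germ (Suc m) t) * v"])
   (use exp_germ_has_real_derivative[of m] in \<open>simp add: has_field_derivative_def\<close>,
    intro Ck_add Ck_mult Ck_const Suc)
qed

text \<open>The standard mollifier, with an off-centre support. \<close>

definition unit_bump :: "'a::euclidean_space => real => 'a => real" where
 "unit_bump a c x=exp_germ 0 (c\<^sup>2 - (x - a) \<bullet> (x - a))"

lemma smooth_unit_bump: "smooth (unit_bump a c)"
proof -
 have lin: "Ck k (%x::'a. x - a)" for k
  using Ck_add[OF Ck_linear[OF bounded_linear_ident] Ck_const[of k "-a"]] by simp
 have "Ck k (%x. c\<^sup>2+(- 1) * ((x - a) \<bullet> (x - a)))" for k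
  by (intro Ck_add Ck_const Ck_mult Ck_bounded_bilinear[OF bounded_bilinear_inner] lin)
 then have "Ck k (%x. exp_germ 0 (c\<^sup>2+(- 1) * ((x - a) \<bullet> (x - a))))" for k
  by (rule Ck_compose) (rule Ck_exp_germ)
 then show ?thesis unfolding smooth_def unit_bump_def by (simp add: fun_eq_iff)
qed

lemma unit_bump_pos:
 assumes "c > 0"
 shows "unit_bump a c x > 0 \<longleftrightarrow> dist a x < c"
proof -
 have "dist a x < c \<longleftrightarrow> (x - a) \<bullet> (x - a) < c\<^sup>2"
  using assms norm_lt_square[of "x - a" c] by (simp add: dist_norm norm_minus_commute)
 then show ?thesis by (auto simp: unit_bump_def exp_germ_def)
qed

lemma unit_bump_nonneg: "unit_bump a c x >= 0"
 by (auto simp: unit_bump_def exp_germ_def)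

text \<open>A rescaled smooth bump. Mollification is the source of all smooth approximations below.\<close>

lemma mollifier_exists:
 fixes a :: "'a::euclidean_space"
 assumes "c > 0"
 obtains rh :: "'a => real" where "smooth rh" "!!x. rh x >= 0" "!!x. x ~: ball a c ==> rh x=0"
  "integ rh" "(LINT x|lborel. rh x)=1"
proof -
 let ?b = "unit_bump a c"
 have cont: "continuous_on UNIV ?b" by (rule smooth_continuous[OF smooth_unit_bump])
 have zero: "?b x=0" if "x ~: ball a c" for x
  using unit_bump_pos[OF assms, of a x] unit_bump_nonneg[of a c x] that by auto
 have int: "integ ?b"
 proof -
  have "integ (%x. indicator (cball a c) x *\<^sub>R ?b x)"
   by (rule borel_integrable_compact) (use continuous_on_subset[OF cont] in auto)
  also have "(%x. indicator (cball a c) x *\<^sub>R ?b x)=?b"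
   using zero by (auto simp: fun_eq_iff indicator_def dist_norm)
  finally show ?thesis .
 qed
 define I where "I=(LINT x|lborel. ?b x)"
 have "I ~= 0"
 proof
  assume "I=0"
  then have "AE x in lborel. ?b x=0"
   using integral_nonneg_eq_0_iff_AE[OF int] unit_bump_nonneg[of a c] unfolding I_def by blast
  then have "AE x in lborel. x ~: ball a c"
   by (rule AE_mp, intro AE_I2 impI) (use unit_bump_pos[OF assms, of a] in "auto simp: less_le")
  then have "ball a c : null_sets lborel"
   by (simp add: AE_iff_null_sets)
  then show False using assms open_ball[of a c] open_not_negligible[of "ball a c"]
   by (simp add: negligible_iff_null_sets null_sets_completionI)
 qed
 moreover have "I >= 0" unfolding I_def by (rule Bochner_Integration.integral_nonneg) (rule unit_bump_nonneg)
 ultimately have I: "I > 0" by simp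
 show ?thesis
 proof (rule that[of "%x. inverse I * ?b x"])
  show "smooth (%x. inverse I * ?b x)" by (intro smooth_mult smooth_const smooth_unit_bump)
  show "0 <= inverse I * ?b x" for x using I unit_bump_nonneg[of a c x] by simp
  show "inverse I * ?b x=0" if "x ~: ball a c" for x using zero[OF that] by simp
  show "integ (%x. inverse I * ?b x)" using int by simp
  show "(LINT x|lborel. inverse I * ?b x)=1" using I by (simp add: I_def[symmetric])
 qed
qed

lemma integral_lborel_shift:
 fixes f :: "'a::euclidean_space => 'b::{banach, second_countable_topology}"
 assumes "f : bmeas borel"
 shows "(LINT x|lborel. f (x+c))=(LINT x|lborel. f x)"
proof -
 have "(LINT x|lborel. f x)=(LINT x|distr lborel borel ((+) c). f x)"
  by (simp add: lborel_distr_plus)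
 also have "...=(LINT x|lborel. f (c+x))"
  using assms by (subst integral_distr) auto
 finally show ?thesis by (simp add: add.commute)
qed

lemma nn_integral_lborel_shift:
 fixes f :: "'a::euclidean_space => ennreal"
 assumes "f : bmeas borel"
 shows "(\<integral>\<^sup>+x. f (x+c) \<partial>lborel)=(\<integral>\<^sup>+x. f x \<partial>lborel)"
proof -
 have "(\<integral>\<^sup>+x. f x \<partial>lborel)=(\<integral>\<^sup>+x. f x \<partial>distr lborel borel ((+) c))"
  by (simp add: lborel_distr_plus)
 also have "...=(\<integral>\<^sup>+x. f (c+x) \<partial>lborel)"
  using assms by (subst nn_integral_distr) auto
 finally show ?thesis by (simp add: add.commute)
qed

lemma integrable_lborel_shift:
 fixes f :: "'a::euclidean_space => 'b::{banach, second_countable_topology}"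
 assumes "integ f"
 shows "integ (%x. f (x+c))"
proof -
 have "integrable (distr lborel borel ((+) c)) f" using assms by (simp add: lborel_distr_plus)
 then show ?thesis
  using assms by (subst (asm) integrable_distr_eq) (auto simp: add.commute)
qed

lemma integrable_shift_diff:
 fixes f :: "'a::euclidean_space => 'b::{banach, second_countable_topology}"
 assumes "integ f"
 shows "integ (%x. norm (f (x+c) - f x))"
 using assms integrable_lborel_shift[OF assms, of c] by auto

lemma tendsto_zero_nonnegI:
 fixes X :: "'a => real"
 assumes "!!e. e > 0 ==> eventually (%n. X n < e) F" "!!n. X n >= 0"
 shows "(X \<longlongrightarrow> 0) F"
proof (rule order_tendstoI)
 fix a :: real assume "a < 0"
 then show "eventually (%n. a < X n) F"
  using assms(2) by (intro always_eventually allI) (rule less_le_trans)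
qed (use assms in auto)

lemma translation_continuous_open:
 fixes U :: "'a::euclidean_space set"
 assumes "open U" "emeasure lborel U < \<infinity>" and Z: "Z ~~> 0"
 shows "(%n. LINT x|lborel. \<bar>indicator U (x+Z n) - indicator U x\<bar> :: real) ~~> 0"
proof -
 let ?i = "indicator U :: 'a => real"
 have [measurable]: "U : sets borel" using assms by auto
 have int: "integ ?i" using assms by (simp add: integrable_indicator_iff)
 have int2: "integ (%x. ?i (x+z))" for z by (rule integrable_lborel_shift[OF int])
 have lim: "(%n. LINT x|lborel. ?i x * (1 - ?i (x+Z n))) ~~> (LINT x::'a|lborel. (0::real))"
 proof (rule integral_dominated_convergence[where w="%x. ?i x" and f="%x. 0" and s="%n x. ?i x * (1 - ?i (x+Z n))"])
  show "AE x in lborel. (%n. ?i x * (1 - ?i (x+Z n))) ~~> 0"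
  proof (rule AE_I2)
   fix x :: 'a
   show "(%n. ?i x * (1 - ?i (x+Z n))) ~~> 0"
   proof (cases "x : U")
    case True
    have "(%n. x+Z n) ~~> x" using tendsto_add[OF tendsto_const Z, of x] by simp
    then have "eventually (%n. x+Z n : U) sequentially"
    using topological_tendstoD[OF _ \<open>open U\<close> True] by auto
    then have "eventually (%n. 0=?i x * (1 - ?i (x+Z n))) sequentially"
    by eventually_elim auto
    then show ?thesis by (rule Lim_transform_eventually[OF tendsto_const])
   qed auto
  qed
  show "AE x in lborel. norm (?i x * (1 - ?i (x+Z n))) <= ?i x" for n
   by (rule AE_I2) (auto simp: indicator_def)
 qed (use int in auto)
 have "(LINT x|lborel. \<bar>?i (x+Z n) - ?i x\<bar>)=2 * (LINT x|lborel. ?i x * (1 - ?i (x+Z n)))" for n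
 proof -
  have i3: "integ (%x. ?i x * (1 - ?i (x+Z n)))"
   by (rule Bochner_Integration.integrable_bound[OF int]) (auto simp: indicator_def)
  have "(%x. \<bar>?i (x+Z n) - ?i x\<bar>)=(%x. ?i (x+Z n) - ?i x+2 * (?i x * (1 - ?i (x+Z n))))"
   by (auto simp: indicator_def fun_eq_iff)
  then have "(LINT x|lborel. \<bar>?i (x + Z n) - ?i x\<bar>)
   = (LINT x|lborel. ?i (x + Z n)) - (LINT x|lborel. ?i x) + 2 * (LINT x|lborel. ?i x * (1 - ?i (x + Z n)))"
   using int int2 i3 by simp
  then show ?thesis using integral_lborel_shift[of ?i "Z n"] by simp
 qed
 then show ?thesis using tendsto_mult_left[OF lim, of 2] by simp
qed

text \<open>Open sets of finite measure are approximated by their translates; indicators, simple functions and then all integrable functions follow by density.\<close>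

lemma translation_continuous_L1:
 fixes f :: "'a::euclidean_space => 'b::{banach, second_countable_topology}"
 assumes "integ f"
 shows "Z ~~> 0 ==> (%n. LINT x|lborel. norm (f (x+Z n) - f x)) ~~> 0"
 using assms
proof (induction rule: integrable_induct)
 case (base A c)
 have [measurable]: "A : sets borel" using base by auto
 have "eventually (%n. (LINT x|lborel. norm (indicator A (x+Z n) *\<^sub>R c - indicator A x *\<^sub>R c)) < e) sequentially"
  if "e > 0" for e
 proof -
  define e' where "e'=e / (4 * (norm c+1))"
  have e': "e' > 0" using that by (simp add: e'_def add_nonneg_pos)
  obtain U where U: "open U" "A \<subseteq> U" "emeasure lborel (U - A) < ennreal e'"
   using outer_regular_lborel[of A e'] base e' by auto
  have [measurable]: "U : sets borel" using U by auto
  have fin: "emeasure lborel U < \<infinity>"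
  proof -
   have "emeasure lborel U <= emeasure lborel (U - A)+emeasure lborel A"
    by (subst plus_emeasure) (use U in "auto intro!: emeasure_mono")
   also have "... < \<infinity>" using base U by (auto simp: less_top[symmetric] top_unique intro: order.strict_trans)
   finally show ?thesis .
  qed
  let ?u = "indicator U :: 'a => real" and ?d = "indicator (U - A) :: 'a => real"
  have iU: "integ ?u" using fin by (simp add: integrable_indicator_iff)
  have iD: "integ ?d" using U(3) e'
   by (auto simp: integrable_indicator_iff less_top[symmetric] top_unique intro: order.strict_trans)
  note iU2 = integrable_lborel_shift[OF iU] and iD2 = integrable_lborel_shift[OF iD]
  have dd: "(LINT x|lborel. ?d x) < e'"
  proof -
   have "ennreal (LINT x|lborel. ?d x)=emeasure lborel (U - A)"
    using iD by (auto simp: emeasure_eq_ennreal_measure integrable_indicator_iff less_top[symmetric])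
   then show ?thesis using U(3) e' by (metis ennreal_less_iff measure_nonneg integral_indicator Int_UNIV_right lborel_def
    Bochner_Integration.integral_nonneg indicator_pos_le)
  qed
  have "eventually (%n. (LINT x|lborel. \<bar>?u (x+Z n) - ?u x\<bar>) < e') sequentially"
   using order_tendstoD(2)[OF translation_continuous_open[OF U(1) fin base(3)] e'] .
  then show ?thesis
  proof eventually_elim
   case (elim n)
   have "(LINT x|lborel. norm (indicator A (x + Z n) *\<^sub>R c - indicator A x *\<^sub>R c))
    <= (LINT x|lborel. norm c * (\<bar>?u (x + Z n) - ?u x\<bar> + ?d (x + Z n) + ?d x))"
   proof (rule integral_mono')
    show "integ (%x. norm c * (\<bar>?u (x+Z n) - ?u x\<bar>+?d (x+Z n)+?d x))"
    using iU2 iD2 iU iD by auto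
    show "norm (indicator A (x + Z n) *\<^sub>R c - indicator A x *\<^sub>R c)
    <= norm c * (\<bar>?u (x + Z n) - ?u x\<bar> + ?d (x + Z n) + ?d x)" for x
    using U(2) by (auto simp: indicator_def)
   qed auto
   also have "...=norm c * ((LINT x|lborel. \<bar>?u (x+Z n) - ?u x\<bar>)+(LINT x|lborel. ?d (x+Z n))+(LINT x|lborel. ?d x))"
    using iU2 iD2 iU iD by simp
   also have "... <= norm c * (e'+e'+e')"
    using elim dd integral_lborel_shift[of ?d "Z n"] by (intro mult_left_mono) auto
   also have "... < (norm c+1) * (4 * e')"
    using e' by (auto simp: algebra_simps intro!: add_nonneg_pos)
   also have "...=e"
   proof -
    have "norm c+1 ~= 0" using norm_ge_zero[of c] by linarith
    then show ?thesis by (simp add: e'_def field_simps)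
   qed
   finally show ?case .
  qed
 qed
 moreover have "(LINT x|lborel. norm (indicator A (x+Z n) *\<^sub>R c - indicator A x *\<^sub>R c)) >= 0" for n
  by (rule Bochner_Integration.integral_nonneg) auto
 ultimately show ?case
  by (rule tendsto_zero_nonnegI)
next
 case (add f g)
 note [measurable] = borel_measurable_integrable[OF add(1)] borel_measurable_integrable[OF add(2)]
 have s: "(%n. (LINT x|lborel. norm (f (x+Z n) - f x))+(LINT x|lborel. norm (g (x+Z n) - g x))) ~~> 0"
  using tendsto_add[OF add(3,4)[OF add(5)]] by simp
 show ?case
 proof (rule tendsto_sandwich[OF _ _ tendsto_const s])
  show "\<forall>\<^sub>F n in sequentially. (LINT x|lborel. norm (f (x + Z n) + g (x + Z n) - (f x + g x)))
   <= (LINT x|lborel. norm (f (x + Z n) - f x)) + (LINT x|lborel. norm (g (x + Z n) - g x))"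
  proof (rule always_eventually, rule allI)
   fix n
   have i: "integ (%x. norm (f (x+Z n) - f x))" "integ (%x. norm (g (x+Z n) - g x))"
    by (rule integrable_shift_diff[OF add(1)], rule integrable_shift_diff[OF add(2)])
   show "(LINT x|lborel. norm (f (x + Z n) + g (x + Z n) - (f x + g x)))
   <= (LINT x|lborel. norm (f (x + Z n) - f x)) + (LINT x|lborel. norm (g (x + Z n) - g x))"
    unfolding Bochner_Integration.integral_add[OF i, symmetric]
   proof (rule integral_mono')
    show "norm (f (x + Z n) + g (x + Z n) - (f x + g x))
    <= norm (f (x + Z n) - f x) + norm (g (x + Z n) - g x)" for x
    using norm_triangle_ineq[of "f (x+Z n) - f x" "g (x+Z n) - g x"] by (simp add: algebra_simps)
   qed (use i in auto)
  qed
 qed (auto intro!: always_eventually Bochner_Integration.integral_nonneg)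
next
 case (lim f s)
 note [measurable] = borel_measurable_integrable[OF lim(1)] borel_measurable_integrable[OF lim(4)]
 have L: "(%i. LINT x|lborel. norm (s i x - f x)) ~~> (LINT x::'a|lborel. (0::real))"
 proof (rule integral_dominated_convergence[where w="%x. 3 * norm (f x)"])
  show "AE x in lborel. (%i. norm (s i x - f x)) ~~> 0"
   by (intro AE_I2 tendsto_norm_zero LIM_zero lim(2))
  show "AE x in lborel. norm (norm (s i x - f x)) <= 3 * norm (f x)" for i
  proof (rule AE_I2)
   fix x
   show "norm (norm (s i x - f x)) <= 3 * norm (f x)"
    using lim(3)[of x i] norm_triangle_ineq4[of "s i x" "f x"] by simp
  qed
 qed (use lim(1,4) in auto)
 have "eventually (%n. (LINT x|lborel. norm (f (x+Z n) - f x)) < e) sequentially" if "e > 0" for e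
 proof -
  have "eventually (%i. (LINT x|lborel. norm (s i x - f x)) < e / 3) sequentially"
   using order_tendstoD(2)[OF L, of "e/3"] that by simp
  then obtain i where i: "(LINT x|lborel. norm (s i x - f x)) < e / 3"
   using eventually_happens[of _ sequentially] by force
  have "eventually (%n. (LINT x|lborel. norm (s i (x+Z n) - s i x)) < e / 3) sequentially"
   using order_tendstoD(2)[OF lim(5)[OF lim(6)], of "e/3"] that by simp
  then show ?thesis
  proof eventually_elim
   case (elim n)
   have i0: "integ (%x. norm (s i x - f x))" using lim(1,4) by auto
   have i1: "integ (%x. norm (s i (x+Z n) - f (x+Z n)))"
    using integrable_lborel_shift[OF i0] .
   have i2: "integ (%x. norm (s i (x+Z n) - s i x))"
    by (rule integrable_shift_diff[OF lim(1)])
   have e: "(LINT x|lborel. norm (s i (x+Z n) - f (x+Z n)))=(LINT x|lborel. norm (s i x - f x))"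
    by (rule integral_lborel_shift) auto
   have "(LINT x|lborel. norm (f (x + Z n) - f x)) \<le>
    (LINT x|lborel. norm (s i (x + Z n) - f (x + Z n)) + norm (s i (x + Z n) - s i x) + norm (s i x - f x))"
   proof (rule integral_mono')
    show "norm (f (x+Z n) - f x) <= norm (s i (x+Z n) - f (x+Z n))+norm (s i (x+Z n) - s i x)+norm (s i x - f x)" for x
    by norm
   qed (use i0 i1 i2 in auto)
   also have "... = (LINT x|lborel. norm (s i (x + Z n) - f (x + Z n))) + (LINT x|lborel. norm (s i (x + Z n) - s i x))
    + (LINT x|lborel. norm (s i x - f x))"
    using i0 i1 i2 by simp
   also have "... < e" using elim i e by simp
   finally show ?case .
  qed
 qed
 moreover have "(LINT x|lborel. norm (f (x+Z n) - f x)) >= 0" for n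
  by (rule Bochner_Integration.integral_nonneg) auto
 ultimately show ?case
  by (rule tendsto_zero_nonnegI)
qed

lemma translation_continuous_L1_eps:
 fixes f :: "'a::euclidean_space => 'b::{banach, second_countable_topology}"
 assumes "integ f" "e > 0"
 obtains d where "d > 0" "!!z. norm z < d ==> (LINT x|lborel. norm (f (x+z) - f x)) < e"
proof (rule ccontr)
 assume "\<not> thesis"
 then have "\<forall>d>0. EX z. norm z < d & \<not> (LINT x|lborel. norm (f (x+z) - f x)) < e"
  using that by auto
 then have "\<forall>n::nat. EX z. norm z < inverse (Suc n) & \<not> (LINT x|lborel. norm (f (x+z) - f x)) < e"
  by simp
 then obtain Z where Z: "!!n::nat. norm (Z n) < inverse (Suc n)"
  "!!n. \<not> (LINT x|lborel. norm (f (x+Z n) - f x)) < e" by metis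
 have "Z ~~> 0"
  by (rule tendsto_norm_zero_cancel, rule tendsto_sandwich[OF _ _ tendsto_const LIMSEQ_inverse_real_of_nat])
   (use Z(1) in "auto intro!: always_eventually less_imp_le")
 from eventually_happens[OF order_tendstoD(2)[OF translation_continuous_L1[OF assms(1) this] assms(2)]]
 obtain n where "(LINT x|lborel. norm (f (x+Z n) - f x)) < e" by auto
 then show False using Z(2)[of n] by simp
qed

subsection \<open>Convolution\<close>

lemma C1_bounded:
 fixes ps :: "'a::euclidean_space => 'b::real_normed_vector"
 assumes "Ck 1 ps" "bounded {x. ps x ~= 0}"
 obtains B where "B >= 0" "!!x v. norm (fderv ps (at x) v) <= B * norm v"
  "!!x y. norm (ps x - ps y) <= B * norm (x - y)" "!!x. norm (ps x) <= B"
proof -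
 define K where "K=closure {x. ps x ~= 0}"
 define D where "D x v=fderv ps (at x) v" for x v
 have K: "compact K" unfolding K_def using assms by (simp add: compact_closure)
 have diff: "ps differentiable (at x)" for x using assms by auto
 have der: "(ps has_derivative D x) (at x)" for x
  using diff frechet_derivative_works unfolding D_def by blast
 have lin: "bounded_linear (D x)" for x using der has_derivative_bounded_linear by blast
 have cont: "continuous_on UNIV (%x. D x v)" for v using assms unfolding D_def by auto
 have zero: "D x v=0" if "x ~: K" for x v
 proof -
  have "open (- K)" unfolding K_def by auto
  moreover have "x : - K" using that by simp
  moreover have "ps y=0" if "y : - K" for y
   using that closure_subset[of "{x. ps x ~= 0}"] unfolding K_def by auto
  ultimately have "(ps has_derivative (%_. 0)) (at x)"
   by (intro has_derivative_transform_within_open[OF has_derivative_const[of 0]]) auto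
  then have "D x=(%_. 0)" using der has_derivative_unique by blast
  then show ?thesis by simp
 qed
 have "EX B. \<forall>x. norm (D x b) <= B" for b
 proof -
  have "bounded ((%x. D x b) ` K)"
   using compact_imp_bounded[OF compact_continuous_image[OF _ K]] cont continuous_on_subset by blast
  then obtain B where "\<forall>x\<in>K. norm (D x b) <= B" by (auto simp: bounded_iff)
  then have "norm (D x b) <= max B 0" for x using zero[of x b] by (cases "x : K") auto
  then show ?thesis by blast
 qed
 then obtain Bb where Bb: "!!b x. norm (D x b) <= Bb b" by metis
 have Bb0: "Bb b >= 0" for b using Bb[of undefined b] norm_ge_zero order_trans by blast
 define B1 where "B1=(\<Sum>b\<in>Basis. Bb b)"
 have B1: "norm (D x v) <= B1 * norm v" for x v
 proof -
  have "D x v=D x (\<Sum>b\<in>Basis. (v \<bullet> b) *\<^sub>R b)" by (simp add: euclidean_representation)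
  also have "...=(\<Sum>b\<in>Basis. (v \<bullet> b) *\<^sub>R D x b)"
   using lin[of x] by (simp add: linear_sum linear_scale bounded_linear.linear)
  also have "norm ... <= (\<Sum>b\<in>Basis. norm v * Bb b)"
   by (rule sum_norm_le) (auto intro!: mult_mono Bb Basis_le_norm)
  finally show ?thesis by (simp add: B1_def sum_distrib_left mult.commute)
 qed
 have "continuous_on UNIV ps"
  using diff by (auto intro!: differentiable_imp_continuous_on simp: differentiable_on_def differentiable_at_withinI)
 then have "bounded (ps ` K)"
  using compact_imp_bounded[OF compact_continuous_image[OF _ K]] continuous_on_subset by blast
 then obtain B2 where "\<forall>x\<in>K. norm (ps x) <= B2" by (auto simp: bounded_iff)
 then have B2: "norm (ps x) <= max B2 0" for x
 proof (cases "ps x=0")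
  case False
  then have "x : K" using closure_subset[of "{x. ps x ~= 0}"] unfolding K_def by auto
  then show ?thesis using \<open>\<forall>x\<in>K. norm (ps x) <= B2\<close> by (simp add: le_max_iff_disj)
 qed simp
 have B10: "B1 >= 0" unfolding B1_def by (intro sum_nonneg Bb0)
 have lip: "norm (ps x - ps y) <= B1 * norm (x - y)" for x y
 proof (rule differentiable_bound[of UNIV ps D B1])
  show "onorm (D x) <= B1" for x by (rule onorm_bound[OF B10 B1])
  show "(ps has_derivative D x) (at x within UNIV)" for x by (rule der)
 qed simp_all
 show ?thesis
 proof (rule that[of "B1+max B2 0"])
  show "norm (fderv ps (at x) v) <= (B1+max B2 0) * norm v" for x v
   using B1[of x v] mult_nonneg_nonneg[OF max.cobounded2[of 0 B2] norm_ge_zero[of v]] unfolding D_def distrib_right by linarith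
  show "norm (ps x - ps y) <= (B1+max B2 0) * norm (x - y)" for x y
   using lip[of x y] mult_nonneg_nonneg[OF max.cobounded2[of 0 B2] norm_ge_zero[of "x - y"]] unfolding distrib_right by linarith
 qed (use B10 B2 in "auto intro: add_increasing")
qed

definition moll :: "('a::euclidean_space => real) => ('a => 'b::{banach, second_countable_topology}) => 'a => 'b" where
 "moll rh f x=(LINT y|lborel. rh (y - x) *\<^sub>R f y)"

lemma moll_integrable:
 fixes f :: "'a::euclidean_space => 'b::{banach, second_countable_topology}"
 assumes "integ f" "rh : bmeas borel" "!!x. \<bar>rh x\<bar> <= B"
 shows "integ (%y. rh (y - x) *\<^sub>R f y)"
proof (rule Bochner_Integration.integrable_bound)
 show "integ (%y. B *\<^sub>R f y)" using assms by auto
 have "0 <= B" using assms(3)[of undefined] by linarith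
 then show "AE y in lborel. norm (rh (y - x) *\<^sub>R f y) <= norm (B *\<^sub>R f y)"
  using assms(3) by (auto intro!: AE_I2 mult_right_mono)
 show "(%y. rh (y - x) *\<^sub>R f y) : bmeas lborel"
  using assms(1,2) by measurable
qed

lemma moll_continuous:
 fixes f :: "'a::euclidean_space => 'b::{banach, second_countable_topology}"
 assumes f: "integ f" and rh: "continuous_on UNIV rh" and B: "!!x. \<bar>rh x\<bar> <= B"
 shows "continuous_on UNIV (moll rh f)"
proof -
 have [measurable]: "rh : bmeas borel" using rh by (rule borel_measurable_continuous_onI)
 have [measurable]: "f : bmeas borel" using f by auto
 have "(%n. moll rh f (X n)) ~~> moll rh f x" if X: "X ~~> x" for X x
  unfolding moll_def
 proof (rule integral_dominated_convergence[where w="%y. B * norm (f y)"])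
  show "AE y in lborel. (%n. rh (y - X n) *\<^sub>R f y) ~~> rh (y - x) *\<^sub>R f y"
  proof (rule AE_I2)
   fix y
   have "isCont rh (y - x)" using rh by (simp add: continuous_on_eq_continuous_at)
   from isCont_tendsto_compose[OF this tendsto_diff[OF tendsto_const X]]
   show "(%n. rh (y - X n) *\<^sub>R f y) ~~> rh (y - x) *\<^sub>R f y"
    by (intro tendsto_scaleR tendsto_const)
  qed
  show "AE y in lborel. norm (rh (y - X n) *\<^sub>R f y) <= B * norm (f y)" for n
   using B by (auto intro!: AE_I2 mult_right_mono)
 qed (use f in auto)
 then show ?thesis
  by (auto simp: continuous_on_eq_continuous_at continuous_at_sequentially o_def)
qed

lemma moll_has_derivative:
 fixes f :: "'a::euclidean_space => 'b::{banach, second_countable_topology}"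
 assumes f: "integ f" and C: "Ck 1 rh" and supp: "bounded {x. rh x ~= 0}"
 shows "(moll rh f has_derivative (%v. - moll (%z. fderv rh (at z) v) f x)) (at x)"
proof -
 define D where "D z v=fderv rh (at z) v" for z v
 obtain B where B0: "B >= 0" and B: "!!x v. norm (D x v) <= B * norm v"
  "!!x y. norm (rh x - rh y) <= B * norm (x - y)" "!!x. norm (rh x) <= B"
  using C1_bounded[OF C supp] unfolding D_def by blast
 have diff: "rh differentiable (at x)" for x using C by auto
 have der: "(rh has_derivative D x) (at x)" for x
  using diff frechet_derivative_works unfolding D_def by blast
 have lin: "linear (D x)" for x using der has_derivative_linear by blast
 have cont: "continuous_on UNIV (%x. D x v)" for v using C unfolding D_def by auto
 have contrh: "continuous_on UNIV rh"
  using diff by (auto intro!: differentiable_imp_continuous_on simp: differentiable_on_def differentiable_at_withinI)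
 have [measurable]: "rh : bmeas borel" "!!v. (%x. D x v) : bmeas borel"
  using cont contrh by (auto intro: borel_measurable_continuous_onI)
 have [measurable]: "f : bmeas borel" using f by auto
 have irh: "integ (%y. rh (y - x) *\<^sub>R f y)" for x
  by (rule moll_integrable[OF f, where B=B]) (use B in auto)
 have iD: "integ (%y. D (y - x) v *\<^sub>R f y)" for x v
  by (rule moll_integrable[OF f, where B="B * norm v"]) (use B in auto)
 define L where "L v=- moll (%z. D z v) f x" for v
 have "bounded_linear L"
 proof (rule bounded_linear_intro[where K="B * (LINT y|lborel. norm (f y))"])
  show "L (v+w)=L v+L w" for v w
   using iD[of x] by (simp add: L_def moll_def linear_add[OF lin] scaleR_add_left)
  show "L (r *\<^sub>R v)=r *\<^sub>R L v" for r v
   by (simp add: L_def moll_def linear_scale[OF lin] flip: scaleR_scaleR)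
  show "norm (L v) <= norm v * (B * (LINT y|lborel. norm (f y)))" for v
  proof -
   have "norm (L v) <= (LINT y|lborel. norm (D (y - x) v *\<^sub>R f y))"
    unfolding L_def moll_def norm_minus_cancel by (rule integral_norm_bound)
   also have "... <= (LINT y|lborel. (B * norm v) * norm (f y))"
    by (rule integral_mono') (use f B B0 in "auto intro!: mult_right_mono mult_nonneg_nonneg")
   finally show ?thesis by (simp add: ac_simps)
  qed
 qed
 moreover have "((%y. norm (moll rh f y - moll rh f x - L (y - x)) / norm (y - x)) \<longlongrightarrow> 0) (at x)"
  unfolding tendsto_at_iff_sequentially o_def
 proof (intro allI impI)
  fix X assume "\<forall>i. X i : UNIV - {x}" and X: "X ~~> x"
  then have ne: "X i ~= x" for i by auto
  define q where "q n y=(rh (y - X n) - rh (y - x)+D (y - x) (X n - x)) / norm (X n - x)" for n y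
  have [measurable]: "q n : bmeas borel" for n unfolding q_def by measurable
  have qb: "\<bar>q n y\<bar> <= 2 * B" for n y
  proof -
   have "\<bar>rh (y - X n) - rh (y - x)+D (y - x) (X n - x)\<bar> <= 2 * B * norm (X n - x)"
    using B(2)[of "y - X n" "y - x"] B(1)[of "y - x" "X n - x"] by (simp add: norm_minus_commute)
   then show ?thesis using ne[of n] by (simp add: q_def divide_simps)
  qed
  have lim: "(%n. LINT y|lborel. q n y *\<^sub>R f y) ~~> (LINT y::'a|lborel. (0::'b))"
  proof (rule integral_dominated_convergence[where w="%y. 2 * B * norm (f y)"])
   show "AE y in lborel. (%n. q n y *\<^sub>R f y) ~~> 0"
   proof (rule AE_I2)
    fix y
    have "((%w. norm (rh w - rh (y - x) - D (y - x) (w - (y - x))) / norm (w - (y - x))) \<longlongrightarrow> 0) (at (y - x))"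
    using der[of "y - x"] by (simp add: has_derivative_iff_norm)
    moreover have "(%n. y - X n) ~~> y - x" by (intro tendsto_intros X)
    ultimately have "(%n. norm (rh (y - X n) - rh (y - x) - D (y - x) ((y - X n) - (y - x))) / norm ((y - X n) - (y - x))) ~~> 0"
    using ne unfolding tendsto_at_iff_sequentially o_def
    by (elim allE[of _ "%n. y - X n"]) auto
    moreover have "norm (rh (y - X n) - rh (y - x) - D (y - x) ((y - X n) - (y - x))) / norm ((y - X n) - (y - x))=\<bar>q n y\<bar>" for n
    proof -
    have "(y - X n) - (y - x)=- (X n - x)" by simp
    then show ?thesis by (simp only: linear_neg[OF lin] norm_minus_cancel q_def) simp
    qed
    ultimately have "(%n. q n y) ~~> 0" by (simp add: tendsto_rabs_zero_iff)
    from tendsto_scaleR[OF this tendsto_const[of "f y"]]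
    show "(%n. q n y *\<^sub>R f y) ~~> 0" by simp
   qed
   show "AE y in lborel. norm (q n y *\<^sub>R f y) <= 2 * B * norm (f y)" for n
    using qb by (auto intro!: AE_I2 mult_right_mono)
  qed (use f in auto)
  have "norm (moll rh f (X n) - moll rh f x - L (X n - x)) / norm (X n - x)=norm (LINT y|lborel. q n y *\<^sub>R f y)" for n
  proof -
   have "q n y *\<^sub>R f y=(1 / norm (X n - x)) *\<^sub>R (rh (y - X n) *\<^sub>R f y - rh (y - x) *\<^sub>R f y+D (y - x) (X n - x) *\<^sub>R f y)" for y
    by (simp add: q_def scaleR_diff_left scaleR_add_left scaleR_add_right scaleR_diff_right
    add_divide_distrib diff_divide_distrib)
   then have "(LINT y|lborel. q n y *\<^sub>R f y)=(1 / norm (X n - x)) *\<^sub>R (moll rh f (X n) - moll rh f x - L (X n - x))"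
    using irh iD by (simp add: moll_def L_def)
   then show ?thesis by simp
  qed
  moreover have "(%n. norm (LINT y|lborel. q n y *\<^sub>R f y)) ~~> 0"
   using tendsto_norm_zero[of "%n. LINT y|lborel. q n y *\<^sub>R f y"] lim by simp
  ultimately show "(%n. norm (moll rh f (X n) - moll rh f x - L (X n - x)) / norm (X n - x)) ~~> 0"
   by (simp only:)
 qed
 ultimately have "(moll rh f has_derivative L) (at x)" unfolding has_derivative_iff_norm by (rule conjI)
 then show ?thesis unfolding L_def D_def .
qed


lemma bounded_support_deriv:
 fixes rh :: "'a::real_normed_vector => 'b::real_normed_vector"
 assumes "bounded {x. rh x ~= 0}"
 shows "bounded {x. fderv rh (at x) v ~= 0}"
proof (rule bounded_subset[OF bounded_closure[OF assms]], rule subsetI, rule ccontr)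
 let ?K = "closure {x. rh x ~= 0}"
 fix x assume x: "x : {x. fderv rh (at x) v ~= 0}" "x ~: ?K"
 have z: "0=rh y" if "y : - ?K" for y
  using that closure_subset[of "{x. rh x ~= 0}"] by auto
 have "open (- ?K)" "x : - ?K" using x by auto
 from has_derivative_transform_within_open[OF has_derivative_const[of 0] this z]
 have "(rh has_derivative (%_. 0)) (at x)" .
 from fun_cong[OF frechet_derivative_at[OF this, symmetric], of v] show False using x by simp
qed

lemma smooth_C1: "smooth rh ==> Ck 1 rh" unfolding smooth_def by (erule allE)

lemma smooth_bounded:
 fixes rh :: "'a::euclidean_space => 'b::real_normed_vector"
 assumes "smooth rh" "bounded {x. rh x ~= 0}"
 shows "EX B. \<forall>x. norm (rh x) <= B"
proof (rule C1_bounded[OF smooth_C1[OF assms(1)] assms(2)])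
 fix B assume "!!x. norm (rh x) <= B"
 then show ?thesis by (intro exI allI)
qed

lemma moll_Ck:
 fixes f :: "'a::euclidean_space => 'b::{banach, second_countable_topology}"
 assumes f: "integ f"
 shows "smooth rh ==> bounded {x. rh x ~= 0} ==> Ck k (moll rh f)"
proof (induction k arbitrary: rh)
 case 0
 obtain B where "!!x. norm (rh x) <= B"
  using smooth_bounded[OF 0] by blast
 then show ?case using moll_continuous[OF f smooth_continuous[OF 0(1)], of B] by simp
next
 case (Suc k)
 have 1: "Ck 1 rh" by (rule smooth_C1[OF Suc.prems(1)])
 have 2: "Ck k (moll (%z. fderv rh (at z) v) f)" for v
  by (rule Suc.IH[OF smooth_deriv[OF Suc.prems(1)] bounded_support_deriv[OF Suc.prems(2)]])
 show ?case
 proof (rule Ck_SucI[OF moll_has_derivative[OF f 1 Suc.prems(2)]])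
  fix v
  have "Ck k (%x. (-1) *\<^sub>R moll (%z. fderv rh (at z) v) f x)"
   by (rule Ck_bounded_bilinear[OF bounded_bilinear_scaleR Ck_const 2])
  then show "Ck k (%x. - moll (%z. fderv rh (at z) v) f x)" by simp
 qed
qed

lemma moll_smooth:
 fixes f :: "'a::euclidean_space => 'b::{banach, second_countable_topology}"
 assumes "integ f" "smooth rh" "bounded {x. rh x ~= 0}"
 shows "smooth (moll rh f)"
 unfolding smooth_def using moll_Ck[OF assms] by blast

text \<open>Fubini reduces the distance to an average of the \<open>L\<^sup>1\<close> distances between the function and its small translates.\<close>

lemma moll_L1_close:
 fixes f :: "'a::euclidean_space => 'b::{banach, second_countable_topology}"
 assumes f: "integ f" and "e > 0"
 obtains d where "d > 0" "!!rh. smooth rh ==> (!!x. rh x >= 0) ==> (!!x. x ~: ball 0 d ==> rh x = 0)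
  ==> integrable lborel rh ==> (LINT x|lborel. rh x) = 1
  ==> integrable lborel (moll rh f) & (LINT x|lborel. norm (moll rh f x - f x)) <= e"
proof -
 obtain d where d: "d > 0" "!!z. norm z < d ==> (LINT x|lborel. norm (f (x+z) - f x)) < e"
  by (rule translation_continuous_L1_eps[OF assms]) blast
 have [measurable]: "f : bmeas borel" using f by auto
 show thesis
 proof (rule that[OF d(1)])
  fix rh :: "'a => real"
  assume sm: "smooth rh" and pos: "!!x. rh x >= 0" and out: "!!x. x ~: ball 0 d ==> rh x=0"
   and int: "integ rh" and one: "(LINT x|lborel. rh x)=1"
  have supp: "bounded {x. rh x ~= 0}"
   by (rule bounded_subset[OF bounded_ball[of 0 d]]) (use out in force)
  obtain B where B: "!!x. norm (rh x) <= B"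
   using smooth_bounded[OF sm supp] by blast
  have [measurable]: "rh : bmeas borel" using int by auto
  have [measurable]: "moll rh f : bmeas borel"
   using smooth_continuous[OF moll_smooth[OF f sm supp]] by (rule borel_measurable_continuous_onI)
  have pt: "ennreal (norm (moll rh f x - f x)) <= (\<integral>\<^sup>+z. rh z * norm (f (x+z) - f x) \<partial>lborel)" for x
  proof -
   have i1: "integ (%z. rh z *\<^sub>R f (x+z))"
    using integrable_lborel_shift[OF moll_integrable[OF f, of rh B x], of x] B by (simp add: add.commute)
   have i2: "integ (%z. rh z *\<^sub>R f x)" using int by auto
   have "moll rh f x=(LINT z|lborel. rh z *\<^sub>R f (x+z))"
    unfolding moll_def using integral_lborel_shift[of "%y. rh (y - x) *\<^sub>R f y" x] by (simp add: add.commute)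
   moreover have "f x=(LINT z|lborel. rh z *\<^sub>R f x)" using int one by simp
   ultimately have "moll rh f x - f x=(LINT z|lborel. rh z *\<^sub>R f (x+z) - rh z *\<^sub>R f x)"
    using i1 i2 by simp
   also have "...=(LINT z|lborel. rh z *\<^sub>R (f (x+z) - f x))" by (simp add: scaleR_diff_right)
   finally have "ennreal (norm (moll rh f x - f x)) <= (\<integral>\<^sup>+z. norm (rh z *\<^sub>R (f (x+z) - f x)) \<partial>lborel)"
    using integral_norm_bound_ennreal[of lborel "%z. rh z *\<^sub>R (f (x+z) - f x)"] i1 i2
    by (simp add: scaleR_diff_right)
   then show ?thesis using pos by simp
  qed
  have inner: "(\<integral>\<^sup>+x. rh z * norm (f (x+z) - f x) \<partial>lborel) <= ennreal (rh z * e)" for z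
  proof (cases "z : ball 0 d")
   case True
   have i: "integ (%x. norm (f (x+z) - f x))" using f by (rule integrable_shift_diff)
   have "(\<integral>\<^sup>+x. rh z * norm (f (x+z) - f x) \<partial>lborel)=ennreal (LINT x|lborel. rh z * norm (f (x+z) - f x))"
    using i pos by (subst nn_integral_eq_integral) auto
   also have "... <= ennreal (rh z * e)"
    using less_imp_le[OF d(2)[of z]] True pos[of z] by (simp add: ennreal_leI mult_left_mono)
   finally show ?thesis .
  qed (use out in auto)
  have "(\<integral>\<^sup>+x. norm (moll rh f x - f x) \<partial>lborel) <= (\<integral>\<^sup>+x. (\<integral>\<^sup>+z. rh z * norm (f (x+z) - f x) \<partial>lborel) \<partial>lborel)"
   by (intro nn_integral_mono pt)
  also have "...=(\<integral>\<^sup>+z. (\<integral>\<^sup>+x. rh z * norm (f (x+z) - f x) \<partial>lborel) \<partial>lborel)"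
   by (rule lborel_pair.Fubini'[symmetric]) measurable
  also have "... <= (\<integral>\<^sup>+z. ennreal (rh z * e) \<partial>lborel)"
   by (intro nn_integral_mono inner)
  also have "...=ennreal e"
   using int one pos \<open>e > 0\<close> by (subst nn_integral_eq_integral) auto
  finally have le: "(\<integral>\<^sup>+x. norm (moll rh f x - f x) \<partial>lborel) <= ennreal e" .
  have id: "integ (%x. moll rh f x - f x)"
   by (rule integrableI_bounded) (use le_less_trans[OF le ennreal_less_top] in auto)
  have "integ (moll rh f)" using Bochner_Integration.integrable_add[OF id f] by simp
  moreover have "(LINT x|lborel. norm (moll rh f x - f x)) <= e"
  proof -
   have "(\<integral>\<^sup>+x. norm (moll rh f x - f x) \<partial>lborel)=ennreal (LINT x|lborel. norm (moll rh f x - f x))"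
    by (rule nn_integral_eq_integral) (use id in auto)
   then show ?thesis using le \<open>e > 0\<close> by simp
  qed
  ultimately show "integ (moll rh f) & (LINT x|lborel. norm (moll rh f x - f x)) <= e" by blast
 qed
qed

section \<open>Weak gradients\<close>

lemma borel_measurable_vec_nth:
 fixes f :: "'a => 'b::euclidean_space^'n"
 assumes "f : bmeas M"
 shows "(%x. f x $ j) : bmeas M"
proof (rule borel_measurable_continuous_on[OF _ assms])
 show "continuous_on UNIV (%x::'b^'n. x $ j)"
  by (rule linear_continuous_on[OF bounded_linear_vec_nth])
qed

lemma borel_measurable_vec_lambda:
 fixes f :: "'n::finite => 'a => 'b::euclidean_space"
 assumes "!!j. f j : bmeas M"
 shows "(%x. \<chi> j. f j x) : bmeas M"
proof (subst borel_measurable_euclidean_space, rule ballI)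
 fix i :: "'b^'n" assume "i : Basis"
 then obtain k b where i: "i=axis k b" "b : Basis" by (auto simp: Basis_vec_def)
 have "(%x. f k x \<bullet> b) : bmeas M" using assms by measurable
 then show "(%x. (\<chi> j. f j x) \<bullet> i) : bmeas M" by (simp add: i inner_axis)
qed

lemma norm_vec_le_sum: "norm (x::'b::real_normed_vector^'n) <= (\<Sum>j\<in>UNIV. norm (x $ j))"
 unfolding norm_vec_def by (rule L2_set_le_sum) simp

lemma integrable_vec_lambda:
 fixes f :: "'n::finite => 'a => 'b::euclidean_space"
 assumes "!!j. integrable M (f j)"
 shows "integrable M (%x. \<chi> j. f j x)"
proof (rule Bochner_Integration.integrable_bound)
 show "integrable M (%x. \<Sum>j\<in>UNIV. norm (f j x))" using assms by (intro Bochner_Integration.integrable_sum integrable_norm)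
 show "(%x. \<chi> j. f j x) : bmeas M" using assms by (intro borel_measurable_vec_lambda borel_measurable_integrable)
 show "AE x in M. norm (\<chi> j. f j x) <= norm (\<Sum>j\<in>UNIV. norm (f j x))"
 proof (rule AE_I2)
  fix x
  show "norm (\<chi> j. f j x) <= norm (\<Sum>j\<in>UNIV. norm (f j x))"
   using norm_vec_le_sum[of "\<chi> j. f j x"] by simp
 qed
qed

lemma integrable_vec_nth:
 fixes f :: "'a => 'b::euclidean_space^'n"
 shows "integrable M f ==> integrable M (%x. f x $ j)"
 by (rule integrable_bounded_linear[OF bounded_linear_vec_nth])

lemma integrable_bounded_mult:
 fixes f :: "'a => 'b::{banach, second_countable_topology}"
 assumes "integrable M f" "rh : bmeas M" "!!x. \<bar>rh x\<bar> <= B"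
 shows "integrable M (%y. rh y *\<^sub>R f y)"
proof (rule Bochner_Integration.integrable_bound)
 show "integrable M (%y. B *\<^sub>R f y)" using assms(1) by (intro integrable_scaleR_right)
 have "0 <= B" using assms(3)[of undefined] by linarith
 then show "AE y in M. norm (rh y *\<^sub>R f y) <= norm (B *\<^sub>R f y)"
  using assms(3) by (intro AE_I2) (auto intro!: mult_right_mono)
 show "(%y. rh y *\<^sub>R f y) : bmeas M"
  by (rule borel_measurable_scaleR[OF assms(2) borel_measurable_integrable[OF assms(1)]])
qed

lemma integrable_continuous_bounded_support:
 fixes f :: "'a::euclidean_space => 'b::{banach, second_countable_topology}"
 assumes "continuous_on UNIV f" "bounded {x. f x ~= 0}"
 shows "integ f"
proof -
 let ?K = "closure {x. f x ~= 0}"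
 have "compact ?K" using assms(2) by (simp add: compact_closure)
 then have "integ (%x. indicator ?K x *\<^sub>R f x)"
  by (rule borel_integrable_compact) (rule continuous_on_subset[OF assms(1) subset_UNIV])
 also have "(%x. indicator ?K x *\<^sub>R f x)=f"
 proof (rule ext)
  fix x show "indicator ?K x *\<^sub>R f x=f x"
   using closure_subset[of "{x. f x ~= 0}"] by (cases "f x=0") (auto simp: indicator_def)
 qed
 finally show ?thesis .
qed

lemma Ck1_continuous: "Ck 1 f ==> continuous_on UNIV f"
 using Ck_Suc_D[of 0 f] by simp

lemma Ck1_deriv_continuous: "Ck 1 f ==> continuous_on UNIV (%x. fderv f (at x) v)"
 by simp

lemma Ck1_has_derivative: "Ck 1 f ==> (f has_derivative fderv f (at x)) (at x)"
 by (simp add: frechet_derivative_works[symmetric])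

lemma integral_deriv_zero_real:
 fixes rh :: "'a::euclidean_space => real"
 assumes C: "Ck 1 rh" and b: "bounded {x. rh x ~= 0}"
 shows "(LINT x|lborel. fderv rh (at x) v)=0"
proof -
 obtain R where R: "!!x. rh x ~= 0 ==> norm x <= R" using b unfolding bounded_iff by blast
 define K where "K=cball (0::'a) (\<bar>R\<bar>+1)"
 let ?i = "indicator K :: 'a => real"
 have K: "compact K" unfolding K_def by simp
 have int: "integ ?i"
  using emeasure_compact_finite[OF K] borel_compact[OF K] by (simp add: integrable_indicator_iff)
 have [measurable]: "rh : bmeas borel"
  by (rule borel_measurable_continuous_onI[OF Ck1_continuous[OF C]])
 have const: "moll rh ?i x=(LINT y|lborel. rh y)" if "x : ball 0 1" for x
 proof -
  have "rh (y - x) *\<^sub>R ?i y=rh (y - x)" for y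
  proof (cases "rh (y - x)=0")
   case False
   from R[OF this] have "norm y <= \<bar>R\<bar>+1"
    using that norm_triangle_sub[of y x] by (simp add: norm_minus_commute)
   then show ?thesis by (simp add: K_def)
  qed simp
  then have "moll rh ?i x=(LINT y|lborel. rh (y - x))" unfolding moll_def by (simp only:)
  also have "...=(LINT y|lborel. rh (y+(- x)))" by simp
  also have "...=(LINT y|lborel. rh y)" by (rule integral_lborel_shift) measurable
  finally show ?thesis .
 qed
 have d1: "(moll rh ?i has_derivative (%v. - moll (%z. fderv rh (at z) v) ?i 0)) (at 0)"
  by (rule moll_has_derivative[OF int C b])
 have d2: "(moll rh ?i has_derivative (%_. 0)) (at 0)"
  by (rule has_derivative_transform_within_open[OF has_derivative_const[of "LINT y|lborel. rh y"], of "ball 0 1"])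
   (simp_all add: const)
 have "moll (%z. fderv rh (at z) v) ?i 0=0"
  using fun_cong[OF has_derivative_unique[OF d1 d2], of v] by simp
 moreover have eq2: "fderv rh (at y) v *\<^sub>R ?i y=fderv rh (at y) v" for y
 proof (cases "y : K")
  case False
  have z: "0=rh w" if "w : - K" for w using R[of w] that unfolding K_def by fastforce
  have "open (- K)" "y : - K" using False K compact_imp_closed by auto
  from has_derivative_transform_within_open[OF has_derivative_const[of 0] this z]
  have "(rh has_derivative (%_. 0)) (at y)" .
  from fun_cong[OF frechet_derivative_at[OF this, symmetric], of v] show ?thesis by simp
 qed simp
 ultimately show ?thesis unfolding moll_def diff_zero by (simp only:)
qed

lemma integral_deriv_zero:
 fixes ps :: "'a::euclidean_space => 'b::euclidean_space"
 assumes C: "Ck 1 ps" and b: "bounded {x. ps x ~= 0}"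
 shows "integ (%x. fderv ps (at x) v)"
  "(LINT x|lborel. fderv ps (at x) v)=0"
proof -
 show int: "integ (%x. fderv ps (at x) v)"
  by (rule integrable_continuous_bounded_support[OF Ck1_deriv_continuous[OF C] bounded_support_deriv[OF b]])
 have "(LINT x|lborel. fderv ps (at x) v) \<bullet> i=0" for i
 proof -
  let ?rh = "%x. ps x \<bullet> i"
  have d: "(?rh has_derivative (%v. fderv ps (at x) v \<bullet> i)) (at x)" for x
   by (rule has_derivative_inner_left[OF Ck1_has_derivative[OF C]])
  have Ci: "Ck 1 ?rh"
   by (rule Ck_bounded_bilinear[OF bounded_bilinear_inner C Ck_const])
  have "bounded {x. ?rh x ~= 0}" by (rule bounded_subset[OF b]) auto
  from integral_deriv_zero_real[OF Ci this, of v]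
  have "(LINT x|lborel. fderv ps (at x) v \<bullet> i)=0"
   by (simp add: frechet_derivative_at[OF d, symmetric])
  then show ?thesis using int by simp
 qed
 then have "(LINT x|lborel. fderv ps (at x) v) \<bullet> i=0 \<bullet> i" for i by simp
 then show "(LINT x|lborel. fderv ps (at x) v)=0"
  by (intro euclidean_eqI[of "LINT x|lborel. fderv ps (at x) v" "0::'b"])
qed

text \<open>The product has compact support, so the integral of its derivative vanishes.\<close>

lemma integration_by_parts:
 fixes ph :: "'a::euclidean_space => real" and f :: "'a => 'b::euclidean_space"
 assumes C: "Ck 1 ph" "Ck 1 f" and b: "bounded {x. ph x ~= 0}"
 shows "(LINT x|lborel. frechet_derivative ph (at x) v *\<^sub>R f x)
  = - (LINT x|lborel. ph x *\<^sub>R frechet_derivative f (at x) v)"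
proof -
 let ?ps = "%x. ph x *\<^sub>R f x"
 have d: "(?ps has_derivative (%v. ph x *\<^sub>R fderv f (at x) v+fderv ph (at x) v *\<^sub>R f x)) (at x)" for x
  by (rule has_derivative_scaleR[OF Ck1_has_derivative[OF C(1)] Ck1_has_derivative[OF C(2)]])
 have Cps: "Ck 1 ?ps"
  by (rule Ck_bounded_bilinear[OF bounded_bilinear_scaleR C])
 have bps: "bounded {x. ?ps x ~= 0}" by (rule bounded_subset[OF b]) auto
 have i1: "integ (%x. ph x *\<^sub>R fderv f (at x) v)"
  by (rule integrable_continuous_bounded_support)
   (rule continuous_on_scaleR[OF Ck1_continuous[OF C(1)] Ck1_deriv_continuous[OF C(2)]],
    rule bounded_subset[OF b], force)
 have i2: "integ (%x. fderv ph (at x) v *\<^sub>R f x)"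
  by (rule integrable_continuous_bounded_support)
   (rule continuous_on_scaleR[OF Ck1_deriv_continuous[OF C(1)] Ck1_continuous[OF C(2)]],
    rule bounded_subset[OF bounded_support_deriv[OF b, of v]], force)
 have "(LINT x|lborel. ph x *\<^sub>R fderv f (at x) v+fderv ph (at x) v *\<^sub>R f x)=0"
  using integral_deriv_zero(2)[OF Cps bps, of v] by (simp add: frechet_derivative_at[OF d, symmetric])
 then show ?thesis using i1 i2 by (simp add: eq_neg_iff_add_eq_0 add.commute)
qed

subsection \<open>Test functions\<close>

lemma test_functionsD:
 assumes "ph : test_functions Om"
 shows "smooth ph" "Ck 1 ph" "bounded {x. ph x ~= 0}" "x ~: Om ==> ph x=0"
  "compact (closure {x. ph x ~= 0})" "closure {x. ph x ~= 0} \<subseteq> Om"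
  "ph : bmeas borel" "pderv j ph : bmeas borel"
proof -
 show s: "smooth ph" and c: "compact (closure {x. ph x ~= 0})" and cs: "closure {x. ph x ~= 0} \<subseteq> Om"
  using assms unfolding test_functions_def by blast+
 show "bounded {x. ph x ~= 0}" by (rule bounded_subset[OF compact_imp_bounded[OF c] closure_subset])
 show "ph x=0" if "x ~: Om" using that cs closure_subset[of "{x. ph x ~= 0}"] by blast
 show "Ck 1 ph" by (rule smooth_C1[OF s])
 show "ph : bmeas borel" by (rule borel_measurable_continuous_onI[OF smooth_continuous[OF s]])
 show "pderv j ph : bmeas borel"
  unfolding partial_deriv_def by (rule borel_measurable_continuous_onI[OF smooth_continuous_deriv[OF s]])
qed

lemma test_function_bound:
 assumes "ph : test_functions Om"
 shows "\<exists>B\<ge>0. (\<forall>x. \<bar>ph x\<bar> <= B) & (\<forall>x j. \<bar>pderv j ph x\<bar> <= B)"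
proof (rule C1_bounded[OF test_functionsD(2,3)[OF assms]])
 fix B assume B: "B >= 0" "!!x v. norm (fderv ph (at x) v) <= B * norm v" "!!x. norm (ph x) <= B"
 show ?thesis
 proof (intro exI conjI allI)
  show "B >= 0" by (rule B(1))
  show "\<bar>ph x\<bar> <= B" for x using B(3)[of x] by simp
  show "\<bar>pderv j ph x\<bar> <= B" for x j
   using B(2)[of x "axis j 1"] by (simp add: partial_deriv_def)
 qed
qed

lemma test_function_deriv_outside:
 assumes "ph : test_functions Om" "x ~: Om"
 shows "pderv j ph x=0"
proof -
 let ?K = "closure {x. ph x ~= 0}"
 have z: "0=ph w" if "w : - ?K" for w using that closure_subset[of "{x. ph x ~= 0}"] by auto
 have "open (- ?K)" "x : - ?K" using assms test_functionsD(6)[OF assms(1)] by auto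
 from has_derivative_transform_within_open[OF has_derivative_const[of 0] this z]
 have "(ph has_derivative (%_. 0)) (at x)" .
 from fun_cong[OF frechet_derivative_at[OF this, symmetric], of "axis j 1"]
 show ?thesis by (simp add: partial_deriv_def)
qed

lemma test_function_mult:
 assumes "ph : test_functions Om" "smooth zt"
 shows "(%x. ph x * zt x) : test_functions Om"
  "pderv j (%x. ph x * zt x) x=pderv j ph x * zt x+ph x * pderv j zt x"
proof -
 have sub: "closure {x. ph x * zt x ~= 0} \<subseteq> closure {x. ph x ~= 0}" by (rule closure_mono) auto
 have c: "compact (closure {x. ph x * zt x ~= 0})"
  by (rule compact_closure[THEN iffD2], rule bounded_subset[OF test_functionsD(3)[OF assms(1)]]) auto
 have sm: "smooth (%x. ph x * zt x)" by (rule smooth_mult[OF test_functionsD(1)[OF assms(1)] assms(2)])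
 show "(%x. ph x * zt x) : test_functions Om"
  using c sm sub test_functionsD(6)[OF assms(1)] unfolding test_functions_def by blast
 have "((%x. ph x * zt x) has_derivative (%v. ph x * fderv zt (at x) v+fderv ph (at x) v * zt x)) (at x)"
  by (rule has_derivative_mult[OF Ck1_has_derivative[OF test_functionsD(2)[OF assms(1)]] Ck1_has_derivative[OF smooth_C1[OF assms(2)]]])
 from fun_cong[OF frechet_derivative_at[OF this], of "axis j 1"]
 show "pderv j (%x. ph x * zt x) x=pderv j ph x * zt x+ph x * pderv j zt x"
  by (simp add: partial_deriv_def)
qed

lemma frechet_derivative_translate:
 assumes "rh differentiable (at (y - x))"
 shows "fderv (%y. rh (y - x)) (at y)=fderv rh (at (y - x))"
proof -
 have "((%y. y - x) has_derivative (%v. v)) (at y)" by (auto intro!: derivative_eq_intros)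
 from diff_chain_at[OF this, of rh "fderv rh (at (y - x))"] assms
 have "((%y. rh (y - x)) has_derivative fderv rh (at (y - x))) (at y)"
  by (simp add: frechet_derivative_works o_def)
 from frechet_derivative_at[OF this] show ?thesis by simp
qed

lemma test_function_translate:
 fixes rh :: "real^'n => real"
 assumes "smooth rh" "!!y. rh y ~= 0 ==> y : cball a c" "cball (x+a) c \<subseteq> Om"
 shows "(%y. rh (y - x)) : test_functions Om"
  "pderv j (%y. rh (y - x)) y=fderv rh (at (y - x)) (axis j 1)"
proof -
 have sub: "{y. rh (y - x) ~= 0} \<subseteq> cball (x+a) c"
 proof
  fix y assume "y : {y. rh (y - x) ~= 0}"
  then have "y - x : cball a c" using assms(2) by simp
  then show "y : cball (x+a) c" by (simp add: dist_norm algebra_simps)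
 qed
 have cl: "closure {y. rh (y - x) ~= 0} \<subseteq> cball (x+a) c"
  by (rule closure_minimal[OF sub closed_cball])
 have c: "compact (closure {y. rh (y - x) ~= 0})"
  by (rule compact_closure[THEN iffD2], rule bounded_subset[OF bounded_cball sub])
 have "smooth (%y. rh (y - x))"
  unfolding smooth_def
 proof
  fix k
  have "Ck k rh" using assms(1) unfolding smooth_def ..
  from Ck_compose_affine[OF bounded_linear_ident this, of "- x"] show "Ck k (%y. rh (y - x))" by simp
 qed
 then show "(%y. rh (y - x)) : test_functions Om"
  unfolding test_functions_def using c order_trans[OF cl assms(3)] by blast
 show "pderv j (%y. rh (y - x)) y=fderv rh (at (y - x)) (axis j 1)"
  unfolding partial_deriv_def by (simp add: frechet_derivative_translate smooth_differentiable[OF assms(1)])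
qed

subsection \<open>Weak gradients of functions extended by zero\<close>

definition wgrad :: "(real^'n) set => (real^'n => 'b::euclidean_space) => (real^'n => 'b^'n) => bool" where
 "wgrad Om f G \<longleftrightarrow> integrable lborel f & integrable lborel G & (\<forall>x. x ~: Om --> f x = 0 & G x = 0) \<and>
  (\<forall>ph\<in>test_functions Om. \<forall>j. (LINT x|lborel. partial_deriv j ph x *\<^sub>R f x) = - (LINT x|lborel. ph x *\<^sub>R G x $ j))"

lemma wgradD:
 assumes "wgrad Om f G"
 shows "integ f" "integ G" "x ~: Om ==> f x=0" "x ~: Om ==> G x=0"
  "ph : test_functions Om ==> (LINT x|lborel. pderv j ph x *\<^sub>R f x)=- (LINT x|lborel. ph x *\<^sub>R G x $ j)"
 using assms unfolding wgrad_def by blast+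

lemma integral_vec_nth:
 fixes G :: "'a => 'b::euclidean_space^'n"
 assumes "integrable M G"
 shows "(LINT x|M. G x) $ j=(LINT x|M. G x $ j)"
 using integral_bounded_linear[OF bounded_linear_vec_nth assms, of j] by simp

lemma moll_weak_gradient:
 assumes w: "wgrad Om f G" and s: "smooth rh"
  and supp: "!!y. rh y ~= 0 ==> y : cball a c" "cball (x+a) c \<subseteq> Om"
 shows "fderv (moll rh f) (at x) (axis j 1)=moll rh G x $ j"
proof -
 have b: "bounded {x. rh x ~= 0}" by (rule bounded_subset[OF bounded_cball[of a c]]) (use supp(1) in blast)
 obtain B where B: "\<forall>x. norm (rh x) <= B" using smooth_bounded[OF s b] by blast
 have rhm: "rh : bmeas borel" by (rule borel_measurable_continuous_onI[OF smooth_continuous[OF s]])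
 have iG: "integ (%y. rh (y - x) *\<^sub>R G y)"
  by (rule moll_integrable[OF wgradD(2)[OF w] rhm, where B=B]) (use B in simp)
 have "fderv (moll rh f) (at x) (axis j 1)=- moll (%z. fderv rh (at z) (axis j 1)) f x"
  using frechet_derivative_at[OF moll_has_derivative[OF wgradD(1)[OF w] smooth_C1[OF s] b, of x], symmetric]
  by (simp add: fun_eq_iff)
 also have "moll (%z. frechet_derivative rh (at z) (axis j 1)) f x
  = (LINT y|lborel. partial_deriv j (%y. rh (y - x)) y *\<^sub>R f y)"
  unfolding moll_def by (simp add: test_function_translate(2)[OF s supp])
 also have "...=- (LINT y|lborel. rh (y - x) *\<^sub>R G y $ j)"
  by (rule wgradD(5)[OF w test_function_translate(1)[OF s supp]])
 also have "(LINT y|lborel. rh (y - x) *\<^sub>R G y $ j)=moll rh G x $ j"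
  unfolding moll_def using integral_vec_nth[OF iG, of j] by simp
 finally show ?thesis by simp
qed

lemma mollifier_close:
 fixes f :: "'a::euclidean_space => 'b::{banach, second_countable_topology}"
  and g :: "'a::euclidean_space => 'c::{banach, second_countable_topology}"
 assumes f: "integ f" and g: "integ g" and "e > 0" "c > 0" "tmax > 0"
 obtains t and rh :: "'a => real" where "0 < t" "t <= tmax" "smooth rh" "!!x. rh x >= 0"
  "!!x. rh x ~= 0 ==> x : cball (t *\<^sub>R a) (t * c)" "bounded {x. rh x ~= 0}"
  "integ (moll rh f)" "(LINT x|lborel. norm (moll rh f x - f x)) <= e"
  "integ (moll rh g)" "(LINT x|lborel. norm (moll rh g x - g x)) <= e"
proof (rule moll_L1_close[OF f \<open>e > 0\<close>], rule moll_L1_close[OF g \<open>e > 0\<close>])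
 fix d1 d2 :: real
 assume d1: "d1 > 0" "!!rh. smooth rh ==> (!!x. rh x >= 0) ==> (!!x. x ~: ball 0 d1 ==> rh x = 0)
  ==> integrable lborel rh ==> (LINT x|lborel. rh x) = 1
  ==> integrable lborel (moll rh f) & (LINT x|lborel. norm (moll rh f x - f x)) <= e"
 and d2: "d2 > 0" "!!rh. smooth rh ==> (!!x. rh x >= 0) ==> (!!x. x ~: ball 0 d2 ==> rh x = 0)
  ==> integrable lborel rh ==> (LINT x|lborel. rh x) = 1
  ==> integrable lborel (moll rh g) & (LINT x|lborel. norm (moll rh g x - g x)) <= e"
 define d where "d=min d1 d2"
 define t where "t=min tmax (d / (2 * (norm a+c)))"
 have nc: "norm a + c > 0" using \<open>c > 0\<close> norm_ge_zero[of a] by linarith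
 have d: "d > 0" using d1 d2 by (simp add: d_def)
 have t: "t > 0" "t <= tmax" using d nc \<open>tmax > 0\<close> by (simp_all add: t_def)
 have "t * (norm a+c) <= d / (2 * (norm a+c)) * (norm a+c)"
  by (rule mult_right_mono) (use nc in "simp_all add: t_def")
 also have "...=d / 2" using nc by (simp only: times_divide_eq_left) (simp add: field_simps)
 also have "... < d" using d by simp
 finally have td: "t * (norm a+c) < d" .
 have "t * c > 0" using t \<open>c > 0\<close> by simp
 from mollifier_exists[OF this, of "t *\<^sub>R a"] obtain rh :: "'a => real" where
  rh: "smooth rh" "!!x. rh x >= 0" "!!x. x ~: ball (t *\<^sub>R a) (t * c) ==> rh x=0"
  "integ rh" "(LINT x|lborel. rh x)=1" by blast
 have supp: "x : cball (t *\<^sub>R a) (t * c)" if "rh x ~= 0" for x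
  using rh(3)[of x] that ball_subset_cball by blast
 have out: "rh x=0" if "x ~: ball 0 d" for x
 proof (rule ccontr)
  assume "rh x ~= 0"
  from supp[OF this] have "norm (x - t *\<^sub>R a) <= t * c" by (simp add: dist_norm norm_minus_commute)
  then have "norm x <= norm (t *\<^sub>R a)+t * c" using norm_triangle_sub[of x "t *\<^sub>R a"] by linarith
  also have "...=t * (norm a+c)" using t by (simp add: algebra_simps)
  finally show False using td that by simp
 qed
 have out1: "rh x=0" if "x ~: ball 0 d1" for x using that out[of x] by (simp add: d_def)
 have out2: "rh x=0" if "x ~: ball 0 d2" for x using that out[of x] by (simp add: d_def)
 have b: "bounded {x. rh x ~= 0}" by (rule bounded_subset[OF bounded_cball]) (use supp in blast)
 show thesis
  using that[OF t rh(1,2) supp b] d1(2)[OF rh(1,2) out1 rh(4,5)] d2(2)[OF rh(1,2) out2 rh(4,5)] by blast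
qed

section \<open>Uniqueness, products and the chain rule\<close>

text \<open>A sequence of mollifiers adapted to two functions, with supports shrinking to a point and, on a
 subsequence, almost everywhere convergence.\<close>

lemma mollifier_sequence:
 fixes f :: "'a::euclidean_space => 'b::{banach, second_countable_topology}"
  and g :: "'a::euclidean_space => 'c::{banach, second_countable_topology}"
 assumes f: "integ f" and g: "integ g"
 obtains rh :: "nat => 'a => real" and t :: "nat => real"
 where "!!n. smooth (rh n)" "!!n. bounded {x. rh n x ~= 0}" "!!n x. rh n x ~= 0 ==> x : cball 0 (t n)"
  "!!n. 0 < t n" "t ~~> 0"
  "!!n. integ (moll (rh n) f)" "!!n. integ (moll (rh n) g)"
  "(%n. LINT x|lborel. norm (moll (rh n) f x - f x)) ~~> 0"
  "(%n. LINT x|lborel. norm (moll (rh n) g x - g x)) ~~> 0"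
  "AE x in lborel. (%n. moll (rh n) f x) ~~> f x"
proof -
 define Q where "Q n rh s \<longleftrightarrow> 0 < s & s <= inverse (Suc n) & smooth rh & (\<forall>x. rh x ~= 0 --> x : cball 0 s) & bounded {x. rh x ~= 0} \<and>
  integrable lborel (moll rh f) & (LINT x|lborel. norm (moll rh f x - f x)) <= inverse (Suc n) \<and>
  integrable lborel (moll rh g) & (LINT x|lborel. norm (moll rh g x - g x)) <= inverse (Suc n)"
  for n :: nat and rh :: "'a => real" and s
 have "\<exists>rh s. Q n rh s" for n
 proof (rule mollifier_close[OF f g, where e="inverse (Suc n)" and c=1 and tmax="inverse (Suc n)" and a=0])
  fix s and rh :: "'a => real"
  assume a: "0 < s" "s <= inverse (Suc n)" "smooth rh" "!!x. rh x ~= 0 ==> x : cball (s *\<^sub>R 0) (s * 1)" "bounded {x. rh x ~= 0}"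
   "integ (moll rh f)" "(LINT x|lborel. norm (moll rh f x - f x)) <= inverse (Suc n)"
   "integ (moll rh g)" "(LINT x|lborel. norm (moll rh g x - g x)) <= inverse (Suc n)"
  have "\<forall>x. rh x ~= 0 --> x : cball 0 s" using a(4) by simp
  with a show ?thesis unfolding Q_def by (intro exI[of _ rh] exI[of _ s]) simp
 qed simp_all
 then obtain rh s where Q: "!!n. Q n (rh n) (s n)" by metis
 have *: "0 < s n & s n <= inverse (Suc n) & smooth (rh n) & (\<forall>x. rh n x ~= 0 --> x : cball 0 (s n)) & bounded {x. rh n x ~= 0} \<and>
  integrable lborel (moll (rh n) f) & (LINT x|lborel. norm (moll (rh n) f x - f x)) <= inverse (Suc n) \<and>
  integrable lborel (moll (rh n) g) & (LINT x|lborel. norm (moll (rh n) g x - g x)) <= inverse (Suc n)" for n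
  using Q[of n] unfolding Q_def .
 have inv: "(%n. inverse (real (Suc n))) ~~> 0" by (rule LIMSEQ_inverse_real_of_nat)
 have s: "s ~~> 0"
  by (rule tendsto_sandwich[OF _ _ tendsto_const inv]) (use * less_imp_le in "auto intro!: always_eventually")
 have cf: "(%n. LINT x|lborel. norm (moll (rh n) f x - f x)) ~~> 0"
  by (rule tendsto_sandwich[OF _ _ tendsto_const inv]) (use * in "auto intro!: always_eventually Bochner_Integration.integral_nonneg")
 have cg: "(%n. LINT x|lborel. norm (moll (rh n) g x - g x)) ~~> 0"
  by (rule tendsto_sandwich[OF _ _ tendsto_const inv]) (use * in "auto intro!: always_eventually Bochner_Integration.integral_nonneg")
 have "integ (%x. moll (rh n) f x - f x)" for n
  using *[of n] f by (intro Bochner_Integration.integrable_diff) blast+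
 from tendsto_L1_AE_subseq[OF this cf] obtain r where r: "strict_mono r"
  "AE x in lborel. (%n. moll (rh (r n)) f x - f x) ~~> 0" by blast
 have AE: "AE x in lborel. (%n. moll (rh (r n)) f x) ~~> f x"
  using r(2) by (rule AE_mp) (rule AE_I2, simp add: LIM_zero_iff)
 show thesis
 proof (rule that[of "%n. rh (r n)" "%n. s (r n)"])
  show "(%n. s (r n)) ~~> 0" using LIMSEQ_subseq_LIMSEQ[OF s r(1)] by (simp add: o_def)
  show "(%n. LINT x|lborel. norm (moll (rh (r n)) f x - f x)) ~~> 0"
   using LIMSEQ_subseq_LIMSEQ[OF cf r(1)] by (simp add: o_def)
  show "(%n. LINT x|lborel. norm (moll (rh (r n)) g x - g x)) ~~> 0"
   using LIMSEQ_subseq_LIMSEQ[OF cg r(1)] by (simp add: o_def)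
 qed (use * AE in blast)+
qed

lemma compact_cball_margin:
 fixes K :: "'a::euclidean_space set"
 assumes "compact K" "K \<subseteq> Om" "open Om"
 obtains d where "d > 0" "!!x. x : K ==> cball x d \<subseteq> Om"
proof (cases "K={}")
 case True
 then show ?thesis using that[of 1] by simp
next
 case False
 show ?thesis
 proof (cases "Om=UNIV")
  case True
  then show ?thesis using that[of 1] by simp
 next
  case neq: False
  have cl: "closed (- Om)" using assms by auto
  have dis: "K \<inter> - Om={}" using assms by blast
  obtain d where d: "d > 0" "!!x y. x : K ==> y : - Om ==> d <= dist x y"
   using separate_compact_closed[OF assms(1) cl dis] by blast
  show ?thesis
  proof (rule that[of "d/2"])
   fix x assume x: "x : K"
   show "cball x (d/2) \<subseteq> Om"
   proof
    fix y assume "y : cball x (d/2)"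
    then have "dist x y < d" using d(1) by simp
    then show "y : Om" using d(2)[OF x, of y] by auto
   qed
  qed (use d in simp)
 qed
qed

text \<open>Test the function against translated mollifiers and let their supports shrink.\<close>

lemma fundamental_lemma_of_variations:
 fixes f :: "real^'n => 'b::euclidean_space"
 assumes f: "integ f" and out: "!!x. x ~: Om ==> f x=0" and "open Om"
  and z: "!!ph. ph : test_functions Om ==> (LINT x|lborel. ph x *\<^sub>R f x)=0"
 shows "AE x in lborel. f x=0"
proof (rule mollifier_sequence[OF f f])
 fix rh :: "nat => real^'n => real" and t :: "nat => real"
 assume sm: "!!n. smooth (rh n)" and supp: "!!n x. rh n x ~= 0 ==> x : cball 0 (t n)" and t: "t ~~> 0"
  and ae: "AE x in lborel. (%n. moll (rh n) f x) ~~> f x"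
 have ev: "(%n. moll (rh n) f x) ~~> 0" if x: "x : Om" for x
 proof -
  obtain d where d: "d > 0" "cball x d \<subseteq> Om" using \<open>open Om\<close> x open_contains_cball by blast
  have "eventually (%n. t n < d) sequentially" by (rule order_tendstoD(2)[OF t d(1)])
  then have "eventually (%n. 0=moll (rh n) f x) sequentially"
  proof eventually_elim
   case (elim n)
   have "cball (x+0) (t n) \<subseteq> Om" using elim d(2) by (auto simp: subset_iff)
   from z[OF test_function_translate(1)[OF sm supp this]] show ?case by (simp add: moll_def)
  qed
  then show ?thesis by (rule Lim_transform_eventually[OF tendsto_const])
 qed
 show ?thesis
  using ae
 proof (rule AE_mp, intro AE_I2 impI)
  fix x assume "(%n. moll (rh n) f x) ~~> f x"
  then show "f x=0" using ev[of x] out[of x] LIMSEQ_unique by blast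
 qed
qed

lemma wgrad_unique:
 assumes G: "wgrad Om f G" and G': "wgrad Om f' G'" and "open Om" and ff: "AE x in lborel. f x=f' x"
 shows "AE x in lborel. G x=G' x"
proof -
 have comp: "AE x in lborel. G x $ j - G' x $ j=0" for j
 proof (rule fundamental_lemma_of_variations[OF _ _ \<open>open Om\<close>])
  show "integ (%x. G x $ j - G' x $ j)"
   by (intro Bochner_Integration.integrable_diff integrable_vec_nth wgradD(2)[OF G] wgradD(2)[OF G'])
  show "G x $ j - G' x $ j=0" if "x ~: Om" for x
   using that wgradD(4)[OF G] wgradD(4)[OF G'] by simp
  fix ph assume ph: "ph : test_functions Om"
  obtain B where B: "!!x. \<bar>ph x\<bar> <= B" "!!x j. \<bar>pderv j ph x\<bar> <= B"
   using test_function_bound[OF ph] by blast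
  have i: "integ (%x. ph x *\<^sub>R G x $ j)" "integ (%x. ph x *\<^sub>R G' x $ j)"
   using integrable_bounded_mult[OF integrable_vec_nth[OF wgradD(2)[OF G], of j] _ B(1)]
    integrable_bounded_mult[OF integrable_vec_nth[OF wgradD(2)[OF G'], of j] _ B(1)] test_functionsD(7)[OF ph] by simp_all
  have "(LINT x|lborel. ph x *\<^sub>R G x $ j)=(LINT x|lborel. ph x *\<^sub>R G' x $ j)"
  proof -
   have "(LINT x|lborel. pderv j ph x *\<^sub>R f x)=(LINT x|lborel. pderv j ph x *\<^sub>R f' x)"
   proof (rule integral_cong_AE)
    show "(%x. pderv j ph x *\<^sub>R f x) : bmeas lborel"
    using test_functionsD(8)[OF ph, of j] wgradD(1)[OF G] by (intro borel_measurable_scaleR) simp_all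
    show "(%x. pderv j ph x *\<^sub>R f' x) : bmeas lborel"
    using test_functionsD(8)[OF ph, of j] wgradD(1)[OF G'] by (intro borel_measurable_scaleR) simp_all
    show "AE x in lborel. pderv j ph x *\<^sub>R f x=pderv j ph x *\<^sub>R f' x"
    using ff by (rule AE_mp) (intro AE_I2 impI, simp)
   qed
   then show ?thesis using wgradD(5)[OF G ph, of j] wgradD(5)[OF G' ph, of j] by simp
  qed
  then show "(LINT x|lborel. ph x *\<^sub>R (G x $ j - G' x $ j))=0"
   using i by (simp add: scaleR_diff_right)
 qed
 have "AE x in lborel. \<forall>j\<in>UNIV. G x $ j - G' x $ j=0"
  by (rule AE_finite_allI[OF finite]) (rule comp)
 then show ?thesis by (rule AE_mp) (intro AE_I2 impI, simp add: vec_eq_iff)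
qed

lemma wgrad_cutoff:
 fixes f :: "real^'n => 'b::euclidean_space"
 assumes w: "wgrad Om f G" and s: "smooth zt" and B: "!!x. \<bar>zt x\<bar> <= B" "!!x j. \<bar>pderv j zt x\<bar> <= B"
 shows "wgrad Om (%x. zt x *\<^sub>R f x) (%x. \<chi> j. zt x *\<^sub>R G x $ j+pderv j zt x *\<^sub>R f x)"
 unfolding wgrad_def
proof (intro conjI allI ballI impI)
 have m: "zt : bmeas lborel" "pderv j zt : bmeas lborel" for j
  using borel_measurable_continuous_onI[OF smooth_continuous[OF s]]
   borel_measurable_continuous_onI[OF smooth_continuous_deriv[OF s, of "axis j 1"]]
  by (simp_all add: partial_deriv_def[abs_def])
 have iG: "integ (%x. zt x *\<^sub>R G x $ j)" for j
  by (rule integrable_bounded_mult[OF integrable_vec_nth[OF wgradD(2)[OF w]] m(1) B(1)])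
 have idf: "integ (%x. pderv j zt x *\<^sub>R f x)" for j
  by (rule integrable_bounded_mult[OF wgradD(1)[OF w] m(2) B(2)])
 show if': "integ (%x. zt x *\<^sub>R f x)"
  by (rule integrable_bounded_mult[OF wgradD(1)[OF w] m(1) B(1)])
 show "integ (%x. \<chi> j. zt x *\<^sub>R G x $ j+pderv j zt x *\<^sub>R f x)"
  by (intro integrable_vec_lambda Bochner_Integration.integrable_add iG idf)
 fix x
 show "x ~: Om ==> zt x *\<^sub>R f x=0" using wgradD(3)[OF w] by simp
 show "x ~: Om ==> (\<chi> j. zt x *\<^sub>R G x $ j+pderv j zt x *\<^sub>R f x)=0"
  using wgradD(3)[OF w] wgradD(4)[OF w] by (simp add: vec_eq_iff)
next
 fix ph j assume ph: "ph : test_functions Om"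
 have m: "zt : bmeas lborel" "pderv j zt : bmeas lborel" for j
  using borel_measurable_continuous_onI[OF smooth_continuous[OF s]]
   borel_measurable_continuous_onI[OF smooth_continuous_deriv[OF s, of "axis j 1"]]
  by (simp_all add: partial_deriv_def[abs_def])
 obtain B' where B': "!!x. \<bar>ph x\<bar> <= B'" "!!x j. \<bar>pderv j ph x\<bar> <= B'"
  using test_function_bound[OF ph] by blast
 have phm: "ph : bmeas lborel" "pderv j ph : bmeas lborel" for j
  using test_functionsD(7,8)[OF ph] by simp_all
 have i1: "integ (%x. pderv j ph x *\<^sub>R zt x *\<^sub>R f x)"
  by (rule integrable_bounded_mult[OF integrable_bounded_mult[OF wgradD(1)[OF w] m(1) B(1)] phm(2) B'(2)])
 have i2: "integ (%x. ph x *\<^sub>R pderv j zt x *\<^sub>R f x)"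
  by (rule integrable_bounded_mult[OF integrable_bounded_mult[OF wgradD(1)[OF w] m(2) B(2)] phm(1) B'(1)])
 have i3: "integ (%x. ph x *\<^sub>R zt x *\<^sub>R G x $ j)"
  by (rule integrable_bounded_mult[OF integrable_bounded_mult[OF integrable_vec_nth[OF wgradD(2)[OF w]] m(1) B(1)] phm(1) B'(1)])
 have "(LINT x|lborel. pderv j (%x. ph x * zt x) x *\<^sub>R f x)=- (LINT x|lborel. (ph x * zt x) *\<^sub>R G x $ j)"
  by (rule wgradD(5)[OF w test_function_mult(1)[OF ph s]])
 then have "(LINT x|lborel. partial_deriv j ph x *\<^sub>R zt x *\<^sub>R f x) + (LINT x|lborel. ph x *\<^sub>R partial_deriv j zt x *\<^sub>R f x)
  = - (LINT x|lborel. ph x *\<^sub>R zt x *\<^sub>R G x $ j)"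
  using i1 i2 by (simp add: test_function_mult(2)[OF ph s] scaleR_add_left)
 then show "(LINT x|lborel. partial_deriv j ph x *\<^sub>R zt x *\<^sub>R f x)
  = - (LINT x|lborel. ph x *\<^sub>R (\<chi> j. zt x *\<^sub>R G x $ j + partial_deriv j zt x *\<^sub>R f x) $ j)"
  using i2 i3 by (simp add: scaleR_add_right eq_neg_iff_add_eq_0 algebra_simps)
qed

text \<open>Chain rule for a bounded \<open>C\<^sup>1\<close> function.\<close>

lemma wgrad_chain_bounded:
 fixes u :: "real^'n => 'b::euclidean_space" and Ph :: "'b => real"
 assumes w: "wgrad Om u G" and "open Om"
  and der: "!!z. (Ph has_derivative Ph' z) (at z)" and cont: "!!v. continuous_on UNIV (%z. Ph' z v)"
  and M: "!!z. \<bar>Ph z\<bar> <= M" "!!z v. \<bar>Ph' z v\<bar> <= M * norm v"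
  and ph: "ph : test_functions Om"
 shows "(LINT x|lborel. pderv j ph x * Ph (u x))=- (LINT x|lborel. ph x * Ph' (u x) (G x $ j))"
proof (rule mollifier_sequence[OF wgradD(1,2)[OF w]])
 fix rh :: "nat => real^'n => real" and t :: "nat => real"
 assume sm: "!!n. smooth (rh n)" and b: "!!n. bounded {x. rh n x ~= 0}"
  and supp: "!!n x. rh n x ~= 0 ==> x : cball 0 (t n)" and t: "t ~~> 0"
  and iu: "!!n. integ (moll (rh n) u)" and iG: "!!n. integ (moll (rh n) G)"
  and LG: "(%n. LINT x|lborel. norm (moll (rh n) G x - G x)) ~~> 0"
  and ae: "AE x in lborel. (%n. moll (rh n) u x) ~~> u x"
 have M0: "M >= 0" using M(1)[of 0] by linarith
 obtain B where B0: "B >= 0" and B: "!!x. \<bar>ph x\<bar> <= B" "!!x j. \<bar>pderv j ph x\<bar> <= B"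
  using test_function_bound[OF ph] by blast
 note phm[measurable] = test_functionsD(7)[OF ph] test_functionsD(8)[OF ph, of j]
 have um[measurable]: "u : bmeas borel" using wgradD(1)[OF w] by simp
 have Gm[measurable]: "(%x. G x $ j) : bmeas borel"
  using integrable_vec_nth[OF wgradD(2)[OF w], of j] by simp
 have iGj: "integ (%x. G x $ j)" by (rule integrable_vec_nth[OF wgradD(2)[OF w]])
 have lin: "linear (Ph' z)" for z using der has_derivative_linear by blast
 have contPh: "continuous_on UNIV Ph"
  by (rule continuous_at_imp_continuous_on) (use has_derivative_continuous[OF der] in blast)
 have Phm[measurable]: "Ph : bmeas borel" by (rule borel_measurable_continuous_onI[OF contPh])
 have rep: "Ph' z v=(\<Sum>i\<in>Basis. (v \<bullet> i) * Ph' z i)" for z v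
 proof -
  have "Ph' z v=Ph' z (\<Sum>i\<in>Basis. (v \<bullet> i) *\<^sub>R i)" by (simp add: euclidean_representation)
  then show ?thesis by (simp add: linear_sum[OF lin] linear_scale[OF lin])
 qed
 have Ph'm[measurable]: "(%z. Ph' z i) : bmeas borel" for i
  by (rule borel_measurable_continuous_onI[OF cont])
 define un where "un n=moll (rh n) u" for n
 have Cun: "Ck 1 (un n)" for n
  unfolding un_def by (rule smooth_C1[OF moll_smooth[OF wgradD(1)[OF w] sm b]])
 have unm[measurable]: "un n : bmeas borel" for n
  by (rule borel_measurable_continuous_onI[OF Ck1_continuous[OF Cun]])
 have Gnm[measurable]: "(%x. moll (rh n) G x $ j) : bmeas borel" for n
  using integrable_vec_nth[OF iG, of n j] by simp
 have m1[measurable]: "(%x. Ph' (f x) (g x)) : bmeas borel"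
  if "f : bmeas borel" "g : bmeas borel" for f g :: "real^'n => 'b"
  unfolding rep[of _ "g _"] using that by measurable
 have parts: "(LINT x|lborel. partial_deriv j ph x * Ph (un n x))
   = - (LINT x|lborel. ph x * Ph' (un n x) (frechet_derivative (un n) (at x) (axis j 1)))" for n
 proof -
  let ?g = "%x. Ph (un n x)"
  have dg: "(?g has_derivative (%v. Ph' (un n x) (fderv (un n) (at x) v))) (at x)" for x
   using diff_chain_at[OF Ck1_has_derivative[OF Cun] der] by (simp add: o_def)
  have "Ck 1 ?g"
  proof -
   have "Ck (Suc 0) ?g"
   proof (rule Ck_SucI[OF dg])
    fix v
    have "continuous_on UNIV (%x. \<Sum>i\<in>Basis. (fderv (un n) (at x) v \<bullet> i) * Ph' (un n x) i)"
    by (intro continuous_on_sum continuous_on_mult continuous_on_inner continuous_on_const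
    Ck1_deriv_continuous[OF Cun] continuous_on_compose2[OF cont Ck1_continuous[OF Cun]]) simp
    then show "Ck 0 (%x. Ph' (un n x) (fderv (un n) (at x) v))"
    by (simp add: rep[of _ "fderv (un n) (at _) v"])
   qed
   then show ?thesis by simp
  qed
  from integration_by_parts[OF test_functionsD(2)[OF ph] this test_functionsD(3)[OF ph], of "axis j 1"]
  show ?thesis by (simp add: partial_deriv_def frechet_derivative_at[OF dg, symmetric])
 qed
 let ?K = "closure {x. ph x ~= 0}"
 obtain d where d: "d > 0" "!!x. x : ?K ==> cball x d \<subseteq> Om"
  using compact_cball_margin[OF test_functionsD(5,6)[OF ph] \<open>open Om\<close>] by blast
 have ev: "eventually (%n. (LINT x|lborel. ph x * Ph' (un n x) (moll (rh n) G x $ j))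
   = - (LINT x|lborel. partial_deriv j ph x * Ph (un n x))) sequentially"
  using order_tendstoD(2)[OF t d(1)]
 proof eventually_elim
  case (elim n)
  have "ph x * Ph' (un n x) (moll (rh n) G x $ j)=ph x * Ph' (un n x) (fderv (un n) (at x) (axis j 1))" for x
  proof (cases "ph x=0")
   case False
   then have "x : ?K" using closure_subset[of "{x. ph x ~= 0}"] by blast
   then have "cball (x+0) (t n) \<subseteq> Om" using elim d(2)[of x] by (auto simp: subset_iff)
   from moll_weak_gradient[OF w sm supp this] show ?thesis by (simp add: un_def)
  qed simp
  then show ?case by (simp only: parts[of n] minus_minus)
 qed
 have cb: "integ (%x. indicator ?K x * C :: real)" for C :: real
  using emeasure_compact_finite[OF test_functionsD(5)[OF ph]] borel_compact[OF test_functionsD(5)[OF ph]]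
  by (intro integrable_mult_left) (simp add: integrable_indicator_iff)
 have out: "pderv j ph x=0" if "x ~: ?K" for x
  by (rule test_function_deriv_outside[of _ ?K])
   (use that test_functionsD(1,5)[OF ph] in "auto simp: test_functions_def")
 have L1: "(%n. LINT x|lborel. pderv j ph x * Ph (un n x)) ~~> (LINT x|lborel. pderv j ph x * Ph (u x))"
 proof (rule integral_dominated_convergence[where w="%x. indicator ?K x * (B * M)"])
  show "AE x in lborel. (%n. pderv j ph x * Ph (un n x)) ~~> pderv j ph x * Ph (u x)"
   using ae
  proof (rule AE_mp, intro AE_I2 impI)
   fix x assume "(%n. moll (rh n) u x) ~~> u x"
   then have "(%n. Ph (un n x)) ~~> Ph (u x)"
    using contPh unfolding un_def by (intro continuous_on_tendsto_compose[OF contPh]) auto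
   then show "(%n. pderv j ph x * Ph (un n x)) ~~> pderv j ph x * Ph (u x)"
    by (intro tendsto_mult tendsto_const)
  qed
  show "AE x in lborel. norm (pderv j ph x * Ph (un n x)) <= indicator ?K x * (B * M)" for n
  proof (rule AE_I2)
   fix x
   show "norm (pderv j ph x * Ph (un n x)) <= indicator ?K x * (B * M)"
    using out[of x] mult_mono[OF B(2)[of j x] M(1)[of "un n x"] B0] by (cases "x : ?K") (simp_all add: abs_mult)
  qed
 qed (use cb in "simp_all, measurable")
 have L2: "(%n. LINT x|lborel. ph x * Ph' (un n x) (G x $ j)) ~~> (LINT x|lborel. ph x * Ph' (u x) (G x $ j))"
 proof (rule integral_dominated_convergence[where w="%x. B * (M * norm (G x $ j))"])
  show "AE x in lborel. (%n. ph x * Ph' (un n x) (G x $ j)) ~~> ph x * Ph' (u x) (G x $ j)"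
   using ae
  proof (rule AE_mp, intro AE_I2 impI)
   fix x assume "(%n. moll (rh n) u x) ~~> u x"
   then have "(%n. Ph' (un n x) (G x $ j)) ~~> Ph' (u x) (G x $ j)"
    unfolding un_def by (intro continuous_on_tendsto_compose[OF cont]) auto
   then show "(%n. ph x * Ph' (un n x) (G x $ j)) ~~> ph x * Ph' (u x) (G x $ j)"
    by (intro tendsto_mult tendsto_const)
  qed
  show "AE x in lborel. norm (ph x * Ph' (un n x) (G x $ j)) <= B * (M * norm (G x $ j))" for n
  proof (rule AE_I2)
   fix x
   show "norm (ph x * Ph' (un n x) (G x $ j)) <= B * (M * norm (G x $ j))"
    using mult_mono[OF B(1)[of x] M(2)[of "un n x" "G x $ j"] B0] by (simp add: abs_mult)
  qed
  show "integ (%x. B * (M * norm (G x $ j)))"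
   by (intro integrable_mult_right integrable_norm iGj)
 qed (simp_all, measurable)
 have L3: "(%n. (LINT x|lborel. ph x * Ph' (un n x) (moll (rh n) G x $ j)) - (LINT x|lborel. ph x * Ph' (un n x) (G x $ j))) ~~> 0"
 proof (rule tendsto_norm_zero_cancel, rule tendsto_sandwich[OF _ _ tendsto_const tendsto_mult_right_zero[OF LG, of "B * M"]])
  show "\<forall>\<^sub>F n in sequentially. norm ((LINT x|lborel. ph x * Ph' (un n x) (moll (rh n) G x $ j)) - (LINT x|lborel. ph x * Ph' (un n x) (G x $ j)))
   <= B * M * (LINT x|lborel. norm (moll (rh n) G x - G x))"
  proof (rule always_eventually, rule allI)
   fix n
   have bd: "norm (ph x * Ph' (un n x) v) <= B * (M * norm v)" for x v
    using mult_mono[OF B(1)[of x] M(2)[of "un n x" v] B0] by (simp add: abs_mult)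
   have int: "integ (%x. ph x * Ph' (un n x) (g x))" if g: "integ g" for g
   proof (rule Bochner_Integration.integrable_bound[of lborel "%x. B * (M * norm (g x))"])
    show "integ (%x. B * (M * norm (g x)))" by (intro integrable_mult_right integrable_norm g)
    have [measurable]: "g : bmeas borel" using g by simp
    show "(%x. ph x * Ph' (un n x) (g x)) : bmeas lborel" by measurable
    show "AE x in lborel. norm (ph x * Ph' (un n x) (g x)) <= norm (B * (M * norm (g x)))"
    using bd B0 M0 by (intro AE_I2) simp
   qed
   have iD: "integ (%x. norm (moll (rh n) G x - G x))"
    by (intro integrable_norm Bochner_Integration.integrable_diff iG wgradD(2)[OF w])
   have "(LINT x|lborel. ph x * Ph' (un n x) (moll (rh n) G x $ j)) - (LINT x|lborel. ph x * Ph' (un n x) (G x $ j))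
    = (LINT x|lborel. ph x * Ph' (un n x) (moll (rh n) G x $ j) - ph x * Ph' (un n x) (G x $ j))"
    by (rule Bochner_Integration.integral_diff[symmetric]) (intro int integrable_vec_nth iG iGj)+
   also have "norm ... <= (LINT x|lborel. norm (ph x * Ph' (un n x) (moll (rh n) G x $ j) - ph x * Ph' (un n x) (G x $ j)))"
    by (rule integral_norm_bound)
   also have "... <= (LINT x|lborel. (B * M) * norm (moll (rh n) G x - G x))"
   proof (rule integral_mono')
    show "integ (%x. (B * M) * norm (moll (rh n) G x - G x))" by (rule integrable_mult_right[OF iD])
    fix x
    have "ph x * Ph' (un n x) (moll (rh n) G x $ j) - ph x * Ph' (un n x) (G x $ j)
    = ph x * Ph' (un n x) ((moll (rh n) G x - G x) $ j)"
    by (simp add: linear_diff[OF lin] right_diff_distrib)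
    also have "norm ... <= B * (M * norm ((moll (rh n) G x - G x) $ j))" by (rule bd)
    also have "... <= B * (M * norm (moll (rh n) G x - G x))"
    by (intro mult_left_mono Finite_Cartesian_Product.norm_nth_le B0 M0)
    finally show "norm (ph x * Ph' (un n x) (moll (rh n) G x $ j) - ph x * Ph' (un n x) (G x $ j))
    <= (B * M) * norm (moll (rh n) G x - G x)" by (simp add: mult.assoc)
    show "0 <= (B * M) * norm (moll (rh n) G x - G x)" using B0 M0 by simp
   qed
   finally show "norm ((LINT x|lborel. ph x * Ph' (un n x) (moll (rh n) G x $ j)) - (LINT x|lborel. ph x * Ph' (un n x) (G x $ j)))
   <= B * M * (LINT x|lborel. norm (moll (rh n) G x - G x))" by simp
  qed
 qed (simp add: always_eventually)
 have "(%n. LINT x|lborel. ph x * Ph' (un n x) (moll (rh n) G x $ j)) ~~> (LINT x|lborel. ph x * Ph' (u x) (G x $ j))"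
  using tendsto_add[OF L3 L2] by simp
 moreover have "(%n. LINT x|lborel. ph x * Ph' (un n x) (moll (rh n) G x $ j)) ~~> - (LINT x|lborel. pderv j ph x * Ph (u x))"
  by (rule Lim_transform_eventually[OF tendsto_minus[OF L1]]) (use ev in eventually_elim, simp)
 ultimately show ?thesis using LIMSEQ_unique by fastforce
qed

section \<open>The square of the modulus\<close>

lemma cutoff_square_facts:
 fixes z v :: complex and N :: real
 assumes "N >= 1"
 defines "Ph \<equiv> %z::complex. (z \<bullet> z) / (1+(z \<bullet> z) / N)"
  and "Ph' \<equiv> %z v::complex. 2 * (z \<bullet> v) / (1+(z \<bullet> z) / N)\<^sup>2"
 shows "(Ph has_derivative Ph' z) (at z)" "continuous_on UNIV (%z. Ph' z v)"
  "\<bar>Ph z\<bar> <= 2 * N" "\<bar>Ph' z v\<bar> <= 2 * N * norm v" "\<bar>Ph z\<bar> <= (cmod z)\<^sup>2" "\<bar>Ph' z v\<bar> <= 2 * \<bar>z \<bullet> v\<bar>"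
proof -
 have pos: "1+(z \<bullet> z) / N > 0" for z :: complex
  using assms(1) inner_ge_zero[of z] by (intro add_pos_nonneg) simp_all
 have ge1: "1+(z \<bullet> z) / N >= 1" for z :: complex
  using assms(1) inner_ge_zero[of z] by simp
 have dz: "((%z. z \<bullet> z) has_derivative (%v. 2 * (z \<bullet> v))) (at z)"
  by (rule has_derivative_eq_rhs[OF has_derivative_inner[OF has_derivative_ident has_derivative_ident]])
   (simp add: inner_commute)
 have dd: "((%z. 1+(z \<bullet> z) / N) has_derivative (%v. 2 * (z \<bullet> v) / N)) (at z)"
  using has_derivative_add[OF has_derivative_const[of 1] has_derivative_mult_left[OF dz, of "1 / N"]] by simp
 show "(Ph has_derivative Ph' z) (at z)"
  unfolding Ph_def
 proof (rule has_derivative_eq_rhs[OF has_derivative_divide'[OF dz dd]])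
  show "1+z \<bullet> z / N ~= 0" using pos[of z] by simp
  show "(%h. (2 * (z \<bullet> h) * (1+z \<bullet> z / N) - (z \<bullet> z) * (2 * (z \<bullet> h) / N)) / ((1+z \<bullet> z / N) * (1+z \<bullet> z / N)))=Ph' z"
   unfolding Ph'_def power2_eq_square by (rule ext) (simp add: algebra_simps)
 qed
 show "continuous_on UNIV (%z. Ph' z v)"
  unfolding Ph'_def
  by (intro continuous_intros) (use assms(1) pos in "simp_all add: less_imp_neq[OF pos, symmetric]")
 have zz: "z \<bullet> z=(norm z)\<^sup>2" by (simp add: power2_norm_eq_inner)
 have q: "(z \<bullet> z) / (1+(z \<bullet> z) / N) <= N"
  using pos[of z] assms(1) by (simp add: divide_le_eq algebra_simps)
 show "\<bar>Ph z\<bar> <= 2 * N"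
  unfolding Ph_def using q pos[of z] assms(1) inner_ge_zero[of z] by (simp add: abs_of_nonneg)
 show "\<bar>Ph z\<bar> <= (cmod z)\<^sup>2"
 proof -
  have "(z \<bullet> z) / (1+(z \<bullet> z) / N) <= (z \<bullet> z) / 1"
   by (rule divide_left_mono) (use ge1[of z] pos[of z] inner_ge_zero[of z] in simp_all)
  then show ?thesis unfolding Ph_def using pos[of z] inner_ge_zero[of z] zz by (simp add: abs_of_nonneg)
 qed
 let ?d = "1+(z \<bullet> z) / N"
 have abs: "\<bar>Ph' z v\<bar>=2 * \<bar>z \<bullet> v\<bar> / ?d\<^sup>2" unfolding Ph'_def using pos[of z] by (simp add: abs_mult)
 have d1: "1 <= ?d\<^sup>2" using ge1[of z] by (simp add: one_le_power)
 have dd2: "?d <= ?d\<^sup>2" using ge1[of z] by (simp add: self_le_power)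
 show "\<bar>Ph' z v\<bar> <= 2 * \<bar>z \<bullet> v\<bar>"
 proof -
  have "2 * \<bar>z \<bullet> v\<bar> / ?d\<^sup>2 <= 2 * \<bar>z \<bullet> v\<bar> / 1" by (rule divide_left_mono) (use d1 pos[of z] in simp_all)
  then show ?thesis unfolding abs by simp
 qed
 show "\<bar>Ph' z v\<bar> <= 2 * N * norm v"
 proof -
  have nz: "norm z <= N * ?d\<^sup>2"
  proof -
   have "norm z <= N+(norm z)\<^sup>2"
   proof (cases "norm z <= 1")
    case True
    then show ?thesis using assms(1) zero_le_power2[of "norm z"] by linarith
   next
    case False
    then have "norm z <= (norm z)\<^sup>2" by (simp add: self_le_power)
    then show ?thesis using assms(1) by linarith
   qed
   also have "...=N * ?d" using assms(1) by (simp add: zz field_simps)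
   also have "... <= N * ?d\<^sup>2" by (rule mult_left_mono[OF dd2]) (use assms(1) in simp)
   finally show ?thesis .
  qed
  have "2 * \<bar>z \<bullet> v\<bar> <= 2 * (norm z * norm v)" using Cauchy_Schwarz_ineq2[of z v] by simp
  also have "... <= 2 * (N * ?d\<^sup>2 * norm v)" using mult_right_mono[OF nz norm_ge_zero[of v]] by simp
  finally have "2 * \<bar>z \<bullet> v\<bar> <= (2 * N * norm v) * ?d\<^sup>2" by (simp add: ac_simps)
  then show ?thesis unfolding abs using d1 pos[of z] by (subst pos_divide_le_eq) simp_all
 qed
qed

text \<open>Here \<open>u\<close> times its gradient is integrable although neither factor need be square integrable. The chain rule is applied to smooth truncations of \<open>\<bar>z\<bar>\<^sup>2\<close>, whose derivatives stay below a multiple of \<open>\<bar>z\<bar>\<close>.\<close>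

lemma wgrad_square:
 fixes u :: "real^'n => complex" and h :: "real^'n => real^'n"
 assumes w: "wgrad Om u G" and "open Om" and h: "integ h" "!!x. x ~: Om ==> h x=0"
  and eq: "AE x in lborel. \<forall>j. u x \<bullet> G x $ j=h x $ j"
  and sq: "integ (%x. (cmod (u x))\<^sup>2)"
 shows "wgrad Om (%x. (cmod (u x))\<^sup>2) (%x. 2 *\<^sub>R h x)"
 unfolding wgrad_def
proof (intro conjI allI ballI impI)
 show "integ (%x. 2 *\<^sub>R h x)" by (rule integrable_scaleR_right[OF h(1)])
 show "x ~: Om ==> (cmod (u x))\<^sup>2=0" for x using wgradD(3)[OF w] by simp
 show "x ~: Om ==> 2 *\<^sub>R h x=0" for x using h(2) by simp
 fix ph j assume ph: "ph : test_functions Om"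
 obtain B where B0: "B >= 0" and B: "!!x. \<bar>ph x\<bar> <= B" "!!x j. \<bar>pderv j ph x\<bar> <= B"
  using test_function_bound[OF ph] by blast
 note [measurable] = test_functionsD(7)[OF ph] test_functionsD(8)[OF ph, of j]
 have um[measurable]: "u : bmeas borel" using wgradD(1)[OF w] by simp
 have hm[measurable]: "(%x. h x $ j) : bmeas borel"
  using integrable_vec_nth[OF h(1), of j] by simp
 define d where "d N x=1+(u x \<bullet> u x) / real (Suc N)" for N x
 have dlim: "(%N. d N x) ~~> 1" for x
 proof -
  have "(%N. 1+(u x \<bullet> u x) * inverse (real (Suc N))) ~~> 1+(u x \<bullet> u x) * 0"
   by (intro tendsto_intros LIMSEQ_inverse_real_of_nat)
  then show ?thesis by (simp add: d_def divide_inverse)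
 qed
 have d1: "d N x >= 1" for N x unfolding d_def by simp
 have dm[measurable]: "d N : bmeas borel" for N unfolding d_def by measurable
 have uu: "u x \<bullet> u x=(cmod (u x))\<^sup>2" for x by (simp add: power2_norm_eq_inner)
 have par: "(LINT x|lborel. partial_deriv j ph x * ((u x \<bullet> u x) / d N x))
  = - (LINT x|lborel. ph x * (2 * h x $ j / (d N x)\<^sup>2))" for N
 proof -
  have N1: "real (Suc N) >= 1" by simp
  note F = cutoff_square_facts[OF N1]
  have M2: "\<bar>2 * (z \<bullet> v) / (1+z \<bullet> z / real (Suc N))\<^sup>2\<bar> <= (2 * real (Suc N)) * norm v" for z v :: complex
   by (rule F(4))
  have "(LINT x|lborel. partial_deriv j ph x * ((u x \<bullet> u x) / d N x))
   = - (LINT x|lborel. ph x * (2 * (u x \<bullet> G x $ j) / (d N x)\<^sup>2))"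
   unfolding d_def by (rule wgrad_chain_bounded[OF w \<open>open Om\<close> F(1) F(2) F(3) M2 ph])
  also have "(LINT x|lborel. ph x * (2 * (u x \<bullet> G x $ j) / (d N x)\<^sup>2))=(LINT x|lborel. ph x * (2 * h x $ j / (d N x)\<^sup>2))"
  proof (rule integral_cong_AE)
   have [measurable]: "(%x. G x $ j) : bmeas borel"
    using integrable_vec_nth[OF wgradD(2)[OF w], of j] by simp
   show "(%x. ph x * (2 * (u x \<bullet> G x $ j) / (d N x)\<^sup>2)) : bmeas lborel" by measurable
   show "(%x. ph x * (2 * h x $ j / (d N x)\<^sup>2)) : bmeas lborel" by measurable
   show "AE x in lborel. ph x * (2 * (u x \<bullet> G x $ j) / (d N x)\<^sup>2)=ph x * (2 * h x $ j / (d N x)\<^sup>2)"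
    using eq by (rule AE_mp) (intro AE_I2 impI, simp)
  qed
  finally show ?thesis .
 qed
 have L1: "(%N. LINT x|lborel. pderv j ph x * ((u x \<bullet> u x) / d N x)) ~~> (LINT x|lborel. pderv j ph x * (cmod (u x))\<^sup>2)"
 proof (rule integral_dominated_convergence[where w="%x. B * (cmod (u x))\<^sup>2"])
  show "integ (%x. B * (cmod (u x))\<^sup>2)" by (rule integrable_mult_right[OF sq])
  show "AE x in lborel. (%N. pderv j ph x * ((u x \<bullet> u x) / d N x)) ~~> pderv j ph x * (cmod (u x))\<^sup>2"
  proof (rule AE_I2)
   fix x
   have "(%N. pderv j ph x * ((u x \<bullet> u x) / d N x)) ~~> pderv j ph x * ((u x \<bullet> u x) / 1)"
    by (intro tendsto_intros dlim) simp
   then show "(%N. pderv j ph x * ((u x \<bullet> u x) / d N x)) ~~> pderv j ph x * (cmod (u x))\<^sup>2"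
    by (simp add: uu)
  qed
  show "AE x in lborel. norm (pderv j ph x * ((u x \<bullet> u x) / d N x)) <= B * (cmod (u x))\<^sup>2" for N
  proof (rule AE_I2)
   fix x
   have "\<bar>(u x \<bullet> u x) / d N x\<bar> <= (cmod (u x))\<^sup>2"
    unfolding d_def using cutoff_square_facts(5)[of "real (Suc N)" "u x"] by simp
   from mult_mono[OF B(2)[of j x] this B0]
   show "norm (pderv j ph x * ((u x \<bullet> u x) / d N x)) <= B * (cmod (u x))\<^sup>2" by (simp add: abs_mult)
  qed
 qed (measurable)
 have L2: "(%N. LINT x|lborel. ph x * (2 * h x $ j / (d N x)\<^sup>2)) ~~> (LINT x|lborel. ph x * (2 * h x $ j))"
 proof (rule integral_dominated_convergence[where w="%x. B * (2 * norm (h x $ j))"])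
  show "integ (%x. B * (2 * norm (h x $ j)))"
   by (intro integrable_mult_right integrable_norm integrable_vec_nth h(1))
  show "AE x in lborel. (%N. ph x * (2 * h x $ j / (d N x)\<^sup>2)) ~~> ph x * (2 * h x $ j)"
  proof (rule AE_I2)
   fix x
   have "(%N. ph x * (2 * h x $ j / (d N x)\<^sup>2)) ~~> ph x * (2 * h x $ j / 1\<^sup>2)"
    by (intro tendsto_intros dlim) simp
   then show "(%N. ph x * (2 * h x $ j / (d N x)\<^sup>2)) ~~> ph x * (2 * h x $ j)" by simp
  qed
  show "AE x in lborel. norm (ph x * (2 * h x $ j / (d N x)\<^sup>2)) <= B * (2 * norm (h x $ j))" for N
  proof (rule AE_I2)
   fix x
   have "1 <= (d N x)\<^sup>2" using d1[of N x] by (simp add: one_le_power)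
   then have "2 * \<bar>h x $ j\<bar> / (d N x)\<^sup>2 <= 2 * \<bar>h x $ j\<bar> / 1" by (intro divide_left_mono) (use d1[of N x] in simp_all)
   then have "\<bar>2 * h x $ j / (d N x)\<^sup>2\<bar> <= 2 * norm (h x $ j)" by (simp add: abs_mult)
   from mult_mono[OF B(1)[of x] this B0]
   show "norm (ph x * (2 * h x $ j / (d N x)\<^sup>2)) <= B * (2 * norm (h x $ j))" by (simp add: abs_mult)
  qed
 qed (measurable)
 have "(%N. LINT x|lborel. pderv j ph x * ((u x \<bullet> u x) / d N x)) ~~> - (LINT x|lborel. ph x * (2 * h x $ j))"
  unfolding par by (rule tendsto_minus[OF L2])
 from LIMSEQ_unique[OF L1 this]
 show "(LINT x|lborel. pderv j ph x *\<^sub>R (cmod (u x))\<^sup>2)=- (LINT x|lborel. ph x *\<^sub>R (2 *\<^sub>R h x) $ j)"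
  by simp
qed (rule sq)

section \<open>Borel representatives\<close>

lemma lebesgue_borel_representative:
 fixes f :: "'a::euclidean_space => 'b::euclidean_space"
 assumes f: "f : bmeas (lebesgue_on Om)" and Om: "open Om"
 shows "\<exists>f'. f' : bmeas borel & (\<forall>x. x ~: Om --> f' x=0) & (AE x in lebesgue_on Om. f x=f' x)"
proof -
 have Omm: "Om \<inter> space lebesgue : sets lebesgue" and Omb[measurable]: "Om : sets borel" using Om by auto
 have "(%x. indicator Om x *\<^sub>R f x) : bmeas lebesgue"
  using f borel_measurable_restrict_space_iff[OF Omm, of f] by simp
 then have "\<forall>b\<in>Basis. (%x. (indicator Om x *\<^sub>R f x) \<bullet> b) : bmeas (completion lborel)"
  using borel_measurable_euclidean_space[of "%x. indicator Om x *\<^sub>R f x" lebesgue] by simp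
 then have "\<forall>b\<in>Basis. EX g. g : bmeas borel & (AE x in lborel. (indicator Om x *\<^sub>R f x) \<bullet> b=g x)"
  using completion_ex_borel_measurable_real[of "%x. (indicator Om x *\<^sub>R f x) \<bullet> _" lborel] by fastforce
 then obtain g where g: "!!b. b : Basis ==> g b : bmeas borel"
  "!!b. b : Basis ==> AE x in lborel. (indicator Om x *\<^sub>R f x) \<bullet> b=g b x" by (auto dest!: bchoice)
 define f' where "f' x=indicator Om x *\<^sub>R (\<Sum>b\<in>Basis. g b x *\<^sub>R b)" for x
 have "f' : bmeas borel" unfolding f'_def using g(1) by measurable
 moreover have "f' x=0" if "x ~: Om" for x using that by (simp add: f'_def)
 moreover have "AE x in lebesgue_on Om. f x=f' x"
 proof -
  have "AE x in lborel. \<forall>b\<in>Basis. (indicator Om x *\<^sub>R f x) \<bullet> b=g b x"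
   by (rule AE_finite_allI[OF finite_Basis]) (rule g(2))
  then have "AE x in lebesgue. \<forall>b\<in>Basis. (indicator Om x *\<^sub>R f x) \<bullet> b=g b x" by (rule AE_completion)
  then have "AE x in lebesgue. x : Om --> f x=f' x"
  proof (rule AE_mp, intro AE_I2 impI)
   fix x assume a: "\<forall>b\<in>Basis. (indicator Om x *\<^sub>R f x) \<bullet> b=g b x" and x: "x : Om"
   have "f' x=(\<Sum>b\<in>Basis. (f x \<bullet> b) *\<^sub>R b)" unfolding f'_def using a x by simp
   then show "f x=f' x" by (simp add: euclidean_representation)
  qed
  then show ?thesis by (simp add: AE_restrict_space_iff[OF Omm])
 qed
 ultimately show ?thesis by blast
qed

lemma lebesgue_on_transfer:
 fixes F F' :: "'a::euclidean_space => 'b::{banach, second_countable_topology}"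
 assumes F: "F : bmeas (lebesgue_on Om)" and Om: "open Om"
  and F': "F' : bmeas borel" "!!x. x ~: Om ==> F' x=0" and eq: "AE x in lebesgue_on Om. F x=F' x"
 shows "(LINT x|lebesgue_on Om. F x)=(LINT x|lborel. F' x)"
  "integrable (lebesgue_on Om) F \<longleftrightarrow> integ F'"
proof -
 have Omm: "Om \<inter> space lebesgue : sets lebesgue" using Om by auto
 have Fm: "(%x. indicator Om x *\<^sub>R F x) : bmeas lebesgue"
  using F borel_measurable_restrict_space_iff[OF Omm, of F] by simp
 have F'm: "F' : bmeas lebesgue" "F' : bmeas lborel"
  using F'(1) by (auto intro: measurable_completion)
 have ae: "AE x in lebesgue. indicator Om x *\<^sub>R F x=F' x"
 proof -
  have "AE x in lebesgue. x : Om --> F x=F' x" using eq by (simp add: AE_restrict_space_iff[OF Omm])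
  then show ?thesis by (rule AE_mp) (intro AE_I2 impI, auto simp: indicator_def F'(2))
 qed
 have "(LINT x|lebesgue_on Om. F x)=(LINT x|lebesgue. indicator Om x *\<^sub>R F x)"
  by (rule integral_restrict_space[OF Omm])
 also have "...=(LINT x|lebesgue. F' x)" by (rule integral_cong_AE[OF Fm F'm(1) ae])
 also have "...=(LINT x|lborel. F' x)" by (rule integral_completion[OF F'm(2)])
 finally show "(LINT x|lebesgue_on Om. F x)=(LINT x|lborel. F' x)" .
 have "integrable (lebesgue_on Om) F \<longleftrightarrow> integrable lebesgue (%x. indicator Om x *\<^sub>R F x)"
  by (rule integrable_restrict_space[OF Omm])
 also have "... \<longleftrightarrow> integrable lebesgue F'" by (rule integrable_cong_AE[OF Fm F'm(1) ae])
 also have "... \<longleftrightarrow> integ F'" by (rule integrable_completion[OF F'm(2)])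
 finally show "integrable (lebesgue_on Om) F \<longleftrightarrow> integ F'" .
qed

lemma integrable_L1_loc:
 fixes u :: "'a::euclidean_space => 'b::euclidean_space"
 assumes u: "integrable (lebesgue_on Om) u" and Om: "open Om"
 shows "u : L1_loc Om"
 unfolding L1_loc_def
proof (intro CollectI conjI allI impI)
 show "u : bmeas (lebesgue_on Om)" using u by simp
 fix K assume K: "compact K & K \<subseteq> Om"
 have Omm: "Om \<inter> space lebesgue : sets lebesgue" using Om by auto
 have Km: "K \<inter> space lebesgue : sets lebesgue" using K borel_compact[of K] by auto
 have "L1_norm (lebesgue_on K) u=(\<integral>\<^sup>+x. ennreal (norm (u x)) * indicator K x \<partial>lebesgue)"
  unfolding L1_norm_def by (rule nn_integral_restrict_space[OF Km])
 also have "... <= (\<integral>\<^sup>+x. ennreal (norm (u x)) * indicator Om x \<partial>lebesgue)"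
  by (intro nn_integral_mono mult_left_mono) (use K in "auto simp: indicator_def")
 also have "...=(\<integral>\<^sup>+x. ennreal (norm (u x)) \<partial>lebesgue_on Om)"
  by (rule nn_integral_restrict_space[OF Omm, symmetric])
 also have "... < \<infinity>" using u by (simp add: integrable_iff_bounded)
 finally show "L1_norm (lebesgue_on K) u < \<infinity>" .
qed

lemma test_function_lebesgue_measurable:
 assumes "ph : test_functions Om"
 shows "ph : bmeas (lebesgue_on S)" "pderv j ph : bmeas (lebesgue_on S)"
 using test_functionsD(7,8)[OF assms] by (auto intro!: measurable_restrict_space1 measurable_completion)

lemma has_weak_gradient_imp_wgrad:
 fixes u :: "real^'n => 'b::euclidean_space"
 assumes w: "has_weak_gradient Om u g" and u: "integrable (lebesgue_on Om) u" and g: "integrable (lebesgue_on Om) g"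
  and Om: "open Om"
  and f: "f : bmeas borel" "!!x. x ~: Om ==> f x=0" "AE x in lebesgue_on Om. u x=f x"
  and G: "G : bmeas borel" "!!x. x ~: Om ==> G x=0" "AE x in lebesgue_on Om. g x=G x"
 shows "wgrad Om f G"
 unfolding wgrad_def
proof (intro conjI allI impI ballI)
 show "integ f" using lebesgue_on_transfer(2)[OF _ Om f] u by simp
 show "integ G" using lebesgue_on_transfer(2)[OF _ Om G] g by simp
 show "f x=0" if "x ~: Om" for x using f(2) that .
 show "G x=0" if "x ~: Om" for x using G(2) that .
 fix ph j assume ph: "ph : test_functions Om"
 note m = test_function_lebesgue_measurable[OF ph, where S=Om]
 note m' = test_functionsD(7)[OF ph] test_functionsD(8)[OF ph, of j]
 have um: "u : bmeas (lebesgue_on Om)" and gm: "(%x. g x $ j) : bmeas (lebesgue_on Om)"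
  using u borel_measurable_vec_nth[of g] g by auto
 have Gm: "(%x. G x $ j) : bmeas borel" by (rule borel_measurable_vec_nth[OF G(1)])
 have "(LINT x|lebesgue_on Om. pderv j ph x *\<^sub>R u x)=(LINT x|lborel. pderv j ph x *\<^sub>R f x)"
 proof (rule lebesgue_on_transfer(1)[OF _ Om])
  show "(%x. pderv j ph x *\<^sub>R u x) : bmeas (lebesgue_on Om)"
   by (rule borel_measurable_scaleR[OF m(2) um])
  show "(%x. pderv j ph x *\<^sub>R f x) : bmeas borel" by (rule borel_measurable_scaleR[OF m'(2) f(1)])
  show "AE x in lebesgue_on Om. pderv j ph x *\<^sub>R u x=pderv j ph x *\<^sub>R f x"
   using f(3) by (rule AE_mp) (intro AE_I2 impI, simp)
 qed (simp add: f(2))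
 moreover have "(LINT x|lebesgue_on Om. ph x *\<^sub>R g x $ j)=(LINT x|lborel. ph x *\<^sub>R G x $ j)"
 proof (rule lebesgue_on_transfer(1)[OF _ Om])
  show "(%x. ph x *\<^sub>R g x $ j) : bmeas (lebesgue_on Om)"
   by (rule borel_measurable_scaleR[OF m(1) gm])
  show "(%x. ph x *\<^sub>R G x $ j) : bmeas borel" by (rule borel_measurable_scaleR[OF m'(1) Gm])
  show "AE x in lebesgue_on Om. ph x *\<^sub>R g x $ j=ph x *\<^sub>R G x $ j"
   using G(3) by (rule AE_mp) (intro AE_I2 impI, simp)
 qed (simp add: G(2))
 ultimately show "(LINT x|lborel. pderv j ph x *\<^sub>R f x)=- (LINT x|lborel. ph x *\<^sub>R G x $ j)"
  using w ph unfolding has_weak_gradient_def by simp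
qed

lemma wgrad_imp_has_weak_gradient:
 fixes u :: "real^'n => 'b::euclidean_space"
 assumes w: "wgrad Om f G" and Om: "open Om"
  and u: "u : bmeas (lebesgue_on Om)" "AE x in lebesgue_on Om. u x=f x"
  and g: "g : bmeas (lebesgue_on Om)" "AE x in lebesgue_on Om. g x=G x"
 shows "has_weak_gradient Om u g" "integrable (lebesgue_on Om) u" "integrable (lebesgue_on Om) g"
proof -
 have fm: "f : bmeas borel" and Gm: "G : bmeas borel"
  using wgradD(1,2)[OF w] by simp_all
 show iu: "integrable (lebesgue_on Om) u"
  using lebesgue_on_transfer(2)[OF u(1) Om fm wgradD(3)[OF w] u(2)] wgradD(1)[OF w] by simp
 show ig: "integrable (lebesgue_on Om) g"
  using lebesgue_on_transfer(2)[OF g(1) Om Gm wgradD(4)[OF w] g(2)] wgradD(2)[OF w] by simp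
 show "has_weak_gradient Om u g"
  unfolding has_weak_gradient_def
 proof (intro conjI ballI allI)
  show "u : L1_loc Om" by (rule integrable_L1_loc[OF iu Om])
  show "g : L1_loc Om" by (rule integrable_L1_loc[OF ig Om])
  fix ph j assume ph: "ph : test_functions Om"
  note m = test_function_lebesgue_measurable[OF ph, where S=Om]
  note m' = test_functionsD(7)[OF ph] test_functionsD(8)[OF ph, of j]
  have gm: "(%x. g x $ j) : bmeas (lebesgue_on Om)" by (rule borel_measurable_vec_nth[OF g(1)])
  have Gm': "(%x. G x $ j) : bmeas borel" by (rule borel_measurable_vec_nth[OF Gm])
  have "(LINT x|lebesgue_on Om. pderv j ph x *\<^sub>R u x)=(LINT x|lborel. pderv j ph x *\<^sub>R f x)"
  proof (rule lebesgue_on_transfer(1)[OF _ Om])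
   show "(%x. pderv j ph x *\<^sub>R u x) : bmeas (lebesgue_on Om)"
    by (rule borel_measurable_scaleR[OF m(2) u(1)])
   show "(%x. pderv j ph x *\<^sub>R f x) : bmeas borel" by (rule borel_measurable_scaleR[OF m'(2) fm])
   show "AE x in lebesgue_on Om. pderv j ph x *\<^sub>R u x=pderv j ph x *\<^sub>R f x"
    using u(2) by (rule AE_mp) (intro AE_I2 impI, simp)
  qed (simp add: wgradD(3)[OF w])
  moreover have "(LINT x|lebesgue_on Om. ph x *\<^sub>R g x $ j)=(LINT x|lborel. ph x *\<^sub>R G x $ j)"
  proof (rule lebesgue_on_transfer(1)[OF _ Om])
   show "(%x. ph x *\<^sub>R g x $ j) : bmeas (lebesgue_on Om)"
    by (rule borel_measurable_scaleR[OF m(1) gm])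
   show "(%x. ph x *\<^sub>R G x $ j) : bmeas borel" by (rule borel_measurable_scaleR[OF m'(1) Gm'])
   show "AE x in lebesgue_on Om. ph x *\<^sub>R g x $ j=ph x *\<^sub>R G x $ j"
    using g(2) by (rule AE_mp) (intro AE_I2 impI, simp)
  qed (simp add: wgradD(4)[OF w])
  ultimately show "(LINT x|lebesgue_on Om. pderv j ph x *\<^sub>R u x)=- (LINT x|lebesgue_on Om. ph x *\<^sub>R g x $ j)"
   using wgradD(5)[OF w ph] by simp
 qed
qed

section \<open>Approximation up to the boundary\<close>

lemma smooth_cutoff:
 fixes p :: "'a::euclidean_space"
 assumes "0 <= r1" "r1 < r2"
 shows "\<exists>zt::'a => real. smooth zt & (\<forall>x\<in>cball p r1. zt x=1) & (\<forall>x. x ~: cball p r2 --> zt x=0)"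
proof -
 define c where "c=(r2 - r1) / 3"
 have c: "c > 0" "r1+c <= r2 - c" using assms by (simp_all add: c_def field_simps)
 let ?K = "cball p (r1+c)"
 let ?i = "indicator ?K :: 'a => real"
 obtain rh :: "'a => real" where "!!x. rh x >= 0" and
  rh: "smooth rh" "!!x. x ~: ball 0 c ==> rh x=0" "integ rh" "(LINT x|lborel. rh x)=1"
  by (rule mollifier_exists[OF c(1), of 0]) (rule that)
 have b: "bounded {x. rh x ~= 0}" by (rule bounded_subset[OF bounded_ball[of 0 c]]) (use rh(2) in force)
 have int: "integ ?i"
  using emeasure_compact_finite[of ?K] by (simp add: integrable_indicator_iff)
 have near: "dist x y < c" if "rh (y - x) ~= 0" for x y
  using rh(2)[of "y - x"] that by (auto simp: dist_norm norm_minus_commute)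
 have one: "moll rh ?i x=1" if x: "x : cball p r1" for x
 proof -
  have eq: "rh (y - x) *\<^sub>R ?i y=rh (y - x)" for y
  proof (cases "rh (y - x)=0")
   case False
   have "dist p y <= dist p x+dist x y" by (rule dist_triangle)
   then have "y : ?K" using near[OF False] x by simp
   then show ?thesis by simp
  qed simp
  have "moll rh ?i x=(LINT y|lborel. rh (y - x))" unfolding moll_def by (simp only: eq)
  also have "...=(LINT y|lborel. rh (y+(- x)))" by simp
  also have "...=1" unfolding rh(4)[symmetric] by (rule integral_lborel_shift) (use rh(3) in simp)
  finally show ?thesis .
 qed
 have zero: "moll rh ?i x=0" if x: "x ~: cball p r2" for x
 proof -
  have eq: "rh (y - x) *\<^sub>R ?i y=0" for y
  proof (cases "rh (y - x)=0")
   case False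
   have "dist p x <= dist p y+dist x y" using dist_triangle[of p x y] by (simp add: dist_commute)
   then have "y ~: ?K" using near[OF False] x c by simp
   then show ?thesis by simp
  qed simp
  show ?thesis unfolding moll_def by (simp only: eq) simp
 qed
 show ?thesis
  using moll_smooth[OF int rh(1) b] one zero by blast
qed

text \<open>A full neighbourhood of a boundary point in which the domain can be pushed into itself along a coordinate axis.\<close>

lemma boundary_chart:
 fixes Om :: "(real^'n) set"
 assumes sb: "smooth_boundary Om" and Om: "open Om" and p: "p : frontier Om"
 shows "\<exists>r>0. EX i. \<exists>s\<in>{1, -1}. \<exists>\<gamma> L. L >= 0 & continuous_on UNIV \<gamma> & (\<forall>x t. \<gamma> (x + t *\<^sub>R axis i 1) = \<gamma> x) \<and>
  (\<forall>x\<in>ball p r. \<forall>y\<in>ball p r. \<bar>\<gamma> x - \<gamma> y\<bar> <= L * norm (x - y)) \<and>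
  (\<forall>x\<in>ball p r. x : Om \<longleftrightarrow> s * x $ i > \<gamma> x) & (\<forall>x\<in>ball p r. x : frontier Om --> s * x $ i = \<gamma> x)"
proof -
 obtain r i s \<gamma> where r: "r > 0" and s: "s : {1, -1::real}" and sm: "smooth \<gamma>"
  and ind: "\<forall>x y. (\<forall>j. j ~= i --> x $ j=y $ j) --> \<gamma> x=\<gamma> y"
  and Omr: "Om \<inter> ball p r={x : ball p r. s * x $ i > \<gamma> x}"
  using sb[unfolded smooth_boundary_def, rule_format, OF p] by blast
 obtain zt :: "real^'n => real" where zt: "smooth zt" "!!x. x : cball p r ==> zt x=1" "!!x. x ~: cball p (r+1) ==> zt x=0"
  using smooth_cutoff[of r "r+1" p] r by auto
 have "bounded {x. zt x * \<gamma> x ~= 0}" by (rule bounded_subset[OF bounded_cball[of p "r+1"]]) (use zt(3) in force)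
 note C1 = C1_bounded[OF smooth_C1[OF smooth_mult[OF zt(1) sm]] this]
 have "\<exists>L\<ge>0. \<forall>x\<in>ball p r. \<forall>y\<in>ball p r. \<bar>\<gamma> x - \<gamma> y\<bar> <= L * norm (x - y)"
 proof (rule C1)
  fix B assume B: "0 <= B" "!!x y. norm (zt x * \<gamma> x - zt y * \<gamma> y) <= B * norm (x - y)"
  show ?thesis
  proof (intro exI[of _ B] conjI ballI)
   fix x y assume "x : ball p r" "y : ball p r"
   then show "\<bar>\<gamma> x - \<gamma> y\<bar> <= B * norm (x - y)" using B(2)[of x y] zt(2)[of x] zt(2)[of y] by simp
  qed (rule B(1))
 qed
 then obtain L where L: "L >= 0" "\<forall>x\<in>ball p r. \<forall>y\<in>ball p r. \<bar>\<gamma> x - \<gamma> y\<bar> <= L * norm (x - y)" by blast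
 have cont: "continuous_on UNIV \<gamma>" by (rule smooth_continuous[OF sm])
 have ind': "\<gamma> (x+t *\<^sub>R axis i 1)=\<gamma> x" for x t
 proof -
  have "\<forall>j. j ~= i --> (x+t *\<^sub>R axis i 1) $ j=x $ j" by (simp add: axis_def)
  then show ?thesis using ind by blast
 qed
 have inOm: "x : Om \<longleftrightarrow> s * x $ i > \<gamma> x" if "x : ball p r" for x
  using Omr that by blast
 have fr: "s * x $ i=\<gamma> x" if x: "x : ball p r" "x : frontier Om" for x
 proof (rule ccontr)
  assume ne: "s * x $ i ~= \<gamma> x"
  have "x ~: Om" using x(2) Om by (simp add: frontier_def interior_open)
  then have lt: "s * x $ i < \<gamma> x" using inOm[OF x(1)] ne by simp
  have op: "open ({y. s * y $ i < \<gamma> y} \<inter> ball p r)"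
  proof (rule open_Int)
   show "open {y. s * y $ i < \<gamma> y}"
    by (rule open_Collect_less) (intro continuous_intros cont)+
  qed simp
  have "x : closure Om" using x(2) by (simp add: frontier_def)
  moreover have "x : {y. s * y $ i < \<gamma> y} \<inter> ball p r" using lt x(1) by simp
  ultimately obtain y where "y : Om" "y : {y. s * y $ i < \<gamma> y} \<inter> ball p r"
   using op open_Int_closure_eq_empty[OF op, of Om] by blast
  then show False using inOm[of y] by simp
 qed
 show ?thesis
  using r s L cont ind' inOm fr by (intro exI[of _ r] conjI exI[of _ i] bexI[of _ s] exI[of _ \<gamma>] exI[of _ L]) simp_all
qed

definition approximable :: "(real^'n) set => (real^'n => real) => (real^'n => real^'n) => bool" where
 "approximable Om f G \<longleftrightarrow> (\<forall>e>0. \<exists>ph H. smooth ph & integrable lborel ph & integrable lborel H \<and>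
  (\<forall>x\<in>Om. \<forall>j. partial_deriv j ph x = H x $ j) \<and>
  (LINT x|lborel. norm (ph x - f x)) <= e & (LINT x|lborel. norm (H x - G x)) <= e)"

lemma approximable_add:
 assumes f: "integ f" "integ f'" and G: "integ G" "integ G'"
  and a: "approximable Om f G" "approximable Om f' G'"
 shows "approximable Om (%x. f x+f' x) (%x. G x+G' x)"
 unfolding approximable_def
proof (intro allI impI)
 fix e :: real assume "e > 0"
 then have e: "e / 2 > 0" by simp
 obtain ph H where 1: "smooth ph" "integ ph" "integ H"
  "\<forall>x\<in>Om. \<forall>j. pderv j ph x=H x $ j"
  "(LINT x|lborel. norm (ph x - f x)) <= e / 2" "(LINT x|lborel. norm (H x - G x)) <= e / 2"
  using a(1) e unfolding approximable_def by meson
 obtain ph' H' where 2: "smooth ph'" "integ ph'" "integ H'"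
  "\<forall>x\<in>Om. \<forall>j. pderv j ph' x=H' x $ j"
  "(LINT x|lborel. norm (ph' x - f' x)) <= e / 2" "(LINT x|lborel. norm (H' x - G' x)) <= e / 2"
  using a(2) e unfolding approximable_def by meson
 have tri: "(LINT x|lborel. norm ((p x+p' x) - (q x+q' x))) <= e"
  if "integ p" "integ p'" "integ q" "integ q'"
   "(LINT x|lborel. norm (p x - q x)) <= e / 2" "(LINT x|lborel. norm (p' x - q' x)) <= e / 2"
  for p p' q q' :: "real^'n => 'c::{banach, second_countable_topology}"
 proof -
  have i: "integ (%x. norm (p x - q x))" "integ (%x. norm (p' x - q' x))"
   by (rule integrable_norm[OF Bochner_Integration.integrable_diff[OF that(1,3)]],
    rule integrable_norm[OF Bochner_Integration.integrable_diff[OF that(2,4)]])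
  have "(LINT x|lborel. norm ((p x+p' x) - (q x+q' x))) <= (LINT x|lborel. norm (p x - q x)+norm (p' x - q' x))"
  proof (rule integral_mono')
   show "norm ((p x+p' x) - (q x+q' x)) <= norm (p x - q x)+norm (p' x - q' x)" for x
    using norm_triangle_ineq[of "p x - q x" "p' x - q' x"] by (simp add: algebra_simps)
  qed (use i in simp_all)
  also have "...=(LINT x|lborel. norm (p x - q x))+(LINT x|lborel. norm (p' x - q' x))"
   by (rule Bochner_Integration.integral_add[OF i])
  finally show ?thesis using that by simp
 qed
 have pd: "pderv j (%x. ph x+ph' x) x=pderv j ph x+pderv j ph' x" for j x
 proof -
  have "((%x. ph x+ph' x) has_derivative (%v. fderv ph (at x) v+fderv ph' (at x) v)) (at x)"
   by (rule has_derivative_add[OF Ck1_has_derivative[OF smooth_C1[OF 1(1)]] Ck1_has_derivative[OF smooth_C1[OF 2(1)]]])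
  from fun_cong[OF frechet_derivative_at[OF this], of "axis j 1"] show ?thesis by (simp add: partial_deriv_def)
 qed
 show "\<exists>ph H. smooth ph & integrable lborel ph & integrable lborel H \<and>
  (\<forall>x\<in>Om. \<forall>j. partial_deriv j ph x = H x $ j) \<and>
  (LINT x|lborel. norm (ph x - (f x + f' x))) <= e & (LINT x|lborel. norm (H x - (G x + G' x))) <= e"
 proof (intro exI conjI)
  show "smooth (%x. ph x+ph' x)" by (rule smooth_add[OF 1(1) 2(1)])
  show "integ (%x. ph x+ph' x)" using 1(2) 2(2) by simp
  show "integ (%x. H x+H' x)" using 1(3) 2(3) by simp
  show "\<forall>x\<in>Om. \<forall>j. pderv j (%x. ph x+ph' x) x=(H x+H' x) $ j" using 1(4) 2(4) by (simp add: pd)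
  show "(LINT x|lborel. norm (ph x+ph' x - (f x+f' x))) <= e" by (rule tri[OF 1(2) 2(2) f 1(5) 2(5)])
  show "(LINT x|lborel. norm (H x+H' x - (G x+G' x))) <= e" by (rule tri[OF 1(3) 2(3) G 1(6) 2(6)])
 qed
qed

text \<open>If small translates in the direction of a cone around \<open>a\<close> stay inside the domain, mollifying
 with a kernel supported in that cone commutes with the weak gradient up to the boundary.\<close>

lemma approximable_one_sided:
 fixes a :: "real^'n"
 assumes w: "wgrad Om f G" and supp: "!!x. x ~: cball p R0 ==> f x=0 & G x=0"
  and R: "R0 < R1" and c: "c > 0" and tm: "tm > 0"
  and cone: "!!t x. 0 < t ==> t <= tm ==> x : Om ==> x : ball p R1 ==> cball (x+t *\<^sub>R a) (t * c) \<subseteq> Om"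
 shows "approximable Om f G"
 unfolding approximable_def
proof (intro allI impI)
 fix e :: real assume "e > 0"
 define t1 where "t1=min tm ((R1 - R0) / (3 * (norm a+c)))"
 have nc: "norm a+c > 0" using c norm_ge_zero[of a] by linarith
 have t1: "t1 > 0" using tm R nc by (simp add: t1_def)
 show "\<exists>ph H. smooth ph & integrable lborel ph & integrable lborel H \<and>
  (\<forall>x\<in>Om. \<forall>j. partial_deriv j ph x = H x $ j) \<and>
  (LINT x|lborel. norm (ph x - f x)) <= e & (LINT x|lborel. norm (H x - G x)) <= e"
 proof (rule mollifier_close[OF wgradD(1,2)[OF w] \<open>e > 0\<close> c t1, of a])
  fix t and rh :: "real^'n => real"
  assume t: "0 < t" "t <= t1" and sm: "smooth rh" and sp: "!!x. rh x ~= 0 ==> x : cball (t *\<^sub>R a) (t * c)"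
   and b: "bounded {x. rh x ~= 0}" and i: "integ (moll rh f)" "integ (moll rh G)"
   and close: "(LINT x|lborel. norm (moll rh f x - f x)) <= e" "(LINT x|lborel. norm (moll rh G x - G x)) <= e"
  have sm': "smooth (moll rh f)" by (rule moll_smooth[OF wgradD(1)[OF w] sm b])
  have ttm: "t <= tm" using t(2) by (simp add: t1_def)
  have tn: "t * (norm a+c) <= (R1 - R0) / 3"
  proof -
   have "t * (norm a+c) <= (R1 - R0) / (3 * (norm a+c)) * (norm a+c)"
    by (rule mult_right_mono) (use t(2) nc in "simp_all add: t1_def")
   also have "...=(R1 - R0) / 3" using nc by (simp only: times_divide_eq_left) (simp add: field_simps)
   finally show ?thesis .
  qed
  have small: "dist x y <= (R1 - R0) / 3" if "rh (y - x) ~= 0" for x y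
  proof -
   have "norm ((y - x) - t *\<^sub>R a) <= t * c" using sp[OF that] by (simp add: dist_norm norm_minus_commute)
   then have "norm (y - x) <= t * norm a+t * c"
    using norm_triangle_sub[of "y - x" "t *\<^sub>R a"] t(1) by simp
   then show ?thesis using tn by (simp add: dist_norm norm_minus_commute algebra_simps)
  qed
  have far: "moll rh f x=0" "moll rh G x=0" if x: "x ~: ball p ((R0+2 * R1) / 3)" for x
  proof -
   have y: "f y=0 & G y=0" if "rh (y - x) ~= 0" for y
   proof -
    have "dist p x <= dist p y+dist x y" using dist_triangle[of p x y] by (simp add: dist_commute)
    then have "y ~: cball p R0" using small[OF that] x R by (simp add: field_simps)
    then show ?thesis by (rule supp)
   qed
   have eq: "rh (y - x) *\<^sub>R f y=0" "rh (y - x) *\<^sub>R G y=0" for y using y[of y] by auto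
   show "moll rh f x=0" "moll rh G x=0" unfolding moll_def by (simp_all only: eq) simp_all
  qed
  have grad: "pderv j (moll rh f) x=moll rh G x $ j" if x: "x : Om" for x j
  proof (cases "x : ball p R1")
   case True
   show ?thesis unfolding partial_deriv_def
    by (rule moll_weak_gradient[OF w sm sp cone[OF t(1) ttm x True]])
  next
   case False
   let ?U = "- cball p ((R0+2 * R1) / 3)"
   have xU: "x : ?U" using False R by (simp add: field_simps)
   have z: "0=moll rh f y" if "y : ?U" for y using far(1)[of y] that by simp
   have "open ?U" by auto
   from has_derivative_transform_within_open[OF has_derivative_const[of 0] this xU z]
   have "(moll rh f has_derivative (%_. 0)) (at x)" .
   from fun_cong[OF frechet_derivative_at[OF this, symmetric], of "axis j 1"]
   show ?thesis using far(2)[of x] xU by (simp add: partial_deriv_def)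
  qed
  show ?thesis
   using sm' i close grad by (intro exI[of _ "moll rh f"] exI[of _ "moll rh G"] conjI ballI allI)
 qed
qed

lemma approximable_near_point:
 fixes Om :: "(real^'n) set"
 assumes Om: "open Om" and sb: "smooth_boundary Om" and p: "p : closure Om"
 shows "\<exists>r>0. \<forall>(f :: real^'n => real) G. wgrad Om f G --> (\<forall>x. x ~: cball p r --> f x=0 & G x=0) --> approximable Om f G"
proof (cases "p : Om")
 case True
 then obtain r where r: "r > 0" "cball p r \<subseteq> Om" using Om open_contains_cball by blast
 show ?thesis
 proof (rule exI[of _ "r / 4"], intro conjI allI impI)
  show "r / 4 > 0" using r by simp
  fix f :: "real^'n => real" and G assume w: "wgrad Om f G" and s: "\<forall>x. x ~: cball p (r / 4) --> f x=0 & G x=0"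
  show "approximable Om f G"
  proof (rule approximable_one_sided[OF w, of p "r / 4" "r / 2" 1 "r / 4" 0])
   show "f x=0 & G x=0" if "x ~: cball p (r / 4)" for x using s that by blast
   fix t x assume t: "0 < t" "t <= r / 4" and x: "x : ball p (r / 2)"
   have "cball (x+t *\<^sub>R 0) (t * 1) \<subseteq> cball p r"
   proof
    fix y assume "y : cball (x+t *\<^sub>R 0) (t * 1)"
    then show "y : cball p r" using t x dist_triangle[of p y x] r by simp
   qed
   then show "cball (x+t *\<^sub>R 0) (t * 1) \<subseteq> Om" using r(2) by blast
  qed (use r in simp_all)
 qed
next
 case False
 then have "p : frontier Om" using p Om by (simp add: frontier_def interior_open)
 from boundary_chart[OF sb Om this] obtain r i s \<gamma> L where r: "r > 0" and s: "s : {1, -1::real}" and L: "L >= 0"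
  and ind: "!!x t. \<gamma> (x+t *\<^sub>R axis i 1)=\<gamma> x"
  and Lip: "!!x y. x : ball p r ==> y : ball p r ==> \<bar>\<gamma> x - \<gamma> y\<bar> <= L * norm (x - y)"
  and inOm: "!!x. x : ball p r ==> x : Om \<longleftrightarrow> s * x $ i > \<gamma> x" by metis
 have ss: "s * s=1" using s by auto
 define c where "c=1 / (2 * (1+L))"
 have c: "c > 0" "c+L * c < 1" "c <= 1"
 proof -
  have "c * (1+L)=1 / 2" using L by (simp add: c_def field_simps)
  then show "c+L * c < 1" by (simp add: algebra_simps)
  show "c > 0" using L by (simp add: c_def)
  then show "c <= 1" using \<open>c + L * c < 1\<close> L mult_nonneg_nonneg[of L c] by linarith
 qed
 let ?a = "s *\<^sub>R axis i (1::real) :: real^'n"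
 show ?thesis
 proof (rule exI[of _ "r / 4"], intro conjI allI impI)
  show "r / 4 > 0" using r by simp
  fix f :: "real^'n => real" and G assume w: "wgrad Om f G" and sp: "\<forall>x. x ~: cball p (r / 4) --> f x=0 & G x=0"
  show "approximable Om f G"
  proof (rule approximable_one_sided[OF w, of p "r / 4" "r / 2" c "r / 8" ?a])
   show "f x=0 & G x=0" if "x ~: cball p (r / 4)" for x using sp that by blast
   fix t x assume t: "0 < t" "t <= r / 8" and x: "x : Om" "x : ball p (r / 2)"
   show "cball (x+t *\<^sub>R ?a) (t * c) \<subseteq> Om"
   proof
    fix y assume y: "y : cball (x+t *\<^sub>R ?a) (t * c)"
    define \<eta> where "\<eta>=y - x - t *\<^sub>R ?a"
    have \<eta>: "norm \<eta> <= t * c" using y by (simp add: \<eta>_def dist_norm norm_minus_commute algebra_simps)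
    have y': "y=(x+\<eta>)+(t * s) *\<^sub>R axis i 1" by (simp add: \<eta>_def)
    have tc: "t * c <= r / 8" using mult_mono[of t "r/8" c 1] t c by simp
    have na: "norm (t *\<^sub>R ?a)=t" using s t by auto
    have "dist p y <= dist p x+norm (y - x)" using dist_triangle[of p y x] by (simp add: dist_norm norm_minus_commute)
    moreover have "norm (y - x) <= norm \<eta>+norm (t *\<^sub>R ?a)"
    using norm_triangle_ineq[of \<eta> "t *\<^sub>R ?a"] by (simp add: \<eta>_def)
    ultimately have yb: "y : ball p r" using x(2) \<eta> tc na t r by simp
    have "dist p (x+\<eta>) <= dist p x+norm \<eta>" using dist_triangle[of p "x+\<eta>" x] by (simp add: dist_norm)
    then have xb: "x+\<eta> : ball p r" using x(2) \<eta> tc r by simp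
    have xr: "x : ball p r" using x(2) r by simp
    have "\<gamma> y=\<gamma> (x+\<eta>)" by (simp only: y' ind)
    also have "... <= \<gamma> x+L * norm \<eta>" using Lip[OF xb xr] by simp
    also have "... <= \<gamma> x+L * (t * c)" using mult_left_mono[OF \<eta> L] by simp
    finally have 1: "\<gamma> y <= \<gamma> x+L * (t * c)" .
    have "s * y $ i=s * x $ i+s * \<eta> $ i+t"
    proof -
    have "y $ i=x $ i+\<eta> $ i+t * s" by (simp add: y')
    then have "s * y $ i=s * x $ i+s * \<eta> $ i+t * (s * s)" by (simp add: algebra_simps)
    then show ?thesis by (simp add: ss)
    qed
    moreover have "\<bar>s * \<eta> $ i\<bar> <= t * c" using s component_le_norm_cart[of \<eta> i] \<eta> by auto
    ultimately have 2: "s * y $ i >= s * x $ i+t - t * c" by linarith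
    have 3: "s * x $ i > \<gamma> x" using inOm[OF xr] x(1) by simp
    have "t * (c+L * c) < t * 1" using t(1) c(2) by (intro mult_strict_left_mono) 
    then have "L * (t * c)+t * c < t" by (simp add: algebra_simps)
    then have "s * y $ i > \<gamma> y" using 1 2 3 by linarith
    then show "y : Om" using inOm[OF yb] by simp
   qed
  qed (use r c in simp_all)
 qed
qed

lemma smooth_partial_bound:
 assumes "smooth zt" "bounded {x. zt x ~= 0}"
 shows "EX B. (\<forall>x. \<bar>zt x\<bar> <= B) & (\<forall>x j. \<bar>pderv j zt x\<bar> <= B)"
proof (rule C1_bounded[OF smooth_C1[OF assms(1)] assms(2)])
 fix B assume B: "!!x v. norm (fderv zt (at x) v) <= B * norm v" "!!x. norm (zt x) <= B"
 show ?thesis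
 proof (intro exI conjI allI)
  show "\<bar>zt x\<bar> <= B" for x using B(2)[of x] by simp
  show "\<bar>pderv j zt x\<bar> <= B" for x j
   using B(1)[of x "axis j 1"] by (simp add: partial_deriv_def)
 qed
qed

lemma partial_deriv_locally_const:
 assumes "open U" "x : U" "!!y. y : U ==> zt y=k"
 shows "pderv j zt x=0"
proof -
 have "(zt has_derivative (%_. 0)) (at x)"
  by (rule has_derivative_transform_within_open[OF has_derivative_const[of k] assms(1,2)]) (simp add: assms(3))
 from fun_cong[OF frechet_derivative_at[OF this, symmetric], of "axis j 1"] show ?thesis by (simp add: partial_deriv_def)
qed

text \<open>A partition of unity reduces the claim to functions supported near one point. Near the boundary a small shift along the axis of the chart makes room for a mollifier.\<close>

theorem wgrad_approximable:
 fixes Om :: "(real^'n) set"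
 assumes Om: "open Om" "bounded Om" and sb: "smooth_boundary Om" and w: "wgrad Om f G"
 shows "approximable Om f G"
proof -
 obtain r where r: "!!p. p : closure Om ==> r p > 0"
  "!!p f G. p : closure Om ==> wgrad Om f G ==> (!!x. x ~: cball p (r p) ==> f x=0 & G x=0) ==> approximable Om f G"
  using approximable_near_point[OF Om(1) sb] by metis
 have cc: "compact (closure Om)" using Om(2) by (simp add: compact_closure)
 have op: "!!p. p : closure Om ==> open (ball p (r p / 2))" by simp
 have cov: "closure Om \<subseteq> (\<Union>p\<in>closure Om. ball p (r p / 2))"
 proof
  fix x assume x: "x : closure Om"
  then have "x : ball x (r x / 2)" using r(1)[OF x] by simp
  then show "x : (\<Union>p\<in>closure Om. ball p (r p / 2))" using x by blast
 qed
 obtain P where P: "P \<subseteq> closure Om" "finite P" "closure Om \<subseteq> (\<Union>p\<in>P. ball p (r p / 2))"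
  by (rule compactE_image[OF cc op cov]) (assumption | rule that)+
 have "finite P ==> P \<subseteq> closure Om ==> wgrad Om f G ==>
   (!!x. x ~: (\<Union>p\<in>P. ball p (r p / 2)) ==> f x = 0 & G x = 0) ==> approximable Om f G"
   for P and f :: "real^'n => real" and G
 proof (induction P arbitrary: f G rule: finite_induct)
  case empty
  then have z: "f=(%x. 0)" "G=(%x. 0)" by auto
  show ?case unfolding approximable_def z
  proof (intro allI impI)
   fix e :: real assume "e > 0"
   have "pderv j (%x. 0) x=0" for j and x :: "real^'n"
    by (rule partial_deriv_locally_const[of UNIV x _ 0]) simp_all
   then show "\<exists>ph H. smooth ph & integrable lborel ph & integrable lborel H \<and>
    (\<forall>x\<in>Om. \<forall>j. partial_deriv j ph x = H x $ j) \<and>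
    (LINT x|lborel. norm (ph x - 0)) <= e & (LINT (x::real^'n)|lborel. norm (H x - 0::real^'n)) <= e"
    using \<open>e > 0\<close> by (intro exI[of _ "%_. 0"]) (simp add: smooth_const)
  qed
 next
  case (insert p P)
  have pc: "p : closure Om" and Pc: "P \<subseteq> closure Om" using insert.prems(1) by auto
  have rp: "r p > 0" by (rule r(1)[OF pc])
  obtain zt :: "real^'n => real" where zt: "smooth zt" "!!x. x : cball p (r p / 2) ==> zt x=1" "!!x. x ~: cball p (r p) ==> zt x=0"
   using smooth_cutoff[of "r p / 2" "r p" p] rp by auto
  have bz: "bounded {x. zt x ~= 0}" by (rule bounded_subset[OF bounded_cball[of p "r p"]]) (use zt(3) in force)
  obtain B where B: "!!x. \<bar>zt x\<bar> <= B" "!!x j. \<bar>pderv j zt x\<bar> <= B"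
   using smooth_partial_bound[OF zt(1) bz] by blast
  define f1 where "f1 x=zt x *\<^sub>R f x" for x
  define G1 where "G1 x=(\<chi> j. zt x *\<^sub>R G x $ j+pderv j zt x *\<^sub>R f x)" for x
  have w1: "wgrad Om f1 G1" unfolding f1_def[abs_def] G1_def[abs_def] by (rule wgrad_cutoff[OF insert.prems(2) zt(1) B])
  define f2 where "f2 x=f x - f1 x" for x
  define G2 where "G2 x=G x - G1 x" for x
  have w2: "wgrad Om f2 G2"
   unfolding wgrad_def
  proof (intro conjI allI ballI impI)
   note W = wgradD[OF insert.prems(2)] and W1 = wgradD[OF w1]
   show "integ f2" unfolding f2_def[abs_def] by (rule Bochner_Integration.integrable_diff[OF W(1) W1(1)])
   show "integ G2" unfolding G2_def[abs_def] by (rule Bochner_Integration.integrable_diff[OF W(2) W1(2)])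
   show "x ~: Om ==> f2 x=0" for x using W(3)[of x] W1(3)[of x] by (simp add: f2_def)
   show "x ~: Om ==> G2 x=0" for x using W(4)[of x] W1(4)[of x] by (simp add: G2_def)
   fix ph j assume ph: "ph : test_functions Om"
   obtain B' where B': "!!x. \<bar>ph x\<bar> <= B'" "!!x j. \<bar>pderv j ph x\<bar> <= B'"
    using test_function_bound[OF ph] by blast
   have m: "ph : bmeas lborel" "pderv j ph : bmeas lborel"
    using test_functionsD(7)[OF ph] test_functionsD(8)[OF ph, of j] by simp_all
   have i: "integ (%x. pderv j ph x *\<^sub>R f x)" "integ (%x. pderv j ph x *\<^sub>R f1 x)"
    by (rule integrable_bounded_mult[OF W(1) m(2) B'(2)], rule integrable_bounded_mult[OF W1(1) m(2) B'(2)])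
   have i': "integ (%x. ph x *\<^sub>R G x $ j)" "integ (%x. ph x *\<^sub>R G1 x $ j)"
    by (rule integrable_bounded_mult[OF integrable_vec_nth[OF W(2)] m(1) B'(1)],
    rule integrable_bounded_mult[OF integrable_vec_nth[OF W1(2)] m(1) B'(1)])
   show "(LINT x|lborel. pderv j ph x *\<^sub>R f2 x)=- (LINT x|lborel. ph x *\<^sub>R G2 x $ j)"
    unfolding f2_def G2_def vector_minus_component scaleR_diff_right
    using W(5)[OF ph, of j] W1(5)[OF ph, of j] Bochner_Integration.integral_diff[OF i] Bochner_Integration.integral_diff[OF i']
    by linarith
  qed
  have a1: "approximable Om f1 G1"
  proof (rule r(2)[OF pc w1])
   fix x assume x: "x ~: cball p (r p)"
   have "pderv j zt x=0" for j
    by (rule partial_deriv_locally_const[of "- cball p (r p)" x zt 0]) (use x zt(3) in auto)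
   then show "f1 x=0 & G1 x=0" using zt(3)[OF x] by (simp add: f1_def G1_def vec_eq_iff)
  qed
  have a2: "approximable Om f2 G2"
  proof (rule insert.IH[OF Pc w2])
   fix x assume x: "x ~: (\<Union>p\<in>P. ball p (r p / 2))"
   show "f2 x=0 & G2 x=0"
   proof (cases "x : ball p (r p / 2)")
    case True
    have "pderv j zt x=0" for j
    by (rule partial_deriv_locally_const[of "ball p (r p / 2)" x zt 1]) (use True zt(2) in auto)
    moreover have "zt x=1" using True zt(2)[of x] by simp
    ultimately show ?thesis by (simp add: f2_def f1_def G2_def G1_def vec_eq_iff)
   next
    case False
    then have "f x=0 & G x=0" using x insert.prems(3)[of x] by simp
    then show ?thesis by (simp add: f2_def f1_def G2_def G1_def vec_eq_iff)
   qed
  qed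
  have "approximable Om (%x. f1 x+f2 x) (%x. G1 x+G2 x)"
   by (rule approximable_add[OF wgradD(1)[OF w1] wgradD(1)[OF w2] wgradD(2)[OF w1] wgradD(2)[OF w2] a1 a2])
  then show ?case by (simp add: f2_def G2_def)
 qed
 from this[OF P(2,1) w] wgradD(3,4)[OF w] P(3) closure_subset[of Om] show ?thesis by blast
qed

section \<open>The trace inequality\<close>

lemma emeasure_measure_of_le: "emeasure (measure_of Om M mu) A <= mu A"
 by (simp add: emeasure_measure_of_conv)

lemma cube_norm_le:
 fixes x y u v :: "real^'n"
 assumes "x : cbox u v" "y : cbox u v" "!!b. b : Basis ==> v \<bullet> b - u \<bullet> b=l"
 shows "norm (x - y) <= real CARD('n) * l"
proof -
 have "norm (x - y) <= (\<Sum>b\<in>Basis. \<bar>(x - y) \<bullet> b\<bar>)" by (rule norm_le_l1)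
 also have "... <= (\<Sum>b\<in>(Basis::(real^'n) set). l)"
 proof (rule sum_mono)
  fix b :: "real^'n" assume b: "b : Basis"
  have "u \<bullet> b <= x \<bullet> b" "x \<bullet> b <= v \<bullet> b" "u \<bullet> b <= y \<bullet> b" "y \<bullet> b <= v \<bullet> b" using assms(1,2) b by (auto simp: mem_box)
  then show "\<bar>(x - y) \<bullet> b\<bar> <= l" using assms(3)[OF b] by (simp add: inner_diff_left abs_le_iff)
 qed
 also have "...=real CARD('n) * l" by simp
 finally show ?thesis .
qed

text \<open>The graph coordinates near a boundary point: \<open>hgt\<close> is the signed height over the graph and
 \<open>foot\<close> the projection along the axis \<open>i\<close>.\<close>

locale graph_chart =
 fixes i :: "'n::finite" and s :: real and \<gamma> :: "real^'n => real" and L :: real and p :: "real^'n" and r :: real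
 assumes s: "s : {1, -1}" and L: "L >= 0" and cont: "continuous_on UNIV \<gamma>" and ind: "\<gamma> (x+t *\<^sub>R axis i 1)=\<gamma> x"
  and Lip: "x : ball p r ==> y : ball p r ==> \<bar>\<gamma> x - \<gamma> y\<bar> <= L * norm (x - y)" and r: "r > 0"
begin

abbreviation "ei \<equiv> (axis i 1 :: real^'n)"
definition "hgt x=s * x $ i - \<gamma> x"
definition "foot x=x - (hgt x * s) *\<^sub>R ei"

lemma ss: "s * s=1" using s by auto

lemma hgt_shift: "hgt (x+t *\<^sub>R ei)=hgt x+s * t"
 by (simp add: hgt_def ind algebra_simps)

lemma foot_shift: "foot (x+t *\<^sub>R ei)=foot x"
proof -
 have "(hgt x+s * t) * s=hgt x * s+t" using ss by (simp add: algebra_simps)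
 then show ?thesis by (simp add: foot_def hgt_shift algebra_simps)
qed

lemma foot_eq: "hgt x=0 ==> foot x=x" by (simp add: foot_def)

lemma foot_dist: "norm (x - foot x)=\<bar>hgt x\<bar>"
 using s by (auto simp: foot_def)

lemma hgt_continuous: "continuous_on UNIV hgt"
 unfolding hgt_def[abs_def] by (intro continuous_intros cont)

lemma foot_continuous: "continuous_on UNIV foot"
 unfolding foot_def[abs_def] by (intro continuous_intros hgt_continuous)

lemma hgt_measurable[measurable]: "hgt : bmeas borel"
 by (rule borel_measurable_continuous_onI[OF hgt_continuous])

lemma foot_measurable[measurable]: "foot : bmeas borel"
 by (rule borel_measurable_continuous_onI[OF foot_continuous])

lemma hgt_lip:
 assumes "x : ball p r" "y : ball p r"
 shows "\<bar>hgt x - hgt y\<bar> <= (1+L) * norm (x - y)"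
proof -
 have "\<bar>s * (x $ i - y $ i)\<bar> <= norm (x - y)"
  using s component_le_norm_cart[of "x - y" i] by auto
 moreover have "hgt x - hgt y=s * (x $ i - y $ i) - (\<gamma> x - \<gamma> y)" by (simp add: hgt_def algebra_simps)
 ultimately show ?thesis using Lip[OF assms] by (simp add: algebra_simps)
qed

lemma foot_lip:
 assumes "x : ball p r" "y : ball p r"
 shows "norm (foot x - foot y) <= (2+L) * norm (x - y)"
proof -
 have "foot x - foot y=(x - y) - ((hgt x - hgt y) * s) *\<^sub>R ei"
  by (simp add: foot_def algebra_simps)
 then have "norm (foot x - foot y) <= norm (x - y)+norm (((hgt x - hgt y) * s) *\<^sub>R ei)"
  by (simp only: norm_triangle_ineq4)
 also have "norm (((hgt x - hgt y) * s) *\<^sub>R ei)=\<bar>hgt x - hgt y\<bar>" using s by auto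
 finally show ?thesis using hgt_lip[OF assms] by (simp add: algebra_simps)
qed

text \<open>A covering of the slab over \<open>E\<close> by small cubes yields, at almost every height \<open>t\<close>, a covering
 of \<open>E\<close>; averaging over \<open>t\<close> compares the Hausdorff measure of \<open>E\<close> with the volume of the slab.\<close>

lemma hausdorff_outer_le_slab:
 assumes card: "CARD('n) >= 2" and h: "h > 0" and Z: "Z : sets borel" "Z \<subseteq> ball p r"
  and slab: "!!x t. x : E ==> 0 < t ==> t < h ==> x+(s * t) *\<^sub>R ei : Z"
  and E: "!!x. x : E ==> hgt x=0"
 shows "ennreal h * hausdorff_outer (CARD('n) - 1) E
  <= ennreal (unit_ball_vol (real (CARD('n) - 1)) * ((2 + L) * CARD('n)) ^ CARD('n) * 2) * emeasure lborel Z"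
proof -
 define m where "m=CARD('n) - 1"
 define \<kappa> where "\<kappa>=(2+L) * real CARD('n)"
 define \<omega> where "\<omega>=unit_ball_vol (real m)"
 have m: "CARD('n)=Suc m" "m >= 1" using card by (auto simp: m_def)
 have \<kappa>: "\<kappa> > 0" unfolding \<kappa>_def using L by simp
 have \<omega>: "\<omega> >= 0" unfolding \<omega>_def by simp
 have Zfin: "emeasure lborel Z < \<infinity>" by (rule emeasure_bounded_finite) (rule bounded_subset[OF bounded_ball Z(2)])
 obtain a0 where a0: "Z \<subseteq> cbox (- a0) a0" using bounded_subset_cbox_symmetric[OF bounded_subset[OF bounded_ball Z(2)]] by blast
 obtain R where R: "R > 0" "Z \<subseteq> cbox (- (R *\<^sub>R One)) (R *\<^sub>R (One :: real^'n))"
 proof -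
  have "bounded Z" by (rule bounded_subset[OF bounded_ball Z(2)])
  then obtain R where R: "R > 0" "!!x. x : Z ==> norm x <= R" unfolding bounded_pos by blast
  have "Z \<subseteq> cbox (- (R *\<^sub>R One)) (R *\<^sub>R (One :: real^'n))"
  proof
   fix x assume "x : Z"
   then have "\<bar>x \<bullet> b\<bar> <= R" if "b : Basis" for b using R(2) Basis_le_norm[OF that, of x] by fastforce
   then show "x : cbox (- (R *\<^sub>R One)) (R *\<^sub>R (One :: real^'n))" by (auto simp: mem_box abs_le_iff inner_minus_left)
    (metis minus_le_iff)
  qed
  then show thesis using that R(1) by blast
 qed
 have content: "ennreal h * hausdorff_content m \<delta> E <= ennreal (\<omega> * \<kappa> ^ CARD('n) * 2) * (emeasure lborel Z+ennreal \<epsilon>)"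
  if \<delta>: "\<delta> > 0" and \<epsilon>: "\<epsilon> > 0" for \<delta> \<epsilon> :: real
 proof -
  obtain U where U: "open U" "Z \<subseteq> U" "emeasure lborel (U - Z) < ennreal \<epsilon>"
   using outer_regular_lborel[OF Z(1) \<epsilon>] by blast
  have Um[measurable]: "U : sets borel" using U by simp
  have Uem: "emeasure lborel U <= emeasure lborel Z+ennreal \<epsilon>"
  proof -
   have "emeasure lborel U <= emeasure lborel (Z \<union> (U - Z))" by (rule emeasure_mono) (use Z in auto)
   also have "... <= emeasure lborel Z+emeasure lborel (U - Z)" by (rule emeasure_subadditive) (use Z(1) in auto)
   also have "... <= emeasure lborel Z+ennreal \<epsilon>" using U(3) by (intro add_left_mono less_imp_le)
   finally show ?thesis .
  qed
  define \<eta> where "\<eta>=\<delta> / (2 * \<kappa>)"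
  have \<eta>: "\<eta> > 0" using \<delta> \<kappa> by (simp add: \<eta>_def)
  define g where "g x=(if x : U then U \<inter> ball x \<eta> else ball x \<eta>)" for x
  have gauge: "gauge g" unfolding gauge_def g_def using U(1) \<eta> by auto
  have box: "box (- (R *\<^sub>R One)) (R *\<^sub>R (One :: real^'n)) ~= {}" using R(1) by (auto simp: box_ne_empty inner_minus_left)
  obtain \<D> where D: "countable \<D>"
   "!!K. K : \<D> ==> interior K ~= {} & (\<exists>c d. K=cbox c d)"
   "pairwise (%A B. interior A \<inter> interior B={}) \<D>"
   "!!K. K : \<D> ==> \<exists>x \<in> Z \<inter> K. K \<subseteq> g x"
   "!!u v. cbox u v : \<D> ==> EX n. \<forall>i \<in> Basis. v \<bullet> i - u \<bullet> i=((R *\<^sub>R (One::real^'n)) \<bullet> i - (- (R *\<^sub>R One)) \<bullet> i) / 2^n"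
   "Z \<subseteq> \<Union>\<D>"
   by (rule covering_lemma[OF R(2) box gauge]) (rule that)
  have cube: "\<exists>u v l. K=cbox u v & l > 0 & (\<forall>b\<in>Basis. v \<bullet> b - u \<bullet> b=l)" if K: "K : \<D>" for K
  proof -
   obtain u v where uv: "K=cbox u v" using D(2)[OF K] by blast
   obtain n where n: "\<forall>i \<in> Basis. v \<bullet> i - u \<bullet> i=((R *\<^sub>R (One::real^'n)) \<bullet> i - (- (R *\<^sub>R One)) \<bullet> i) / 2^n"
    using D(5)[of u v] K uv by blast
   have "\<forall>b\<in>Basis. v \<bullet> b - u \<bullet> b=2 * R / 2 ^ n" using n by (simp add: inner_minus_left)
   moreover have "2 * R / 2 ^ n > 0" using R(1) by simp
   ultimately show ?thesis using uv by blast
  qed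
  define idx where "idx=to_nat_on \<D>"
  define N where "N=idx ` \<D>"
  have inj: "inj_on idx \<D>" unfolding idx_def by (rule inj_on_to_nat_on[OF D(1)])
  define Q where "Q n=(if n : N then inv_into \<D> idx n else {})" for n
  have QD: "Q n : \<D>" if "n : N" for n using that by (simp add: Q_def N_def inv_into_into)
  have Qcov: "EX n. x : Q n" if x: "x : Z" for x
  proof -
   obtain K where K: "K : \<D>" "x : K" using D(6) x by blast
   then have "Q (idx K)=K" using inv_into_f_f[OF inj K(1)] by (simp add: Q_def N_def)
   then show ?thesis using K(2) by blast
  qed
  have "\<exists>l\<ge>0. (n : N --> (\<exists>u v. Q n=cbox u v & (\<forall>b\<in>Basis. v \<bullet> b - u \<bullet> b=l))) & (n ~: N --> l=0)" for n
   using cube[OF QD, of n] by (cases "n : N") (auto intro: less_imp_le)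
  then obtain l where l: "!!n. l n >= 0" "!!n. n : N ==> \<exists>u v. Q n=cbox u v & (\<forall>b\<in>Basis. v \<bullet> b - u \<bullet> b=l n)" "!!n. n ~: N ==> l n=0"
   by metis
  have diamQ: "norm (x - y) <= real CARD('n) * l n" if xy: "x : Q n" "y : Q n" for x y n
  proof -
   have n: "n : N" using xy(1) by (auto simp: Q_def split: if_splits)
   obtain u v where "Q n=cbox u v" "\<forall>b\<in>Basis. v \<bullet> b - u \<bullet> b=l n" using l(2)[OF n] by blast
   then show ?thesis using cube_norm_le[of x u v y "l n"] xy by simp
  qed
  have vol: "ennreal (l n ^ CARD('n))=emeasure lborel (interior (Q n))" for n
  proof (cases "n : N")
   case True
   obtain u v where uv: "Q n=cbox u v" "\<forall>b\<in>Basis. v \<bullet> b - u \<bullet> b=l n" using l(2)[OF True] by blast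
   have "u \<bullet> b <= v \<bullet> b" if "b : Basis" for b using uv(2)[rule_format, OF that] l(1)[of n] by linarith
   then have "emeasure lborel (box u v)=ennreal (\<Prod>b\<in>Basis. (v - u) \<bullet> b)" by (rule emeasure_lborel_box)
   also have "(\<Prod>b\<in>Basis. (v - u) \<bullet> b)=(\<Prod>b\<in>(Basis::(real^'n) set). l n)" using uv(2) by (intro prod.cong) (simp_all add: inner_diff_left)
   also have "...=l n ^ CARD('n)" by simp
   finally show ?thesis by (simp add: uv(1) interior_cbox)
  next
   case False
   then show ?thesis using l(3)[of n] by (simp add: Q_def)
  qed
  have disj: "disjoint_family (%n. interior (Q n))"
   unfolding disjoint_family_on_def
  proof (intro ballI impI)
   fix n k :: nat assume nk: "n ~= k"
   show "interior (Q n) \<inter> interior (Q k)={}"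
   proof (cases "n : N & k : N")
    case True
    then have "Q n ~= Q k" using nk inj by (auto simp: Q_def N_def)
    then show ?thesis using D(3) QD True unfolding pairwise_def by blast
   qed (auto simp: Q_def)
  qed
  have QU: "Q n \<subseteq> U" for n
  proof (cases "n : N")
   case True
   then obtain x where "x : Z" "Q n \<subseteq> g x" using D(4)[OF QD[OF True]] by blast
   then show ?thesis using U(2) by (auto simp: g_def split: if_splits)
  qed (simp add: Q_def)
  have Qsmall: "norm (x - y) <= 2 * \<eta>" if xy: "x : Q n" "y : Q n" for x y n
  proof -
   have n: "n : N" using xy(1) by (auto simp: Q_def split: if_splits)
   obtain z where z: "Q n \<subseteq> g z" using D(4)[OF QD[OF n]] by blast
   have "x : ball z \<eta>" "y : ball z \<eta>" using z xy by (auto simp: g_def split: if_splits)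
   then show ?thesis using dist_triangle2[of x y z] by (simp add: dist_norm norm_minus_commute)
  qed
  have sumvol: "(\<Sum>n. ennreal (l n ^ CARD('n))) <= emeasure lborel U"
  proof -
   have "(\<Sum>n. ennreal (l n ^ CARD('n)))=(\<Sum>n. emeasure lborel (interior (Q n)))" by (simp only: vol)
   also have "...=emeasure lborel (\<Union>n. interior (Q n))"
    by (rule suminf_emeasure[OF _ disj]) auto
   also have "... <= emeasure lborel U" by (rule emeasure_mono) (use QU interior_subset in "blast+, simp")
   finally show ?thesis .
  qed
  have "\<exists>\<alpha>. \<forall>x\<in>Q n \<inter> Z. \<bar>hgt x - \<alpha>\<bar> <= \<kappa> * l n" for n
  proof (cases "Q n \<inter> Z={}")
   case False
   then obtain x0 where x0: "x0 : Q n" "x0 : Z" by blast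
   show ?thesis
   proof (intro exI[of _ "hgt x0"] ballI)
    fix x assume x: "x : Q n \<inter> Z"
    have "\<bar>hgt x - hgt x0\<bar> <= (1+L) * norm (x - x0)" using hgt_lip x x0 Z(2) by blast
    also have "... <= (2+L) * (real CARD('n) * l n)" using diamQ[of x n x0] x x0 L by (intro mult_mono) simp_all
    finally show "\<bar>hgt x - hgt x0\<bar> <= \<kappa> * l n" by (simp add: \<kappa>_def mult.assoc)
   qed
  qed simp
  then obtain \<alpha> where \<alpha>: "!!n x. x : Q n \<inter> Z ==> \<bar>hgt x - \<alpha> n\<bar> <= \<kappa> * l n" by metis
  define T where "T n={\<alpha> n - \<kappa> * l n .. \<alpha> n+\<kappa> * l n}" for n
  define Bt where "Bt t n=foot ` (Q n \<inter> Z \<inter> {x. hgt x=t})" for t n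
  have slice: "hausdorff_content m \<delta> E <= (\<Sum>n. ennreal (\<omega> * (\<kappa> * l n / 2) ^ m) * indicator (T n) t)"
   if t: "0 < t" "t < h" for t
  proof -
   have cov: "E \<subseteq> (\<Union>n. Bt t n)"
   proof
    fix x assume x: "x : E"
    let ?y = "x+(s * t) *\<^sub>R ei"
    have yZ: "?y : Z" by (rule slab[OF x t])
    then obtain n where n: "?y : Q n" using Qcov by blast
    have "s * (s * t)=t" using ss by (simp flip: mult.assoc)
    then have "hgt ?y=t" using E[OF x] by (simp add: hgt_shift)
    moreover have "foot ?y=x" using foot_eq[OF E[OF x]] by (simp add: foot_shift)
    ultimately have "x : Bt t n" unfolding Bt_def using yZ n by (intro image_eqI[of _ _ ?y]) auto
    then show "x : (\<Union>n. Bt t n)" by blast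
   qed
   have dm: "norm (x - y) <= (2+L) * (real CARD('n) * l n) & norm (x - y) <= \<delta>" if xy: "x : Bt t n" "y : Bt t n" for x y n
   proof -
    obtain x' y' where x': "x=foot x'" "x' : Q n" "x' : Z" and y': "y=foot y'" "y' : Q n" "y' : Z" using xy unfolding Bt_def by blast
    have f: "norm (x - y) <= (2+L) * norm (x' - y')" unfolding x'(1) y'(1) using foot_lip x'(3) y'(3) Z(2) by blast
    have "(2+L) * norm (x' - y') <= (2+L) * (real CARD('n) * l n)"
    using diamQ[OF x'(2) y'(2)] L by (intro mult_left_mono) simp_all
    moreover have "(2+L) * norm (x' - y') <= \<delta>"
    proof -
    have "(2+L) * norm (x' - y') <= \<kappa> * (2 * \<eta>)"
    unfolding \<kappa>_def using Qsmall[OF x'(2) y'(2)] L m(1) by (intro mult_mono) (simp_all add: mult_le_cancel_left1)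
    also have "...=\<delta>" using \<kappa> by (simp add: \<eta>_def)
    finally show ?thesis .
    qed
    ultimately show ?thesis using f by linarith
   qed
   have dB: "diameter (Bt t n) <= \<kappa> * l n" for n
    by (rule diameter_le) (use dm[of _ n] mult_nonneg_nonneg[OF less_imp_le[OF \<kappa>] l(1)[of n]] in "auto simp: \<kappa>_def mult.assoc")
   have dB\<delta>: "diameter (Bt t n) <= \<delta>" for n
    by (rule diameter_le) (use dm[of _ n] \<delta> in auto)
   have bB: "bounded (Bt t n)" for n
   proof -
    have "\<forall>x\<in>Bt t n. \<forall>y\<in>Bt t n. dist x y <= \<delta>" using dm[of _ n] by (simp add: dist_norm)
    then show ?thesis by (rule bounded_two_points[THEN iffD2, OF exI])
   qed
   have "hausdorff_content m \<delta> E <= (\<Sum>n. ennreal (\<omega> * (diameter (Bt t n) / 2) ^ m))"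
    unfolding hausdorff_content_def \<omega>_def by (rule INF_lower) (use cov bB dB\<delta> in simp)
   also have "... <= (\<Sum>n. ennreal (\<omega> * (\<kappa> * l n / 2) ^ m) * indicator (T n) t)"
   proof (rule suminf_le)
    fix n
    show "ennreal (\<omega> * (diameter (Bt t n) / 2) ^ m) <= ennreal (\<omega> * (\<kappa> * l n / 2) ^ m) * indicator (T n) t"
    proof (cases "Bt t n={}")
    case True
    then show ?thesis using m(2) by (simp add: power_0_left)
    next
    case False
    then obtain x where x: "x : Q n \<inter> Z" "hgt x=t" by (auto simp: Bt_def)
    have "t : T n" using \<alpha>[OF x(1)] x(2) unfolding T_def by (simp add: abs_le_iff)
    moreover have "0 <= diameter (Bt t n)" by (rule diameter_ge_0[OF bB])
    ultimately show ?thesis using dB[of n] \<omega>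
    by (simp, intro ennreal_leI mult_left_mono power_mono) simp_all
    qed
   qed simp_all
   finally show ?thesis .
  qed
  have Tm: "T n : sets borel" for n unfolding T_def by simp
  have "ennreal h * hausdorff_content m \<delta> E=(\<integral>\<^sup>+t. hausdorff_content m \<delta> E * indicator {0<..<h} t \<partial>lborel)"
   using h by (simp add: nn_integral_cmult_indicator mult.commute)
  also have "... <= (\<integral>\<^sup>+t. (\<Sum>n. ennreal (\<omega> * (\<kappa> * l n / 2) ^ m) * indicator (T n) t) \<partial>lborel)"
   by (rule nn_integral_mono) (use slice in "auto simp: indicator_def")
  also have "...=(\<Sum>n. \<integral>\<^sup>+t. ennreal (\<omega> * (\<kappa> * l n / 2) ^ m) * indicator (T n) t \<partial>lborel)"
   by (rule nn_integral_suminf) (use Tm in measurable)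
  also have "...=(\<Sum>n. ennreal (\<omega> * (\<kappa> * l n / 2) ^ m) * ennreal (2 * (\<kappa> * l n)))"
  proof (rule suminf_cong)
   fix n
   have "emeasure lborel (T n)=ennreal (2 * (\<kappa> * l n))" unfolding T_def using \<kappa> l(1)[of n] by (subst emeasure_lborel_Icc) simp_all
   then show "(\<integral>\<^sup>+t. ennreal (\<omega> * (\<kappa> * l n / 2) ^ m) * indicator (T n) t \<partial>lborel)=ennreal (\<omega> * (\<kappa> * l n / 2) ^ m) * ennreal (2 * (\<kappa> * l n))"
    using Tm[of n] by (simp add: nn_integral_cmult_indicator)
  qed
  also have "... <= (\<Sum>n. ennreal (\<omega> * \<kappa> ^ CARD('n) * 2) * ennreal (l n ^ CARD('n)))"
  proof (rule suminf_le)
   fix n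
   have k0: "0 <= \<kappa> * l n" using \<kappa> l(1)[of n] by simp
   have "\<omega> * (\<kappa> * l n / 2) ^ m * (2 * (\<kappa> * l n)) <= \<omega> * (\<kappa> * l n) ^ m * (2 * (\<kappa> * l n))"
    using k0 \<omega> by (intro mult_right_mono mult_left_mono power_mono) simp_all
   also have "...=\<omega> * \<kappa> ^ CARD('n) * 2 * l n ^ CARD('n)" by (simp add: m(1) power_mult_distrib)
   finally have "ennreal (\<omega> * (\<kappa> * l n / 2) ^ m * (2 * (\<kappa> * l n))) <= ennreal (\<omega> * \<kappa> ^ CARD('n) * 2 * l n ^ CARD('n))" by (rule ennreal_leI)
   then show "ennreal (\<omega> * (\<kappa> * l n / 2) ^ m) * ennreal (2 * (\<kappa> * l n)) <= ennreal (\<omega> * \<kappa> ^ CARD('n) * 2) * ennreal (l n ^ CARD('n))"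
    using k0 \<omega> \<kappa> l(1)[of n] by (simp only: ennreal_mult[symmetric] mult_nonneg_nonneg zero_le_power divide_nonneg_nonneg zero_le_numeral less_imp_le)
  qed simp_all
  also have "...=ennreal (\<omega> * \<kappa> ^ CARD('n) * 2) * (\<Sum>n. ennreal (l n ^ CARD('n)))" by (rule ennreal_suminf_cmult)
  also have "... <= ennreal (\<omega> * \<kappa> ^ CARD('n) * 2) * (emeasure lborel Z+ennreal \<epsilon>)"
   by (intro mult_left_mono order_trans[OF sumvol Uem]) simp
  finally show ?thesis .
 qed
 let ?c = "\<omega> * \<kappa> ^ CARD('n) * 2"
 have c0: "?c >= 0" using \<omega> \<kappa> by simp
 have content': "ennreal h * hausdorff_content m \<delta> E <= ennreal ?c * emeasure lborel Z" if \<delta>: "\<delta> > 0" for \<delta>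
 proof (rule ennreal_le_epsilon)
  fix e :: real assume e: "0 < e"
  define \<epsilon> where "\<epsilon>=e / (?c+1)"
  have \<epsilon>: "\<epsilon> > 0" using e c0 by (simp add: \<epsilon>_def)
  have "?c * \<epsilon> <= e" using e c0 by (simp add: \<epsilon>_def divide_le_eq) 
  have "ennreal h * hausdorff_content m \<delta> E <= ennreal ?c * (emeasure lborel Z+ennreal \<epsilon>)" by (rule content[OF \<delta> \<epsilon>])
  also have "...=ennreal ?c * emeasure lborel Z+ennreal (?c * \<epsilon>)" using c0 \<epsilon> by (simp add: distrib_left ennreal_mult)
  also have "... <= ennreal ?c * emeasure lborel Z + ennreal e" using \<open>?c * \<epsilon> <= e\<close> by (intro add_left_mono ennreal_leI)
  finally show "ennreal h * hausdorff_content m \<delta> E <= ennreal ?c * emeasure lborel Z+ennreal e" .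
 qed
 have "ennreal h * hausdorff_outer m E=(SUP \<delta>\<in>{0<..}. ennreal h * hausdorff_content m \<delta> E)"
  unfolding hausdorff_outer_def by (rule SUP_mult_left_ennreal)
 also have "... <= ennreal ?c * emeasure lborel Z" by (rule SUP_least) (use content' in simp)
 finally show ?thesis by (simp only: m_def[symmetric] \<omega>_def \<kappa>_def)
qed

end

lemma sets_hausdorff[simp, measurable_cong]: "sets (hausdorff_measure m :: 'a::metric_space measure)=sets borel"
 and space_hausdorff[simp]: "space (hausdorff_measure m :: 'a::metric_space measure)=UNIV"
proof -
 have "sets (hausdorff_measure m :: 'a measure)=sigma_sets UNIV (sets borel)"
  unfolding hausdorff_measure_def by (rule sets_measure_of) simp
 also have "...=sets borel" using sets.sigma_sets_eq[of "borel :: 'a measure"] by simp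
 finally show "sets (hausdorff_measure m :: 'a measure)=sets borel" .
 show "space (hausdorff_measure m :: 'a measure)=UNIV"
  unfolding hausdorff_measure_def by (rule space_measure_of) simp
qed

lemma nn_integral_surface:
 assumes "f : bmeas borel"
 shows "(\<integral>\<^sup>+x. f x \<partial>surface_measure (Om :: (real^'n) set))=(\<integral>\<^sup>+x. f x * indicator (frontier Om) x \<partial>hausdorff_measure (CARD('n) - 1))"
 unfolding surface_measure_def by (rule nn_integral_restrict_space) simp

lemma borel_measurable_surface:
 fixes Om :: "(real^'n) set"
 assumes "f : bmeas borel"
 shows "f : bmeas (surface_measure Om)"
proof -
 have "f : bmeas (hausdorff_measure m :: (real^'n) measure)" for m
  using assms by (simp cong: measurable_cong_sets)
 then show ?thesis unfolding surface_measure_def by (rule measurable_restrict_space1)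
qed

definition sobolev_norm :: "(real^'n) set => (real^'n => real) => ennreal" where
 "sobolev_norm Om ps=(\<integral>\<^sup>+x. ennreal (\<bar>ps x\<bar>+norm (\<chi> j. pderv j ps x)) * indicator Om x \<partial>lborel)"

context graph_chart
begin

lemma surface_integral_le_slab:
 assumes card: "CARD('n) >= 2"
  and fr: "!!x. x : ball p r ==> x : frontier Om ==> hgt x=0"
 defines "F \<equiv> frontier Om \<inter> ball p (r / 4)" and "Z0 \<equiv> {x. foot x : frontier Om \<inter> ball p (r / 4) & 0 < hgt x & hgt x < r / 8}"
 shows "EX C. \<forall>f \<in> borel_measurable borel. (\<integral>\<^sup>+x. f x * indicator (ball p (r / 4)) x \<partial>surface_measure Om)
  <= ennreal C * (\<integral>\<^sup>+x. f (foot x) * indicator Z0 x \<partial>lborel)" "Z0 : sets borel" "Z0 \<subseteq> ball p r"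
proof -
 have Fb[measurable]: "F : sets borel" unfolding F_def by (intro sets.Int) (simp_all add: frontier_closed)
 have Z0F: "Z0={x. foot x : F & 0 < hgt x & hgt x < r / 8}" unfolding Z0_def F_def ..
 show Z0m[measurable]: "Z0 : sets borel" unfolding Z0F by measurable
 show Z0b: "Z0 \<subseteq> ball p r"
 proof
  fix x assume x: "x : Z0"
  have "dist p x <= dist p (foot x)+dist (foot x) x" by (rule dist_triangle)
  moreover have "dist (foot x) x < r / 8" using x foot_dist[of x] by (simp add: Z0_def dist_norm norm_minus_commute)
  ultimately show "x : ball p r" using x r by (simp add: Z0_def)
 qed
 define c where "c=unit_ball_vol (real (CARD('n) - 1)) * ((2+L) * CARD('n)) ^ CARD('n) * 2"
 have c0: "c >= 0" unfolding c_def using L by (intro mult_nonneg_nonneg zero_le_power) simp_all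
 define h where "h=r / 8"
 have h: "h > 0" using r by (simp add: h_def)
 let ?H = "hausdorff_measure (CARD('n) - 1) :: (real^'n) measure"
 have key: "emeasure ?H (F \<inter> A) <= ennreal (c / h) * emeasure lborel (Z0 \<inter> (foot -` A))" if A[measurable]: "A : sets borel" for A
 proof -
  have Zm: "Z0 \<inter> (foot -` A) : sets borel"
   using measurable_sets[OF foot_measurable A] by (intro sets.Int Z0m) simp
  have "ennreal h * hausdorff_outer (CARD('n) - 1) (F \<inter> A) <= ennreal c * emeasure lborel (Z0 \<inter> (foot -` A))"
   unfolding c_def
  proof (rule hausdorff_outer_le_slab[OF card h Zm])
   show "Z0 \<inter> foot -` A \<subseteq> ball p r" using Z0b by blast
   show E0: "hgt x=0" if "x : F \<inter> A" for x
    by (rule fr) (use that r in "auto simp: F_def")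
   fix x t assume x: "x : F \<inter> A" and t: "0 < t" "t < h"
   have "s * (s * t)=t" using ss by (simp flip: mult.assoc)
   then have "hgt (x+(s * t) *\<^sub>R ei)=t" using E0[OF x] by (simp add: hgt_shift)
   moreover have "foot (x+(s * t) *\<^sub>R ei)=x" using foot_eq[OF E0[OF x]] by (simp add: foot_shift)
   ultimately show "x+(s * t) *\<^sub>R ei : Z0 \<inter> foot -` A" using x t by (simp add: Z0F h_def)
  qed
  moreover have "emeasure ?H (F \<inter> A) <= hausdorff_outer (CARD('n) - 1) (F \<inter> A)"
   unfolding hausdorff_measure_def by (rule emeasure_measure_of_le)
  ultimately have "ennreal h * emeasure ?H (F \<inter> A) <= ennreal c * emeasure lborel (Z0 \<inter> (foot -` A))"
   by (meson mult_left_mono order_trans zero_le)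
  then have "ennreal (1 / h) * (ennreal h * emeasure ?H (F \<inter> A)) <= ennreal (1 / h) * (ennreal c * emeasure lborel (Z0 \<inter> (foot -` A)))"
   by (rule mult_left_mono) simp
  moreover have "ennreal (1 / h) * (ennreal h * x)=x" for x
   using h by (simp add: mult.assoc[symmetric] ennreal_mult[symmetric])
  moreover have "ennreal (1 / h) * (ennreal c * x)=ennreal (c / h) * x" for x
   using h c0 by (simp add: mult.assoc[symmetric] ennreal_mult[symmetric])
  ultimately show ?thesis by simp
 qed
 define mu where "mu=density ?H (indicator F)"
 define N where "N=density (distr (density lborel (indicator Z0)) borel foot) (%_. ennreal (c / h))"
 have sets: "sets mu=sets N" unfolding mu_def N_def by simp
 have le: "mu <= N"
 proof (rule le_measure[OF sets, THEN iffD2], rule ballI)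
  fix A assume "A : sets mu"
  then have A[measurable]: "A : sets borel" by (simp add: mu_def)
  have m1: "foot -` A \<inter> Z0 : sets borel"
   using measurable_sets[OF foot_measurable A] by (intro sets.Int Z0m) simp
  have "emeasure mu A=(\<integral>\<^sup>+x. indicator F x * indicator A x \<partial>?H)" unfolding mu_def by (subst emeasure_density) simp_all
  also have "...=(\<integral>\<^sup>+x. indicator (F \<inter> A) x \<partial>?H)" by (simp only: indicator_inter_arith)
  also have "...=emeasure ?H (F \<inter> A)" by (rule nn_integral_indicator) simp
  finally have 1: "emeasure mu A=emeasure ?H (F \<inter> A)" .
  have "emeasure N A=(\<integral>\<^sup>+x. ennreal (c / h) * indicator A x \<partial>distr (density lborel (indicator Z0)) borel foot)"
   unfolding N_def by (subst emeasure_density) simp_all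
  also have "...=ennreal (c / h) * emeasure (distr (density lborel (indicator Z0)) borel foot) A"
   by (simp add: nn_integral_cmult_indicator)
  also have "emeasure (distr (density lborel (indicator Z0)) borel foot) A=emeasure (density lborel (indicator Z0)) (foot -` A)"
   by (subst emeasure_distr) simp_all
  also have "...=(\<integral>\<^sup>+x. indicator Z0 x * indicator (foot -` A) x \<partial>lborel)"
   using measurable_sets[OF foot_measurable A] by (subst emeasure_density) simp_all
  also have "...=(\<integral>\<^sup>+x. indicator (Z0 \<inter> (foot -` A)) x \<partial>lborel)" by (simp only: indicator_inter_arith)
  also have "...=emeasure lborel (Z0 \<inter> (foot -` A))"
   by (rule nn_integral_indicator) (use m1 in "simp add: Int_commute")
  finally show "emeasure mu A <= emeasure N A" using key[OF A] 1 by simp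
 qed
 show "EX C. \<forall>f \<in> borel_measurable borel. (\<integral>\<^sup>+x. f x * indicator (ball p (r / 4)) x \<partial>surface_measure Om)
  <= ennreal C * (\<integral>\<^sup>+x. f (foot x) * indicator Z0 x \<partial>lborel)"
 proof (intro exI[of _ "c / h"] ballI)
  fix f :: "real^'n => ennreal" assume f[measurable]: "f : bmeas borel"
  have [measurable]: "ball p (r / 4) : sets borel" by simp
  have "(\<integral>\<^sup>+x. f x * indicator (ball p (r / 4)) x \<partial>surface_measure Om)=(\<integral>\<^sup>+x. f x * indicator (ball p (r / 4)) x * indicator (frontier Om) x \<partial>?H)"
   by (rule nn_integral_surface) measurable
  also have "...=(\<integral>\<^sup>+x. indicator F x * f x \<partial>?H)"
   by (rule nn_integral_cong) (auto simp: F_def indicator_def)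
  also have "...=(\<integral>\<^sup>+x. f x \<partial>mu)" unfolding mu_def by (subst nn_integral_density) simp_all
  also have "... <= (\<integral>\<^sup>+x. f x \<partial>N)" by (rule nn_integral_mono_measure[OF sets le])
  also have "...=(\<integral>\<^sup>+x. ennreal (c / h) * f x \<partial>distr (density lborel (indicator Z0)) borel foot)"
   unfolding N_def by (subst nn_integral_density) simp_all
  also have "...=ennreal (c / h) * (\<integral>\<^sup>+x. f x \<partial>distr (density lborel (indicator Z0)) borel foot)"
   by (rule nn_integral_cmult) simp
  also have "(\<integral>\<^sup>+x. f x \<partial>distr (density lborel (indicator Z0)) borel foot)=(\<integral>\<^sup>+x. f (foot x) \<partial>density lborel (indicator Z0))"
   by (rule nn_integral_distr) simp_all
  also have "...=(\<integral>\<^sup>+x. indicator Z0 x * f (foot x) \<partial>lborel)" by (subst nn_integral_density) simp_all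
  finally show "(\<integral>\<^sup>+x. f x * indicator (ball p (r / 4)) x \<partial>surface_measure Om) <= ennreal (c / h) * (\<integral>\<^sup>+x. f (foot x) * indicator Z0 x \<partial>lborel)"
   by (simp add: mult.commute)
 qed
qed

lemma local_trace_inequality:
 assumes card: "CARD('n) >= 2"
  and fr: "!!x. x : ball p r ==> x : frontier Om ==> hgt x=0"
  and ins: "!!x. x : ball p r ==> 0 < hgt x ==> x : Om"
 shows "EX C. \<forall>ps. Ck 1 ps --> (\<integral>\<^sup>+x. ennreal \<bar>ps x\<bar> * indicator (ball p (r / 4)) x \<partial>surface_measure Om) <= ennreal C * sobolev_norm Om ps"
proof -
 define h where "h=r / 8"
 have h: "h > 0" using r by (simp add: h_def)
 define Z0 where "Z0={x. foot x : frontier Om \<inter> ball p (r / 4) & 0 < hgt x & hgt x < r / 8}"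
 have Z0m[measurable]: "Z0 : sets borel" and Z0b: "Z0 \<subseteq> ball p r"
  unfolding Z0_def using surface_integral_le_slab(2,3)[OF card fr] by blast+
 have Z0Om: "Z0 \<subseteq> Om" using Z0b ins by (auto simp: Z0_def)
 obtain C where C: "!!f. f : borel_measurable borel ==> (\<integral>\<^sup>+x. f x * indicator (ball p (r / 4)) x \<partial>surface_measure Om)
  <= ennreal C * (\<integral>\<^sup>+x. f (foot x) * indicator Z0 x \<partial>lborel)"
  using surface_integral_le_slab(1)[OF card fr] unfolding Z0_def by blast
 show ?thesis
 proof (intro exI[of _ "max C 0 * (1+2 * h)"] allI impI)
  fix ps :: "real^'n => real" assume C1: "Ck 1 ps"
  have [measurable]: "ps : bmeas borel" by (rule borel_measurable_continuous_onI[OF Ck1_continuous[OF C1]])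
  define d where "d=pderv i ps"
  have dc: "continuous_on UNIV d" unfolding d_def partial_deriv_def[abs_def] by (rule Ck1_deriv_continuous[OF C1])
  have [measurable]: "d : bmeas borel" by (rule borel_measurable_continuous_onI[OF dc])
  define g where "g x=ennreal \<bar>d x\<bar> * indicator Z0 x" for x
  have gm[measurable]: "g : bmeas borel" unfolding g_def[abs_def] by measurable
  have pt: "ennreal \<bar>ps (foot x)\<bar> <= ennreal \<bar>ps x\<bar>+(\<integral>\<^sup>+u. g (x+u *\<^sub>R ei) * indicator {-h..h} u \<partial>lborel)" if x: "x : Z0" for x
  proof -
   define u0 where "u0=- (hgt x * s)"
   have fx: "foot x=x+u0 *\<^sub>R ei" by (simp add: foot_def u0_def)
   define a b where "a=min 0 u0" and "b=max 0 u0"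
   have ab: "a <= b" by (simp add: a_def b_def)
   let ?k = "%u. ps (x+u *\<^sub>R ei)"
   have der: "(?k has_vector_derivative d (x+u *\<^sub>R ei)) (at u within S)" for u S
   proof -
    have "((%u. x+u *\<^sub>R ei) has_derivative (%v. v *\<^sub>R ei)) (at u)" by (auto intro!: derivative_eq_intros)
    from diff_chain_at[OF this Ck1_has_derivative[OF C1]]
    have D: "(?k has_derivative (%v. fderv ps (at (x+u *\<^sub>R ei)) (v *\<^sub>R ei))) (at u)" by (simp add: o_def)
    have "linear (fderv ps (at (x+u *\<^sub>R ei)))"
    using Ck1_has_derivative[OF C1] has_derivative_linear by blast
    then have "fderv ps (at (x+u *\<^sub>R ei)) (v *\<^sub>R ei)=v *\<^sub>R d (x+u *\<^sub>R ei)" for v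
    by (simp add: linear_scale d_def partial_deriv_def)
    then have "(?k has_derivative (%v. v *\<^sub>R d (x+u *\<^sub>R ei))) (at u)" using D by simp
    then show ?thesis unfolding has_vector_derivative_def by (rule has_derivative_at_withinI)
   qed
   have dcx: "continuous_on UNIV (%u. d (x+u *\<^sub>R ei))"
    by (intro continuous_on_compose2[OF dc] continuous_intros) simp
   have ftc: "(LINT u|lborel. indicator {a..b} u *\<^sub>R d (x+u *\<^sub>R ei))=?k b - ?k a"
    by (rule integral_FTC_Icc[OF ab]) (rule der, rule continuous_on_subset[OF dcx subset_UNIV])
   have int: "integ (%u. indicator {a..b} u *\<^sub>R d (x+u *\<^sub>R ei))"
    by (rule borel_integrable_compact) (simp, rule continuous_on_subset[OF dcx subset_UNIV])
   have "ennreal \<bar>?k b - ?k a\<bar> <= (\<integral>\<^sup>+u. ennreal (norm (indicator {a..b} u *\<^sub>R d (x+u *\<^sub>R ei))) \<partial>lborel)"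
    using integral_norm_bound_ennreal[OF int] unfolding ftc by simp
   also have "... <= (\<integral>\<^sup>+u. g (x+u *\<^sub>R ei) * indicator {-h..h} u \<partial>lborel)"
   proof (rule nn_integral_mono_AE, rule AE_mp[OF AE_lborel_singleton[of u0]], intro AE_I2 impI)
    fix u :: real assume u: "u ~= u0"
    show "ennreal (norm (indicator {a..b} u *\<^sub>R d (x+u *\<^sub>R ei))) <= g (x+u *\<^sub>R ei) * indicator {-h..h} u"
    proof (cases "u : {a..b}")
    case True
    have hx: "0 < hgt x" "hgt x < h" using x by (auto simp: Z0_def h_def)
    have "0 < hgt x+s * u & hgt x+s * u < h & \<bar>u\<bar> <= h"
    using s True u hx by (auto simp: a_def b_def u0_def min_def max_def split: if_splits)
    then have "x+u *\<^sub>R ei : Z0" "u : {-h..h}" using x by (auto simp: Z0_def hgt_shift foot_shift h_def)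
    then show ?thesis using True by (simp add: g_def)
    qed simp
   qed
   finally have le: "ennreal \<bar>?k b - ?k a\<bar> <= (\<integral>\<^sup>+u. g (x+u *\<^sub>R ei) * indicator {-h..h} u \<partial>lborel)" .
   have "\<bar>ps (foot x)\<bar> <= \<bar>ps x\<bar>+\<bar>?k b - ?k a\<bar>" unfolding fx by (auto simp: a_def b_def min_def max_def)
   then have "ennreal \<bar>ps (foot x)\<bar> <= ennreal (\<bar>ps x\<bar>+\<bar>?k b - ?k a\<bar>)" by (rule ennreal_leI)
   also have "...=ennreal \<bar>ps x\<bar>+ennreal \<bar>?k b - ?k a\<bar>" by (rule ennreal_plus) simp_all
   also have "... <= ennreal \<bar>ps x\<bar>+(\<integral>\<^sup>+u. g (x+u *\<^sub>R ei) * indicator {-h..h} u \<partial>lborel)" by (rule add_left_mono[OF le])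
   finally show ?thesis .
  qed
  let ?I = "sobolev_norm Om ps"
  have I1: "(\<integral>\<^sup>+x. ennreal \<bar>ps x\<bar> * indicator Z0 x \<partial>lborel) <= ?I"
   unfolding sobolev_norm_def by (rule nn_integral_mono) (use Z0Om in "auto simp: indicator_def intro!: ennreal_leI")
  have I2: "(\<integral>\<^sup>+x. g x \<partial>lborel) <= ?I"
   unfolding sobolev_norm_def g_def
  proof (rule nn_integral_mono)
   fix x
   have "\<bar>d x\<bar> <= norm (\<chi> j. pderv j ps x)"
    using component_le_norm_cart[of "\<chi> j. pderv j ps x" i] by (simp add: d_def)
   then have le: "ennreal \<bar>d x\<bar> <= ennreal (\<bar>ps x\<bar>+norm (\<chi> j. pderv j ps x))" by (intro ennreal_leI) linarith
   show "ennreal \<bar>d x\<bar> * indicator Z0 x <= ennreal (\<bar>ps x\<bar>+norm (\<chi> j. pderv j ps x)) * indicator Om x"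
    by (rule mult_mono[OF le]) (use Z0Om in "auto simp: indicator_def")
  qed
  have gm2: "(%(x, u). g (x+u *\<^sub>R ei) * indicator {-h..h} u) : bmeas (lborel \<Otimes>\<^sub>M (lborel :: real measure))"
   by measurable
  have I3: "(\<integral>\<^sup>+x. (\<integral>\<^sup>+u. g (x+u *\<^sub>R ei) * indicator {-h..h} u \<partial>lborel) \<partial>lborel) <= ennreal (2 * h) * ?I"
  proof -
   have "(\<integral>\<^sup>+x. (\<integral>\<^sup>+u. g (x + u *\<^sub>R ei) * indicator {-h..h} u \<partial>lborel) \<partial>lborel)
    = (\<integral>\<^sup>+u. (\<integral>\<^sup>+x. g (x + u *\<^sub>R ei) * indicator {-h..h} u \<partial>lborel) \<partial>lborel)"
    by (rule lborel_pair.Fubini'[symmetric]) (use gm2 in simp)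
   also have "...=(\<integral>\<^sup>+u. (\<integral>\<^sup>+x. g x \<partial>lborel) * indicator {-h..h} u \<partial>lborel)"
   proof (rule nn_integral_cong)
    fix u :: real
    have "(\<integral>\<^sup>+x. g (x+u *\<^sub>R ei) * indicator {-h..h} u \<partial>lborel)=(\<integral>\<^sup>+x. g (x+u *\<^sub>R ei) \<partial>lborel) * indicator {-h..h} u"
    by (rule nn_integral_multc) measurable
    then show "(\<integral>\<^sup>+x. g (x+u *\<^sub>R ei) * indicator {-h..h} u \<partial>lborel)=(\<integral>\<^sup>+x. g x \<partial>lborel) * indicator {-h..h} u"
    by (simp add: nn_integral_lborel_shift[OF gm])
   qed
   also have "...=(\<integral>\<^sup>+x. g x \<partial>lborel) * ennreal (2 * h)"
    using h by (subst nn_integral_cmult_indicator) simp_all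
   also have "... <= ?I * ennreal (2 * h)" by (rule mult_right_mono[OF I2]) simp
   finally show ?thesis by (simp add: mult.commute)
  qed
  have im: "(%x. \<integral>\<^sup>+u. g (x+u *\<^sub>R ei) * indicator {-h..h} u \<partial>lborel) : bmeas lborel"
   using lborel.borel_measurable_nn_integral[OF gm2] by simp
  have "(\<integral>\<^sup>+x. ennreal \<bar>ps x\<bar> * indicator (ball p (r / 4)) x \<partial>surface_measure Om)
   <= ennreal C * (\<integral>\<^sup>+x. ennreal \<bar>ps (foot x)\<bar> * indicator Z0 x \<partial>lborel)" by (rule C) measurable
  also have "... <= ennreal (max C 0) * ((1+ennreal (2 * h)) * ?I)"
  proof (rule mult_mono)
   have "(\<integral>\<^sup>+x. ennreal \<bar>ps (foot x)\<bar> * indicator Z0 x \<partial>lborel)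
    <= (\<integral>\<^sup>+x. ennreal \<bar>ps x\<bar> * indicator Z0 x + (\<integral>\<^sup>+u. g (x + u *\<^sub>R ei) * indicator {-h..h} u \<partial>lborel) \<partial>lborel)"
    by (rule nn_integral_mono) (use pt in "auto simp: indicator_def")
   also have "...=(\<integral>\<^sup>+x. ennreal \<bar>ps x\<bar> * indicator Z0 x \<partial>lborel)+(\<integral>\<^sup>+x. (\<integral>\<^sup>+u. g (x+u *\<^sub>R ei) * indicator {-h..h} u \<partial>lborel) \<partial>lborel)"
    by (rule nn_integral_add) (use im in "simp_all, measurable")
   also have "... <= ?I+ennreal (2 * h) * ?I" by (rule add_mono[OF I1 I3])
   also have "...=(1+ennreal (2 * h)) * ?I" by (simp add: distrib_right)
   finally show "(\<integral>\<^sup>+x. ennreal \<bar>ps (foot x)\<bar> * indicator Z0 x \<partial>lborel) <= (1+ennreal (2 * h)) * ?I" .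
  qed (simp_all add: ennreal_leI)
  also have "...=ennreal (max C 0 * (1+2 * h)) * ?I"
   using h by (simp add: ennreal_mult mult.assoc)
  finally show "(\<integral>\<^sup>+x. ennreal \<bar>ps x\<bar> * indicator (ball p (r / 4)) x \<partial>surface_measure Om) <= ennreal (max C 0 * (1+2 * h)) * ?I" .
 qed
qed

end

text \<open>Near the boundary the value at a point of the graph is the integral of a derivative along the chart axis, which costs one derivative in \<open>L\<^sup>1\<close>. Finitely many charts cover the boundary.\<close>

theorem trace_inequality:
 fixes Om :: "(real^'n) set"
 assumes card: "CARD('n) >= 2" and Om: "open Om" "bounded Om" and sb: "smooth_boundary Om"
 shows "\<exists>C\<ge>0. \<forall>ps. Ck 1 ps --> (\<integral>\<^sup>+x. ennreal \<bar>ps x\<bar> \<partial>surface_measure Om) <= ennreal C * sobolev_norm Om ps"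
proof -
 define Q where "Q p rh C \<longleftrightarrow> rh > 0 & (\<forall>ps. Ck 1 ps --> (\<integral>\<^sup>+x. ennreal \<bar>ps x\<bar> * indicator (ball p rh) x \<partial>surface_measure Om) <= ennreal C * sobolev_norm Om ps)"
  for p rh C
 have loc: "\<exists>rh C. Q p rh C" if p: "p : frontier Om" for p
 proof -
  from boundary_chart[OF sb Om(1) p] obtain r i s \<gamma> L where r: "r > 0" and s: "s : {1, -1::real}" and L: "L >= 0"
   and cont: "continuous_on UNIV \<gamma>"
   and ind: "!!x t. \<gamma> (x+t *\<^sub>R axis i 1)=\<gamma> x"
   and Lip: "!!x y. x : ball p r ==> y : ball p r ==> \<bar>\<gamma> x - \<gamma> y\<bar> <= L * norm (x - y)"
   and inOm: "!!x. x : ball p r ==> x : Om \<longleftrightarrow> s * x $ i > \<gamma> x"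
   and fr: "!!x. x : ball p r ==> x : frontier Om ==> s * x $ i=\<gamma> x" by metis
  interpret graph_chart i s \<gamma> L p r by unfold_locales (use s L cont ind Lip r in auto)
  have "EX C. \<forall>ps. Ck 1 ps --> (\<integral>\<^sup>+x. ennreal \<bar>ps x\<bar> * indicator (ball p (r / 4)) x \<partial>surface_measure Om) <= ennreal C * sobolev_norm Om ps"
   by (rule local_trace_inequality[OF card]) (use inOm fr in "auto simp: hgt_def")
  then obtain C where C: "\<forall>ps. Ck 1 ps --> (\<integral>\<^sup>+x. ennreal \<bar>ps x\<bar> * indicator (ball p (r / 4)) x \<partial>surface_measure Om) <= ennreal C * sobolev_norm Om ps" ..
  have "r / 4 > 0" using r by simp
  then have "Q p (r / 4) C" unfolding Q_def using C by (rule conjI)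
  then show ?thesis by blast
 qed
 then obtain rh C where Q: "!!p. p : frontier Om ==> Q p (rh p) (C p)" by metis
 have rh: "rh p > 0" if "p : frontier Om" for p using Q[OF that] unfolding Q_def by blast
 have C: "(\<integral>\<^sup>+x. ennreal \<bar>ps x\<bar> * indicator (ball p (rh p)) x \<partial>surface_measure Om) <= ennreal (C p) * sobolev_norm Om ps"
  if "p : frontier Om" "Ck 1 ps" for p ps using Q[OF that(1)] that(2) unfolding Q_def by blast
 have cc: "compact (frontier Om)" using Om(2) by (simp add: compact_frontier_bounded)
 have op: "!!p. p : frontier Om ==> open (ball p (rh p))" by simp
 have cov: "frontier Om \<subseteq> (\<Union>p\<in>frontier Om. ball p (rh p))" using rh by fastforce
 obtain P where P: "P \<subseteq> frontier Om" "finite P" "frontier Om \<subseteq> (\<Union>p\<in>P. ball p (rh p))"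
  by (rule compactE_image[OF cc op cov]) (assumption | rule that)+
 show ?thesis
 proof (intro exI[of _ "\<Sum>p\<in>P. max (C p) 0"] conjI allI impI)
  show "0 <= (\<Sum>p\<in>P. max (C p) 0)" by (rule sum_nonneg) simp
  fix ps :: "real^'n => real" assume C1: "Ck 1 ps"
  have psm: "ps : bmeas borel" by (rule borel_measurable_continuous_onI[OF Ck1_continuous[OF C1]])
  have m: "(%x. ennreal \<bar>ps x\<bar> * indicator (ball p (rh p)) x) : bmeas (surface_measure Om)" for p
  proof (rule borel_measurable_surface)
   have [measurable]: "ball p (rh p) : sets borel" by simp
   show "(%x. ennreal \<bar>ps x\<bar> * indicator (ball p (rh p)) x) : bmeas borel" using psm by measurable
  qed
  have sp: "space (surface_measure Om)=frontier Om" by (simp add: surface_measure_def space_restrict_space)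
  have "(\<integral>\<^sup>+x. ennreal \<bar>ps x\<bar> \<partial>surface_measure Om) <= (\<integral>\<^sup>+x. (\<Sum>p\<in>P. ennreal \<bar>ps x\<bar> * indicator (ball p (rh p)) x) \<partial>surface_measure Om)"
  proof (rule nn_integral_mono)
   fix x assume "x : space (surface_measure Om)"
   then obtain p where p: "p : P" "x : ball p (rh p)" using P(3) sp by blast
   have "ennreal \<bar>ps x\<bar>=ennreal \<bar>ps x\<bar> * indicator (ball p (rh p)) x" using p(2) by simp
   also have "... <= (\<Sum>p\<in>P. ennreal \<bar>ps x\<bar> * indicator (ball p (rh p)) x)"
    by (rule member_le_sum[OF p(1)]) (simp_all add: P(2))
   finally show "ennreal \<bar>ps x\<bar> <= (\<Sum>p\<in>P. ennreal \<bar>ps x\<bar> * indicator (ball p (rh p)) x)" .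
  qed
  also have "...=(\<Sum>p\<in>P. \<integral>\<^sup>+x. ennreal \<bar>ps x\<bar> * indicator (ball p (rh p)) x \<partial>surface_measure Om)"
   by (rule nn_integral_sum) (rule m)
  also have "... <= (\<Sum>p\<in>P. ennreal (max (C p) 0) * sobolev_norm Om ps)"
  proof (rule sum_mono)
   fix p assume "p : P"
   then have "(\<integral>\<^sup>+x. ennreal \<bar>ps x\<bar> * indicator (ball p (rh p)) x \<partial>surface_measure Om) <= ennreal (C p) * sobolev_norm Om ps"
    using C[OF _ C1] P(1) by blast
   also have "... <= ennreal (max (C p) 0) * sobolev_norm Om ps" by (intro mult_right_mono ennreal_leI) simp_all
   finally show "(\<integral>\<^sup>+x. ennreal \<bar>ps x\<bar> * indicator (ball p (rh p)) x \<partial>surface_measure Om) <= ennreal (max (C p) 0) * sobolev_norm Om ps" .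
  qed
  also have "...=ennreal (\<Sum>p\<in>P. max (C p) 0) * sobolev_norm Om ps"
  proof -
   have "(\<Sum>p\<in>P. ennreal (max (C p) 0))=ennreal (\<Sum>p\<in>P. max (C p) 0)" by (rule sum_ennreal) simp
   then show ?thesis by (simp only: sum_distrib_right[symmetric])
  qed
  finally show "(\<integral>\<^sup>+x. ennreal \<bar>ps x\<bar> \<partial>surface_measure Om) <= ennreal (\<Sum>p\<in>P. max (C p) 0) * sobolev_norm Om ps" .
 qed
qed

section \<open>Completeness and elementary facts about \<open>L\<^sup>1\<close> and \<open>L\<^sup>2\<close>\<close>

lemma eventually_geometric_convergent:
 fixes g :: "nat => 'b::banach"
 assumes "eventually (%k. norm (g (Suc k) - g k) <= (1 / 2) ^ k) sequentially"
 shows "convergent g"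
proof -
 have "summable (%k. g (Suc k) - g k)"
  by (rule summable_comparison_test_ev[OF assms]) (simp add: summable_geometric)
 then have "convergent (%n. \<Sum>k<n. g (Suc k) - g k)" by (simp only: summable_iff_convergent)
 then have "convergent (%n. g n - g 0)" by (simp add: sum_lessThan_telescope)
 from convergent_add[OF this convergent_const[of "g 0"]] show ?thesis by simp
qed

text \<open>A subsequence with geometrically small increments converges almost everywhere by Borel-Cantelli, and Fatou identifies the limit.\<close>

lemma Lp_complete:
 fixes f :: "nat => 'a => 'b::{banach, second_countable_topology}" and p :: nat
 assumes f[measurable]: "!!n. f n : bmeas M" and p: "p >= 1"
  and cauchy: "!!e. e > 0 ==> EX N. \<forall>m\<ge>N. \<forall>n\<ge>N. (\<integral>\<^sup>+x. ennreal (norm (f m x - f n x) ^ p) \<partial>M) < ennreal e"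
 shows "\<exists>g\<in>bmeas M. (%n. \<integral>\<^sup>+x. ennreal (norm (f n x - g x) ^ p) \<partial>M) ~~> 0"
proof -
 define I where "I m n=(\<integral>\<^sup>+x. ennreal (norm (f m x - f n x) ^ p) \<partial>M)" for m n
 define c where "c k=((1 / 2 :: real) ^ (Suc p)) ^ k" for k :: nat
 have c: "c k > 0" for k unfolding c_def by simp
 obtain N where N: "!!k m n. m >= N k ==> n >= N k ==> I m n < ennreal (c k)"
  using cauchy[OF c] unfolding I_def by metis
 define r where "r k=(\<Sum>j\<le>k. N j)+k" for k
 have rN: "r k >= N k" for k
  unfolding r_def using member_le_sum[of k "{..k}" N] by simp
 have rS: "r k <= r (Suc k)" for k unfolding r_def by simp
 have rge: "k <= r k" for k unfolding r_def by simp
 define g where "g k x=f (r k) x" for k x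
 have gm[measurable]: "g k : bmeas M" for k unfolding g_def[abs_def] by measurable
 define A where "A k={x\<in>space M. (1 / 2) ^ k < norm (g (Suc k) x - g k x)}" for k
 have Am[measurable]: "A k : sets M" for k unfolding A_def by measurable
 have Aem: "emeasure M (A k) <= ennreal ((1 / 2) ^ k)" for k
 proof -
  let ?v = "%x. ennreal (norm (g (Suc k) x - g k x) ^ p)"
  have "emeasure M (A k)=(\<integral>\<^sup>+x. indicator (A k) x \<partial>M)" by simp
  also have "... <= (\<integral>\<^sup>+x. ennreal ((2 ^ p) ^ k) * ?v x \<partial>M)"
  proof (rule nn_integral_mono)
   fix x
   show "indicator (A k) x <= ennreal ((2 ^ p) ^ k) * ?v x"
   proof (cases "x : A k")
    case True
    then have "((1 / 2) ^ k) ^ p <= norm (g (Suc k) x - g k x) ^ p"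
    unfolding A_def by (intro power_mono) simp_all
    then have "(2 ^ p) ^ k * ((1 / 2) ^ k) ^ p <= (2 ^ p) ^ k * norm (g (Suc k) x - g k x) ^ p"
    by (rule mult_left_mono) simp
    moreover have "(2 ^ p) ^ k * ((1 / 2) ^ k) ^ p=(1::real)"
    by (simp add: power_mult[symmetric] mult.commute[of k p] power_mult_distrib[symmetric])
    ultimately have "1 <= ennreal ((2 ^ p) ^ k * norm (g (Suc k) x - g k x) ^ p)" by simp
    then show ?thesis using True by (simp add: ennreal_mult)
   qed simp
  qed
  also have "...=ennreal ((2 ^ p) ^ k) * (\<integral>\<^sup>+x. ?v x \<partial>M)" by (rule nn_integral_cmult) measurable
  also have "(\<integral>\<^sup>+x. ?v x \<partial>M)=I (r (Suc k)) (r k)" by (simp add: I_def g_def)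
  also have "... <= ennreal (c k)" using N[of k "r (Suc k)" "r k"] rN[of k] rS[of k] by simp
  also have "ennreal ((2 ^ p) ^ k) * ennreal (c k)=ennreal ((1 / 2) ^ k)"
  proof -
   have "(2 ^ p) ^ k * c k=(2 ^ p * (1 / 2) ^ Suc p) ^ k" by (simp only: c_def power_mult_distrib)
   also have "(2::real) ^ p * (1 / 2) ^ Suc p=1 / 2" by (simp add: power_divide)
   finally show ?thesis using c[of k] by (simp add: ennreal_mult[symmetric])
  qed
  finally show ?thesis by (simp add: mult_left_mono)
 qed
 have Afin: "emeasure M (A k) < \<infinity>" for k using Aem[of k] by (simp add: le_less_trans)
 have "summable (%k. measure M (A k))"
 proof (rule summable_comparison_test[OF _ summable_geometric[of "1/2 :: real"]])
  have "measure M (A k) <= (1 / 2) ^ k" for k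
   unfolding measure_def using enn2real_mono[OF Aem[of k]] by simp
  then show "EX N. \<forall>k\<ge>N. norm (measure M (A k)) <= (1 / 2) ^ k" by simp
 qed simp
 from borel_cantelli_AE1[OF Am Afin this]
 have conv: "AE x in M. convergent (%k. g k x)"
 proof (rule AE_mp, intro AE_I2 impI)
  fix x assume x: "x : space M" "eventually (%k. x : space M - A k) sequentially"
  then have "eventually (%k. norm (g (Suc k) x - g k x) <= (1 / 2) ^ k) sequentially"
   by (elim eventually_mono) (auto simp: A_def)
  then show "convergent (%k. g k x)" by (rule eventually_geometric_convergent)
 qed
 define h where "h x=lim (%k. g k x)" for x
 have hm[measurable]: "h : bmeas M" unfolding h_def[abs_def] by (rule borel_measurable_lim_metric) measurable
 have bound: "(\<integral>\<^sup>+x. ennreal (norm (f m x - h x) ^ p) \<partial>M) <= ennreal (c k)" if m: "m >= N k" for m k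
 proof -
  have "(\<integral>\<^sup>+x. ennreal (norm (f m x - h x) ^ p) \<partial>M) <= (\<integral>\<^sup>+x. liminf (%j. ennreal (norm (f m x - g j x) ^ p)) \<partial>M)"
  proof (rule nn_integral_mono_AE, rule AE_mp[OF conv], intro AE_I2 impI)
   fix x assume "convergent (%k. g k x)"
   then have "(%k. g k x) ~~> h x" unfolding h_def by (simp add: convergent_LIMSEQ_iff)
   then have "(%j. ennreal (norm (f m x - g j x) ^ p)) ~~> ennreal (norm (f m x - h x) ^ p)"
    by (intro tendsto_ennrealI tendsto_power tendsto_norm tendsto_diff tendsto_const)
   then show "ennreal (norm (f m x - h x) ^ p) <= liminf (%j. ennreal (norm (f m x - g j x) ^ p))"
    using lim_imp_Liminf[OF sequentially_bot] by fastforce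
  qed
  also have "... <= liminf (%j. \<integral>\<^sup>+x. ennreal (norm (f m x - g j x) ^ p) \<partial>M)"
   by (rule nn_integral_liminf) measurable
  also have "... <= ennreal (c k)"
  proof (rule Liminf_le)
   show "eventually (%j. (\<integral>\<^sup>+x. ennreal (norm (f m x - g j x) ^ p) \<partial>M) <= ennreal (c k)) sequentially"
    using eventually_ge_at_top[of "N k"]
   proof eventually_elim
    case (elim j)
    have "I m (r j) < ennreal (c k)" by (rule N[OF m]) (use elim rge[of j] in simp)
    then show ?case by (simp add: I_def g_def less_imp_le)
   qed
  qed simp
  finally show ?thesis .
 qed
 have c0: "(%k. ennreal (c k)) ~~> ennreal 0"
 proof (rule tendsto_ennrealI)
  have "(1 / 2 :: real) ^ Suc p < 1" by (rule power_Suc_less_one) simp_all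
  then show "c ~~> 0" unfolding c_def[abs_def] by (intro LIMSEQ_realpow_zero) simp_all
 qed
 have "(%n. \<integral>\<^sup>+x. ennreal (norm (f n x - h x) ^ p) \<partial>M) ~~> 0"
 proof (rule order_tendstoI)
  fix a :: ennreal assume a: "0 < a"
  have "eventually (%k. ennreal (c k) < a) sequentially" by (rule order_tendstoD(2)[OF c0]) (use a in simp)
  then obtain k where k: "ennreal (c k) < a" using eventually_happens[of _ sequentially] by force
  show "eventually (%n. (\<integral>\<^sup>+x. ennreal (norm (f n x - h x) ^ p) \<partial>M) < a) sequentially"
   using eventually_ge_at_top[of "N k"] by eventually_elim (rule le_less_trans[OF bound k])
 qed simp
 then show ?thesis using hm by blast
qed

lemma L2_iff:
 "f : L2 M \<longleftrightarrow> f : bmeas M & integrable M (%x. (norm (f x))\<^sup>2)"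
proof -
 have "integrable M (%x. (norm (f x))\<^sup>2) \<longleftrightarrow> L2_normsq M f < \<infinity>" if "f : bmeas M"
  unfolding L2_normsq_def integrable_iff_bounded using that by simp
 then show ?thesis unfolding L2_def by blast
qed

lemma L2_measurable: "f : L2 M ==> f : bmeas M" and
 L2_integrable_sq: "f : L2 M ==> integrable M (%x. (norm (f x))\<^sup>2)" by (simp_all add: L2_iff)

lemma L2_normsq_eq: "f : L2 M ==> L2_normsq M f=ennreal (LINT x|M. (norm (f x))\<^sup>2)"
 unfolding L2_normsq_def by (rule nn_integral_eq_integral) (simp_all add: L2_iff)

lemma L2_dominated:
 fixes f :: "'a => 'b::euclidean_space"
 assumes "f : bmeas M" "integrable M w" "!!x. (norm (f x))\<^sup>2 <= w x"
 shows "f : L2 M"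
 unfolding L2_iff
proof (intro conjI assms(1))
 show "integrable M (%x. (norm (f x))\<^sup>2)"
 proof (rule Bochner_Integration.integrable_bound[OF assms(2)])
  show "(%x. (norm (f x))\<^sup>2) : bmeas M" using assms(1) by measurable
  show "AE x in M. norm ((norm (f x))\<^sup>2) <= norm (w x)" using assms(3) by (intro AE_I2) (simp add: order_trans[OF _ abs_ge_self])
 qed
qed

lemma norm_sq_add_le:
 fixes x y :: "'b::real_inner"
 shows "(norm (x+y))\<^sup>2 <= 2 * (norm x)\<^sup>2+2 * (norm y)\<^sup>2"
proof -
 have "(norm (x+y))\<^sup>2 <= (norm x+norm y)\<^sup>2" by (intro power_mono norm_triangle_ineq) simp
 then show ?thesis using sum_squares_bound[of "norm x" "norm y"] by (simp add: power2_sum)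
qed

lemma L2_add: "f : L2 M ==> g : L2 M ==> (%x. f x+g x :: 'b::euclidean_space) : L2 M"
 by (rule L2_dominated[where w="%x. 2 * (norm (f x))\<^sup>2+2 * (norm (g x))\<^sup>2"])
  (auto simp: L2_iff norm_sq_add_le)

lemma L2_minus: "f : L2 M ==> (%x. - f x :: 'b::euclidean_space) : L2 M"
 by (rule L2_dominated[where w="%x. (norm (f x))\<^sup>2"]) (simp_all add: L2_iff)

lemma L2_diff: "f : L2 M ==> g : L2 M ==> (%x. f x - g x :: 'b::euclidean_space) : L2 M"
 using L2_add[OF _ L2_minus, of f M g] by simp

lemma L2_cmult: "f : L2 M ==> (%x. c * f x :: complex) : L2 M"
 by (rule L2_dominated[where w="%x. (cmod c)\<^sup>2 * (norm (f x))\<^sup>2"]) (auto simp: L2_iff norm_mult power_mult_distrib)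

lemma L2_product_integrable:
 fixes f :: "'a => 'b::euclidean_space" and g :: "'a => 'c::euclidean_space" and P :: "'a => 'd::euclidean_space"
 assumes f: "f : L2 M" and g: "g : L2 M" and P: "P : bmeas M" "!!x. norm (P x) <= norm (f x) * norm (g x)"
 shows "integrable M P"
proof (rule Bochner_Integration.integrable_bound[OF _ P(1)])
 show "integrable M (%x. (norm (f x))\<^sup>2+(norm (g x))\<^sup>2)" using f g by (simp add: L2_iff)
 show "AE x in M. norm (P x) <= norm ((norm (f x))\<^sup>2+(norm (g x))\<^sup>2)"
 proof (rule AE_I2)
  fix x
  have "norm (f x) * norm (g x) <= (norm (f x))\<^sup>2+(norm (g x))\<^sup>2"
   using sum_squares_bound[of "norm (f x)" "norm (g x)"] mult_nonneg_nonneg[OF norm_ge_zero[of "f x"] norm_ge_zero[of "g x"]] by linarith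
  then show "norm (P x) <= norm ((norm (f x))\<^sup>2+(norm (g x))\<^sup>2)" using P(2)[of x] by simp
 qed
qed

lemma cnj_measurable_compose: "f : bmeas M ==> (%x. cnj (f x)) : bmeas M"
 by (rule borel_measurable_continuous_on[OF continuous_on_cnj[OF continuous_on_id]])

lemma L2_inner_integrable: "f : L2 M ==> g : L2 M ==> integrable M (%x. f x * cnj (g x))"
 by (rule L2_product_integrable[of f M g]) (simp_all add: L2_iff cnj_measurable_compose borel_measurable_times norm_mult)

lemma L2_imp_integrable:
 fixes f :: "'a => 'b::euclidean_space"
 assumes fin: "emeasure M (space M) < \<infinity>" and f: "f : L2 M"
 shows "integrable M f"
proof (rule Bochner_Integration.integrable_bound)
 interpret finite_measure M by (rule finite_measureI) (use fin in simp)
 show "integrable M (%x. 1+(norm (f x))\<^sup>2)" using f by (simp add: L2_iff)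
 show "f : bmeas M" using f by (simp add: L2_iff)
 show "AE x in M. norm (f x) <= norm (1+(norm (f x))\<^sup>2)"
 proof (rule AE_I2)
  fix x
  have "2 * norm (f x) <= 1+(norm (f x))\<^sup>2" using sum_squares_bound[of 1 "norm (f x)"] by simp
  then have "norm (f x) <= 1+(norm (f x))\<^sup>2" using norm_ge_zero[of "f x"] by linarith
  then show "norm (f x) <= norm (1+(norm (f x))\<^sup>2)" by simp
 qed
qed

lemma L2_complete:
 fixes f :: "nat => 'a => 'b::euclidean_space"
 assumes f: "!!n. f n : L2 M"
  and cauchy: "!!e. e > 0 ==> EX N. \<forall>m\<ge>N. \<forall>n\<ge>N. (LINT x|M. (norm (f m x - f n x))\<^sup>2) < e"
 shows "\<exists>g\<in>L2 M. (%n. LINT x|M. (norm (f n x - g x))\<^sup>2) ~~> 0"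
proof -
 have "\<exists>g\<in>bmeas M. (%n. \<integral>\<^sup>+x. ennreal (norm (f n x - g x) ^ 2) \<partial>M) ~~> 0"
 proof (rule Lp_complete)
  fix e :: real assume e: "e > 0"
  have "(\<integral>\<^sup>+x. ennreal (norm (f m x - f n x) ^ 2) \<partial>M)=ennreal (LINT x|M. (norm (f m x - f n x))\<^sup>2)" for m n
   using L2_normsq_eq[OF L2_diff[OF f f], of m n] by (simp add: L2_normsq_def)
  then show "EX N. \<forall>m\<ge>N. \<forall>n\<ge>N. (\<integral>\<^sup>+x. ennreal (norm (f m x - f n x) ^ 2) \<partial>M) < ennreal e"
   using cauchy[OF e] e by (simp add: ennreal_less_iff Bochner_Integration.integral_nonneg)
 qed (simp_all add: L2_measurable[OF f])
 then obtain g where g: "g : bmeas M" "(%n. \<integral>\<^sup>+x. ennreal (norm (f n x - g x) ^ 2) \<partial>M) ~~> 0" by blast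
 have "eventually (%n. (\<integral>\<^sup>+x. ennreal (norm (f n x - g x) ^ 2) \<partial>M) < 1) sequentially"
  by (rule order_tendstoD(2)[OF g(2)]) simp
 then obtain n where n: "(\<integral>\<^sup>+x. ennreal (norm (f n x - g x) ^ 2) \<partial>M) < 1" using eventually_happens[of _ sequentially] by force
 have d: "(%x. f n x - g x) : L2 M"
  unfolding L2_def L2_normsq_def using g(1) L2_measurable[OF f] n by (auto intro: order.strict_trans)
 have gL: "g : L2 M" using L2_diff[OF f d, of n] by simp
 have "(\<integral>\<^sup>+x. ennreal (norm (f n x - g x) ^ 2) \<partial>M)=ennreal (LINT x|M. (norm (f n x - g x))\<^sup>2)" for n
  using L2_normsq_eq[OF L2_diff[OF f gL], of n] by (simp add: L2_normsq_def)
 then have "(%n. ennreal (LINT x|M. (norm (f n x - g x))\<^sup>2)) ~~> ennreal 0" using g(2) by simp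
 then have "(%n. LINT x|M. (norm (f n x - g x))\<^sup>2) ~~> 0"
  by (rule tendsto_ennrealD) (simp_all add: Bochner_Integration.integral_nonneg)
 then show ?thesis using gL by blast
qed

lemma L2_cauchy_schwarz:
 fixes f :: "'a => 'b::euclidean_space" and g :: "'a => 'c::euclidean_space"
 assumes f: "f : L2 M" and g: "g : L2 M"
 shows "(LINT x|M. norm (f x) * norm (g x))\<^sup>2 <= (LINT x|M. (norm (f x))\<^sup>2) * (LINT x|M. (norm (g x))\<^sup>2)"
proof -
 have m: "f : bmeas M" "g : bmeas M" using f g by (simp_all add: L2_iff)
 have i: "integrable M (%x. norm (f x) * norm (g x))"
  by (rule L2_product_integrable[OF f g]) (use m in simp_all)
 have e: "(\<integral>\<^sup>+x. ennreal (norm (f x)) * ennreal (norm (g x)) \<partial>M)=ennreal (LINT x|M. norm (f x) * norm (g x))"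
  using nn_integral_eq_integral[OF i] by (simp add: ennreal_mult)
 have "(\<integral>\<^sup>+x. ennreal (norm (f x)) * ennreal (norm (g x)) \<partial>M)\<^sup>2 <= (\<integral>\<^sup>+x. ennreal (norm (f x)) ^ 2 \<partial>M) * (\<integral>\<^sup>+x. ennreal (norm (g x)) ^ 2 \<partial>M)"
  by (rule Cauchy_Schwarz_nn_integral) (use m in simp_all)
 also have "(\<integral>\<^sup>+x. ennreal (norm (f x)) ^ 2 \<partial>M)=ennreal (LINT x|M. (norm (f x))\<^sup>2)"
  using L2_normsq_eq[OF f] by (simp add: L2_normsq_def ennreal_power)
 also have "(\<integral>\<^sup>+x. ennreal (norm (g x)) ^ 2 \<partial>M)=ennreal (LINT x|M. (norm (g x))\<^sup>2)"
  using L2_normsq_eq[OF g] by (simp add: L2_normsq_def ennreal_power)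
 finally have "ennreal ((LINT x|M. norm (f x) * norm (g x))\<^sup>2) <= ennreal ((LINT x|M. (norm (f x))\<^sup>2) * (LINT x|M. (norm (g x))\<^sup>2))"
  unfolding e by (simp add: ennreal_power ennreal_mult Bochner_Integration.integral_nonneg)
 then show ?thesis by (subst (asm) ennreal_le_iff) (simp_all add: Bochner_Integration.integral_nonneg)
qed

lemma L2_product_tendsto:
 fixes f :: "nat => 'a => 'b::euclidean_space" and k :: "'a => 'c::euclidean_space" and p :: "'b => 'c => 'd::euclidean_space"
 assumes f: "!!n. f n : L2 M" "f0 : L2 M" "(%n. LINT x|M. (norm (f n x - f0 x))\<^sup>2) ~~> 0" and k: "k : L2 M"
  and bb: "bounded_bilinear p" and bd: "!!x y. norm (p x y) <= norm x * norm y"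
 shows "(%n. LINT x|M. p (f n x) (k x)) ~~> (LINT x|M. p (f0 x) (k x))"
proof -
 have pm: "(%x. p (g x) (k x)) : bmeas M" if "g : L2 M" for g
 proof -
  have "continuous_on UNIV (%z. p (fst z) (snd z))"
   by (intro bounded_bilinear.continuous_on[OF bb] continuous_intros)
  from borel_measurable_continuous_on[OF this, of "%x. (g x, k x)" M]
  show ?thesis using that k by (simp add: L2_iff borel_measurable_Pair)
 qed
 have pi: "integrable M (%x. p (g x) (k x))" if "g : L2 M" for g
  by (rule L2_product_integrable[OF that k pm[OF that] bd])
 have "(%n. sqrt ((LINT x|M. (norm (f n x - f0 x))\<^sup>2) * (LINT x|M. (norm (k x))\<^sup>2))) ~~> sqrt (0 * (LINT x|M. (norm (k x))\<^sup>2))"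
  by (intro tendsto_real_sqrt tendsto_mult f(3) tendsto_const)
 then have l: "(%n. sqrt ((LINT x|M. (norm (f n x - f0 x))\<^sup>2) * (LINT x|M. (norm (k x))\<^sup>2))) ~~> 0" by simp
 have "(%n. (LINT x|M. p (f n x) (k x)) - (LINT x|M. p (f0 x) (k x))) ~~> 0"
 proof (rule Lim_null_comparison[OF _ l], rule always_eventually, rule allI)
  fix n
  have d: "(%x. f n x - f0 x) : L2 M" by (rule L2_diff[OF f(1,2)])
  have m: "(%x. f n x - f0 x) : bmeas M" "k : bmeas M" using d k by (simp_all add: L2_iff)
  have ni: "integrable M (%x. norm (f n x - f0 x) * norm (k x))"
   by (rule L2_product_integrable[OF d k]) (use m in simp_all)
  have "(LINT x|M. p (f n x) (k x)) - (LINT x|M. p (f0 x) (k x))=(LINT x|M. p (f n x - f0 x) (k x))"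
   using pi[OF f(1), of n] pi[OF f(2)] by (simp add: bounded_bilinear.diff_left[OF bb])
  also have "norm ... <= (LINT x|M. norm (p (f n x - f0 x) (k x)))" by (rule integral_norm_bound)
  also have "... <= (LINT x|M. norm (f n x - f0 x) * norm (k x))"
   by (rule integral_mono'[OF ni]) (simp_all add: bd)
  also have "... <= sqrt ((LINT x|M. (norm (f n x - f0 x))\<^sup>2) * (LINT x|M. (norm (k x))\<^sup>2))"
   by (rule real_le_rsqrt[OF L2_cauchy_schwarz[OF d k]])
  finally show "norm ((LINT x|M. p (f n x) (k x)) - (LINT x|M. p (f0 x) (k x))) <= sqrt ((LINT x|M. (norm (f n x - f0 x))\<^sup>2) * (LINT x|M. (norm (k x))\<^sup>2))" .
 qed
 then show ?thesis by (simp add: LIM_zero_iff)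
qed

lemma L1_norm_triangle:
 fixes f g :: "'a => 'b::{real_normed_vector, second_countable_topology}"
 assumes "f : bmeas M" "g : bmeas M"
 shows "L1_norm M (%x. f x+g x) <= L1_norm M f+L1_norm M g"
proof -
 have "L1_norm M (%x. f x+g x) <= (\<integral>\<^sup>+x. ennreal (norm (f x))+ennreal (norm (g x)) \<partial>M)"
  unfolding L1_norm_def
  by (rule nn_integral_mono) (simp add: norm_triangle_ineq ennreal_leI flip: ennreal_plus)
 also have "...=L1_norm M f+L1_norm M g"
  unfolding L1_norm_def by (rule nn_integral_add) (use assms in measurable)
 finally show ?thesis .
qed

lemma L1_norm_commute: "L1_norm M (%x. f x - g x)=L1_norm M (%x. g x - f x)"
 unfolding L1_norm_def by (simp add: norm_minus_commute)

lemma L1_norm_scaleR: "f : borel_measurable M ==>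
 L1_norm M (%x. c *\<^sub>R f x) = ennreal \<bar>c\<bar> * L1_norm M (f :: 'a => 'b::{real_normed_vector, second_countable_topology})"
 unfolding L1_norm_def by (subst nn_integral_cmult[symmetric]) (simp_all add: ennreal_mult)

lemma L1_norm_eq:
 fixes f :: "'a => 'b::{banach, second_countable_topology}"
 shows "integrable M f ==> L1_norm M f=ennreal (LINT x|M. norm (f x))"
 unfolding L1_norm_def by (rule nn_integral_eq_integral) simp_all

section \<open>Traces\<close>

abbreviation grad :: "(real^'n => real) => real^'n => real^'n" where
 "grad ph x \<equiv> (\<chi> j. pderv j ph x)"

lemma measurable_lebesgue_on_borel:
 "f : bmeas borel ==> f : bmeas (lebesgue_on S)"
 by (intro measurable_restrict_space1 measurable_completion) simp

lemma smooth_measurable: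
 assumes "smooth ph"
 shows "ph : bmeas borel" "grad ph : bmeas borel"
proof -
 show "ph : bmeas borel" by (rule borel_measurable_continuous_onI[OF smooth_continuous[OF assms]])
 show "grad ph : bmeas borel"
  unfolding partial_deriv_def
  by (intro borel_measurable_vec_lambda borel_measurable_continuous_onI smooth_continuous_deriv assms)
qed

lemma grad_lincomb:
 assumes "smooth ph" "smooth ps"
 shows "grad (%x. a * ph x+b * ps x) x=a *\<^sub>R grad ph x+b *\<^sub>R grad ps x"
proof -
 have "((%x. a * ph x+b * ps x) has_derivative (%v. a * fderv ph (at x) v+b * fderv ps (at x) v)) (at x)"
  by (intro has_derivative_add has_derivative_mult_right Ck1_has_derivative smooth_C1 assms)
 from fun_cong[OF frechet_derivative_at[OF this]] show ?thesis by (simp add: vec_eq_iff partial_deriv_def)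
qed

lemma smooth_lincomb:
 fixes ph ps :: "'a::real_normed_vector => real"
 assumes "smooth ph" "smooth ps" shows "smooth (%x. a * ph x+b * ps x)"
 by (intro smooth_add smooth_mult smooth_const assms)

lemma has_weak_gradient_lincomb:
 fixes u v :: "real^'n => 'b::euclidean_space" and T T' :: "'b => 'b"
 assumes Om: "open Om" and u: "has_weak_gradient Om u g" "integrable (lebesgue_on Om) u" "integrable (lebesgue_on Om) g"
  and v: "has_weak_gradient Om v h" "integrable (lebesgue_on Om) v" "integrable (lebesgue_on Om) h"
  and T: "bounded_linear T" "bounded_linear T'"
 shows "has_weak_gradient Om (%x. T (u x)+T' (v x)) (%x. \<chi> j. T (g x $ j)+T' (h x $ j))"
 unfolding has_weak_gradient_def
proof (intro conjI ballI allI)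
 let ?M = "lebesgue_on Om"
 have iTu: "integrable ?M (%x. T (u x))" "integrable ?M (%x. T' (v x))"
  using integrable_bounded_linear T u(2) v(2) by blast+
 have iTg: "integrable ?M (%x. T (g x $ j))" "integrable ?M (%x. T' (h x $ j))" for j
  using integrable_bounded_linear[OF T(1) integrable_vec_nth[OF u(3)]] integrable_bounded_linear[OF T(2) integrable_vec_nth[OF v(3)]] by blast+
 show "(%x. T (u x)+T' (v x)) : L1_loc Om" by (rule integrable_L1_loc[OF Bochner_Integration.integrable_add[OF iTu] Om])
 show "(%x. \<chi> j. T (g x $ j)+T' (h x $ j)) : L1_loc Om"
  by (rule integrable_L1_loc[OF integrable_vec_lambda[OF Bochner_Integration.integrable_add[OF iTg]] Om])
 fix ph j assume ph: "ph : test_functions Om"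
 obtain B where B: "!!x. \<bar>ph x\<bar> <= B" "!!x j. \<bar>pderv j ph x\<bar> <= B" using test_function_bound[OF ph] by blast
 note m = test_function_lebesgue_measurable[OF ph, where S=Om]
 have one: "(LINT x|?M. pderv j ph x *\<^sub>R L (w x))=- (LINT x|?M. ph x *\<^sub>R L (k x $ j))"
  if L: "bounded_linear L" and w: "has_weak_gradient Om w k" "integrable ?M w" "integrable ?M k"
  for L :: "'b => 'b" and w k
 proof -
  have i1: "integrable ?M (%x. pderv j ph x *\<^sub>R w x)" by (rule integrable_bounded_mult[OF w(2) m(2) B(2)])
  have i2: "integrable ?M (%x. ph x *\<^sub>R k x $ j)" by (rule integrable_bounded_mult[OF integrable_vec_nth[OF w(3)] m(1) B(1)])
  have "(LINT x|?M. pderv j ph x *\<^sub>R L (w x))=L (LINT x|?M. pderv j ph x *\<^sub>R w x)"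
   using integral_bounded_linear[OF L i1] by (simp add: linear_scale[OF bounded_linear.linear[OF L]])
  also have "(LINT x|?M. pderv j ph x *\<^sub>R w x)=- (LINT x|?M. ph x *\<^sub>R k x $ j)"
   using w(1) ph unfolding has_weak_gradient_def by blast
  also have "L (- (LINT x|?M. ph x *\<^sub>R k x $ j))=- (LINT x|?M. ph x *\<^sub>R L (k x $ j))"
   using integral_bounded_linear[OF L i2] by (simp add: linear_scale[OF bounded_linear.linear[OF L]] linear_neg[OF bounded_linear.linear[OF L]])
  finally show ?thesis .
 qed
 have i: "integrable ?M (%x. pderv j ph x *\<^sub>R T (u x))" "integrable ?M (%x. pderv j ph x *\<^sub>R T' (v x))"
  "integrable ?M (%x. ph x *\<^sub>R T (g x $ j))" "integrable ?M (%x. ph x *\<^sub>R T' (h x $ j))"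
  by (rule integrable_bounded_mult[OF iTu(1) m(2) B(2)], rule integrable_bounded_mult[OF iTu(2) m(2) B(2)],
    rule integrable_bounded_mult[OF iTg(1) m(1) B(1)], rule integrable_bounded_mult[OF iTg(2) m(1) B(1)])
 show "(LINT x|?M. pderv j ph x *\<^sub>R (T (u x)+T' (v x)))=- (LINT x|?M. ph x *\<^sub>R (\<chi> j. T (g x $ j)+T' (h x $ j)) $ j)"
  using i one[OF T(1) u] one[OF T(2) v] by (simp add: scaleR_add_right)
qed

locale trace_domain =
 fixes Om :: "(real^'n) set"
 assumes card: "CARD('n) >= 2" and Om: "open Om" "bounded Om" and sb: "smooth_boundary Om"
begin

abbreviation "M \<equiv> lebesgue_on Om"
abbreviation "S \<equiv> surface_measure Om"

lemma Om_sets: "Om \<inter> space lebesgue : sets lebesgue" using Om(1) by auto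

lemma space_M: "space M=Om" by (simp add: space_restrict_space)

lemma M_finite: "emeasure M (space M) < \<infinity>"
proof -
 have "emeasure M (space M)=emeasure lebesgue Om"
  using Om_sets by (simp add: space_M emeasure_restrict_space)
 also have "...=emeasure lborel Om" using Om(1) by simp
 also have "... < \<infinity>" by (rule emeasure_bounded_finite[OF Om(2)])
 finally show ?thesis .
qed

lemma nn_integral_M:
 assumes "f : bmeas borel"
 shows "(\<integral>\<^sup>+x. f x \<partial>M)=(\<integral>\<^sup>+x. f x * indicator Om x \<partial>lborel)"
 using nn_integral_restrict_space[OF Om_sets, of f] by (simp add: nn_integral_completion)

lemma sobolev_norm_eq:
 assumes "smooth ps"
 shows "sobolev_norm Om ps=L1_norm M ps+L1_norm M (grad ps)"
proof -
 note m = smooth_measurable[OF assms]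
 have "sobolev_norm Om ps=(\<integral>\<^sup>+x. ennreal (\<bar>ps x\<bar>+norm (grad ps x)) \<partial>M)"
  unfolding sobolev_norm_def by (rule nn_integral_M[symmetric]) (use m in measurable)
 also have "...=(\<integral>\<^sup>+x. ennreal (norm (ps x))+ennreal (norm (grad ps x)) \<partial>M)"
  by (simp add: ennreal_plus)
 also have "...=L1_norm M ps+L1_norm M (grad ps)"
  unfolding L1_norm_def
  by (rule nn_integral_add) (use measurable_lebesgue_on_borel[OF m(1)] measurable_lebesgue_on_borel[OF m(2)] in simp_all)
 finally show ?thesis .
qed

lemma trace_constant: "\<exists>C\<ge>0. \<forall>ps. smooth ps --> L1_norm S ps <= ennreal C * (L1_norm M ps+L1_norm M (grad ps))"
proof -
 obtain C where C: "C >= 0" "!!ps. Ck 1 ps ==> (\<integral>\<^sup>+x. ennreal \<bar>ps x\<bar> \<partial>S) <= ennreal C * sobolev_norm Om ps"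
  using trace_inequality[OF card Om sb] by blast
 have "L1_norm S ps <= ennreal C * (L1_norm M ps+L1_norm M (grad ps))" if "smooth ps" for ps
  using C(2)[OF smooth_C1[OF that]] unfolding sobolev_norm_eq[OF that] L1_norm_def by simp
 then show ?thesis using C(1) by blast
qed

definition "Ctr=(SOME C. C >= 0 & (\<forall>ps. smooth ps --> L1_norm S ps <= ennreal C * (L1_norm M ps+L1_norm M (grad ps))))"

lemma Ctr: "Ctr >= 0" "smooth ps ==> L1_norm S ps <= ennreal Ctr * (L1_norm M ps+L1_norm M (grad ps))"
proof -
 have "Ctr >= 0 & (\<forall>ps. smooth ps --> L1_norm S ps <= ennreal Ctr * (L1_norm M ps+L1_norm M (grad ps)))"
  unfolding Ctr_def by (rule someI_ex[OF trace_constant[unfolded Bex_def]])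
 then show "Ctr >= 0" "smooth ps ==> L1_norm S ps <= ennreal Ctr * (L1_norm M ps+L1_norm M (grad ps))" by blast+
qed

definition trace_approx :: "(real^'n => real) => (real^'n => real) => (real^'n => real^'n) => (nat => real^'n => real) => bool" where
 "trace_approx w ta g ph \<longleftrightarrow> integrable M w & integrable S ta & has_weak_gradient Om w g & integrable M g \<and>
  (\<forall>n. smooth (ph n)) & (%n. L1_norm M (%x. ph n x - w x)) ~~> 0 \<and>
  (%n. L1_norm M (%x. grad (ph n) x - g x)) ~~> 0 & (%n. L1_norm S (%x. ph n x - ta x)) ~~> 0"

lemma has_trace_iff: "has_trace Om w ta \<longleftrightarrow> (\<exists>g ph. trace_approx w ta g ph)"
 unfolding has_trace_def trace_approx_def by blast

lemma trace_approxD: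
 assumes "trace_approx w ta g ph"
 shows "integrable M w" "integrable S ta" "has_weak_gradient Om w g" "integrable M g" "smooth (ph n)"
  "(%n. L1_norm M (%x. ph n x - w x)) ~~> 0" "(%n. L1_norm M (%x. grad (ph n) x - g x)) ~~> 0"
  "(%n. L1_norm S (%x. ph n x - ta x)) ~~> 0"
 using assms unfolding trace_approx_def by blast+

lemma smooth_mM: "smooth ph ==> ph : bmeas M" "smooth ph ==> grad ph : bmeas M" "smooth ph ==> ph : bmeas S"
 using measurable_lebesgue_on_borel smooth_measurable borel_measurable_surface by blast+

text \<open>The trace inequality passes to the limit along the approximating smooth functions. Uniqueness and linearity of traces rest on this estimate.\<close>

lemma trace_approx_bound:
 assumes t: "trace_approx w ta g ph"
 shows "L1_norm S ta <= ennreal Ctr * (L1_norm M w+L1_norm M g)"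
proof -
 note T = trace_approxD[OF t]
 have w: "w : bmeas M" and g: "g : bmeas M" and ta: "ta : bmeas S" using T by simp_all
 note m = smooth_mM[OF T(5)]
 have bd: "L1_norm S ta <= L1_norm S (%x. ph n x - ta x) + ennreal Ctr * ((L1_norm M (%x. ph n x - w x) + L1_norm M w)
   + (L1_norm M (%x. grad (ph n) x - g x) + L1_norm M g))" for n
 proof -
  have "L1_norm S ta=L1_norm S (%x. (ta x - ph n x)+ph n x)" by simp
  also have "... <= L1_norm S (%x. ta x - ph n x)+L1_norm S (ph n)"
   by (rule L1_norm_triangle) (use ta m(3)[of n] in simp_all)
  also have "L1_norm S (%x. ta x - ph n x)=L1_norm S (%x. ph n x - ta x)" by (rule L1_norm_commute)
  also have "L1_norm S (ph n) <= ennreal Ctr * (L1_norm M (ph n)+L1_norm M (grad (ph n)))" by (rule Ctr(2)[OF T(5)])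
  also have "L1_norm M (ph n) <= L1_norm M (%x. ph n x - w x)+L1_norm M w"
   using L1_norm_triangle[of "%x. ph n x - w x" M w] w m(1)[of n] by simp
  also have "L1_norm M (grad (ph n)) <= L1_norm M (%x. grad (ph n) x - g x)+L1_norm M g"
   using L1_norm_triangle[of "%x. grad (ph n) x - g x" M g] g m(2)[of n] by simp
  finally show ?thesis by (simp add: add_left_mono add_mono mult_left_mono)
 qed
 have "(%n. L1_norm S (%x. ph n x - ta x) + ennreal Ctr * ((L1_norm M (%x. ph n x - w x) + L1_norm M w)
   + (L1_norm M (%x. grad (ph n) x - g x) + L1_norm M g)))
  ~~> 0 + ennreal Ctr * ((0 + L1_norm M w) + (0 + L1_norm M g))"
  by (intro tendsto_add T(6,7,8) tendsto_const ennreal_tendsto_cmult) simp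
 from LIMSEQ_le_const[OF this] bd show ?thesis by simp
qed

lemma L1_lincomb_tendsto:
 fixes p q :: "nat => 'a => 'b::{banach, second_countable_topology}"
 assumes "!!n. p n : bmeas N" "!!n. q n : bmeas N" "P : bmeas N" "Q : bmeas N"
  and l: "(%n. L1_norm N (%x. p n x - P x)) ~~> 0" "(%n. L1_norm N (%x. q n x - Q x)) ~~> 0"
 shows "(%n. L1_norm N (%x. (a *\<^sub>R p n x+b *\<^sub>R q n x) - (a *\<^sub>R P x+b *\<^sub>R Q x))) ~~> 0"
proof (rule tendsto_sandwich[OF _ _ tendsto_const])
 have "(%n. ennreal \<bar>a\<bar> * L1_norm N (%x. p n x - P x)+ennreal \<bar>b\<bar> * L1_norm N (%x. q n x - Q x)) ~~> ennreal \<bar>a\<bar> * 0+ennreal \<bar>b\<bar> * 0"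
  by (intro tendsto_add ennreal_tendsto_cmult l) simp_all
 then show "(%n. ennreal \<bar>a\<bar> * L1_norm N (%x. p n x - P x)+ennreal \<bar>b\<bar> * L1_norm N (%x. q n x - Q x)) ~~> 0" by simp
 have "L1_norm N (%x. (a *\<^sub>R p n x + b *\<^sub>R q n x) - (a *\<^sub>R P x + b *\<^sub>R Q x))
  <= ennreal \<bar>a\<bar> * L1_norm N (%x. p n x - P x) + ennreal \<bar>b\<bar> * L1_norm N (%x. q n x - Q x)" for n
 proof -
  have m: "(%x. p n x - P x) : bmeas N" "(%x. q n x - Q x) : bmeas N" using assms(1-4) by simp_all
  have "L1_norm N (%x. (a *\<^sub>R p n x+b *\<^sub>R q n x) - (a *\<^sub>R P x+b *\<^sub>R Q x))=L1_norm N (%x. a *\<^sub>R (p n x - P x)+b *\<^sub>R (q n x - Q x))"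
   by (simp add: algebra_simps)
  also have "... <= L1_norm N (%x. a *\<^sub>R (p n x - P x))+L1_norm N (%x. b *\<^sub>R (q n x - Q x))"
   by (rule L1_norm_triangle) (use m in simp_all)
  finally show ?thesis by (simp only: L1_norm_scaleR[OF m(1)] L1_norm_scaleR[OF m(2)])
 qed
 then show "\<forall>\<^sub>F n in sequentially. L1_norm N (%x. (a *\<^sub>R p n x + b *\<^sub>R q n x) - (a *\<^sub>R P x + b *\<^sub>R Q x))
  <= ennreal \<bar>a\<bar> * L1_norm N (%x. p n x - P x) + ennreal \<bar>b\<bar> * L1_norm N (%x. q n x - Q x)" by (intro always_eventually allI)
qed simp

lemma trace_approx_lincomb:
 assumes t: "trace_approx w ta g ph" and t': "trace_approx w' ta' g' ph'"
 shows "trace_approx (%x. a * w x+b * w' x) (%x. a * ta x+b * ta' x) (%x. a *\<^sub>R g x+b *\<^sub>R g' x) (%n x. a * ph n x+b * ph' n x)"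
 unfolding trace_approx_def
proof (intro conjI allI)
 note T = trace_approxD[OF t] and T' = trace_approxD[OF t']
 show "integrable M (%x. a * w x+b * w' x)" using T(1) T'(1) by simp
 show "integrable S (%x. a * ta x+b * ta' x)" using T(2) T'(2) by simp
 show "integrable M (%x. a *\<^sub>R g x+b *\<^sub>R g' x)" using T(4) T'(4) by simp
 have "has_weak_gradient Om (%x. a * w x+b * w' x) (%x. \<chi> j. a * g x $ j+b * g' x $ j)"
  by (rule has_weak_gradient_lincomb[OF Om(1) T(3,1,4) T'(3,1,4)]) (rule bounded_linear_mult_right)+
 moreover have "(%x. \<chi> j. a * g x $ j+b * g' x $ j)=(%x. a *\<^sub>R g x+b *\<^sub>R g' x)" by (simp add: fun_eq_iff vec_eq_iff)
 ultimately show "has_weak_gradient Om (%x. a * w x+b * w' x) (%x. a *\<^sub>R g x+b *\<^sub>R g' x)" by simp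
 show "smooth (%x. a * ph n x+b * ph' n x)" for n by (rule smooth_lincomb[OF T(5) T'(5)])
 note m = smooth_mM[OF T(5)] and m' = smooth_mM[OF T'(5)]
 show "(%n. L1_norm M (%x. a * ph n x+b * ph' n x - (a * w x+b * w' x))) ~~> 0"
  using L1_lincomb_tendsto[OF m(1) m'(1) _ _ T(6) T'(6), of a b] T(1) T'(1) by simp
 show "(%n. L1_norm S (%x. a * ph n x+b * ph' n x - (a * ta x+b * ta' x))) ~~> 0"
  using L1_lincomb_tendsto[OF m(3) m'(3) _ _ T(8) T'(8), of a b] T(2) T'(2) by simp
 show "(%n. L1_norm M (%x. grad (%x. a * ph n x+b * ph' n x) x - (a *\<^sub>R g x+b *\<^sub>R g' x))) ~~> 0"
  unfolding grad_lincomb[OF T(5) T'(5)]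
  by (rule L1_lincomb_tendsto[OF m(2) m'(2) _ _ T(7) T'(7)]) (use T(4) T'(4) in simp_all)
qed

lemma weak_gradient_unique:
 fixes u u' :: "real^'n => 'b::euclidean_space"
 assumes u: "has_weak_gradient Om u g" "integrable M u" "integrable M g"
  and u': "has_weak_gradient Om u' g'" "integrable M u'" "integrable M g'" and ae: "AE x in M. u x=u' x"
 shows "AE x in M. g x=g' x"
proof -
 have rep: "EX f. f : bmeas borel & (\<forall>x. x ~: Om --> f x=0) & (AE x in M. v x=f x)"
  if "integrable M v" for v :: "real^'n => 'c::euclidean_space"
  by (rule lebesgue_borel_representative[OF _ Om(1)]) (use that in simp)
 obtain f where f: "f : bmeas borel" "!!x. x ~: Om ==> f x=0" "AE x in M. u x=f x" using rep[OF u(2)] by blast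
 obtain G where G: "G : bmeas borel" "!!x. x ~: Om ==> G x=0" "AE x in M. g x=G x" using rep[OF u(3)] by blast
 obtain G' where G': "G' : bmeas borel" "!!x. x ~: Om ==> G' x=0" "AE x in M. g' x=G' x" using rep[OF u'(3)] by blast
 have f': "AE x in M. u' x=f x" using f(3) ae by eventually_elim simp
 have w: "wgrad Om f G" by (rule has_weak_gradient_imp_wgrad[OF u Om(1) f G])
 have w': "wgrad Om f G'" by (rule has_weak_gradient_imp_wgrad[OF u' Om(1) f(1,2) f' G'])
 have "AE x in lborel. G x=G' x" by (rule wgrad_unique[OF w w' Om(1)]) simp
 then have "AE x in lebesgue. G x=G' x" by (rule AE_completion)
 then have "AE x in M. G x=G' x" by (subst AE_restrict_space_iff[OF Om_sets]) (rule AE_mp, auto)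
 with G(3) G'(3) show ?thesis by eventually_elim simp
qed

lemma has_weak_gradient_zero: "has_weak_gradient Om (%x. 0 :: 'b::euclidean_space) (%x. 0)"
 unfolding has_weak_gradient_def by (simp add: integrable_L1_loc[OF _ Om(1)])

lemma trace_unique:
 assumes t: "trace_approx w ta g ph" and t': "trace_approx w' ta' g' ph'" and ae: "AE x in M. w x=w' x"
 shows "AE x in S. ta x=ta' x"
proof -
 have d: "trace_approx (%x. 1 * w x+(-1) * w' x) (%x. 1 * ta x+(-1) * ta' x) (%x. 1 *\<^sub>R g x+(-1) *\<^sub>R g' x) (%n x. 1 * ph n x+(-1) * ph' n x)"
  by (rule trace_approx_lincomb[OF t t'])
 note T = trace_approxD[OF d]
 have w0: "AE x in M. 1 * w x+(-1) * w' x=0" using ae by eventually_elim simp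
 have g0: "AE x in M. 1 *\<^sub>R g x+(-1) *\<^sub>R g' x=0"
  by (rule weak_gradient_unique[OF T(3,1,4) has_weak_gradient_zero _ _ w0]) simp_all
 have "L1_norm M (%x. 1 * w x+(-1) * w' x)=0"
  unfolding L1_norm_def using w0 by (subst nn_integral_0_iff_AE) (use T(1) in "simp_all")
 moreover have "L1_norm M (%x. 1 *\<^sub>R g x+(-1) *\<^sub>R g' x)=0"
  unfolding L1_norm_def using g0 by (subst nn_integral_0_iff_AE) (use T(4) in "simp_all")
 ultimately have "L1_norm S (%x. 1 * ta x+(-1) * ta' x)=0" using trace_approx_bound[OF d] by simp
 then have "AE x in S. ennreal (norm (1 * ta x+(-1) * ta' x))=0"
  unfolding L1_norm_def using T(2) by (subst (asm) nn_integral_0_iff_AE) simp_all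
 then show ?thesis by eventually_elim simp
qed

text \<open>By the trace inequality the boundary values of a \<open>W\<^sup>1\<^sup>,\<^sup>1\<close> approximation form a Cauchy sequence in \<open>L\<^sup>1\<close> of the boundary.\<close>

lemma trace_exists:
 assumes w: "has_weak_gradient Om w g" "integrable M w" "integrable M g"
 shows "\<exists>ta ph. trace_approx w ta g ph"
proof -
 have rep: "EX f. f : bmeas borel & (\<forall>x. x ~: Om --> f x=0) & (AE x in M. v x=f x)"
  if "integrable M v" for v :: "real^'n => 'c::euclidean_space"
  by (rule lebesgue_borel_representative[OF _ Om(1)]) (use that in simp)
 obtain f where f: "f : bmeas borel" "!!x. x ~: Om ==> f x=0" "AE x in M. w x=f x" using rep[OF w(2)] by blast
 obtain G where G: "G : bmeas borel" "!!x. x ~: Om ==> G x=0" "AE x in M. g x=G x" using rep[OF w(3)] by blast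
 have wg: "wgrad Om f G" by (rule has_weak_gradient_imp_wgrad[OF w Om(1) f G])
 note app = wgrad_approximable[OF Om sb wg, unfolded approximable_def, rule_format]
 have L1close: "L1_norm M (%x. p x - v x) <= ennreal e"
  if P: "integ P" "!!x. x : Om ==> p x=P x" and F: "integ F" "AE x in M. v x=F x" and le: "(LINT x|lborel. norm (P x - F x)) <= e"
  for p P v F :: "real^'n => 'c::euclidean_space" and e
 proof -
  have Pm: "P : bmeas borel" "F : bmeas borel" using P(1) F(1) by simp_all
  have "L1_norm M (%x. p x - v x)=(\<integral>\<^sup>+x. ennreal (norm (P x - F x)) \<partial>M)"
   unfolding L1_norm_def
  proof (rule nn_integral_cong_AE, rule AE_mp[OF F(2)], intro AE_I2 impI)
   fix x assume "x : space M" "v x=F x"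
   then show "ennreal (norm (p x - v x))=ennreal (norm (P x - F x))" using P(2)[of x] by (simp add: space_M)
  qed
  also have "...=(\<integral>\<^sup>+x. ennreal (norm (P x - F x)) * indicator Om x \<partial>lborel)"
   by (rule nn_integral_M) (use Pm in measurable)
  also have "... <= (\<integral>\<^sup>+x. ennreal (norm (P x - F x)) \<partial>lborel)" by (rule nn_integral_mono) (simp add: indicator_def)
  also have "...=ennreal (LINT x|lborel. norm (P x - F x))"
   by (rule nn_integral_eq_integral) (use P(1) F(1) in simp_all)
  also have "... <= ennreal e" by (rule ennreal_leI[OF le])
  finally show ?thesis .
 qed
 have "\<exists>ph. smooth ph & L1_norm M (%x. ph x - w x) <= ennreal e & L1_norm M (%x. grad ph x - g x) <= ennreal e" if e: "e > 0" for e
 proof -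
  obtain ph H where H: "smooth ph" "integ ph" "integ H" "\<forall>x\<in>Om. \<forall>j. pderv j ph x=H x $ j"
   "(LINT x|lborel. norm (ph x - f x)) <= e" "(LINT x|lborel. norm (H x - G x)) <= e"
   using app[OF e] by blast
  have "grad ph x=H x" if "x : Om" for x using H(4) that by (simp add: vec_eq_iff)
  then show ?thesis using H(1) L1close[OF H(2) refl wgradD(1)[OF wg] f(3) H(5)] L1close[OF H(3) _ wgradD(2)[OF wg] G(3) H(6), of "grad ph"] by blast
 qed
 then have "\<exists>ph. smooth ph & L1_norm M (%x. ph x - w x) <= ennreal (inverse (Suc n)) & L1_norm M (%x. grad ph x - g x) <= ennreal (inverse (Suc n))" for n :: nat
  by simp
 then have "\<forall>n::nat. \<exists>ph. smooth ph & L1_norm M (%x. ph x - w x) <= ennreal (inverse (Suc n)) & L1_norm M (%x. grad ph x - g x) <= ennreal (inverse (Suc n))" ..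
 from choice[OF this] obtain ph where ph: "!!n. smooth (ph n)" "!!n. L1_norm M (%x. ph n x - w x) <= ennreal (inverse (Suc n))"
  "!!n. L1_norm M (%x. grad (ph n) x - g x) <= ennreal (inverse (Suc n))" by blast
 have inv: "(%n. ennreal (inverse (real (Suc n)))) ~~> 0"
  using tendsto_ennrealI[OF LIMSEQ_inverse_real_of_nat] by simp
 have l1: "(%n. L1_norm M (%x. ph n x - w x)) ~~> 0"
  by (rule tendsto_sandwich[OF _ _ tendsto_const inv]) (use ph(2) in "simp_all add: always_eventually")
 have l2: "(%n. L1_norm M (%x. grad (ph n) x - g x)) ~~> 0"
  by (rule tendsto_sandwich[OF _ _ tendsto_const inv]) (use ph(3) in "simp_all add: always_eventually")
 note m = smooth_mM[OF ph(1)]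
 have wm: "w : bmeas M" "g : bmeas M" using w by simp_all
 have "\<exists>ta\<in>bmeas S. (%n. \<integral>\<^sup>+x. ennreal (norm (ph n x - ta x) ^ 1) \<partial>S) ~~> 0"
 proof (rule Lp_complete[OF m(3)])
  fix e :: real assume e: "e > 0"
  have "(%n. ennreal (Ctr * (4 * inverse (real (Suc n))))) ~~> ennreal (Ctr * (4 * 0))"
   by (intro tendsto_ennrealI tendsto_mult tendsto_const LIMSEQ_inverse_real_of_nat)
  then have "eventually (%n. ennreal (Ctr * (4 * inverse (real (Suc n)))) < ennreal e) sequentially"
   by (rule order_tendstoD(2)) (use ennreal_less_iff[of 0 e] e in simp)
  then obtain N where N: "ennreal (Ctr * (4 * inverse (real (Suc N)))) < ennreal e" using eventually_happens[of _ sequentially] by force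
  have "L1_norm S (%x. ph i x - ph j x) < ennreal e" if ij: "i >= N" "j >= N" for i j
  proof -
   let ?d = "%x. 1 * ph i x+(-1) * ph j x"
   have sm: "smooth ?d" by (rule smooth_lincomb[OF ph(1) ph(1)])
   have le: "ennreal (inverse (Suc k)) <= ennreal (inverse (Suc N))" if "k >= N" for k
    using that by (intro ennreal_leI) (simp add: field_simps)
   have half: "L1_norm M (%x. p i x - p j x) <= ennreal (2 * inverse (Suc N))"
    if "!!n. L1_norm M (%x. p n x - v x) <= ennreal (inverse (Suc n))" "!!n. p n : bmeas M" "v : bmeas M"
    for p :: "nat => real^'n => 'c::{banach, second_countable_topology}" and v
   proof -
    have "L1_norm M (%x. p i x - p j x)=L1_norm M (%x. (p i x - v x)+(v x - p j x))" by simp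
    also have "... <= L1_norm M (%x. p i x - v x)+L1_norm M (%x. v x - p j x)"
    by (rule L1_norm_triangle) (use that in simp_all)
    also have "L1_norm M (%x. v x - p j x)=L1_norm M (%x. p j x - v x)" by (rule L1_norm_commute)
    also have "L1_norm M (%x. p i x - v x)+L1_norm M (%x. p j x - v x) <= ennreal (inverse (Suc N))+ennreal (inverse (Suc N))"
    by (intro add_mono order_trans[OF that(1) le] ij)
    also have "...=ennreal (2 * inverse (Suc N))" by (subst ennreal_plus[symmetric]) simp_all
    finally show ?thesis .
   qed
   have "L1_norm S (%x. ph i x - ph j x)=L1_norm S ?d" by simp
   also have "... <= ennreal Ctr * (L1_norm M ?d+L1_norm M (grad ?d))" by (rule Ctr(2)[OF sm])
   also have "L1_norm M ?d=L1_norm M (%x. ph i x - ph j x)" by simp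
   also have "L1_norm M (grad ?d)=L1_norm M (%x. grad (ph i) x - grad (ph j) x)"
    unfolding grad_lincomb[OF ph(1) ph(1)] by simp
   also have "ennreal Ctr * (L1_norm M (%x. ph i x - ph j x) + L1_norm M (%x. grad (ph i) x - grad (ph j) x))
    <= ennreal Ctr * (ennreal (2 * inverse (Suc N)) + ennreal (2 * inverse (Suc N)))"
    by (intro mult_left_mono add_mono half[OF ph(2) m(1) wm(1)] half[OF ph(3) m(2) wm(2)]) simp
   also have "...=ennreal (Ctr * (4 * inverse (Suc N)))"
    using Ctr(1) by (simp add: ennreal_mult[symmetric] ennreal_plus[symmetric] del: ennreal_plus)
   finally show ?thesis using N by simp
  qed
  then show "EX N. \<forall>m\<ge>N. \<forall>n\<ge>N. (\<integral>\<^sup>+x. ennreal (norm (ph m x - ph n x) ^ 1) \<partial>S) < ennreal e"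
   unfolding L1_norm_def by (intro exI[of _ N]) simp
 qed simp
 then obtain ta where ta: "ta : bmeas S" "(%n. L1_norm S (%x. ph n x - ta x)) ~~> 0" unfolding L1_norm_def by auto
 have "eventually (%n. L1_norm S (%x. ph n x - ta x) < 1) sequentially" by (rule order_tendstoD(2)[OF ta(2)]) simp
 then obtain n where n: "L1_norm S (%x. ph n x - ta x) < 1" using eventually_happens[of _ sequentially] by force
 have "integrable S ta"
 proof (rule integrableI_bounded[OF ta(1)])
  have fin: "L1_norm M (ph n) < \<infinity>" "L1_norm M (grad (ph n)) < \<infinity>"
  proof -
   have "L1_norm M (ph n) <= L1_norm M (%x. ph n x - w x)+L1_norm M w"
    using L1_norm_triangle[of "%x. ph n x - w x" M w] wm(1) m(1)[of n] by simp
   also have "... <= ennreal (inverse (Suc n))+ennreal (LINT x|M. norm (w x))" by (intro add_mono ph(2)) (simp add: L1_norm_eq[OF w(2)])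
   also have "... < \<infinity>" by simp
   finally show "L1_norm M (ph n) < \<infinity>" .
   have "L1_norm M (grad (ph n)) <= L1_norm M (%x. grad (ph n) x - g x)+L1_norm M g"
    using L1_norm_triangle[of "%x. grad (ph n) x - g x" M g] wm(2) m(2)[of n] by simp
   also have "... <= ennreal (inverse (Suc n))+ennreal (LINT x|M. norm (g x))" by (intro add_mono ph(3)) (simp add: L1_norm_eq[OF w(3)])
   also have "... < \<infinity>" by simp
   finally show "L1_norm M (grad (ph n)) < \<infinity>" .
  qed
  have "L1_norm S ta=L1_norm S (%x. (ta x - ph n x)+ph n x)" by simp
  also have "... <= L1_norm S (%x. ta x - ph n x)+L1_norm S (ph n)" by (rule L1_norm_triangle) (use ta(1) m(3)[of n] in simp_all)
  also have "... <= 1+ennreal Ctr * (L1_norm M (ph n)+L1_norm M (grad (ph n)))"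
   using n by (intro add_mono Ctr(2)[OF ph(1)]) (simp add: L1_norm_commute less_imp_le)
  also have "... < \<infinity>" using fin by (simp add: ennreal_mult_less_top)
  finally show "(\<integral>\<^sup>+x. ennreal (norm (ta x)) \<partial>S) < \<infinity>" by (simp add: L1_norm_def)
 qed
 then have "trace_approx w ta g ph" unfolding trace_approx_def using w ph(1) l1 l2 ta(2) by blast
 then show ?thesis by blast
qed

lemma trace_one: "trace_approx (%x. 1) (%x. 1) (%x. 0) (%n x. 1)"
proof -
 have g1: "grad (%x. 1) x=0" for x :: "real^'n"
  using partial_deriv_locally_const[of UNIV x "%x. 1" 1] by (simp add: vec_eq_iff)
 interpret finite_measure M by (rule finite_measureI) (use M_finite in simp)
 have iS: "integrable S (%x. 1::real)"
 proof (rule integrableI_bounded)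
  have "(\<integral>\<^sup>+x. ennreal (norm (1::real)) \<partial>S)=L1_norm S (%x. 1::real)" by (simp add: L1_norm_def)
  also have "... <= ennreal Ctr * (L1_norm M (%x. 1::real)+L1_norm M (grad (%x. 1)))" by (rule Ctr(2)[OF smooth_const])
  also have "... < \<infinity>" using M_finite unfolding g1 by (simp add: L1_norm_def ennreal_mult_less_top)
  finally show "(\<integral>\<^sup>+x. ennreal (norm (1::real)) \<partial>S) < \<infinity>" .
 qed simp
 have "has_weak_gradient Om (%x. 1::real) (%x. 0)"
  unfolding has_weak_gradient_def
 proof (intro conjI ballI allI)
  show "(%x. 1::real) : L1_loc Om" by (rule integrable_L1_loc[OF _ Om(1)]) simp
  show "(%x. 0::real^'n) : L1_loc Om" by (rule integrable_L1_loc[OF _ Om(1)]) simp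
  fix ph j assume ph: "ph : test_functions Om"
  have "(LINT x|M. pderv j ph x *\<^sub>R (1::real))=(LINT x|lborel. pderv j ph x *\<^sub>R 1)"
   by (rule lebesgue_on_transfer(1)[OF _ Om(1)])
    (use test_function_lebesgue_measurable(2)[OF ph] test_functionsD(8)[OF ph] test_function_deriv_outside[OF ph] in simp_all)
  also have "...=0" using integral_deriv_zero(2)[OF test_functionsD(2,3)[OF ph], of "axis j 1"] by (simp add: partial_deriv_def)
  finally show "(LINT x|M. pderv j ph x *\<^sub>R (1::real))=- (LINT x|M. ph x *\<^sub>R (0::real^'n) $ j)" by simp
 qed
 then show ?thesis unfolding trace_approx_def using iS by (simp add: smooth_const g1) (simp add: L1_norm_def)
qed

end

section \<open>The Robin form\<close>

lemma has_weak_gradient_cong: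
 fixes u u' :: "real^'n => 'b::euclidean_space"
 assumes Om: "open Om" and w: "has_weak_gradient Om u g"
  and u': "integrable (lebesgue_on Om) u'" "AE x in lebesgue_on Om. u x=u' x"
  and g': "integrable (lebesgue_on Om) g'" "AE x in lebesgue_on Om. g x=g' x"
 shows "has_weak_gradient Om u' g'"
 unfolding has_weak_gradient_def
proof (intro conjI ballI allI integrable_L1_loc[OF u'(1) Om] integrable_L1_loc[OF g'(1) Om])
 let ?M = "lebesgue_on Om"
 fix ph j assume ph: "ph : test_functions Om"
 have m: "u : bmeas ?M" "g : bmeas ?M" "u' : bmeas ?M" "g' : bmeas ?M"
  using w u'(1) g'(1) by (simp_all add: has_weak_gradient_def L1_loc_def)
 note mg = borel_measurable_vec_nth[OF m(2)] borel_measurable_vec_nth[OF m(4)]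
 note p = test_function_lebesgue_measurable[OF ph, where S=Om]
 have "(LINT x|?M. pderv j ph x *\<^sub>R u' x)=(LINT x|?M. pderv j ph x *\<^sub>R u x)"
  by (rule integral_cong_AE) (use m p u'(2) in auto)
 also have "...=- (LINT x|?M. ph x *\<^sub>R g x $ j)" using w ph unfolding has_weak_gradient_def by blast
 also have "(LINT x|?M. ph x *\<^sub>R g x $ j)=(LINT x|?M. ph x *\<^sub>R g' x $ j)"
  by (rule integral_cong_AE) (use mg p g'(2) in auto)
 finally show "(LINT x|?M. pderv j ph x *\<^sub>R u' x)=- (LINT x|?M. ph x *\<^sub>R g' x $ j)" .
qed

lemma norm_smult: "norm (a *s (x :: complex^'n))=cmod a * norm x"
 by (simp add: norm_vec_def norm_mult L2_set_right_distrib[symmetric])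

lemma smult_measurable: "g : bmeas M ==> (%x. a *s (g x :: complex^'n)) : bmeas M"
 unfolding vector_scalar_mult_def
 by (intro borel_measurable_vec_lambda borel_measurable_times borel_measurable_const borel_measurable_vec_nth)

lemma L2_smult: "g : L2 M ==> (%x. a *s (g x :: complex^'n)) : L2 M"
 by (rule L2_dominated[where w="%x. (cmod a)\<^sup>2 * (norm (g x))\<^sup>2"])
  (auto simp: L2_iff norm_smult power_mult_distrib smult_measurable)

locale robin_setting = trace_domain Om for Om :: "(real^'n) set" +
 fixes A :: "real^'n => real^'n" and V \<sigma> :: "real^'n => real"
 assumes A: "A : L2 (lebesgue_on Om)" and V: "integrable (lebesgue_on Om) V"
  and V0: "AE x in lebesgue_on Om. 0 <= V x" and \<sigma>: "\<sigma> : L_infty (surface_measure Om)"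
begin

subsection \<open>The boundary term\<close>

definition bint :: "(real^'n => real) => real" where
 "bint w=(LINT x|S. \<sigma> x * boundary_trace Om w x)"

definition W11 :: "(real^'n => real) => (real^'n => real^'n) => bool" where
 "W11 w g \<longleftrightarrow> has_weak_gradient Om w g & integrable M w & integrable M g"

lemma W11_trace: "W11 w g ==> \<exists>ta ph. trace_approx w ta g ph"
 unfolding W11_def by (blast intro: trace_exists)

lemma \<sigma>_measurable: "\<sigma> : bmeas S" using \<sigma> by (simp add: L_infty_def)

lemma \<sigma>_bound: "\<exists>C\<ge>0. AE x in S. \<bar>\<sigma> x\<bar> <= C"
proof -
 obtain C where "AE x in S. \<bar>\<sigma> x\<bar> <= C" using \<sigma> unfolding L_infty_def by blast
 then have "AE x in S. \<bar>\<sigma> x\<bar> <= \<bar>C\<bar>" by eventually_elim linarith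
 then show ?thesis using abs_ge_zero by blast
qed

lemma \<sigma>_integrable: assumes "integrable S ta" shows "integrable S (%x. \<sigma> x * ta x)"
proof -
 obtain C where C: "AE x in S. \<bar>\<sigma> x\<bar> <= C" "C >= 0" using \<sigma>_bound by blast
 show ?thesis
 proof (rule Bochner_Integration.integrable_bound)
  show "integrable S (%x. C * ta x)" using assms by simp
  show "(%x. \<sigma> x * ta x) : bmeas S" using \<sigma>_measurable assms by simp
  show "AE x in S. norm (\<sigma> x * ta x) <= norm (C * ta x)"
   using C(1) by eventually_elim (use C(2) in "simp add: abs_mult mult_right_mono")
 qed
qed

text \<open>The chosen trace in the definition of the form may be replaced by any other, because traces are unique almost everywhere.\<close>

lemma bint_eq:
 assumes t: "trace_approx w ta g ph"
 shows "bint w=(LINT x|S. \<sigma> x * ta x)"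
proof -
 have "has_trace Om w ta" using t has_trace_iff by blast
 then have "has_trace Om w (boundary_trace Om w)" unfolding boundary_trace_def by (rule someI[of "has_trace Om w" ta])
 then obtain g' ph' where t': "trace_approx w (boundary_trace Om w) g' ph'" using has_trace_iff by blast
 have "AE x in S. boundary_trace Om w x=ta x" by (rule trace_unique[OF t' t]) simp
 then show ?thesis unfolding bint_def
  by (intro integral_cong_AE) (use \<sigma>_measurable trace_approxD(2)[OF t] trace_approxD(2)[OF t'] in "auto")
qed

lemma W11_lincomb: "W11 w g ==> W11 w' g' ==> W11 (%x. a * w x+b * w' x) (%x. a *\<^sub>R g x+b *\<^sub>R g' x)"
 using W11_trace[of w g] W11_trace[of w' g'] trace_approxD(1,3,4)[OF trace_approx_lincomb, of w _ g _ w' _ g' _ a b]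
 unfolding W11_def by blast

lemma bint_lincomb:
 assumes w: "W11 w g" and w': "W11 w' g'"
 shows "bint (%x. a * w x+b * w' x)=a * bint w+b * bint w'"
proof -
 obtain ta ph ta' ph' where t: "trace_approx w ta g ph" "trace_approx w' ta' g' ph'" using W11_trace[OF w] W11_trace[OF w'] by blast
 have "bint (%x. a * w x+b * w' x)=(LINT x|S. a * (\<sigma> x * ta x)+b * (\<sigma> x * ta' x))"
  unfolding bint_eq[OF trace_approx_lincomb[OF t]] by (simp add: algebra_simps)
 also have "...=a * (LINT x|S. \<sigma> x * ta x)+b * (LINT x|S. \<sigma> x * ta' x)"
  using \<sigma>_integrable trace_approxD(2)[OF t(1)] trace_approxD(2)[OF t(2)] by simp
 finally show ?thesis unfolding bint_eq[OF t(1)] bint_eq[OF t(2)] .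
qed

lemma bint_bound: "\<exists>K\<ge>0. \<forall>w g. W11 w g --> \<bar>bint w\<bar> <= K * ((LINT x|M. \<bar>w x\<bar>)+(LINT x|M. norm (g x)))"
proof -
 obtain C where C: "AE x in S. \<bar>\<sigma> x\<bar> <= C" "C >= 0" using \<sigma>_bound by blast
 have "\<bar>bint w\<bar> <= C * Ctr * ((LINT x|M. \<bar>w x\<bar>)+(LINT x|M. norm (g x)))" if w: "W11 w g" for w g
 proof -
  obtain ta ph where t: "trace_approx w ta g ph" using W11_trace[OF w] by blast
  note T = trace_approxD[OF t]
  have "ennreal (LINT x|S. norm (ta x)) <= ennreal Ctr * (ennreal (LINT x|M. norm (w x))+ennreal (LINT x|M. norm (g x)))"
   using trace_approx_bound[OF t] unfolding L1_norm_eq[OF T(1)] L1_norm_eq[OF T(2)] L1_norm_eq[OF T(4)] .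
  also have "...=ennreal (Ctr * ((LINT x|M. norm (w x))+(LINT x|M. norm (g x))))"
   using Ctr(1) by (simp add: ennreal_mult)
  finally have b: "(LINT x|S. norm (ta x)) <= Ctr * ((LINT x|M. norm (w x))+(LINT x|M. norm (g x)))"
   by (subst (asm) ennreal_le_iff) (use Ctr(1) in "simp_all")
  have "\<bar>bint w\<bar> <= (LINT x|S. norm (\<sigma> x * ta x))" unfolding bint_eq[OF t] using integral_norm_bound[of S "%x. \<sigma> x * ta x"] by simp
  also have "... <= (LINT x|S. C * norm (ta x))"
  proof (rule integral_mono_AE)
   show "integrable S (%x. norm (\<sigma> x * ta x))" by (rule integrable_norm[OF \<sigma>_integrable[OF T(2)]])
   show "integrable S (%x. C * norm (ta x))" using T(2) by simp
   show "AE x in S. norm (\<sigma> x * ta x) <= C * norm (ta x)"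
    using C(1) by eventually_elim (simp add: abs_mult mult_right_mono)
  qed
  also have "...=C * (LINT x|S. norm (ta x))" by simp
  also have "... <= C * (Ctr * ((LINT x|M. norm (w x))+(LINT x|M. norm (g x))))" by (rule mult_left_mono[OF b C(2)])
  finally show ?thesis by (simp add: mult.assoc)
 qed
 then show ?thesis using C(2) Ctr(1) by (intro exI[of _ "C * Ctr"]) simp
qed

subsection \<open>The magnetic gradient\<close>

definition mg :: "(real^'n => complex) => (real^'n => complex^'n) => bool" where
 "mg u g \<longleftrightarrow> u : L2 M & g : L2 M & has_magnetic_gradient Om A u g"

abbreviation full :: "(real^'n => complex) => (real^'n => complex^'n) => real^'n => complex^'n" where
 "full u g x \<equiv> (\<chi> j. g x $ j+\<i> * cof (A x $ j) * u x)"

lemma A_nth_measurable: "(%x. A x $ j) : bmeas M"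
 by (rule borel_measurable_vec_nth[OF L2_measurable[OF A]])

lemma full_integrable:
 assumes "u : L2 M" "g : L2 M" shows "integrable M (full u g)"
proof (rule integrable_vec_lambda, rule Bochner_Integration.integrable_add)
 fix j
 show "integrable M (%x. g x $ j)" by (rule integrable_vec_nth[OF L2_imp_integrable[OF M_finite assms(2)]])
 show "integrable M (%x. \<i> * cof (A x $ j) * u x)"
  by (rule L2_product_integrable[OF A assms(1)])
   (use A_nth_measurable[of j] L2_measurable[OF assms(1)] in
    \<open>simp_all add: norm_mult mult_right_mono component_le_norm_cart\<close>)
qed

lemma mgD:
 assumes "mg u g"
 shows "u : L2 M" "g : L2 M" "has_weak_gradient Om u (full u g)" "integrable M u" "integrable M (full u g)" "integrable M g"
 using assms full_integrable L2_imp_integrable[OF M_finite] unfolding mg_def has_magnetic_gradient_def by blast+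

lemma mg_unique:
 assumes u: "mg u g" and u': "mg u' g'" and ae: "AE x in M. u x=u' x"
 shows "AE x in M. g x=g' x"
 using weak_gradient_unique[OF mgD(3,4,5)[OF u] mgD(3,4,5)[OF u'] ae] ae
 by eventually_elim (simp add: vec_eq_iff)

lemma mg_cong:
 assumes u: "mg u g" and u': "u' : L2 M" and ae: "AE x in M. u x=u' x"
 shows "mg u' g"
 unfolding mg_def has_magnetic_gradient_def
proof (intro conjI u' mgD(2)[OF u])
 show "has_weak_gradient Om u' (full u' g)"
  by (rule has_weak_gradient_cong[OF Om(1) mgD(3)[OF u] L2_imp_integrable[OF M_finite u'] ae full_integrable[OF u' mgD(2)[OF u]]])
   (use ae in eventually_elim, simp)
qed

lemma mg_lincomb:
 assumes u: "mg u g" and v: "mg v h"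
 shows "mg (%x. a * u x+b * v x) (%x. a *s g x+b *s h x)"
 unfolding mg_def has_magnetic_gradient_def
proof (intro conjI)
 show "(%x. a * u x+b * v x) : L2 M" by (intro L2_add L2_cmult mgD(1)[OF u] mgD(1)[OF v])
 show "(%x. a *s g x+b *s h x) : L2 M" by (intro L2_add L2_smult mgD(2)[OF u] mgD(2)[OF v])
 have "has_weak_gradient Om (%x. a * u x+b * v x) (%x. \<chi> j. a * full u g x $ j+b * full v h x $ j)"
  by (rule has_weak_gradient_lincomb[OF Om(1) mgD(3,4,5)[OF u] mgD(3,4,5)[OF v]]) (rule bounded_linear_mult_right)+
 moreover have "(%x. \<chi> j. a * full u g x $ j+b * full v h x $ j)=full (%x. a * u x+b * v x) (%x. a *s g x+b *s h x)"
  by (simp add: fun_eq_iff vec_eq_iff algebra_simps)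
 ultimately show "has_weak_gradient Om (%x. a * u x+b * v x) (full (%x. a * u x+b * v x) (%x. a *s g x+b *s h x))" by simp
qed

lemma norm_inner_nth_le: "norm (\<chi> j. (c::complex) \<bullet> (y::complex^'n) $ j) <= cmod c * norm y"
proof -
 have "norm (\<chi> j. c \<bullet> y $ j) <= L2_set (%j. cmod c * norm (y $ j)) UNIV"
  unfolding norm_vec_def by (rule L2_set_mono) (simp_all add: Cauchy_Schwarz_ineq2)
 also have "...=cmod c * norm y" by (simp add: norm_vec_def L2_set_right_distrib[symmetric])
 finally show ?thesis .
qed

lemma inner_nth_integrable:
 fixes g :: "real^'n => complex^'n"
 assumes "u : L2 M" "g : L2 M" shows "integrable M (%x. \<chi> j. u x \<bullet> g x $ j)"
 by (rule L2_product_integrable[OF assms])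
  (use L2_measurable[OF assms(1)] borel_measurable_vec_nth[OF L2_measurable[OF assms(2)]] norm_inner_nth_le in
   \<open>auto intro!: borel_measurable_vec_lambda\<close>)

text \<open>The magnetic term \<open>iAu\<close> is orthogonal to \<open>u\<close> as a real vector and drops out of the gradient of \<open>\<bar>u\<bar>\<^sup>2\<close>.\<close>

lemma mg_square:
 assumes u: "mg u g"
 shows "W11 (%x. (cmod (u x))\<^sup>2) (%x. 2 *\<^sub>R (\<chi> j. u x \<bullet> g x $ j))"
proof -
 note m = mgD[OF u]
 obtain f where f: "f : bmeas borel" "!!x. x ~: Om ==> f x=0" "AE x in M. u x=f x"
  using lebesgue_borel_representative[OF L2_measurable[OF m(1)] Om(1)] by blast
 obtain G where G: "G : bmeas borel" "!!x. x ~: Om ==> G x=0" "AE x in M. full u g x=G x"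
  using lebesgue_borel_representative[OF borel_measurable_integrable[OF m(5)] Om(1)] by blast
 define h where "h x=(\<chi> j. f x \<bullet> G x $ j)" for x
 have hb: "h : bmeas borel" unfolding h_def[abs_def]
  using f(1) borel_measurable_vec_nth[OF G(1)] by (auto intro!: borel_measurable_vec_lambda)
 have h0: "h x=0" if "x ~: Om" for x using f(2)[OF that] by (simp add: h_def vec_eq_iff)
 have hae: "AE x in M. (\<chi> j. u x \<bullet> g x $ j)=h x"
  using f(3) G(3)
 proof eventually_elim
  case (elim x)
  have "f x \<bullet> (\<i> * cof (A x $ j) * f x)=0" for j
   by (simp add: inner_complex_def algebra_simps)
  moreover have "G x $ j=g x $ j+\<i> * cof (A x $ j) * f x" for j using elim by (simp add: vec_eq_iff)
  ultimately show ?case using elim(1) by (simp add: h_def vec_eq_iff inner_add_right)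
 qed
 have ik: "integrable M (%x. \<chi> j. u x \<bullet> g x $ j)" by (rule inner_nth_integrable[OF m(1,2)])
 have hi: "integ h"
  using lebesgue_on_transfer(2)[OF borel_measurable_integrable[OF ik] Om(1) hb h0 hae] ik by blast
 have sqm: "(%x. (cmod (u x))\<^sup>2) : bmeas M" using L2_measurable[OF m(1)] by measurable
 have sqae: "AE x in M. (cmod (u x))\<^sup>2=(cmod (f x))\<^sup>2" using f(3) by eventually_elim simp
 have sqi: "integ (%x. (cmod (f x))\<^sup>2)"
  using lebesgue_on_transfer(2)[OF sqm Om(1) _ _ sqae] L2_integrable_sq[OF m(1)] f(1,2) by simp
 have w: "wgrad Om f G" by (rule has_weak_gradient_imp_wgrad[OF m(3,4,5) Om(1) f G])
 have w2: "wgrad Om (%x. (cmod (f x))\<^sup>2) (%x. 2 *\<^sub>R h x)"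
  by (rule wgrad_square[OF w Om(1) hi h0 _ sqi]) (simp_all add: h_def)
 have "(%x. 2 *\<^sub>R (\<chi> j. u x \<bullet> g x $ j)) : bmeas M" using ik by simp
 moreover have "AE x in M. 2 *\<^sub>R (\<chi> j. u x \<bullet> g x $ j)=2 *\<^sub>R h x" using hae by eventually_elim simp
 ultimately show ?thesis unfolding W11_def using wgrad_imp_has_weak_gradient[OF w2 Om(1) sqm sqae] by blast
qed

lemma mg_inner:
 assumes u: "mg u g" and v: "mg v h"
 shows "W11 (%x. u x \<bullet> v x) (%x. (\<chi> j. u x \<bullet> h x $ j)+(\<chi> j. v x \<bullet> g x $ j))"
proof -
 have c: "(1/4) * (cmod (1 * z+1 * w))\<^sup>2+(-1/4) * (cmod (1 * z+(-1) * w))\<^sup>2=z \<bullet> w" for z w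
  by (simp add: power2_norm_eq_inner inner_diff inner_add inner_commute field_simps)
 have d: "(1/4) *\<^sub>R (2 *\<^sub>R (\<chi> j. (1 * z + 1 * w) \<bullet> (1 *s p + 1 *s q) $ j)) + (-1/4) *\<^sub>R (2 *\<^sub>R (\<chi> j. (1 * z + (-1) * w) \<bullet> (1 *s p + (-1) *s q) $ j))
  = (\<chi> j. z \<bullet> q $ j) + (\<chi> j. w \<bullet> p $ j)" for z w :: complex and p q :: "complex^'n"
  by (simp add: vec_eq_iff inner_diff inner_add algebra_simps)
 show ?thesis
  using W11_lincomb[OF mg_square[OF mg_lincomb[OF u v, of 1 1]] mg_square[OF mg_lincomb[OF u v, of 1 "-1"]], of "1/4" "-1/4"]
  unfolding c d .
qed

subsection \<open>The sesquilinear form\<close>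

abbreviation D :: "(real^'n => complex) set" where "D \<equiv> robin_domain Om A V"
abbreviation "Dg \<equiv> magnetic_gradient Om A"
abbreviation "rV x \<equiv> cof (sqrt (V x))"

lemma D_iff: "u : D \<longleftrightarrow> (EX g. mg u g) & (%x. rV x * u x) : L2 M"
 unfolding robin_domain_def mg_def by blast

lemma mg_Dg: "mg u g ==> mg u (Dg u)"
proof -
 assume "mg u g"
 then have "u : L2 M" "g : L2 M & has_magnetic_gradient Om A u g" unfolding mg_def by blast+
 then show ?thesis unfolding mg_def magnetic_gradient_def using someI[of "%g. g : L2 M & has_magnetic_gradient Om A u g" g] by blast
qed

lemma D_mg: "u : D ==> mg u (Dg u)" using D_iff mg_Dg by blast
lemma D_L2: "u : D ==> u : L2 M" using D_mg mgD(1) by blast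
lemma D_rV: "u : D ==> (%x. rV x * u x) : L2 M" using D_iff by blast

lemma D_lincomb:
 assumes u: "u : D" and v: "v : D" shows "(%x. a * u x+b * v x) : D"
proof -
 have "(%x. a * (rV x * u x)+b * (rV x * v x)) : L2 M" by (intro L2_add L2_cmult D_rV u v)
 moreover have "(%x. a * (rV x * u x)+b * (rV x * v x))=(%x. rV x * (a * u x+b * v x))" by (simp add: fun_eq_iff algebra_simps)
 ultimately show ?thesis unfolding D_iff using mg_lincomb[OF D_mg[OF u] D_mg[OF v]] by auto
qed

lemma D_cmult: "u : D ==> (%x. c * u x) : D" using D_lincomb[of u u c 0] by simp

definition F :: "(real^'n => complex) => real^'n => complex \<times> complex \<times> (complex^'n)" where
 "F u x=(u x, rV x * u x, Dg u x)"

lemma norm_F: "(norm (F u x))\<^sup>2=(cmod (u x))\<^sup>2+(cmod (rV x * u x))\<^sup>2+(norm (Dg u x))\<^sup>2"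
 by (simp add: F_def norm_Pair)

lemma norm_F_ge: "cmod (u x) <= norm (F u x)" "norm (Dg u x) <= norm (F u x)"
proof -
 show "cmod (u x) <= norm (F u x)" using norm_fst_le[of "u x" "(rV x * u x, Dg u x)"] by (simp add: F_def)
 have "norm (Dg u x) <= norm (rV x * u x, Dg u x)" by (rule norm_snd_le)
 also have "... <= norm (F u x)" unfolding F_def by (rule norm_snd_le)
 finally show "norm (Dg u x) <= norm (F u x)" .
qed

lemma F_L2: assumes u: "u : D" shows "F u : L2 M"
 unfolding L2_iff norm_F
proof
 note m = D_L2[OF u] D_rV[OF u] mgD(2)[OF D_mg[OF u]]
 show "F u : bmeas M" unfolding F_def[abs_def] by (intro borel_measurable_Pair L2_measurable m)
 show "integrable M (%x. (cmod (u x))\<^sup>2+(cmod (rV x * u x))\<^sup>2+(norm (Dg u x))\<^sup>2)"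
  by (intro Bochner_Integration.integrable_add L2_integrable_sq m)
qed

lemma Dg_lincomb:
 assumes u: "u : D" and v: "v : D"
 shows "AE x in M. Dg (%x. a * u x+b * v x) x=a *s Dg u x+b *s Dg v x"
 by (rule mg_unique[OF mg_Dg[OF mg_lincomb[OF D_mg[OF u] D_mg[OF v]]] mg_lincomb[OF D_mg[OF u] D_mg[OF v]]]) simp

lemma of_real_smult: "cof a *s x=a *\<^sub>R (x :: complex^'n)"
 unfolding vector_scalar_mult_def vec_eq_iff by (simp add: scaleR_conv_of_real[where 'a=complex])

lemma F_lincomb:
 assumes u: "u : D" and v: "v : D"
 shows "AE x in M. F (%x. of_real a * u x + of_real b * v x) x=a *\<^sub>R F u x+b *\<^sub>R F v x"
 using Dg_lincomb[OF assms, of "of_real a" "of_real b"]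
 by eventually_elim (simp add: F_def of_real_smult scaleR_conv_of_real algebra_simps)

lemma F_i_inner:
 assumes u: "u : D" and v: "v : D"
 shows "AE x in M. F (%x. \<i> * u x) x \<bullet> F (%x. \<i> * v x) x=F u x \<bullet> F v x"
proof -
 have i: "(\<i> * z) \<bullet> (\<i> * w)=z \<bullet> w" for z w by (simp add: inner_complex_def)
 have j: "(\<i> *s p) \<bullet> (\<i> *s q)=p \<bullet> q" for p q :: "complex^'n" by (simp add: inner_vec_def i)
 have k: "rV x * (\<i> * z)=\<i> * (rV x * z)" for x z by simp
 show ?thesis using Dg_lincomb[OF u u, of \<i> 0] Dg_lincomb[OF v v, of \<i> 0]
  by eventually_elim (simp add: F_def k i j)
qed

lemma L2_inner_real_integrable: 
 fixes f g :: "real^'n => 'b::euclidean_space"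
 assumes "f : L2 M" "g : L2 M" shows "integrable M (%x. f x \<bullet> g x)"
 by (rule L2_product_integrable[OF assms])
  (use L2_measurable[OF assms(1)] L2_measurable[OF assms(2)] Cauchy_Schwarz_ineq2 in "auto intro!: borel_measurable_inner")

definition R :: "(real^'n => complex) => (real^'n => complex) => real" where
 "R u v=(LINT x|M. F u x \<bullet> F v x) - (LINT x|M. u x \<bullet> v x)+bint (%x. u x \<bullet> v x)"

abbreviation "q \<equiv> robin_form Om A V \<sigma>"

lemma q_eq: assumes u: "u : D" shows "q u=R u u"
proof -
 note m = D_L2[OF u] D_rV[OF u] mgD(2)[OF D_mg[OF u]]
 have "(LINT x|M. V x * (cmod (u x))\<^sup>2)=(LINT x|M. (cmod (rV x * u x))\<^sup>2)"
 proof (rule integral_cong_AE)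
  show "(%x. V x * (cmod (u x))\<^sup>2) : bmeas M" using V L2_measurable[OF m(1)] by simp
  show "(%x. (cmod (rV x * u x))\<^sup>2) : bmeas M" using L2_measurable[OF m(2)] by simp
  show "AE x in M. V x * (cmod (u x))\<^sup>2=(cmod (rV x * u x))\<^sup>2"
   using V0 by eventually_elim (simp add: norm_mult power_mult_distrib)
 qed
 moreover have "(LINT x|M. F u x \<bullet> F u x)=(LINT x|M. (cmod (u x))\<^sup>2)+(LINT x|M. (cmod (rV x * u x))\<^sup>2)+(LINT x|M. (norm (Dg u x))\<^sup>2)"
  unfolding power2_norm_eq_inner[symmetric] norm_F using L2_integrable_sq[OF m(1)] L2_integrable_sq[OF m(2)] L2_integrable_sq[OF m(3)] by simp
 ultimately show ?thesis unfolding R_def robin_form_def bint_def[symmetric] by (simp add: power2_norm_eq_inner)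
qed

lemma R_sym: "R u v=R v u" unfolding R_def by (simp add: inner_commute)

lemma R_lincomb:
 assumes u: "u : D" and u': "u' : D" and v: "v : D"
 shows "R (%x. of_real a * u x + of_real b * u' x) v=a * R u v+b * R u' v"
proof -
 let ?w = "%x. of_real a * u x + of_real b * u' x"
 have w: "?w : D" by (rule D_lincomb[OF u u'])
 note i = L2_inner_real_integrable[OF F_L2 F_L2] L2_inner_real_integrable[OF D_L2 D_L2]
 have e: "?w x \<bullet> v x=a * (u x \<bullet> v x)+b * (u' x \<bullet> v x)" for x
  by (simp add: inner_add_left scaleR_conv_of_real[symmetric])
 have "(LINT x|M. F ?w x \<bullet> F v x)=(LINT x|M. a * (F u x \<bullet> F v x)+b * (F u' x \<bullet> F v x))"
 proof (rule integral_cong_AE)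
  show "AE x in M. F ?w x \<bullet> F v x=a * (F u x \<bullet> F v x)+b * (F u' x \<bullet> F v x)"
   using F_lincomb[OF u u', of a b] by eventually_elim (simp add: inner_add_left)
 qed (use i(1)[OF w v] i(1)[OF u v] i(1)[OF u' v] in simp_all)
 also have "...=a * (LINT x|M. F u x \<bullet> F v x)+b * (LINT x|M. F u' x \<bullet> F v x)"
  using i(1)[OF u v] i(1)[OF u' v] by simp
 finally have 1: "(LINT x|M. F ?w x \<bullet> F v x)=a * (LINT x|M. F u x \<bullet> F v x)+b * (LINT x|M. F u' x \<bullet> F v x)" .
 have 2: "(LINT x|M. ?w x \<bullet> v x)=a * (LINT x|M. u x \<bullet> v x)+b * (LINT x|M. u' x \<bullet> v x)"
  unfolding e using i(2)[OF u v] i(2)[OF u' v] by simp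
 have 3: "bint (%x. ?w x \<bullet> v x)=a * bint (%x. u x \<bullet> v x)+b * bint (%x. u' x \<bullet> v x)"
  unfolding e by (rule bint_lincomb[OF mg_inner[OF D_mg D_mg] mg_inner[OF D_mg D_mg]]) (use u u' v in simp_all)
 show ?thesis unfolding R_def 1 2 3 by (simp add: algebra_simps)
qed

lemma R_i: assumes u: "u : D" and v: "v : D" shows "R (%x. \<i> * u x) (%x. \<i> * v x)=R u v"
proof -
 have i: "(\<i> * z) \<bullet> (\<i> * w)=z \<bullet> w" for z w by (simp add: inner_complex_def)
 have "(LINT x|M. F (%x. \<i> * u x) x \<bullet> F (%x. \<i> * v x) x)=(LINT x|M. F u x \<bullet> F v x)"
  by (rule integral_cong_AE[OF _ _ F_i_inner[OF u v]])
   (use L2_inner_real_integrable[OF F_L2 F_L2] D_cmult u v in "blast intro: borel_measurable_integrable")+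
 then show ?thesis unfolding R_def i by simp
qed

lemma bint_inner_bound: "\<exists>K\<ge>0. \<forall>u\<in>D. \<forall>v\<in>D. \<bar>bint (%x. u x \<bullet> v x)\<bar> \<le>
  K * (LINT x|M. cmod (u x) * cmod (v x) + (cmod (u x) * norm (Dg v x) + cmod (v x) * norm (Dg u x)))"
proof -
 obtain K where K: "K >= 0" "!!w g. W11 w g ==> \<bar>bint w\<bar> <= K * ((LINT x|M. \<bar>w x\<bar>)+(LINT x|M. norm (g x)))" using bint_bound by blast
 have "\<bar>bint (%x. u x \<bullet> v x)\<bar> <= K * (LINT x|M. cmod (u x) * cmod (v x)+(cmod (u x) * norm (Dg v x)+cmod (v x) * norm (Dg u x)))"
  if u: "u : D" and v: "v : D" for u v
 proof -
  have ni: "integrable M (%x. norm (p x) * norm (r x))" if "p : L2 M" "r : L2 M" for p :: "real^'n => complex" and r :: "real^'n => 'c::euclidean_space"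
   by (rule L2_product_integrable[OF that]) (use that[THEN L2_measurable] in simp_all)
  note W = mg_inner[OF D_mg[OF u] D_mg[OF v]]
  let ?g = "%x. (\<chi> j. u x \<bullet> Dg v x $ j)+(\<chi> j. v x \<bullet> Dg u x $ j)"
  have i: "integrable M (%x. \<bar>u x \<bullet> v x\<bar>)" "integrable M (%x. norm (?g x))" using W unfolding W11_def by simp_all
  note n = ni[OF D_L2[OF u] D_L2[OF v]] ni[OF D_L2[OF u] mgD(2)[OF D_mg[OF v]]] ni[OF D_L2[OF v] mgD(2)[OF D_mg[OF u]]]
  have "\<bar>bint (%x. u x \<bullet> v x)\<bar> <= K * ((LINT x|M. \<bar>u x \<bullet> v x\<bar>)+(LINT x|M. norm (?g x)))" by (rule K(2)[OF W])
  also have "(LINT x|M. \<bar>u x \<bullet> v x\<bar>)+(LINT x|M. norm (?g x))=(LINT x|M. \<bar>u x \<bullet> v x\<bar>+norm (?g x))" using i by simp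
  also have "... <= (LINT x|M. cmod (u x) * cmod (v x)+(cmod (u x) * norm (Dg v x)+cmod (v x) * norm (Dg u x)))"
  proof (rule integral_mono)
   show "integrable M (%x. \<bar>u x \<bullet> v x\<bar>+norm (?g x))" using i by simp
   show "integrable M (%x. cmod (u x) * cmod (v x)+(cmod (u x) * norm (Dg v x)+cmod (v x) * norm (Dg u x)))" using n by simp
   fix x
   show "\<bar>u x \<bullet> v x\<bar>+norm (?g x) <= cmod (u x) * cmod (v x)+(cmod (u x) * norm (Dg v x)+cmod (v x) * norm (Dg u x))"
    by (intro add_mono Cauchy_Schwarz_ineq2 order_trans[OF norm_triangle_ineq] norm_inner_nth_le)
  qed
  finally show ?thesis using K(1) by (simp add: mult_left_mono)
 qed
 then show ?thesis using K(1) by blast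
qed

abbreviation "N u \<equiv> (LINT x|M. (norm (F u x))\<^sup>2)"

lemma R_bound: "\<exists>C\<ge>0. \<forall>u\<in>D. \<forall>v\<in>D. \<bar>R u v\<bar> <= C * sqrt (N u * N v)"
proof -
 obtain K where K: "K >= 0" "!!u v. u : D ==> v : D ==> \<bar>bint (%x. u x \<bullet> v x)\<bar> \<le>
  K * (LINT x|M. cmod (u x) * cmod (v x) + (cmod (u x) * norm (Dg v x) + cmod (v x) * norm (Dg u x)))" using bint_inner_bound by blast
 have "\<bar>R u v\<bar> <= (2+3 * K) * sqrt (N u * N v)" if u: "u : D" and v: "v : D" for u v
 proof -
  let ?I = "LINT x|M. norm (F u x) * norm (F v x)"
  note m = F_L2[OF u] F_L2[OF v]
  have i: "integrable M (%x. norm (F u x) * norm (F v x))"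
   by (rule L2_product_integrable[OF m]) (use m[THEN L2_measurable] in simp_all)
  have 1: "\<bar>LINT x|M. F u x \<bullet> F v x\<bar> <= ?I"
   by (rule order_trans[OF integral_abs_bound], rule integral_mono'[OF i]) (simp_all add: Cauchy_Schwarz_ineq2)
  have 2: "\<bar>LINT x|M. u x \<bullet> v x\<bar> <= ?I"
   by (rule order_trans[OF integral_abs_bound], rule integral_mono'[OF i])
    (auto intro!: order_trans[OF Cauchy_Schwarz_ineq2] mult_mono norm_F_ge)
  have "(LINT x|M. cmod (u x) * cmod (v x)+(cmod (u x) * norm (Dg v x)+cmod (v x) * norm (Dg u x))) <= (LINT x|M. 3 * (norm (F u x) * norm (F v x)))"
  proof (rule integral_mono')
   show "integrable M (%x. 3 * (norm (F u x) * norm (F v x)))" using i by simp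
   fix x
   have "cmod (u x) * cmod (v x) <= norm (F u x) * norm (F v x)" "cmod (u x) * norm (Dg v x) <= norm (F u x) * norm (F v x)"
    "cmod (v x) * norm (Dg u x) <= norm (F v x) * norm (F u x)" by (intro mult_mono norm_F_ge norm_ge_zero)+
   then show "cmod (u x) * cmod (v x)+(cmod (u x) * norm (Dg v x)+cmod (v x) * norm (Dg u x)) <= 3 * (norm (F u x) * norm (F v x))" by (simp add: mult.commute)
  qed simp
  then have "\<bar>bint (%x. u x \<bullet> v x)\<bar> <= K * (3 * ?I)" using order_trans[OF K(2)[OF u v] mult_left_mono[OF _ K(1)]] by simp
  then have "\<bar>R u v\<bar> <= (2+3 * K) * ?I" unfolding R_def using 1 2 by (simp add: algebra_simps)
  also have "... <= (2+3 * K) * sqrt (N u * N v)"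
   by (intro mult_left_mono real_le_rsqrt L2_cauchy_schwarz m) (use K(1) in simp)
  finally show ?thesis .
 qed
 then show ?thesis using K(1) by (intro exI[of _ "2+3 * K"]) simp
qed

text \<open>The boundary term costs \<open>\<bar>u\<bar> \<bar>\<nabla>u - iAu\<bar>\<close> in \<open>L\<^sup>1\<close>; half of the form absorbs it up to a multiple of \<open>\<bar>u\<bar>\<^sup>2\<close>.\<close>

lemma R_lower: "\<exists>C\<ge>0. \<forall>u\<in>D. N u / 2 <= R u u+C * (LINT x|M. (cmod (u x))\<^sup>2)"
proof -
 obtain K where K: "K >= 0" "!!u v. u : D ==> v : D ==> \<bar>bint (%x. u x \<bullet> v x)\<bar> \<le>
  K * (LINT x|M. cmod (u x) * cmod (v x) + (cmod (u x) * norm (Dg v x) + cmod (v x) * norm (Dg u x)))" using bint_inner_bound by blast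
 have "N u / 2 <= R u u+(1+K+2 * K\<^sup>2) * (LINT x|M. (cmod (u x))\<^sup>2)" if u: "u : D" for u
 proof -
  note i = L2_integrable_sq[OF F_L2[OF u]] L2_integrable_sq[OF D_L2[OF u]]
  have "K * (LINT x|M. cmod (u x) * cmod (u x) + (cmod (u x) * norm (Dg u x) + cmod (u x) * norm (Dg u x)))
   = (LINT x|M. K * (cmod (u x) * cmod (u x) + (cmod (u x) * norm (Dg u x) + cmod (u x) * norm (Dg u x))))" by simp
  also have "... <= (LINT x|M. (norm (F u x))\<^sup>2 / 2+(K+2 * K\<^sup>2) * (cmod (u x))\<^sup>2)"
  proof (rule integral_mono')
   show "integrable M (%x. (norm (F u x))\<^sup>2 / 2+(K+2 * K\<^sup>2) * (cmod (u x))\<^sup>2)" using i by simp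
   fix x
   have "(norm (Dg u x))\<^sup>2 <= (norm (F u x))\<^sup>2" by (rule power_mono[OF norm_F_ge(2)]) simp
   moreover have "2 * (2 * K * cmod (u x)) * norm (Dg u x) <= (2 * K * cmod (u x))\<^sup>2+(norm (Dg u x))\<^sup>2" by (rule sum_squares_bound)
   ultimately show "K * (cmod (u x) * cmod (u x) + (cmod (u x) * norm (Dg u x) + cmod (u x) * norm (Dg u x)))
    <= (norm (F u x))\<^sup>2 / 2 + (K + 2 * K\<^sup>2) * (cmod (u x))\<^sup>2"
    by (simp add: power2_eq_square algebra_simps)
  qed (use K(1) in simp)
  also have "...=N u / 2+(K+2 * K\<^sup>2) * (LINT x|M. (cmod (u x))\<^sup>2)" using i by simp
  finally have "\<bar>bint (%x. u x \<bullet> u x)\<bar> <= N u / 2+(K+2 * K\<^sup>2) * (LINT x|M. (cmod (u x))\<^sup>2)"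
   by (rule order_trans[OF K(2)[OF u u]])
  then show ?thesis unfolding R_def by (simp add: power2_norm_eq_inner[symmetric] algebra_simps)
 qed
 then show ?thesis using K(1) by (intro exI[of _ "1+K+2 * K\<^sup>2"]) simp
qed

abbreviation "B \<equiv> polar_form q"

lemma polar_q:
 assumes u: "u : D" and v: "v : D"
 shows "B u v = of_real (R u v)+\<i> * of_real (R u (%x. \<i> * v x))"
proof -
 have q: "q (%x. u x+w x) - q (%x. u x - w x)=4 * R u w" if w: "w : D" for w
 proof -
  have s: "(%x. u x + of_real b * w x) : D" for b using D_lincomb[OF u w, of 1 "of_real b"] by simp
  have r: "R (%x. u x + of_real b * w x) z=R u z+b * R w z" if "z : D" for b z
   using R_lincomb[OF u w that, of 1 b] by simp
  have "R (%x. u x + of_real b * w x) (%x. u x + of_real b * w x)=R u u+2 * b * R u w+b\<^sup>2 * R w w" for b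
   unfolding r[OF s] R_sym[of u "%x. u x + of_real b * w x"] R_sym[of w "%x. u x + of_real b * w x"] r[OF u] r[OF w]
   by (simp add: R_sym[of w u] power2_eq_square algebra_simps)
  from this[of 1] this[of "-1"] show ?thesis using q_eq[OF s[of 1]] q_eq[OF s[of "-1"]] by simp
 qed
 have "B u v=(of_real (q (%x. u x+v x) - q (%x. u x - v x))+\<i> * of_real (q (%x. u x+\<i> * v x) - q (%x. u x - \<i> * v x))) / 4"
  unfolding polar_form_def by (simp add: algebra_simps)
 also have "...=(of_real (4 * R u v)+\<i> * of_real (4 * R u (%x. \<i> * v x))) / 4"
  by (simp only: q[OF v] q[OF D_cmult[OF v]])
 also have "... = of_real (R u v)+\<i> * of_real (R u (%x. \<i> * v x))" by (simp add: field_simps)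
 finally show ?thesis .
qed

lemma R_i_left: assumes u: "u : D" and v: "v : D" shows "R (%x. \<i> * u x) v=- R u (%x. \<i> * v x)"
proof -
 have "R (%x. \<i> * u x) v=R (%x. \<i> * (\<i> * u x)) (%x. \<i> * v x)" by (rule R_i[OF D_cmult[OF u] v, symmetric])
 also have "(%x. \<i> * (\<i> * u x))=(%x. of_real (-1) * u x + of_real 0 * u x)" by (simp add: mult.assoc[symmetric])
 also have "R ... (%x. \<i> * v x)=- R u (%x. \<i> * v x)" using R_lincomb[OF u u D_cmult[OF v], of "-1" 0] by simp
 finally show ?thesis .
qed

lemma B_add: assumes "u : D" "v : D" "w : D" shows "B (%x. u x+v x) w=B u w+B v w"
proof -
 have "(%x. u x+v x) : D" using D_lincomb[OF assms(1,2), of 1 1] by simp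
 moreover have "R (%x. u x+v x) z=R u z+R v z" if "z : D" for z
  using R_lincomb[OF assms(1,2) that, of 1 1] by simp
 ultimately show ?thesis using assms by (simp add: polar_q D_cmult algebra_simps)
qed

lemma B_scl: assumes "u : D" "w : D" shows "B (%x. c * u x) w=c * B u w"
proof -
 have c: "(%x. c * u x)=(%x. of_real (Re c) * u x + of_real (Im c) * (\<i> * u x))"
  by (subst complex_eq[of c]) (simp add: algebra_simps fun_eq_iff)
 have r: "R (%x. c * u x) z=Re c * R u z - Im c * R u (%x. \<i> * z x)" if "z : D" for z
  unfolding c using R_lincomb[OF assms(1) D_cmult[OF assms(1)] that, of "Re c" "Im c" \<i>] R_i_left[OF assms(1) that] by simp
 have i: "R u (%x. \<i> * (\<i> * w x))=- R u w"
 proof -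
  have "(%x. \<i> * (\<i> * w x))=(%x. of_real (-1) * w x + of_real 0 * w x)" by (simp add: mult.assoc[symmetric])
  then show ?thesis using R_lincomb[OF assms(2,2,1), of "-1" 0] by (simp add: R_sym[of u])
 qed
 show ?thesis unfolding polar_q[OF D_cmult[OF assms(1)] assms(2)] polar_q[OF assms] r[OF assms(2)] r[OF D_cmult[OF assms(2)]] i
  by (simp add: complex_eq_iff algebra_simps)
qed

lemma B_cnj: "u : D ==> v : D ==> B v u=cnj (B u v)"
 using R_i_left[of u v] by (simp add: polar_q R_sym[of v u] R_sym[of v "%x. \<i> * u x"] complex_eq_iff)

lemma B_self: "u : D ==> Re (B u u)=R u u" by (simp add: polar_q)

end

section \<open>The form is closed and densely defined\<close>

lemma L2_tendsto_iff:
 assumes "!!n. w n : L2 M" "u : L2 M"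
 shows "L2_tendsto M w u \<longleftrightarrow> (%n. LINT x|M. (cmod (w n x - u x))\<^sup>2) ~~> 0"
proof -
 have e: "L2_normsq M (%x. w n x - u x)=ennreal (LINT x|M. (cmod (w n x - u x))\<^sup>2)" for n
  by (rule L2_normsq_eq[OF L2_diff[OF assms]])
 show ?thesis
  unfolding L2_tendsto_def e using tendsto_ennrealI[of "%n. LINT x|M. (cmod (w n x - u x))\<^sup>2" 0 sequentially]
   tendsto_ennrealD[of "%n. LINT x|M. (cmod (w n x - u x))\<^sup>2" 0 sequentially]
  by (auto simp: Bochner_Integration.integral_nonneg)
qed

lemma AE_zero_if_bounds_vanish:
 fixes h :: "'a => complex"
 assumes h: "h : bmeas M" and s: "!!n::nat. integrable M (s n)" "!!n x. (cmod (h x))\<^sup>2 <= s n x"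
  and lim: "(%n. LINT x|M. s n x) ~~> 0"
 shows "AE x in M. h x=0"
proof -
 have i: "integrable M (%x. (cmod (h x))\<^sup>2)" using L2_integrable_sq[OF L2_dominated[OF h s]] .
 have "(LINT x|M. (cmod (h x))\<^sup>2) <= (LINT x|M. s n x)" for n by (rule integral_mono[OF i s(1)]) (rule s(2))
 then have "(LINT x|M. (cmod (h x))\<^sup>2) <= 0" using LIMSEQ_le_const[OF lim] by blast
 moreover have "0 <= (LINT x|M. (cmod (h x))\<^sup>2)" by (rule Bochner_Integration.integral_nonneg) simp
 ultimately have "(LINT x|M. (cmod (h x))\<^sup>2)=0" by simp
 then show ?thesis using integral_nonneg_eq_0_iff_AE[OF i] by simp
qed

lemma L2_linear_image:
 fixes Z :: "'a => 'b::euclidean_space" and p :: "'b => 'c::euclidean_space"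
 assumes p: "bounded_linear p" "!!z. norm (p z) <= norm z" and Z: "Z : L2 M"
 shows "(%x. p (Z x)) : L2 M"
proof (rule L2_dominated[OF _ L2_integrable_sq[OF Z]])
 show "(%x. p (Z x)) : bmeas M"
  by (rule borel_measurable_continuous_on[OF bounded_linear.continuous_on[OF p(1) continuous_on_id] L2_measurable[OF Z]])
 show "(norm (p (Z x)))\<^sup>2 <= (norm (Z x))\<^sup>2" for x by (rule power_mono[OF p(2)]) simp
qed

lemma L2_linear_image_tendsto:
 fixes f :: "nat => 'a => 'b::euclidean_space" and p :: "'b => 'c::euclidean_space"
 assumes p: "bounded_linear p" "!!z. norm (p z) <= norm z" and f: "!!n. f n : L2 M" "Z : L2 M"
  and lim: "(%n. LINT x|M. (norm (f n x - Z x))\<^sup>2) ~~> 0"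
 shows "(%n. LINT x|M. (norm (p (f n x) - p (Z x)))\<^sup>2) ~~> 0"
proof (rule tendsto_sandwich[OF _ _ tendsto_const lim])
 have "(LINT x|M. (norm (p (f n x) - p (Z x)))\<^sup>2) <= (LINT x|M. (norm (f n x - Z x))\<^sup>2)" for n
 proof (rule integral_mono')
  show "integrable M (%x. (norm (f n x - Z x))\<^sup>2)" by (rule L2_integrable_sq[OF L2_diff[OF f]])
  show "(norm (p (f n x) - p (Z x)))\<^sup>2 <= (norm (f n x - Z x))\<^sup>2" for x
   unfolding linear_diff[OF bounded_linear.linear[OF p(1)], symmetric] by (rule power_mono[OF p(2)]) simp
 qed simp
 then show "\<forall>\<^sub>F n in sequentially. (LINT x|M. (norm (p (f n x) - p (Z x)))\<^sup>2) <= (LINT x|M. (norm (f n x - Z x))\<^sup>2)"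
  by (intro always_eventually allI)
qed (simp add: Bochner_Integration.integral_nonneg)

lemma Ck1I:
 assumes "!!x. (f has_derivative f' x) (at x)" "!!v. continuous_on UNIV (%x. f' x v)"
 shows "Ck 1 f" "fderv f (at x)=f' x"
proof -
 have e: "fderv f (at x)=f' x" for x by (rule frechet_derivative_at[OF assms(1), symmetric])
 show "Ck 1 f" using assms(2) differentiableI[OF assms(1)] by (simp add: e)
 show "fderv f (at x)=f' x" by (rule e)
qed

context robin_setting
begin

lemma rV_measurable: "(%x. rV x) : bmeas M" using V by simp

lemma N_diff: assumes u: "u : D" and v: "v : D"
 shows "N (%x. u x - v x)=(LINT x|M. (norm (F u x - F v x))\<^sup>2)"
proof (rule integral_cong_AE)
 have d: "(%x. u x - v x) : D" using D_lincomb[OF u v, of 1 "-1"] by simp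
 note m = L2_measurable[OF F_L2]
 show "(%x. (norm (F (%x. u x - v x) x))\<^sup>2) : bmeas M" using m[OF d] by simp
 show "(%x. (norm (F u x - F v x))\<^sup>2) : bmeas M" using m[OF u] m[OF v] by simp
 show "AE x in M. (norm (F (%x. u x - v x) x))\<^sup>2=(norm (F u x - F v x))\<^sup>2"
  using F_lincomb[OF u v, of 1 "-1"] by eventually_elim simp
qed

lemma D_diff: "u : D ==> v : D ==> (%x. u x - v x) : D" using D_lincomb[of u v 1 "-1"] by simp

lemma B_tendsto:
 assumes w: "!!n. w n : D" and u: "u : D" and v: "v : D" and lim: "(%n. N (%x. w n x - u x)) ~~> 0"
 shows "(%n. B (w n) v) ~~> B u v"
proof -
 obtain C where C: "!!u v. u : D ==> v : D ==> \<bar>R u v\<bar> <= C * sqrt (N u * N v)" using R_bound by blast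
 have r: "(%n. R (w n) z) ~~> R u z" if z: "z : D" for z
 proof -
  have "(%n. C * sqrt (N (%x. w n x - u x) * N z)) ~~> C * sqrt (0 * N z)"
   by (intro tendsto_mult tendsto_const tendsto_real_sqrt lim)
  then have l: "(%n. C * sqrt (N (%x. w n x - u x) * N z)) ~~> 0" by simp
  have "(%n. R (w n) z - R u z) ~~> 0"
  proof (rule Lim_null_comparison[OF always_eventually l], rule allI)
   fix n
   have "R (w n) z - R u z=R (%x. w n x - u x) z" using R_lincomb[OF w u z, of 1 n "-1"] by simp
   then show "norm (R (w n) z - R u z) <= C * sqrt (N (%x. w n x - u x) * N z)" using C[OF D_diff[OF w u] z, of n] by simp
  qed
  then show ?thesis by (simp add: LIM_zero_iff)
 qed
 show ?thesis unfolding polar_q[OF w v] polar_q[OF u v]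
  by (intro tendsto_add tendsto_mult tendsto_const tendsto_of_real r v D_cmult)
qed

lemma bounded_L2: "rh : bmeas M ==> (!!x. norm (rh x) <= K) ==> rh : L2 M" for rh :: "real^'n => 'b::euclidean_space"
proof (rule L2_dominated)
 interpret finite_measure M by (rule finite_measureI) (use M_finite in simp)
 show "integrable M (%x. K\<^sup>2)" by simp
 show "(norm (rh x))\<^sup>2 <= K\<^sup>2" if "!!x. norm (rh x) <= K" for x by (rule power_mono[OF that]) simp
qed

lemma mg_limit:
 assumes w: "!!n. mg (w n) (g n)" and z: "z : L2 M" "h : L2 M"
  and lim: "(%n. LINT x|M. (cmod (w n x - z x))\<^sup>2) ~~> 0" "(%n. LINT x|M. (norm (g n x - h x))\<^sup>2) ~~> 0"
 shows "mg z h"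
 unfolding mg_def has_magnetic_gradient_def
proof (intro conjI z)
 note W = mgD[OF w]
 have sc: "bounded_bilinear (%(a::complex) (b::real). b *\<^sub>R a)" by (rule bounded_bilinear.flip[OF bounded_bilinear_scaleR])
 show "has_weak_gradient Om z (full z h)"
  unfolding has_weak_gradient_def
 proof (intro conjI ballI allI)
  show "z : L1_loc Om" "full z h : L1_loc Om"
   by (intro integrable_L1_loc L2_imp_integrable[OF M_finite] full_integrable z Om)+
  fix ph j assume ph: "ph : test_functions Om"
  obtain K where K: "K >= 0" "!!x. \<bar>ph x\<bar> <= K" "!!x j. \<bar>pderv j ph x\<bar> <= K" using test_function_bound[OF ph] by blast
  note pm = test_function_lebesgue_measurable[OF ph, where S=Om]
  have L: "ph : L2 M" "pderv j ph : L2 M" by (rule bounded_L2[of _ K]; use pm K in simp)+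
  let ?k = "%x. ph x *\<^sub>R (\<i> * cof (A x $ j))"
  have k: "?k : L2 M"
  proof (rule L2_dominated)
   show "?k : bmeas M" using pm(1) A_nth_measurable[of j] by simp
   show "integrable M (%x. K\<^sup>2 * (norm (A x))\<^sup>2)" using L2_integrable_sq[OF A] by simp
   fix x
   have "norm (?k x) <= K * norm (A x)"
    using mult_mono[OF K(2) component_le_norm_cart[of "A x" j]] K(1) by (simp add: norm_mult)
   then have "(norm (?k x))\<^sup>2 <= (K * norm (A x))\<^sup>2" by (rule power_mono) simp
   then show "(norm (?k x))\<^sup>2 <= K\<^sup>2 * (norm (A x))\<^sup>2" by (simp only: power_mult_distrib)
  qed
  have split: "(LINT x|M. ph x *\<^sub>R full u r x $ j)=(LINT x|M. ph x *\<^sub>R r x $ j)+(LINT x|M. u x * ?k x)"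
   if u: "u : L2 M" "r : L2 M" for u r
  proof -
   have "integrable M (%x. ph x *\<^sub>R r x $ j)"
    by (rule integrable_bounded_mult[OF integrable_vec_nth[OF L2_imp_integrable[OF M_finite u(2)]] pm(1) K(2)])
   moreover have "integrable M (%x. u x * ?k x)"
    by (rule L2_product_integrable[OF u(1) k borel_measurable_times[OF L2_measurable[OF u(1)] L2_measurable[OF k]]])
    (simp add: norm_mult)
   moreover have "ph x *\<^sub>R full u r x $ j=ph x *\<^sub>R r x $ j+u x * ?k x" for x by (simp add: scaleR_conv_of_real algebra_simps)
   ultimately show ?thesis by simp
  qed
  have nj: "bounded_linear (%y::complex^'n. y $ j)" "!!y::complex^'n. norm (y $ j) <= norm y"
   by (rule bounded_linear_vec_nth) (rule Finite_Cartesian_Product.norm_nth_le)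
  have 1: "(%n. LINT x|M. pderv j ph x *\<^sub>R w n x) ~~> (LINT x|M. pderv j ph x *\<^sub>R z x)"
   by (rule L2_product_tendsto[OF W(1) z(1) lim(1) L(2) sc]) simp
  have 2: "(%n. LINT x|M. ph x *\<^sub>R g n x $ j) ~~> (LINT x|M. ph x *\<^sub>R h x $ j)"
   by (rule L2_product_tendsto[OF L2_linear_image[OF nj W(2)] L2_linear_image[OF nj z(2)] L2_linear_image_tendsto[OF nj W(2) z(2) lim(2)] L(1) sc]) simp
  have 3: "(%n. LINT x|M. w n x * ?k x) ~~> (LINT x|M. z x * ?k x)"
   by (rule L2_product_tendsto[OF W(1) z(1) lim(1) k bounded_bilinear_mult]) (simp add: norm_mult)
  have e: "(LINT x|M. pderv j ph x *\<^sub>R w n x)=- ((LINT x|M. ph x *\<^sub>R g n x $ j)+(LINT x|M. w n x * ?k x))" for n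
   unfolding split[OF W(1,2), symmetric] using W(3) ph unfolding has_weak_gradient_def by blast
  show "(LINT x|M. pderv j ph x *\<^sub>R z x)=- (LINT x|M. ph x *\<^sub>R full z h x $ j)"
   unfolding split[OF z] by (rule LIMSEQ_unique[OF 1]) (unfold e, intro tendsto_minus tendsto_add 2 3)
 qed
qed

text \<open>A form-Cauchy sequence converges in the graph norm \<open>N\<close> by \<open>R_lower\<close>; the weak formulation survives the limit.\<close>

lemma form_closed:
 assumes w: "!!n. w n : D" and u: "u : L2 M" and lim: "L2_tendsto M w u"
  and cauchy: "!!e. e > 0 ==> EX n0. \<forall>m\<ge>n0. \<forall>n\<ge>n0. \<bar>q (%x. w m x - w n x)\<bar> < e"
 shows "u : D & (%n. N (%x. w n x - u x)) ~~> 0"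
proof -
 obtain C where C: "C >= 0" "!!u. u : D ==> N u / 2 <= R u u+C * (LINT x|M. (cmod (u x))\<^sup>2)" using R_lower by blast
 define a where "a n=(LINT x|M. (cmod (w n x - u x))\<^sup>2)" for n
 have a0: "a ~~> 0" using lim unfolding a_def[abs_def] by (subst (asm) L2_tendsto_iff[OF D_L2[OF w] u])
 note si = L2_integrable_sq[OF L2_diff]
 have ww: "(LINT x|M. (cmod (w m x - w n x))\<^sup>2) <= 2 * a m+2 * a n" for m n
 proof -
  have "(LINT x|M. (cmod (w m x - w n x))\<^sup>2) <= (LINT x|M. 2 * (cmod (w m x - u x))\<^sup>2+2 * (cmod (w n x - u x))\<^sup>2)"
  proof (rule integral_mono')
   show "integrable M (%x. 2 * (cmod (w m x - u x))\<^sup>2+2 * (cmod (w n x - u x))\<^sup>2)" using si[OF D_L2[OF w] u] by simp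
   show "(cmod (w m x - w n x))\<^sup>2 <= 2 * (cmod (w m x - u x))\<^sup>2+2 * (cmod (w n x - u x))\<^sup>2" for x
    using norm_sq_add_le[of "w m x - u x" "u x - w n x"] by (simp add: norm_minus_commute)
  qed simp
  then show ?thesis unfolding a_def using si[OF D_L2[OF w] u] by simp
 qed
 have "\<exists>Z\<in>L2 M. (%n. LINT x|M. (norm (F (w n) x - Z x))\<^sup>2) ~~> 0"
 proof (rule L2_complete[OF F_L2[OF w]])
  fix e :: real assume e: "e > 0"
  obtain n1 where n1: "!!m n. m >= n1 ==> n >= n1 ==> \<bar>q (%x. w m x - w n x)\<bar> < e / 4" using cauchy[of "e / 4"] e by auto
  have "eventually (%n. a n < e / (16 * (C+1))) sequentially" by (rule order_tendstoD(2)[OF a0]) (use e C(1) in simp)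
  then obtain n2 where n2: "!!n. n >= n2 ==> a n < e / (16 * (C+1))" unfolding eventually_sequentially by blast
  have "(LINT x|M. (norm (F (w m) x - F (w n) x))\<^sup>2) < e" if mn: "m >= max n1 n2" "n >= max n1 n2" for m n
  proof -
   have d: "(%x. w m x - w n x) : D" by (rule D_diff[OF w w])
   have "C * (LINT x|M. (cmod (w m x - w n x))\<^sup>2) <= C * (2 * (e / (16 * (C+1)))+2 * (e / (16 * (C+1))))"
    by (rule mult_left_mono[OF order_trans[OF ww] C(1)]) (use n2[of m] n2[of n] mn in simp)
   also have "... <= e / 4"
   proof -
    define s where "s=e / (16 * (C+1))"
    have "c * (e / (16 * c))=e / 16" if "c > 0" for c :: real using that by simp
    from this[of "C+1"] have "(C+1) * s=e / 16" "s >= 0" using e C(1) by (simp_all only: s_def) simp_all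
    then show ?thesis unfolding s_def[symmetric] by (simp add: algebra_simps)
   qed
   finally have "N (%x. w m x - w n x) / 2 < e / 4+e / 4"
    using C(2)[OF d] n1[of m n] mn unfolding q_eq[OF d] by simp
   then show ?thesis unfolding N_diff[OF w w] by simp
  qed
  then show "EX n0. \<forall>m\<ge>n0. \<forall>n\<ge>n0. (LINT x|M. (norm (F (w m) x - F (w n) x))\<^sup>2) < e" by blast
 qed
 then obtain Z where Z: "Z : L2 M" "(%n. LINT x|M. (norm (F (w n) x - Z x))\<^sup>2) ~~> 0" by blast
 have p1: "bounded_linear (fst :: complex \<times> complex \<times> (complex^'n) => _)" "!!z :: complex \<times> complex \<times> (complex^'n). norm (fst z) <= norm z"
  by (rule bounded_linear_fst) (metis norm_fst_le prod.collapse)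
 have n2: "norm (snd z) <= norm z" for z :: "complex \<times> complex \<times> (complex^'n)" by (metis norm_snd_le prod.collapse)
 have p2: "bounded_linear (%z :: complex \<times> complex \<times> (complex^'n). fst (snd z))" "!!z :: complex \<times> complex \<times> (complex^'n). norm (fst (snd z)) <= norm z"
  by (rule bounded_linear_compose[OF bounded_linear_fst bounded_linear_snd]) (metis n2 norm_fst_le prod.collapse order_trans)
 have p3: "bounded_linear (%z :: complex \<times> complex \<times> (complex^'n). snd (snd z))" "!!z :: complex \<times> complex \<times> (complex^'n). norm (snd (snd z)) <= norm z"
  by (rule bounded_linear_compose[OF bounded_linear_snd bounded_linear_snd]) (metis n2 norm_snd_le prod.collapse order_trans)
 note L = L2_linear_image[OF p1 Z(1)] L2_linear_image[OF p2 Z(1)] L2_linear_image[OF p3 Z(1)]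
 note l = L2_linear_image_tendsto[OF p1 F_L2[OF w] Z] L2_linear_image_tendsto[OF p2 F_L2[OF w] Z] L2_linear_image_tendsto[OF p3 F_L2[OF w] Z]
 note l = l[unfolded F_def fst_conv snd_conv]
 have mgZ: "mg (%x. fst (Z x)) (%x. snd (snd (Z x)))" by (rule mg_limit[OF D_mg[OF w] L(1,3) l(1,3)])
 have "AE x in M. fst (Z x) - u x=0"
 proof (rule AE_zero_if_bounds_vanish)
  show "(%x. fst (Z x) - u x) : bmeas M" using L2_measurable[OF L(1)] L2_measurable[OF u] by simp
  show "integrable M (%x. 2 * (cmod (w n x - fst (Z x)))\<^sup>2+2 * (cmod (w n x - u x))\<^sup>2)" for n
   using si[OF D_L2[OF w] L(1)] si[OF D_L2[OF w] u] by simp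
  then have "(LINT x|M. 2 * (cmod (w n x - fst (Z x)))\<^sup>2+2 * (cmod (w n x - u x))\<^sup>2)=2 * (LINT x|M. (cmod (w n x - fst (Z x)))\<^sup>2)+2 * a n" for n
   unfolding a_def using si[OF D_L2[OF w] L(1)] si[OF D_L2[OF w] u] by simp
  moreover have "(%n. 2 * (LINT x|M. (cmod (w n x - fst (Z x)))\<^sup>2)+2 * a n) ~~> 2 * 0+2 * 0" by (intro tendsto_intros l(1) a0)
  ultimately show "(%n. LINT x|M. 2 * (cmod (w n x - fst (Z x)))\<^sup>2+2 * (cmod (w n x - u x))\<^sup>2) ~~> 0" by simp
  show "(cmod (fst (Z x) - u x))\<^sup>2 <= 2 * (cmod (w n x - fst (Z x)))\<^sup>2+2 * (cmod (w n x - u x))\<^sup>2" for n x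
   using norm_sq_add_le[of "fst (Z x) - w n x" "w n x - u x"] by (simp add: norm_minus_commute)
 qed
 then have Zu: "AE x in M. fst (Z x)=u x" by eventually_elim simp
 \<comment> \<open>multiplication by \<open>sqrt V\<close> is unbounded; the weight \<open>1 / sqrt (1 + \<bar>V\<bar>)\<close> makes it a contraction\<close>
 have Zq: "AE x in M. (rV x * fst (Z x) - fst (snd (Z x))) / cof (sqrt (1+\<bar>V x\<bar>))=0"
 proof (rule AE_zero_if_bounds_vanish)
  show "(%x. (rV x * fst (Z x) - fst (snd (Z x))) / cof (sqrt (1+\<bar>V x\<bar>))) : bmeas M"
   using L2_measurable[OF L(1)] L2_measurable[OF L(2)] V by simp
  note i = si[OF D_L2[OF w] L(1)] si[OF D_rV[OF w] L(2)]
  show "integrable M (%x. 2 * (cmod (w n x - fst (Z x)))\<^sup>2+2 * (cmod (rV x * w n x - fst (snd (Z x))))\<^sup>2)" for n using i by simp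
  have "(LINT x|M. 2 * (cmod (w n x - fst (Z x)))\<^sup>2 + 2 * (cmod (rV x * w n x - fst (snd (Z x))))\<^sup>2)
   = 2 * (LINT x|M. (cmod (w n x - fst (Z x)))\<^sup>2) + 2 * (LINT x|M. (cmod (rV x * w n x - fst (snd (Z x))))\<^sup>2)" for n using i by simp
  moreover have "(%n. 2 * (LINT x|M. (cmod (w n x - fst (Z x)))\<^sup>2)+2 * (LINT x|M. (cmod (rV x * w n x - fst (snd (Z x))))\<^sup>2)) ~~> 2 * 0+2 * 0"
   by (intro tendsto_add tendsto_mult tendsto_const l(1,2))
  ultimately show "(%n. LINT x|M. 2 * (cmod (w n x - fst (Z x)))\<^sup>2+2 * (cmod (rV x * w n x - fst (snd (Z x))))\<^sup>2) ~~> 0" by simp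
  fix n x
  let ?V = "1+\<bar>V x\<bar>"
  have "(cmod (rV x * fst (Z x) - fst (snd (Z x))))\<^sup>2
   = (cmod (rV x * (fst (Z x) - w n x) + (rV x * w n x - fst (snd (Z x)))))\<^sup>2" by (simp add: algebra_simps)
  also have "... <= 2 * (cmod (rV x * (fst (Z x) - w n x)))\<^sup>2+2 * (cmod (rV x * w n x - fst (snd (Z x))))\<^sup>2"
   by (rule norm_sq_add_le)
  also have "(cmod (rV x * (fst (Z x) - w n x)))\<^sup>2=\<bar>V x\<bar> * (cmod (w n x - fst (Z x)))\<^sup>2"
   by (simp add: norm_mult power_mult_distrib norm_minus_commute power2_eq_square)
  also have "2 * (\<bar>V x\<bar> * (cmod (w n x - fst (Z x)))\<^sup>2) + 2 * (cmod (rV x * w n x - fst (snd (Z x))))\<^sup>2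
   <= ?V * (2 * (cmod (w n x - fst (Z x)))\<^sup>2 + 2 * (cmod (rV x * w n x - fst (snd (Z x))))\<^sup>2)"
   by (simp add: algebra_simps)
  finally show "(cmod ((rV x * fst (Z x) - fst (snd (Z x))) / complex_of_real (sqrt ?V)))\<^sup>2
   <= 2 * (cmod (w n x - fst (Z x)))\<^sup>2 + 2 * (cmod (rV x * w n x - fst (snd (Z x))))\<^sup>2"
   by (simp add: norm_divide power_divide divide_le_eq mult.commute)
 qed
 have V1: "sqrt (1+\<bar>V x\<bar>) ~= 0" for x by simp
 have Zr: "AE x in M. rV x * u x=fst (snd (Z x))" using Zq Zu by eventually_elim (use V1 in auto)
 have mgu: "mg u (%x. snd (snd (Z x)))" by (rule mg_cong[OF mgZ u Zu])
 have rm: "(%x. rV x * u x) : bmeas M" using rV_measurable L2_measurable[OF u] by simp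
 have "integrable M (%x. (cmod (rV x * u x))\<^sup>2)"
 proof (rule integrable_cong_AE_imp[OF L2_integrable_sq[OF L(2)]])
  show "(%x. (cmod (rV x * u x))\<^sup>2) : bmeas M" using rm by simp
  show "AE x in M. (cmod (fst (snd (Z x))))\<^sup>2=(cmod (rV x * u x))\<^sup>2" using Zr by eventually_elim simp
 qed
 then have uD: "u : D" unfolding D_iff L2_iff using mgu rm by blast
 have "AE x in M. Dg u x=snd (snd (Z x))" by (rule mg_unique[OF D_mg[OF uD] mgu]) simp
 then have FZ: "AE x in M. F u x=Z x" using Zu Zr by eventually_elim (simp add: F_def prod_eq_iff)
 have "N (%x. w n x - u x)=(LINT x|M. (norm (F (w n) x - Z x))\<^sup>2)" for n
  unfolding N_diff[OF w uD]
 proof (rule integral_cong_AE)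
  note m = L2_measurable[OF F_L2[OF w]] L2_measurable[OF F_L2[OF uD]] L2_measurable[OF Z(1)]
  show "(%x. (norm (F (w n) x - F u x))\<^sup>2) : bmeas M" "(%x. (norm (F (w n) x - Z x))\<^sup>2) : bmeas M"
   using m by simp_all
  show "AE x in M. (norm (F (w n) x - F u x))\<^sup>2=(norm (F (w n) x - Z x))\<^sup>2" using FZ by eventually_elim simp
 qed
 then show ?thesis using uD Z(2) by simp
qed

text \<open>As the form is closed on its domain, the closure adds nothing and the operator has its usual weak description.\<close>

lemma robin_operator_iff:
 "robin_operator Om A V \<sigma> u f \<longleftrightarrow> u : D & f : L2 M & (\<forall>v\<in>D. B u v=L2_inner M f v)"
proof
 assume "robin_operator Om A V \<sigma> u f"
 then obtain w where u: "u : L2 M" and f: "f : L2 M" and w: "!!n::nat. w n : D" and l: "L2_tendsto M w u"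
  and c: "!!e. e > 0 ==> EX n0. \<forall>m\<ge>n0. \<forall>n\<ge>n0. \<bar>q (%x. w m x - w n x)\<bar> < e"
  and b: "!!v. v : D ==> (%n. B (w n) v) ~~> L2_inner M f v"
  unfolding robin_operator_def form_operator_def by blast
 have uD: "u : D" "(%n. N (%x. w n x - u x)) ~~> 0" using form_closed[OF w u l c] by blast+
 have "B u v=L2_inner M f v" if "v : D" for v
  by (rule LIMSEQ_unique[OF B_tendsto[OF w uD(1) that uD(2)] b[OF that]])
 then show "u : D & f : L2 M & (\<forall>v\<in>D. B u v=L2_inner M f v)" using uD(1) f by blast
next
 assume *: "u : D & f : L2 M & (\<forall>v\<in>D. B u v=L2_inner M f v)"
 then have u: "u : D" by blast
 have "q (%x. u x - u x)=R (%x. u x - u x) (%x. u x - u x)" by (rule q_eq[OF D_diff[OF u u]])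
 also have "...=0" using R_lincomb[OF u u D_diff[OF u u], of 1 "-1"] by simp
 finally have q0: "q (%x. u x - u x)=0" .
 have "L2_tendsto M (%n. u) u" unfolding L2_tendsto_def by (simp add: L2_normsq_def)
 then show "robin_operator Om A V \<sigma> u f" unfolding robin_operator_def form_operator_def
  using * D_L2[OF u] q0 by (intro conjI exI[of _ "%n::nat. u"]) auto
qed

lemma B_null:
 assumes u: "u : D" and v: "v : D" and z: "(LINT x|M. (cmod (u x))\<^sup>2)=0"
 shows "B u v=0"
proof -
 have u0: "AE x in M. u x=0"
  using z integral_nonneg_eq_0_iff_AE[OF L2_integrable_sq[OF D_L2[OF u]]] by simp
 have "mg (%x. 0 * u x+0 * u x) (%x. 0 *s Dg u x+0 *s Dg u x)" by (rule mg_lincomb[OF D_mg[OF u] D_mg[OF u]])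
 from mg_unique[OF D_mg[OF u] this] u0 have "AE x in M. Dg u x=0" by simp
 then have "AE x in M. (norm (F u x))\<^sup>2=0" using u0 by eventually_elim (simp add: F_def)
 then have N0: "N u=0" using integral_nonneg_eq_0_iff_AE[OF L2_integrable_sq[OF F_L2[OF u]]] by simp
 have "R u w=0" if "w : D" for w
 proof -
  obtain C where C: "!!u v. u : D ==> v : D ==> \<bar>R u v\<bar> <= C * sqrt (N u * N v)" using R_bound by blast
  show ?thesis using C[OF u that] unfolding N0 by simp
 qed
 then show ?thesis unfolding polar_q[OF u v] using v D_cmult[OF v] by simp
qed

lemma C1_mg:
 fixes p :: "real^'n => complex"
 assumes p: "Ck 1 p" and K: "!!x. cmod (p x) <= K" "!!x j. cmod (fderv p (at x) (axis j 1)) <= K"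
 shows "mg p (%x. \<chi> j. fderv p (at x) (axis j 1) - \<i> * cof (A x $ j) * p x)" "p : D"
proof -
 let ?d = "%x. \<chi> j. fderv p (at x) (axis j 1)"
 have mb: "p : bmeas borel" "(%x. fderv p (at x) (axis j 1)) : bmeas borel" for j
  by (intro borel_measurable_continuous_onI Ck1_continuous[OF p] Ck1_deriv_continuous[OF p])+
 note m = measurable_lebesgue_on_borel[OF mb(1), where S=Om] measurable_lebesgue_on_borel[OF mb(2), where S=Om]
 have K0: "0 <= K" using K(1)[of 0] norm_ge_zero[of "p 0"] by linarith
 have p2: "p : L2 M" by (rule bounded_L2[OF m(1) K(1)])
 have d2: "?d : L2 M"
 proof (rule bounded_L2)
  show "?d : bmeas M" by (intro borel_measurable_vec_lambda m)
  fix x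
  have "norm (?d x) <= (\<Sum>j\<in>UNIV. cmod (?d x $ j))" by (rule norm_vec_le_sum)
  also have "... <= (\<Sum>j\<in>(UNIV::'n set). K)" by (rule sum_mono) (use K(2) in simp)
  finally show "norm (?d x) <= real CARD('n) * K" by simp
 qed
 let ?a = "%x. \<chi> j. \<i> * cof (A x $ j) * p x"
 have a2: "?a : L2 M"
 proof (rule L2_dominated)
  show "?a : bmeas M" using A_nth_measurable m(1) by (intro borel_measurable_vec_lambda) simp
  show "integrable M (%x. K\<^sup>2 * (norm (A x))\<^sup>2)" using L2_integrable_sq[OF A] by simp
  fix x
  have "norm (?a x)=norm (A x) * cmod (p x)"
   unfolding norm_vec_def by (simp add: norm_mult L2_set_left_distrib)
  also have "... <= K * norm (A x)" using K(1)[of x] by (simp add: mult.commute mult_right_mono)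
  finally have "(norm (?a x))\<^sup>2 <= (K * norm (A x))\<^sup>2" by (rule power_mono) simp
  then show "(norm (?a x))\<^sup>2 <= K\<^sup>2 * (norm (A x))\<^sup>2" by (simp only: power_mult_distrib)
 qed
 let ?g = "%x. \<chi> j. fderv p (at x) (axis j 1) - \<i> * cof (A x $ j) * p x"
 have g: "?g=(%x. ?d x - ?a x)" by (simp add: fun_eq_iff vec_eq_iff)
 have g2: "?g : L2 M" unfolding g by (rule L2_diff[OF d2 a2])
 have "has_weak_gradient Om p ?d"
  unfolding has_weak_gradient_def
 proof (intro conjI ballI allI integrable_L1_loc L2_imp_integrable[OF M_finite] p2 d2 Om(1))
  fix ph j assume ph: "ph : test_functions Om"
  note t = test_functionsD[OF ph]
  have "(LINT x|M. pderv j ph x *\<^sub>R p x)=(LINT x|lborel. pderv j ph x *\<^sub>R p x)"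
   by (rule lebesgue_on_transfer(1)[OF _ Om(1)])
    (use test_function_lebesgue_measurable(2)[OF ph] m(1) mb(1) t(8) test_function_deriv_outside[OF ph] in simp_all)
  also have "...=- (LINT x|lborel. ph x *\<^sub>R fderv p (at x) (axis j 1))"
   unfolding partial_deriv_def by (rule integration_by_parts[OF t(2) p t(3)])
  also have "(LINT x|lborel. ph x *\<^sub>R fderv p (at x) (axis j 1))=(LINT x|M. ph x *\<^sub>R ?d x $ j)"
   by (rule lebesgue_on_transfer(1)[OF _ Om(1), symmetric])
    (use test_function_lebesgue_measurable(1)[OF ph] m(2) mb(2) t(7) t(4) in simp_all)
  finally show "(LINT x|M. pderv j ph x *\<^sub>R p x)=- (LINT x|M. ph x *\<^sub>R ?d x $ j)" .
 qed
 moreover have "full p ?g=?d" by (simp add: fun_eq_iff vec_eq_iff)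
 ultimately show "mg p ?g" unfolding mg_def has_magnetic_gradient_def using p2 g2 by simp
 moreover have "(%x. rV x * p x) : L2 M"
 proof (rule L2_dominated)
  show "(%x. rV x * p x) : bmeas M" using rV_measurable m(1) by simp
  show "integrable M (%x. \<bar>V x\<bar> * K\<^sup>2)" using V by simp
  fix x
  have "(cmod (p x))\<^sup>2 <= K\<^sup>2" by (rule power_mono[OF K(1)]) simp
  then show "(cmod (rV x * p x))\<^sup>2 <= \<bar>V x\<bar> * K\<^sup>2" by (simp add: norm_mult power_mult_distrib power2_eq_square[of "sqrt _"] mult_left_mono)
 qed
 ultimately show "p : D" unfolding D_iff by blast
qed

lemma test_function_D:
 assumes ph: "ph : test_functions Om" shows "(%x. cof (ph x)) : D"
proof -
 note t = test_functionsD[OF ph]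
 obtain K where K: "!!x. \<bar>ph x\<bar> <= K" "!!x j. \<bar>pderv j ph x\<bar> <= K" using test_function_bound[OF ph] by blast
 have d: "((%x. cof (ph x)) has_derivative (%v. cof (fderv ph (at x) v))) (at x)" for x
  by (rule has_derivative_of_real[OF Ck1_has_derivative[OF t(2)]])
 note c = Ck1I[OF d continuous_on_of_real[OF Ck1_deriv_continuous[OF t(2)]]]
 show ?thesis by (rule C1_mg(2)[OF c(1), of K]) (use K in "simp_all add: c(2) partial_deriv_def")
qed

lemma D_dense:
 assumes f: "f : L2 M" and o: "!!v. v : D ==> L2_inner M f v=0"
 shows "(LINT x|M. (cmod (f x))\<^sup>2)=0"
proof -
 obtain h where h: "h : bmeas borel" "!!x. x ~: Om ==> h x=0" "AE x in M. f x=h x"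
  using lebesgue_borel_representative[OF L2_measurable[OF f] Om(1)] by blast
 have hi: "integ h"
  using lebesgue_on_transfer(2)[OF L2_measurable[OF f] Om(1) h] L2_imp_integrable[OF M_finite f] by blast
 have "AE x in lborel. h x=0"
 proof (rule fundamental_lemma_of_variations[OF hi h(2) Om(1)])
  fix ph assume ph: "ph : test_functions Om"
  have "(LINT x|M. ph x *\<^sub>R f x)=(LINT x|lborel. ph x *\<^sub>R h x)"
  proof (rule lebesgue_on_transfer(1)[OF _ Om(1)])
   show "(%x. ph x *\<^sub>R f x) : bmeas M" using test_function_lebesgue_measurable(1)[OF ph] L2_measurable[OF f] by simp
   show "(%x. ph x *\<^sub>R h x) : bmeas borel" using test_functionsD(7)[OF ph] h(1) by simp
   show "AE x in M. ph x *\<^sub>R f x=ph x *\<^sub>R h x" using h(3) by eventually_elim simp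
  qed (simp add: h(2))
  moreover have "(LINT x|M. ph x *\<^sub>R f x)=0"
   using o[OF test_function_D[OF ph]] unfolding L2_inner_def by (simp add: scaleR_conv_of_real mult.commute)
  ultimately show "(LINT x|lborel. ph x *\<^sub>R h x)=0" by simp
 qed
 then have "AE x in lebesgue. h x=0" by (rule AE_completion)
 then have "AE x in M. h x=0" by (subst AE_restrict_space_iff[OF Om_sets]) (rule AE_mp, auto)
 with h(3) have "AE x in M. (cmod (f x))\<^sup>2=0" by eventually_elim simp
 then show ?thesis using integral_nonneg_eq_0_iff_AE[OF L2_integrable_sq[OF f]] by simp
qed

subsection \<open>Plane waves\<close>

lemma plane_wave:
 fixes xi :: "real^'n"
 assumes \<sigma>0: "AE x in S. \<sigma> x < 0"
 shows "(%x. iexp (xi \<bullet> x)) : D"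
  "R (%x. iexp (xi \<bullet> x)) (%x. iexp (xi \<bullet> x)) <= (LINT x|M. (norm (xi - A x))\<^sup>2)+(LINT x|M. V x)"
proof -
 let ?e = "%x. iexp (xi \<bullet> x)"
 have d: "(?e has_derivative (%v. \<i> * of_real (xi \<bullet> v) * ?e x)) (at x)" for x
 proof -
  have "((%x. \<i> * cof (xi \<bullet> x)) has_derivative (%v. \<i> * of_real (xi \<bullet> v))) (at x)"
   by (intro has_derivative_mult_right has_derivative_of_real has_derivative_inner_right has_derivative_ident)
  from has_derivative_compose[OF this DERIV_exp[unfolded has_field_derivative_def]] show ?thesis by (simp add: ac_simps)
 qed
 have dc: "continuous_on UNIV (%x. \<i> * of_real (xi \<bullet> v) * ?e x)" for v by (intro continuous_intros)
 note c = Ck1I[OF d dc]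
 have K: "cmod (?e x) <= 1+norm xi" "cmod (fderv ?e (at x) (axis j 1)) <= 1+norm xi" for x j
  unfolding c(2) using component_le_norm_cart[of xi j] by (simp_all add: norm_mult inner_axis)
 note mgE = C1_mg(1)[OF c(1) K]
 show D: "?e : D" by (rule C1_mg(2)[OF c(1) K])
 let ?g = "%x. \<chi> j. fderv ?e (at x) (axis j 1) - \<i> * cof (A x $ j) * ?e x"
 have ng: "norm (?g x)=norm (xi - A x)" for x
 proof -
  have "?g x $ j=\<i> * of_real ((xi - A x) $ j) * ?e x" for j by (simp add: c(2) inner_axis algebra_simps)
  then have "cmod (?g x $ j)=norm ((xi - A x) $ j)" for j
   by (simp add: norm_mult del: of_real_diff vector_minus_component vec_lambda_beta)
  then show ?thesis unfolding norm_vec_def by (simp only:)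
 qed
 have "(LINT x|M. (norm (Dg ?e x))\<^sup>2)=(LINT x|M. (norm (?g x))\<^sup>2)"
 proof (rule integral_cong_AE)
  have "AE x in M. Dg ?e x=?g x" by (rule mg_unique[OF D_mg[OF D] mgE]) simp
  then show "AE x in M. (norm (Dg ?e x))\<^sup>2=(norm (?g x))\<^sup>2" by eventually_elim simp
  note m = L2_measurable[OF mgD(2)[OF D_mg[OF D]]] L2_measurable[OF mgD(2)[OF mgE]]
  show "(%x. (norm (Dg ?e x))\<^sup>2) : bmeas M" by (rule borel_measurable_power[OF measurable_compose[OF m(1) borel_measurable_norm]])
  show "(%x. (norm (?g x))\<^sup>2) : bmeas M" by (rule borel_measurable_power[OF measurable_compose[OF m(2) borel_measurable_norm]])
 qed
 then have 1: "(LINT x|M. (norm (Dg ?e x))\<^sup>2)=(LINT x|M. (norm (xi - A x))\<^sup>2)" unfolding ng .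
 have "bint (%x. 1)=(LINT x|S. \<sigma> x * 1)" by (rule bint_eq[OF trace_one])
 also have "... <= (LINT x|S. 0)"
  by (rule integral_mono_AE[OF \<sigma>_integrable[OF trace_approxD(2)[OF trace_one]]]) (use \<sigma>0 in "simp, eventually_elim, simp")
 finally have "bint (%x. 1) <= 0" by simp
 then show "R ?e ?e <= (LINT x|M. (norm (xi - A x))\<^sup>2)+(LINT x|M. V x)"
  unfolding q_eq[OF D, symmetric] robin_form_def bint_def[symmetric] 1 by simp
qed

end

section \<open>Compact resolvents and eigenfunction expansions\<close>

locale semi_hilbert = module scl for scl :: "complex => 'v::ab_group_add => 'v" +
 fixes H :: "'v set" and ip :: "'v => 'v => complex"
 assumes H0[simp]: "0 : H" and Hadd[simp]: "x : H ==> y : H ==> x+y : H"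
  and Hscl[simp]: "x : H ==> scl c x : H"
  and ip_add: "x : H ==> y : H ==> z : H ==> ip (x+y) z=ip x z+ip y z"
  and ip_scl: "x : H ==> z : H ==> ip (scl c x) z=c * ip x z"
  and ip_cnj: "x : H ==> y : H ==> ip y x=cnj (ip x y)"
  and ip_pos: "x : H ==> 0 <= Re (ip x x)"
  and complete: "(!!n::nat. X n : H) ==> (!!e. e > 0 ==> EX N. \<forall>m\<ge>N. \<forall>n\<ge>N. Re (ip (X m - X n) (X m - X n)) < e)
    ==> \<exists>x\<in>H. (%n. Re (ip (X n - x) (X n - x))) ~~> 0"
begin

definition nsq :: "'v => real" where "nsq x=Re (ip x x)"

lemma Hminus[simp]: assumes "x : H" shows "- x : H"
proof -
 have "scl (- 1) x=- x" by (simp add: scale_minus_left)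
 then show ?thesis using Hscl[OF assms, of "- 1"] by simp
qed

lemma Hdiff[simp]: "x : H ==> y : H ==> x - y : H"
 using Hadd[of x "- y"] by simp

lemma Hsum: "(!!i. i : S ==> f i : H) ==> sum f S : H"
 by (induction S rule: infinite_finite_induct) auto

lemma ip_zero[simp]: "z : H ==> ip 0 z=0"
 using ip_scl[of 0 z 0] by simp

lemma ip_minus: assumes "x : H" "z : H" shows "ip (- x) z=- ip x z"
proof -
 have "scl (- 1) x=- x" by (simp add: scale_minus_left)
 then show ?thesis using ip_scl[OF assms, of "- 1"] by simp
qed

lemma ip_diff: "x : H ==> y : H ==> z : H ==> ip (x - y) z=ip x z - ip y z"
 using ip_add[of x "- y" z] ip_minus[of y z] by simp

lemma ip_add_right: "x : H ==> y : H ==> z : H ==> ip z (x+y)=ip z x+ip z y"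
 using ip_add[of x y z] ip_cnj[of "x+y" z] ip_cnj[of x z] ip_cnj[of y z] by simp

lemma ip_diff_right: "x : H ==> y : H ==> z : H ==> ip z (x - y)=ip z x - ip z y"
 using ip_diff[of x y z] ip_cnj[of "x - y" z] ip_cnj[of x z] ip_cnj[of y z] by simp

lemma ip_scl_right: "x : H ==> z : H ==> ip z (scl c x)=cnj c * ip z x"
 using ip_scl[of x z c] ip_cnj[of "scl c x" z] ip_cnj[of x z] by simp

lemma ip_sum: "(!!i. i : S ==> f i : H) ==> z : H ==> ip (sum f S) z=(\<Sum>i\<in>S. ip (f i) z)"
 by (induction S rule: infinite_finite_induct) (auto simp: ip_add Hsum)

lemma ip_sum_right: "(!!i. i : S ==> f i : H) ==> z : H ==> ip z (sum f S)=(\<Sum>i\<in>S. ip z (f i))"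
 using ip_sum[of S f z] ip_cnj[of "sum f S" z] ip_cnj[of "f _" z]
 by (simp add: Hsum cnj_sum)

lemma ip_self: assumes "x : H" shows "ip x x = of_real (nsq x)"
proof -
 have "Im (ip x x)=- Im (ip x x)" using arg_cong[OF ip_cnj[OF assms assms], of Im] by simp
 then show ?thesis by (simp add: complex_eq_iff nsq_def)
qed

lemma nsq_nonneg[simp]: "x : H ==> 0 <= nsq x" unfolding nsq_def by (rule ip_pos)

lemma nsq_add: assumes "x : H" "y : H" shows "nsq (x+y)=nsq x+2 * Re (ip x y)+nsq y"
 using ip_cnj[OF assms] assms by (simp add: nsq_def ip_add ip_add_right)

lemma nsq_diff: assumes "x : H" "y : H" shows "nsq (x - y)=nsq x - 2 * Re (ip x y)+nsq y"
 using ip_cnj[OF assms] assms by (simp add: nsq_def ip_diff ip_diff_right)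

lemma nsq_scl: assumes "x : H" shows "nsq (scl c x)=(cmod c)\<^sup>2 * nsq x"
proof -
 have "ip (scl c x) (scl c x)=c * (cnj c * ip x x)"
  using assms by (simp add: ip_scl ip_scl_right)
 also have "... = of_real ((cmod c)\<^sup>2 * nsq x)"
  by (simp only: ip_self[OF assms] of_real_mult complex_norm_square mult.assoc)
 finally show ?thesis by (simp add: nsq_def)
qed

lemma nsq_add_le: assumes "x : H" "y : H" shows "nsq (x+y) <= 2 * nsq x+2 * nsq y"
 using nsq_add[OF assms] nsq_diff[OF assms] nsq_nonneg[OF Hdiff[OF assms]] by linarith

lemma nsq_diff_le: assumes "x : H" "y : H" shows "nsq (x - y) <= 2 * nsq x+2 * nsq y"
 using nsq_add[OF assms] nsq_diff[OF assms] nsq_nonneg[OF Hadd[OF assms]] by linarith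

lemma nsq_zero[simp]: "nsq 0=0" by (simp add: nsq_def)

lemma nsq_commute: assumes "x : H" "y : H" shows "nsq (x - y)=nsq (y - x)"
 using nsq_diff[OF assms] nsq_diff[OF assms(2,1)] ip_cnj[OF assms] by simp

lemma cauchy_schwarz: assumes "x : H" "y : H" shows "(cmod (ip x y))\<^sup>2 <= nsq x * nsq y"
proof -
 let ?a = "(cmod (ip x y))\<^sup>2"
 have p: "0 <= nsq x - 2 * t * ?a+t\<^sup>2 * ?a * nsq y" for t :: real
 proof -
  have "ip x (scl (of_real t * ip x y) y) = of_real t * of_real ?a"
   using assms complex_norm_square[of "ip x y"] by (simp add: ip_scl_right mult.commute mult.left_commute)
  moreover have "nsq (scl (of_real t * ip x y) y)=t\<^sup>2 * ?a * nsq y"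
   using assms by (simp add: nsq_scl norm_mult power_mult_distrib)
  moreover have "0 <= nsq (x - scl (of_real t * ip x y) y)" using assms by simp
  ultimately show ?thesis using assms nsq_diff[of x "scl (of_real t * ip x y) y"] by simp
 qed
 show ?thesis
 proof (cases "nsq y=0")
  case True
  have "?a <= 0"
  proof (rule ccontr)
   assume "\<not> ?a <= 0"
   then have a: "?a > 0" by simp
   have "0 <= nsq x - 2 * ((nsq x+1) / ?a) * ?a" using p[of "(nsq x+1) / ?a"] True by simp
   then have "0 <= nsq x - 2 * (nsq x+1)" using a by simp
   then show False using nsq_nonneg[OF assms(1)] by simp
  qed
  then show ?thesis using True by simp
 next
  case False
  then have y: "nsq y > 0" using nsq_nonneg[OF assms(2)] by simp
  have "(1 / nsq y)\<^sup>2 * ?a * nsq y=1 / nsq y * ?a" using y by (simp add: power2_eq_square)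
  then have "0 <= nsq x - 1 / nsq y * ?a" using p[of "1 / nsq y"] by simp
  then have "?a / nsq y <= nsq x" by simp
  then show ?thesis using y by (simp add: divide_le_eq)
 qed
qed

lemma ip_null: assumes "x : H" "y : H" "nsq x=0" shows "ip x y=0"
 using cauchy_schwarz[OF assms(1,2)] assms(3) by simp

lemma ip_null_right: assumes "x : H" "y : H" "nsq x=0" shows "ip y x=0"
 using ip_null[OF assms] ip_cnj[OF assms(1,2)] by simp

lemma ip_null_diff: assumes "x : H" "y : H" "z : H" "nsq (x - y)=0" shows "ip x z=ip y z" "ip z x=ip z y"
 using ip_null[OF _ assms(3,4)] ip_null_right[OF _ assms(3,4)] assms(1-3) by (simp_all add: ip_diff ip_diff_right)

lemma nsq_null_add: assumes "x : H" "y : H" "nsq x=0" shows "nsq (x+y)=nsq y"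
 using nsq_add[OF assms(1,2)] ip_null[OF assms] assms(3) by simp

lemma nsq_null_trans: assumes "x : H" "y : H" "z : H" "nsq (x - y)=0" "nsq (y - z)=0" shows "nsq (x - z)=0"
 using nsq_null_add[of "x - y" "y - z"] assms by simp

lemma ip_tendsto:
 assumes X: "!!n. X n : H" "x : H" "(%n. nsq (X n - x)) ~~> 0" and y: "y : H"
 shows "(%n. ip (X n) y) ~~> ip x y"
proof -
 have "(%n. sqrt (nsq (X n - x) * nsq y)) ~~> sqrt (0 * nsq y)"
  by (intro tendsto_real_sqrt tendsto_mult X(3) tendsto_const)
 then have l: "(%n. sqrt (nsq (X n - x) * nsq y)) ~~> 0" by simp
 have "(%n. ip (X n) y - ip x y) ~~> 0"
 proof (rule Lim_null_comparison[OF _ l], rule always_eventually, rule allI)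
  fix n
  have "cmod (ip (X n - x) y) <= sqrt (nsq (X n - x) * nsq y)"
   using cauchy_schwarz[OF Hdiff[OF X(1,2)] y] by (intro real_le_rsqrt)
  then show "norm (ip (X n) y - ip x y) <= sqrt (nsq (X n - x) * nsq y)" using X(1,2) y by (simp add: ip_diff)
 qed
 then show ?thesis by (simp add: LIM_zero_iff)
qed

text \<open>Orthonormalisation inside a linear subspace \<open>E\<close>.\<close>

lemma gram_schmidt:
 assumes E: "E \<subseteq> H" "!!x y. x : E ==> y : E ==> x+y : E" "!!c x. x : E ==> scl c x : E" "0 : E"
  and v: "!!j. j < m ==> v j : E"
  and indep: "!!c. nsq (\<Sum>j<m. scl (c j) (v j))=0 ==> \<forall>j<m. c j=0"
 shows "EX e::nat => 'v. (\<forall>j<m. e j : E) & (\<forall>i<m. \<forall>j<m. ip (e i) (e j)=(if i=j then 1 else 0))"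
proof -
 define comb where "comb k x \<longleftrightarrow> (EX c. x=(\<Sum>j<k. scl (c j) (v j)))" for k :: nat and x
 have comb_add: "comb k (x+y)" if xy: "comb k x" "comb k y" for k x y
 proof -
  obtain c d where "x=(\<Sum>j<k. scl (c j) (v j))" "y=(\<Sum>j<k. scl (d j) (v j))"
   using xy unfolding comb_def by blast
  then have "x+y=(\<Sum>j<k. scl (c j+d j) (v j))" by (simp add: scale_left_distrib sum.distrib)
  then show ?thesis unfolding comb_def by (rule exI[of _ "%j. c j+d j"])
 qed
 have comb_scl: "comb k (scl a x)" if x: "comb k x" for k x a
 proof -
  obtain c where "x=(\<Sum>j<k. scl (c j) (v j))" using x unfolding comb_def by blast
  then have "scl a x=(\<Sum>j<k. scl (a * c j) (v j))" by (simp add: scale_sum_right)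
  then show ?thesis unfolding comb_def by (rule exI[of _ "%j. a * c j"])
 qed
 have comb_Suc: "comb (Suc k) x" if x: "comb k x" for k x
 proof -
  obtain c where c: "x=(\<Sum>j<k. scl (c j) (v j))" using x unfolding comb_def by blast
  have "x=(\<Sum>j<Suc k. scl (if j < k then c j else 0) (v j))" by (simp add: c)
  then show ?thesis unfolding comb_def by (rule exI[of _ "%j. if j < k then c j else 0"])
 qed
 have comb_0: "comb k 0" for k
 proof -
  have "0=(\<Sum>j<k. scl 0 (v j))" by simp
  then show ?thesis unfolding comb_def by (rule exI[of _ "%_. 0"])
 qed
 have comb_sum: "comb k (sum f S)" if "!!i. i : S ==> comb k (f i)" for k f and S :: "nat set"
  using that by (induction S rule: infinite_finite_induct) (simp_all add: comb_0 comb_add)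
 have combE: "x : E" if ck: "comb k x" and km: "k <= m" for k x
 proof -
  obtain c where c: "x=(\<Sum>j<k. scl (c j) (v j))" using ck unfolding comb_def by blast
  have "finite S ==> S \<subseteq> {..<m} ==> (\<Sum>j\<in>S. scl (c j) (v j)) : E" for S
   by (induction S rule: finite_induct) (simp_all add: E v)
  then show ?thesis using km by (simp add: c lessThan_subset_iff)
 qed
 have "k <= m ==> EX e::nat => 'v. (\<forall>j<k. comb k (e j)) & (\<forall>i<k. \<forall>j<k. ip (e i) (e j)=(if i=j then 1 else 0))" for k
 proof (induction k)
  case 0
  show ?case by simp
 next
  case (Suc k)
  then obtain e where e: "\<forall>j<k. comb k (e j)" "\<forall>i<k. \<forall>j<k. ip (e i) (e j)=(if i=j then 1 else 0)" by auto
  have km: "k < m" "k <= m" using Suc by auto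
  have eH: "e j : H" if "j < k" for j using combE[OF _ km(2)] e(1) that E(1) by blast
  have vH: "v k : H" using v[OF km(1)] E(1) by blast
  define p where "p=(\<Sum>j<k. scl (- ip (v k) (e j)) (e j))"
  define w where "w=v k+p"
  have pH: "p : H" unfolding p_def by (intro Hsum Hscl eH) simp
  have cp: "comb k p" unfolding p_def by (intro comb_sum comb_scl) (use e(1) in simp)
  then obtain c where c: "p=(\<Sum>j<k. scl (c j) (v j))" unfolding comb_def by blast
  have wH: "w : H" using vH pH by (simp add: w_def)
  have cw: "comb (Suc k) w"
  proof -
   have "w=(\<Sum>j<Suc k. scl (if j < k then c j else 1) (v j))" by (simp add: w_def c add.commute)
   then show ?thesis unfolding comb_def by (rule exI[of _ "%j. if j < k then c j else 1"])
  qed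
  have "nsq w ~= 0"
  proof
   assume z: "nsq w=0"
   let ?c = "%j. if j < k then c j else if j=k then 1 else 0"
   have "(\<Sum>j<m. scl (?c j) (v j))=(\<Sum>j<Suc k. scl (?c j) (v j))"
    by (rule sum.mono_neutral_right) (use km in "auto simp: not_less_eq")
   also have "...=w" by (simp add: w_def c)
   finally have "nsq (\<Sum>j<m. scl (?c j) (v j))=0" using z by simp
   from indep[OF this] km(1) show False by auto
  qed
  then have nw: "nsq w > 0" using nsq_nonneg[OF wH] by simp
  have orth: "ip w (e i)=0" if i: "i < k" for i
  proof -
   have "ip p (e i)=(\<Sum>j<k. - ip (v k) (e j) * ip (e j) (e i))"
    unfolding p_def using eH i by (subst ip_sum) (auto simp: ip_scl ip_minus)
   also have "...=(\<Sum>j<k. if j=i then - ip (v k) (e i) else 0)"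
    by (rule sum.cong) (use e(2) i in auto)
   also have "...=- ip (v k) (e i)" using i by simp
   finally show ?thesis using vH pH eH[OF i] by (simp add: w_def ip_add)
  qed
  define s where "s=cof (1 / sqrt (nsq w))"
  define e' where "e'=e(k := scl s w)"
  have "ip (scl s w) (scl s w) = of_real (nsq (scl s w))" using wH by (simp add: ip_self)
  also have "nsq (scl s w)=1" using nw wH by (simp add: nsq_scl s_def norm_divide power_divide)
  finally have self: "ip (scl s w) (scl s w)=1" by simp
  have o1: "ip (scl s w) (e i)=0" if "i < k" for i using orth[OF that] eH[OF that] wH by (simp add: ip_scl)
  have o2: "ip (e i) (scl s w)=0" if "i < k" for i using o1[OF that] ip_cnj[OF Hscl[OF wH] eH[OF that], of s] by simp
  have "\<forall>j<Suc k. comb (Suc k) (e' j)"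
   using e(1) comb_Suc comb_scl[OF cw] by (simp add: e'_def less_Suc_eq)
  moreover have "\<forall>i<Suc k. \<forall>j<Suc k. ip (e' i) (e' j)=(if i=j then 1 else 0)"
   using e(2) self o1 o2 by (auto simp: e'_def less_Suc_eq)
  ultimately show ?case by blast
 qed
 from this[OF order_refl] combE show ?thesis by blast
qed

end

locale form_operator_compact = semi_hilbert scl H ip
 for scl :: "complex => 'v::ab_group_add => 'v" and H ip +
 fixes D :: "'v set" and b :: "'v => 'v => complex" and C :: real and T :: "'v => 'v => bool" and lam :: "nat => real"
 assumes DH: "u : D ==> u : H" and Dadd: "u : D ==> v : D ==> u+v : D" and Dscl: "u : D ==> scl c u : D"
  and b_add: "u : D ==> v : D ==> w : D ==> b (u+v) w=b u w+b v w"
  and b_scl: "u : D ==> w : D ==> b (scl c u) w=c * b u w"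
  and b_cnj: "u : D ==> v : D ==> b v u=cnj (b u v)"
  and b_lower: "u : D ==> - C * nsq u <= Re (b u u)"
  and b_null: "u : D ==> v : D ==> nsq u=0 ==> b u v=0"
  and dense: "x : H ==> (!!v. v : D ==> ip x v=0) ==> nsq x=0"
  and T_iff: "T u f \<longleftrightarrow> u : D & f : H & (\<forall>v\<in>D. b u v=ip f v)"
  and surj: "f : H ==> EX u. T u (f - u)"
  and inj: "T u (- u) ==> nsq u=0"
  and compact: "(!!n::nat. fs n : H) ==> (!!n. T (us n) (fs n - us n)) ==> (!!n. nsq (fs n) <= K) ==>
   \<exists>r w. strict_mono (r::nat => nat) & w : H & (%n. nsq (us (r n) - w)) ~~> 0"
  and lam_mono: "1 <= j ==> lam j <= lam (Suc j)" and lam_pos: "0 < lam 1"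
  and lam_finite: "finite {j. 1 <= j & lam j=mu}"
  and lam_ex: "EX u::nat => 'v. (\<forall>j<card {j. 1 <= j & lam j = mu}. T (u j) (scl (of_real mu) (u j))) \<and>
   (\<forall>c. nsq (\<Sum>j<card {j. 1 <= j & lam j = mu}. scl (c j) (u j)) = 0 --> (\<forall>j<card {j. 1 <= j & lam j = mu}. c j = 0))"
  and lam_max: "(!!j. j < m ==> T (us j) (scl (of_real mu) (us j))) ==>
   (!!cs. nsq (\<Sum>j<m. scl (cs j) (us j)) = 0 ==> \<forall>j<m. cs j = 0) ==> m <= card {j. 1 <= j & lam j = mu}"
begin

lemma Dminus: assumes "u : D" shows "- u : D"
proof -
 have "scl (- 1) u=- u" by (simp add: scale_minus_left)
 then show ?thesis using Dscl[OF assms, of "- 1"] by simp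
qed

lemma D0: "0 : D"
proof -
 obtain u where "T u (0 - u)" using surj[OF H0] by blast
 then have "u : D" by (simp add: T_iff)
 from Dscl[OF this, of 0] show ?thesis by simp
qed

lemma Ddiff: "u : D ==> v : D ==> u - v : D"
 using Dadd[of u "- v"] Dminus[of v] by simp

lemma T_D: "T u f ==> u : D" and T_H: "T u f ==> u : H" and T_H': "T u f ==> f : H"
 by (simp_all add: T_iff DH)

lemma T_add: assumes "T u f" "T v g" shows "T (u+v) (f+g)"
 using assms by (simp add: T_iff Dadd b_add ip_add DH)

lemma T_scl: assumes "T u f" shows "T (scl c u) (scl c f)"
 using assms by (simp add: T_iff Dscl b_scl ip_scl DH)

lemma T_diff: assumes "T u f" "T v g" shows "T (u - v) (f - g)"
 using T_add[OF assms(1) T_scl[OF assms(2), of "- 1"]] by (simp add: scale_minus_left)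

lemma T_sym: assumes "T u f" "T v g" shows "ip f v=ip u g"
proof -
 have "ip f v=b u v" using assms by (simp add: T_iff)
 also have "...=cnj (b v u)" using b_cnj[of v u] assms by (simp add: T_iff)
 also have "...=cnj (ip g u)" using assms by (simp add: T_iff)
 also have "...=ip u g" using ip_cnj[of g u] assms T_H T_H' by simp
 finally show ?thesis .
qed

definition R :: "'v => 'v" where "R f=(SOME u. T u (f - u))"

lemma TR: "f : H ==> T (R f) (f - R f)" unfolding R_def by (rule someI_ex) (rule surj)
lemma RD: "f : H ==> R f : D" by (rule T_D[OF TR])
lemma RH[simp]: "f : H ==> R f : H" by (rule T_H[OF TR])

lemma R_sym: assumes "f : H" "g : H" shows "ip (R f) g=ip f (R g)"
 using T_sym[OF TR[OF assms(1)] TR[OF assms(2)]] assms by (simp add: ip_diff ip_diff_right)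

lemma R_unique: assumes "f : H" "T u (f - u)" shows "nsq (u - R f)=0"
proof (rule inj)
 have "T (u - R f) ((f - u) - (f - R f))" by (rule T_diff[OF assms(2) TR[OF assms(1)]])
 then show "T (u - R f) (- (u - R f))" by simp
qed

lemma R_lin: assumes "f : H" "g : H" shows "nsq ((R f+scl c (R g)) - R (f+scl c g))=0"
proof (rule R_unique)
 have "T (R f+scl c (R g)) ((f - R f)+scl c (g - R g))"
  by (intro T_add T_scl TR assms)
 moreover have "(f - R f)+scl c (g - R g)=(f+scl c g) - (R f+scl c (R g))"
  by (simp add: scale_right_diff_distrib)
 ultimately show "T (R f+scl c (R g)) (f+scl c g - (R f+scl c (R g)))" by simp
qed (use assms in simp)

lemma R_inj: assumes f: "f : H" and z: "nsq (R f)=0" shows "nsq f=0"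
proof -
 have "ip (f - R f) v=0" if "v : D" for v
  using TR[OF f] b_null[OF RD[OF f] that z] that by (simp add: T_iff)
 then have "nsq (f - R f)=0" using dense f by simp
 then show ?thesis using nsq_null_add[of "R f" "f - R f"] f z by simp
qed

lemma R_null: assumes f: "f : H" and z: "nsq f=0" shows "nsq (R f)=0"
proof -
 have "ip (R f) (R f)=ip f (R (R f))" using R_sym[of f "R f"] f by simp
 also have "...=0" using ip_null[OF f _ z] f by simp
 finally show ?thesis by (simp add: nsq_def)
qed

lemma R_bounded: "\<exists>K>0. \<forall>f\<in>H. nsq (R f) <= K * nsq f"
proof (rule ccontr)
 assume "\<not> ?thesis"
 then have "\<forall>n::nat. \<exists>f\<in>H. \<not> nsq (R f) <= real (Suc n) * nsq f" by (metis of_nat_0_less_iff zero_less_Suc)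
 then obtain f where f: "!!n::nat. f n : H" "!!n. real (Suc n) * nsq (f n) < nsq (R (f n))"
  by (metis not_le)
 have fp: "nsq (f n) > 0" for n
 proof (rule ccontr)
  assume "\<not> nsq (f n) > 0"
  then have "nsq (f n)=0" using nsq_nonneg[OF f(1)[of n]] by simp
  with R_null[OF f(1) this] f(2)[of n] show False by simp
 qed
 define s where "s n=cof (1 / sqrt (nsq (f n)))" for n
 have sn: "(cmod (s n))\<^sup>2=1 / nsq (f n)" for n using fp[of n] by (simp add: s_def norm_divide power_divide)
 have "T (scl (s n) (R (f n))) (scl (s n) (f n) - scl (s n) (R (f n)))" for n
  using T_scl[OF TR[OF f(1)], of "s n" n] by (simp add: scale_right_diff_distrib)
 moreover have "nsq (scl (s n) (f n)) <= 1" for n using fp[of n] f(1)[of n] by (simp add: nsq_scl sn)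
 ultimately obtain r w where r: "strict_mono (r::nat=>nat)" "w : H" "(%n. nsq (scl (s (r n)) (R (f (r n))) - w)) ~~> 0"
  using compact[of "%n. scl (s n) (f n)" "%n. scl (s n) (R (f n))" 1] f(1) by auto
 have "eventually (%n. nsq (scl (s (r n)) (R (f (r n))) - w) < 1) sequentially"
  by (rule order_tendstoD(2)[OF r(3)]) simp
 then obtain N where N: "!!n. n >= N ==> nsq (scl (s (r n)) (R (f (r n))) - w) < 1"
  unfolding eventually_sequentially by blast
 obtain n where n: "n >= N" "real n > 2+2 * nsq w"
  using reals_Archimedean2[of "max (real N) (2+2 * nsq w)"] by (auto intro: that less_imp_le)
 let ?v = "scl (s (r n)) (R (f (r n)))"
 have vH: "?v : H" using f(1) by simp
 have "real (Suc (r n)) < nsq ?v"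
  using f(2)[of "r n"] fp[of "r n"] f(1) by (simp add: nsq_scl sn field_simps)
 also have "nsq ?v <= 2 * nsq (?v - w)+2 * nsq w"
  using nsq_add_le[of "?v - w" w] vH r(2) by simp
 also have "... <= 2+2 * nsq w" using N[OF n(1)] by simp
 finally show False using n(2) seq_suble[OF r(1), of n] by linarith
qed

lemma lam_mono_le: assumes "1 <= i" "i <= j" shows "lam i <= lam j"
 using assms(2)
proof (induction j rule: dec_induct)
 case (step n)
 then show ?case using lam_mono[of n] assms(1) by simp
qed simp

lemma lam_positive: "1 <= j ==> 0 < lam j"
 using lam_mono_le[of 1 j] lam_pos by linarith

lemma eigen_orthogonal:
 assumes "T u (scl (of_real mu) u)" "T v (scl (of_real \<nu>) v)" "mu ~= \<nu>"
 shows "ip u v=0"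
proof -
 have "of_real mu * ip u v = of_real \<nu> * ip u v"
  using T_sym[OF assms(1,2)] T_H[OF assms(1)] T_H[OF assms(2)] by (simp add: ip_scl ip_scl_right)
 then show ?thesis using assms(3) by simp
qed

text \<open>Gram-Schmidt inside each eigenspace; different eigenspaces are orthogonal.\<close>

lemma eigenbasis_exists:
 "EX u::nat => 'v. (\<forall>j\<ge>1. T (u j) (scl (of_real (lam j)) (u j))) \<and>
  (\<forall>i\<ge>1. \<forall>j\<ge>1. ip (u i) (u j) = (if i = j then 1 else 0)) \<and>
  (\<forall>mu z. T z (scl (of_real mu) z) --> (\<forall>j\<ge>1. ip z (u j) = 0) --> nsq z = 0)"
proof -
 define J where "J mu={j. 1 <= j & lam j=mu}" for mu
 define E where "E mu={u. T u (scl (cof mu) u)}" for mu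
 have E: "E mu \<subseteq> H" "!!x y. x : E mu ==> y : E mu ==> x+y : E mu" "!!c x. x : E mu ==> scl c x : E mu" "0 : E mu" for mu
 proof -
  show "E mu \<subseteq> H" using T_H by (auto simp: E_def)
  show "x+y : E mu" if "x : E mu" "y : E mu" for x y
   using T_add[of x "scl (of_real mu) x" y "scl (of_real mu) y"] that by (simp add: E_def scale_right_distrib)
  show scl: "scl c x : E mu" if "x : E mu" for c x
   using T_scl[of x "scl (of_real mu) x" c] that by (simp add: E_def mult.commute)
  have "T 0 0" using D0 b_null[OF D0] by (simp add: T_iff DH)
  then show "0 : E mu" by (simp add: E_def)
 qed
 have "EX e::nat => 'v. (\<forall>j<card (J mu). e j : E mu) & (\<forall>i<card (J mu). \<forall>j<card (J mu). ip (e i) (e j)=(if i=j then 1 else 0))" for mu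
 proof -
  obtain v where v: "\<forall>j<card (J mu). T (v j) (scl (of_real mu) (v j))"
   "\<forall>c. nsq (\<Sum>j<card (J mu). scl (c j) (v j))=0 --> (\<forall>j<card (J mu). c j=0)"
   using lam_ex[of mu] unfolding J_def by blast
  show ?thesis
   by (rule gram_schmidt[OF E, where v=v]) (use v in "auto simp: E_def")
 qed
 then obtain e where e: "!!mu j. j < card (J mu) ==> e mu j : E mu"
  "!!mu i j. i < card (J mu) ==> j < card (J mu) ==> ip (e mu i) (e mu j)=(if i=j then 1 else 0)" by metis
 have "EX h. bij_betw h (J mu) {..<card (J mu)}" for mu
  using ex_bij_betw_finite_nat[OF lam_finite[of mu]] by (simp add: J_def atLeast0LessThan)
 then obtain h where h: "!!mu. bij_betw (h mu) (J mu) {..<card (J mu)}" by metis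
 define u where "u j=e (lam j) (h (lam j) j)" for j
 have hJ: "h (lam j) j < card (J (lam j))" if "1 <= j" for j
  using bij_betwE[OF h[of "lam j"]] that by (auto simp: J_def)
 have uE: "T (u j) (scl (of_real (lam j)) (u j))" if "1 <= j" for j
  using e(1)[OF hJ[OF that]] by (simp add: u_def E_def)
 have orth: "ip (u i) (u j)=(if i=j then 1 else 0)" if ij: "1 <= i" "1 <= j" for i j
 proof (cases "lam i=lam j")
  case True
  have "h (lam j) i=h (lam j) j \<longleftrightarrow> i=j"
   using bij_betw_imp_inj_on[OF h[of "lam j"]] ij True by (auto simp: J_def inj_on_def)
  then show ?thesis using e(2)[of "h (lam j) i" "lam j" "h (lam j) j"] hJ[OF ij(1)] hJ[OF ij(2)] True by (simp add: u_def)
 next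
  case False
  then show ?thesis using eigen_orthogonal[OF uE[OF ij(1)] uE[OF ij(2)]] by auto
 qed
 have max: "nsq z=0" if z: "T z (scl (of_real mu) z)" "\<forall>j\<ge>1. ip z (u j)=0" for mu z
 proof (rule ccontr)
  assume nz: "nsq z ~= 0"
  let ?m = "card (J mu)"
  have zH: "z : H" by (rule T_H[OF z(1)])
  have eH: "e mu i : H" if "i < ?m" for i using e(1)[OF that] E(1) by blast
  have ze: "ip z (e mu i)=0" if "i < ?m" for i
  proof -
   have "i : h mu ` J mu" using bij_betw_imp_surj_on[OF h[of mu]] that by simp
   then obtain j where j: "j : J mu" "h mu j=i" by blast
   then have "e mu i=u j" "1 <= j" by (auto simp: u_def J_def)
   then show ?thesis using z(2) by simp
  qed
  have ez: "ip (e mu i) z=0" if "i < ?m" for i using ze[OF that] ip_cnj[OF zH eH[OF that]] by simp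
  let ?e = "(e mu)(?m := z)"
  have "Suc ?m <= ?m"
  proof (rule lam_max[where us="?e" and mu=mu, folded J_def])
   show "T (?e j) (scl (of_real mu) (?e j))" if "j < Suc ?m" for j
    using e(1)[of j mu] z(1) that by (auto simp: E_def less_Suc_eq)
   fix c assume c: "nsq (\<Sum>j<Suc ?m. scl (c j) (?e j))=0"
   have eeH: "?e j : H" if "j < Suc ?m" for j using eH[of j] zH that by (auto simp: less_Suc_eq)
   let ?s = "\<Sum>j<Suc ?m. scl (c j) (?e j)"
   have sH: "?s : H" by (intro Hsum Hscl eeH) simp
   have val: "ip ?s (?e i)=c i * ip (?e i) (?e i)" if i: "i < Suc ?m" for i
   proof -
    have "ip ?s (?e i)=(\<Sum>j<Suc ?m. c j * ip (?e j) (?e i))"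
    using eeH i by (subst ip_sum) (auto simp: ip_scl simp del: sum.lessThan_Suc)
    also have "...=(\<Sum>j<Suc ?m. if j=i then c i * ip (?e i) (?e i) else 0)"
    by (rule sum.cong) (use e(2)[of _ mu ] ez ze i in "auto simp: less_Suc_eq")
    also have "...=c i * ip (?e i) (?e i)" using i by (simp del: sum.lessThan_Suc)
    finally show ?thesis .
   qed
   show "\<forall>j<Suc ?m. c j=0"
   proof (intro allI impI)
    fix i assume i: "i < Suc ?m"
    have "ip (?e i) (?e i) ~= 0" using i e(2)[of i mu i] nz ip_self[OF zH] by (auto simp: less_Suc_eq)
    then show "c i=0" using val[OF i] ip_null[OF sH eeH[OF i] c] by simp
   qed
  qed
  then show False by simp
 qed
 show ?thesis using uE orth max by blast
qed

text \<open>The orthogonal complement of the eigenvectors is invariant under the compact symmetric resolvent \<open>R\<close>. If it were nonzero, a maximizing sequence for \<open>\<bar>R x\<bar>\<close> would yield a further eigenvector. So the eigenvectors are complete, and expanding \<open>f\<close> while bounding the form from below on the remainder gives the inequality.\<close>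

theorem eigenvalue_inequality:
 "EX u::nat => 'v. (\<forall>j\<ge>1. u j : D & nsq (u j) = 1) \<and>
  (\<forall>f\<in>D. \<forall>k. (\<Sum>j=1..k. lam j * (cmod (ip f (u j)))\<^sup>2)
    + lam (Suc k) * (nsq f - (\<Sum>j=1..k. (cmod (ip f (u j)))\<^sup>2)) <= Re (b f f))"
proof -
 obtain u :: "nat => 'v" where u: "!!j. j >= 1 ==> T (u j) (scl (of_real (lam j)) (u j))"
  and on: "!!i j. i >= 1 ==> j >= 1 ==> ip (u i) (u j)=(if i=j then 1 else 0)"
  and max: "!!mu z. T z (scl (of_real mu) z) ==> (!!j. j >= 1 ==> ip z (u j)=0) ==> nsq z=0"
  using eigenbasis_exists by metis
 have uD: "u j : D" and uH: "u j : H" if "j >= 1" for j using T_D[OF u[OF that]] T_H[OF u[OF that]] .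
 define X where "X={x\<in>H. \<forall>j\<ge>1. ip x (u j)=0}"
 have XH: "x : H" if "x : X" for x using that by (simp add: X_def)
 have Xadd: "x+y : X" if "x : X" "y : X" for x y using that uH by (simp add: X_def ip_add)
 have Xscl: "scl c x : X" if "x : X" for x c using that uH by (simp add: X_def ip_scl)
 have XR: "R x : X" if x: "x : X" for x
 proof -
  have "ip (R x) (u j)=0" if j: "j >= 1" for j
  proof -
   let ?c = "cof (1 / (lam j+1))"
   have l1: "lam j+1 ~= 0" using lam_positive[OF j] by linarith
   have "?c * cof (lam j)=1 - ?c"
   proof -
    have "1 / (lam j+1) * lam j=1 - 1 / (lam j+1)" using l1 by (simp add: field_simps)
    then show ?thesis by (metis of_real_1 of_real_diff of_real_mult)
   qed
   then have "scl ?c (scl (of_real (lam j)) (u j))=u j - scl ?c (u j)"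
    by (simp only: scale_scale) (simp add: scale_left_diff_distrib)
   with T_scl[OF u[OF j], of ?c] have "T (scl ?c (u j)) (u j - scl ?c (u j))" by simp
   from R_unique[OF uH[OF j] this] have nz: "nsq (scl ?c (u j) - R (u j))=0" .
   have "ip (R x) (u j)=ip x (R (u j))" by (rule R_sym[OF XH[OF x] uH[OF j]])
   also have "...=ip x (scl ?c (u j))"
    by (rule ip_null_diff(2)[symmetric, OF _ _ XH[OF x] nz]) (use uH[OF j] in simp_all)
   also have "...=0" using x uH[OF j] XH[OF x] j by (simp add: ip_scl_right X_def)
   finally show ?thesis .
  qed
  then show ?thesis using x by (simp add: X_def)
 qed
 have no_eig: "nsq x=0" if x: "x : X" and r: "r ~= 0" and e: "nsq (R x - scl (of_real r) x)=0" for x and r :: real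
 proof -
  let ?z = "R x" and ?c = "cof (1 / r - 1)"
  have zH: "?z : H" and zD: "?z : D" and xH: "x : H" using RD[OF XH[OF x]] XH[OF x] by simp_all
  have nd: "nsq ((x - ?z) - scl ?c ?z)=0"
  proof -
   have "scl (of_real (1 / r)) ?z - x=scl (of_real (1 / r)) (?z - scl (of_real r) x)"
    using r by (simp add: scale_right_diff_distrib flip: of_real_mult)
   then have "nsq (scl (of_real (1 / r)) ?z - x)=0" using e xH zH by (simp add: nsq_scl)
   then have "nsq (x - scl (of_real (1 / r)) ?z)=0"
    using nsq_commute[of x "scl (of_real (1 / r)) ?z"] xH zH by simp
   moreover have "(x - ?z) - scl ?c ?z=x - scl (of_real (1 / r)) ?z"
    by (simp add: scale_left_diff_distrib)
   ultimately show ?thesis by (simp only:)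
  qed
  have bz: "b ?z v=ip (scl ?c ?z) v" if v: "v : D" for v
  proof -
   have "b ?z v=ip (x - ?z) v" using TR[OF xH] v by (simp add: T_iff)
   also have "...=ip (scl ?c ?z) v" by (rule ip_null_diff(1)[OF _ _ DH[OF v] nd]) (use xH zH in simp_all)
   finally show ?thesis .
  qed
  have "T ?z (scl ?c ?z)" by (rule T_iff[THEN iffD2]) (use bz zD Hscl[OF zH] in blast)
  then have "nsq ?z = 0" by (rule max) (use XR[OF x] in "simp add: X_def")
  then show ?thesis by (rule R_inj[OF xH])
 qed
 have Xnull: "nsq x0=0" if x0: "x0 : X" for x0
 proof (rule ccontr)
  assume n0: "nsq x0 ~= 0"
  obtain K where K: "K > 0" "!!f. f : H ==> nsq (R f) <= K * nsq f" using R_bounded by blast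
  define S where "S={nsq (R x) |x. x : X & nsq x <= 1}"
  have Sb: "bdd_above S"
  proof (rule bdd_aboveI[of _ K])
   fix y assume "y : S"
   then obtain x where x: "y=nsq (R x)" "x : X" "nsq x <= 1" by (auto simp: S_def)
   have "y <= K * nsq x" using K(2)[OF XH[OF x(2)]] x(1) by simp
   also have "... <= K * 1" using K(1) x(3) by (intro mult_left_mono) simp_all
   finally show "y <= K" by simp
  qed
  define m where "m=Sup S"
  have sclR: "nsq (R (scl c x))=(cmod c)\<^sup>2 * nsq (R x)" if "x : H" for c x
  proof -
   have "nsq ((R 0+scl c (R x)) - R (0+scl c x))=0" by (rule R_lin) (use that in simp_all)
   moreover have "nsq ((0+scl c (R x)) - (R 0+scl c (R x)))=0"
    using R_null[of 0] nsq_scl[of "R 0" "- 1"] by (simp add: scale_minus_left)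
   ultimately have "nsq (scl c (R x) - R (scl c x))=0"
    using nsq_null_trans[of "scl c (R x)" "R 0+scl c (R x)" "R (scl c x)"] that by simp
   then have n: "nsq (R (scl c x) - scl c (R x))=0" using nsq_commute[of "scl c (R x)" "R (scl c x)"] that by simp
   have "nsq ((R (scl c x) - scl c (R x))+scl c (R x))=nsq (scl c (R x))"
    by (rule nsq_null_add[OF _ _ n]) (use that in simp_all)
   then show ?thesis using that by (simp add: nsq_scl)
  qed
  have mub: "nsq (R x) <= m * nsq x" if x: "x : X" for x
  proof (cases "nsq x=0")
   case True
   then show ?thesis using R_null[OF XH[OF x]] by simp
  next
   case False
   then have xp: "nsq x > 0" using nsq_nonneg[OF XH[OF x]] by simp
   let ?s = "cof (1 / sqrt (nsq x))"
   have s2: "(cmod ?s)\<^sup>2=1 / nsq x" using xp by (simp add: norm_divide power_divide)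
   have "nsq (R (scl ?s x)) : S"
    unfolding S_def using Xscl[OF x, of ?s] xp XH[OF x] s2 by (intro CollectI exI[of _ "scl ?s x"]) (simp add: nsq_scl)
   from cSup_upper[OF this Sb] have "nsq (R (scl ?s x)) <= m" by (simp add: m_def)
   then have "1 / nsq x * nsq (R x) <= m" by (simp only: sclR[OF XH[OF x]] s2)
   then show ?thesis using xp by (simp add: field_simps)
  qed
  have m0: "m > 0"
  proof (rule ccontr)
   assume "\<not> m > 0"
   then have "m * nsq x0 <= 0" using nsq_nonneg[OF XH[OF x0]] by (simp add: mult_nonpos_nonneg)
   with mub[OF x0] have "nsq (R x0)=0" using nsq_nonneg[of "R x0"] XH[OF x0] by (simp add: order_antisym)
   from R_inj[OF XH[OF x0] this] n0 show False by simp
  qed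
  have Sne: "S ~= {}"
  proof -
   have "0 : X" using uH by (simp add: X_def)
   then have "nsq (R 0) : S" unfolding S_def by (intro CollectI exI[of _ 0]) simp
   then show ?thesis by blast
  qed
  have "EX x. x : X & nsq x <= 1 & m - inverse (Suc n) < nsq (R x)" for n :: nat
  proof -
   have "m - inverse (Suc n) < Sup S" by (simp add: m_def)
   then obtain y where "y : S" "m - inverse (Suc n) < y" using less_cSup_iff[OF Sne Sb] by blast
   then show ?thesis unfolding S_def by blast
  qed
  then obtain x where x: "!!n::nat. x n : X" "!!n. nsq (x n) <= 1" "!!n. m - inverse (Suc n) < nsq (R (x n))" by metis
  have xH: "x n : H" for n using XH[OF x(1)] .
  define y where "y n=R (x n)" for n
  have yX: "y n : X" for n using XR[OF x(1)] by (simp add: y_def)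
  have yH: "y n : H" for n using XH[OF yX] .
  have ym: "nsq (y n) <= m" for n
  proof -
   have "nsq (y n) <= m * nsq (x n)" using mub[OF x(1)] by (simp add: y_def)
   also have "... <= m * 1" by (rule mult_left_mono) (use x(2) m0 in simp_all)
   finally show ?thesis by simp
  qed
  have "nsq (R (y n) - scl (of_real m) (x n)) <= m * (m - nsq (y n))" for n
  proof -
   have "ip (R (y n)) (x n) = of_real (nsq (y n))" using R_sym[OF yH xH] ip_self[OF yH] by (simp add: y_def)
   then have "nsq (R (y n) - scl (of_real m) (x n))=nsq (R (y n)) - 2 * (m * nsq (y n))+m\<^sup>2 * nsq (x n)"
    using yH xH by (simp add: nsq_diff ip_scl_right nsq_scl)
   also have "... <= m * nsq (y n) - 2 * (m * nsq (y n))+m\<^sup>2 * 1"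
    using mub[OF yX] x(2)[of n] m0 by (intro add_mono diff_mono mult_left_mono) simp_all
   also have "...=m * (m - nsq (y n))" by (simp add: power2_eq_square algebra_simps)
   finally show ?thesis .
  qed
  moreover have "m * (m - nsq (y n)) <= m * inverse (Suc n)" for n
   by (rule mult_left_mono) (use x(3)[of n] m0 in "simp_all add: y_def")
  ultimately have close: "nsq (R (y n) - scl (of_real m) (x n)) <= m * inverse (Suc n)" for n using order_trans by blast
  have linv: "(%n. m * inverse (real (Suc n))) ~~> 0" using tendsto_mult_right_zero[OF LIMSEQ_inverse_real_of_nat] .
  have lim1: "(%n. nsq (R (y n) - scl (of_real m) (x n))) ~~> 0"
   by (rule tendsto_sandwich[OF _ _ tendsto_const linv]) (use close xH yH in "simp_all add: always_eventually")
  have limy: "(%n. nsq (y n)) ~~> m"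
  proof -
   have "(%n. m - inverse (real (Suc n))) ~~> m - 0"
    by (rule tendsto_diff[OF tendsto_const LIMSEQ_inverse_real_of_nat])
   then have l: "(%n. m - inverse (real (Suc n))) ~~> m" by simp
   show ?thesis
    by (rule tendsto_sandwich[OF _ _ l tendsto_const]) (use x(3) ym less_imp_le in "auto intro!: always_eventually simp: y_def")
  qed
  obtain r w where r: "strict_mono (r::nat=>nat)" "w : H" "(%n. nsq (y (r n) - w)) ~~> 0"
   using compact[of x y 1] xH x(2) TR[OF xH] by (auto simp: y_def)
  have wX: "w : X"
  proof -
   have "ip w (u j)=0" if j: "j >= 1" for j
   proof -
    have "(%n. ip (y (r n)) (u j)) ~~> ip w (u j)" by (rule ip_tendsto[OF yH r(2,3) uH[OF j]])
    moreover have "ip (y (r n)) (u j)=0" for n using yX[of "r n"] j by (simp add: X_def)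
    ultimately show ?thesis using LIMSEQ_unique[OF _ tendsto_const] by simp
   qed
   then show ?thesis using r(2) by (simp add: X_def)
  qed
  have rle: "2 * nsq p+2 * nsq q >= 0" if "p : H" "q : H" for p q using that by simp
  have Rdiff: "nsq (R p - R q) <= K * nsq (p - q)" if "p : H" "q : H" for p q
  proof -
   have n: "nsq ((R p+scl (- 1) (R q)) - R (p+scl (- 1) q))=0" by (rule R_lin[OF that])
   have "nsq (((R p - R q) - R (p - q))+R (p - q))=nsq (R (p - q))"
    by (rule nsq_null_add) (use n that in "simp_all add: scale_minus_left")
   then show ?thesis using K(2)[of "p - q"] that by simp
  qed
  have limRy: "(%n. nsq (R (y (r n)) - R w)) ~~> 0"
   by (rule tendsto_sandwich[OF _ _ tendsto_const tendsto_mult_right_zero[OF r(3), of K]])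
    (use Rdiff[OF yH r(2)] yH r(2) in "simp_all add: always_eventually")
  have lim1r: "(%n. nsq (R (y (r n)) - scl (of_real m) (x (r n)))) ~~> 0"
   using LIMSEQ_subseq_LIMSEQ[OF lim1 r(1)] by (simp add: o_def)
  have limx: "(%n. nsq (scl (of_real m) (x (r n)) - R w)) ~~> 0"
  proof (rule tendsto_sandwich[OF _ _ tendsto_const])
   show "(%n. 2 * nsq (R (y (r n)) - R w)+2 * nsq (R (y (r n)) - scl (of_real m) (x (r n)))) ~~> 0"
    using tendsto_add[OF tendsto_mult_right_zero[OF limRy, of 2] tendsto_mult_right_zero[OF lim1r, of 2]] by simp
   have "nsq (scl (of_real m) (x (r n)) - R w) <= 2 * nsq (R (y (r n)) - R w)+2 * nsq (R (y (r n)) - scl (of_real m) (x (r n)))" for n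
    using nsq_diff_le[of "R (y (r n)) - R w" "R (y (r n)) - scl (of_real m) (x (r n))"] yH xH r(2) by simp
   then show "\<forall>\<^sub>F n in sequentially. nsq (scl (of_real m) (x (r n)) - R w)
    <= 2 * nsq (R (y (r n)) - R w) + 2 * nsq (R (y (r n)) - scl (of_real m) (x (r n)))" by (intro always_eventually allI)
  qed (use xH r(2) in "simp add: always_eventually")
  have limRx: "(%n. nsq (R (scl (of_real m) (x (r n))) - R (R w))) ~~> 0"
   by (rule tendsto_sandwich[OF _ _ tendsto_const tendsto_mult_right_zero[OF limx, of K]])
    (use Rdiff[of "scl (of_real m) (x (r _))" "R w"] xH r(2) in "simp_all add: always_eventually")
  have eq: "nsq (R (scl (of_real m) (x n)) - scl (of_real m) (y n))=0" for n
  proof -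
   have "nsq ((R 0+scl (of_real m) (R (x n))) - R (0+scl (of_real m) (x n)))=0" by (rule R_lin) (use xH in simp_all)
   moreover have "nsq ((0+scl (of_real m) (R (x n))) - (R 0+scl (of_real m) (R (x n))))=0"
    using R_null[of 0] nsq_scl[of "R 0" "- 1"] by (simp add: scale_minus_left)
   ultimately have "nsq (scl (of_real m) (R (x n)) - R (scl (of_real m) (x n)))=0"
    using nsq_null_trans[of "scl (of_real m) (R (x n))" "R 0+scl (of_real m) (R (x n))" "R (scl (of_real m) (x n))"] xH by simp
   then show ?thesis using nsq_commute[of "R (scl (of_real m) (x n))" "scl (of_real m) (y n)"] xH yH by (simp add: y_def)
  qed
  have RRw: "nsq (R (R w) - scl (of_real m) w)=0"
  proof -
   let ?a = "%n. R (scl (of_real m) (x (r n)))" and ?c = "%n. scl (of_real m) (y (r n))"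
   have bd: "nsq (R (R w) - scl (of_real m) w) <= 2 * nsq (?a n - R (R w))+2 * (m\<^sup>2 * nsq (y (r n) - w))" for n
   proof -
    have "nsq ((?c n - scl (of_real m) w)+(?a n - ?c n))=nsq (?c n - scl (of_real m) w)"
    using nsq_null_add[of "?a n - ?c n" "?c n - scl (of_real m) w"] eq[of "r n"] xH yH r(2) by (simp add: add.commute)
    then have e1: "nsq (?a n - scl (of_real m) w)=nsq (scl (of_real m) (y (r n) - w))" by (simp add: scale_right_diff_distrib)
    have "nsq (R (R w) - scl (of_real m) w)=nsq ((?a n - scl (of_real m) w) - (?a n - R (R w)))" by simp
    also have "... <= 2 * nsq (?a n - scl (of_real m) w)+2 * nsq (?a n - R (R w))"
    by (rule nsq_diff_le) (use xH r(2) in simp_all)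
    also have "nsq (?a n - scl (of_real m) w)=m\<^sup>2 * nsq (y (r n) - w)"
    unfolding e1 using yH r(2) by (simp add: nsq_scl)
    finally show ?thesis by simp
   qed
   have "(%n. 2 * nsq (?a n - R (R w))+2 * (m\<^sup>2 * nsq (y (r n) - w))) ~~> 0"
    using tendsto_add[OF tendsto_mult_right_zero[OF limRx, of 2] tendsto_mult_right_zero[OF tendsto_mult_right_zero[OF r(3), of "m\<^sup>2"], of 2]] by simp
   then have "nsq (R (R w) - scl (of_real m) w) <= 0"
    by (rule LIMSEQ_le_const) (use bd in blast)
   then show ?thesis using r(2) by (simp add: order_antisym)
  qed
  have nw: "nsq w ~= 0"
  proof
   assume z: "nsq w=0"
   have "nsq (y (r n))=nsq (y (r n) - w)" for n
    using nsq_null_add[of w "y (r n) - w"] z r(2) yH by simp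
   then have "(%n. nsq (y (r n))) ~~> 0" using r(3) by simp
   moreover have "(%n. nsq (y (r n))) ~~> m" using LIMSEQ_subseq_LIMSEQ[OF limy r(1)] by (simp add: o_def)
   ultimately show False using LIMSEQ_unique m0 by blast
  qed
  define s where "s=sqrt m"
  have s: "s > 0" "s * s=m" using m0 by (simp_all add: s_def)
  let ?z = "R w+scl (of_real s) w"
  have wH: "w : H" by (rule r(2))
  have zX: "?z : X" by (intro Xadd Xscl XR wX)
  have "nsq (R ?z - scl (of_real s) ?z)=0"
  proof -
   have 1: "nsq ((R (R w)+scl (of_real s) (R w)) - R ?z)=0" by (rule R_lin) (use wH in simp_all)
   have "scl (of_real s) ?z=scl (of_real m) w+scl (of_real s) (R w)"
    by (simp add: scale_right_distrib s(2) add.commute flip: of_real_mult)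
   then have 2: "nsq ((R (R w)+scl (of_real s) (R w)) - scl (of_real s) ?z)=0" using RRw by simp
   have 3: "nsq (R ?z - (R (R w)+scl (of_real s) (R w)))=0"
    using 1 nsq_commute[of "R ?z" "R (R w)+scl (of_real s) (R w)"] wH by simp
   show ?thesis by (rule nsq_null_trans[OF _ _ _ 3 2]) (use wH in simp_all)
  qed
  then have "nsq ?z=0" by (rule no_eig[OF zX, rotated]) (use s in simp)
  then have "nsq (R w - scl (of_real (- s)) w)=0" by (simp add: scale_minus_left)
  then have "nsq w=0" by (rule no_eig[OF wX, rotated]) (use s in simp)
  with nw show False ..
 qed
 define c where "c f j=ip f (u j)" for f j
 define P where "P N f=(\<Sum>j=1..N. scl (c f j) (u j))" for N f
 have PH: "P N f : H" for N f unfolding P_def by (intro Hsum Hscl uH) simp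
 have PD: "P N f : D" for N f
 proof -
  have "finite S ==> S \<subseteq> {1..} ==> (\<Sum>j\<in>S. scl (c f j) (u j)) : D" for S
   by (induction S rule: finite_induct) (simp_all add: D0 Dadd Dscl uD)
  then show ?thesis by (simp add: P_def)
 qed
 have ipP: "ip (P N f) (u i)=(if i <= N then c f i else 0)" if i: "i >= 1" for N f i
 proof -
  have "ip (P N f) (u i)=(\<Sum>j=1..N. c f j * ip (u j) (u i))"
   unfolding P_def using uH i by (subst ip_sum) (auto simp: ip_scl)
  also have "...=(\<Sum>j=1..N. if j=i then c f i else 0)" by (rule sum.cong) (use on i in auto)
  finally show ?thesis using i by simp
 qed
 define s where "s f N=(\<Sum>j=1..N. (cmod (c f j))\<^sup>2)" for f and N :: nat
 have ipPg: "ip (P N f) g=(\<Sum>j=1..N. c f j * cnj (c g j))" if g: "g : H" for N f g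
 proof -
  have "ip (P N f) g=(\<Sum>j=1..N. c f j * ip (u j) g)"
   unfolding P_def using uH g by (subst ip_sum) (auto simp: ip_scl)
  also have "...=(\<Sum>j=1..N. c f j * cnj (c g j))"
   by (rule sum.cong) (use ip_cnj[OF g uH] in "auto simp: c_def")
  finally show ?thesis .
 qed
 have cP: "c (P N f) j=(if j <= N then c f j else 0)" if "j >= 1" for N f j using ipP[OF that] by (simp add: c_def)
 have re: "c f j * cnj (c f j) = of_real ((cmod (c f j))\<^sup>2)" for f j by (simp only: complex_norm_square)
 have re2: "c f j * cnj (c f j)=(cof (cmod (c f j)))\<^sup>2" for f j by (simp only: re of_real_power)
 have re3: "c f j * (cof l * cnj (c f j)) = of_real (l * (cmod (c f j))\<^sup>2)" for f j l
  by (simp only: of_real_mult re[symmetric] mult.left_commute)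
 have nP: "nsq (P N f)=s f N" for N f
 proof -
  have "ip (P N f) (P N f)=(\<Sum>j=1..N. of_real ((cmod (c f j))\<^sup>2))"
   unfolding ipPg[OF PH] by (rule sum.cong) (simp_all add: cP re2)
  then show ?thesis by (simp add: nsq_def s_def)
 qed
 have ng: "nsq (f - P N f)=nsq f - s f N" if f: "f : H" for N f
 proof -
  have "ip (P N f) f = of_real (s f N)" unfolding ipPg[OF f] s_def by (simp add: re2)
  then have "Re (ip f (P N f))=s f N" using ip_cnj[OF PH[of N f] f] by simp
  then show ?thesis using nsq_diff[OF f PH] nP by simp
 qed
 have complete_basis: "(%N. nsq (f - P N f)) ~~> 0" if f: "f : H" for f
 proof -
  have smono: "s f i <= s f j" if "i <= j" for i j
   unfolding s_def by (rule sum_mono2) (use that in auto)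
  have sb: "s f N <= nsq f" for N using ng[OF f, of N] nsq_nonneg[of "f - P N f"] f PH by simp
  have s0: "0 <= s f N" for N unfolding s_def by (rule sum_nonneg) simp
  have "Bseq (s f)" by (rule BseqI'[of _ "nsq f"]) (use sb s0 in simp)
  then have "convergent (s f)" by (rule Bseq_mono_convergent) (use smono in blast)
  then have Cs: "Cauchy (s f)" by (simp add: Cauchy_convergent_iff)
  have nd: "nsq (P i f - P j f)=\<bar>s f i - s f j\<bar>" for i j
  proof -
   have le: "nsq (P i f - P j f)=s f j - s f i" if "i <= j" for i j
   proof -
    have "P j f - P i f=P j f - P i (P j f)"
    proof -
    have "P i (P j f)=P i f" unfolding P_def[of i] by (rule sum.cong) (use cP that in auto)
    then show ?thesis by simp
    qed
    then have "nsq (P j f - P i f)=s f j - s (P j f) i" using ng[OF PH] nP by simp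
    also have "s (P j f) i=s f i" unfolding s_def by (rule sum.cong) (use cP that in auto)
    finally show ?thesis using nsq_commute[OF PH PH] by simp
   qed
   show ?thesis
   proof (cases "i <= j")
    case True
    then show ?thesis using le[OF True] smono[OF True] by simp
   next
    case False
    then have "j <= i" by simp
    then show ?thesis using le[of j i] smono[of j i] nsq_commute[OF PH PH, of i f j f] by simp
   qed
  qed
  have "\<exists>x\<in>H. (%n. Re (ip ((f - P n f) - x) ((f - P n f) - x))) ~~> 0"
  proof (rule complete)
   fix e :: real assume "e > 0"
   then obtain N where "\<forall>m\<ge>N. \<forall>n\<ge>N. \<bar>s f m - s f n\<bar> < e"
    using Cs unfolding Cauchy_def by (auto simp: dist_real_def)
   moreover have "nsq ((f - P m f) - (f - P n f))=\<bar>s f m - s f n\<bar>" for m n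
   proof -
    have "(f - P m f) - (f - P n f)=P n f - P m f" by simp
    then show ?thesis using nd[of n m] by (simp add: abs_minus_commute)
   qed
   ultimately show "EX N. \<forall>m\<ge>N. \<forall>n\<ge>N. Re (ip (f - P m f - (f - P n f)) (f - P m f - (f - P n f))) < e"
    unfolding nsq_def[symmetric] by auto
  qed (use f PH in simp)
  then obtain g where g: "g : H" "(%n. nsq ((f - P n f) - g)) ~~> 0" unfolding nsq_def by blast
  have gX: "g : X"
  proof -
   have "ip g (u j)=0" if j: "j >= 1" for j
   proof -
    have l: "(%n. ip (f - P n f) (u j)) ~~> ip g (u j)" by (rule ip_tendsto[OF _ g uH[OF j]]) (use f PH in simp)
    have "eventually (%n. 0=ip (f - P n f) (u j)) sequentially"
    using eventually_ge_at_top[of j]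
    proof eventually_elim
    case (elim n)
    then show ?case using ipP[OF j, of n f] f PH uH[OF j] by (simp add: ip_diff c_def)
    qed
    from Lim_transform_eventually[OF tendsto_const this] l show ?thesis using LIMSEQ_unique by blast
   qed
   then show ?thesis using g(1) by (simp add: X_def)
  qed
  have "nsq (f - P n f)=nsq ((f - P n f) - g)" for n
   using nsq_null_add[of g "(f - P n f) - g"] Xnull[OF gX] g(1) f PH by simp
  then show ?thesis using g(2) by simp
 qed
 have main: "(\<Sum>j=1..k. lam j * (cmod (c f j))\<^sup>2)+lam (Suc k) * (nsq f - s f k) <= Re (b f f)" if f: "f : D" for f k
 proof -
  have fH: "f : H" by (rule DH[OF f])
  let ?L = "%N. \<Sum>j=1..N. lam j * (cmod (c f j))\<^sup>2"
  have bP: "b (P N f) v=(\<Sum>j=1..N. c f j * (lam j * cnj (c v j)))" if v: "v : D" for N v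
  proof -
   have "finite S ==> S \<subseteq> {1..} ==> (\<Sum>j\<in>S. scl (c f j) (u j)) : D \<and>
    b (\<Sum>j\<in>S. scl (c f j) (u j)) v = (\<Sum>j\<in>S. c f j * (lam j * cnj (c v j)))" for S
   proof (induction S rule: finite_induct)
    case empty
    have "b 0 v=0" by (rule b_null[OF D0 v]) simp
    then show ?case by (simp add: D0)
   next
    case (insert i S)
    then have i: "i >= 1" by simp
    have "b (u i) v=ip (scl (of_real (lam i)) (u i)) v" using u[OF i] v by (simp add: T_iff)
    also have "...=lam i * cnj (c v i)" using uH[OF i] DH[OF v] ip_cnj[OF DH[OF v] uH[OF i]] by (simp add: ip_scl c_def)
    finally show ?case using insert uD[OF i] v by (simp add: b_add b_scl Dscl Dadd)
   qed
   from this[of "{1..N}"] show ?thesis by (simp add: P_def)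
  qed
  have q: "Re (b (f - P N f) (f - P N f))=Re (b f f) - ?L N" for N
  proof -
   have bPf: "b (P N f) f = of_real (?L N)"
    unfolding bP[OF f] of_real_sum by (rule sum.cong) (simp_all only: re3)
   have bPP: "b (P N f) (P N f) = of_real (?L N)"
    unfolding bP[OF PD] of_real_sum by (rule sum.cong) (simp_all add: cP re3 del: of_real_mult of_real_power)
   have bfP: "b f (P N f) = of_real (?L N)" using b_cnj[OF PD f, of N f] bPf by simp
   have bm: "b (x - y) z=b x z - b y z" if "x : D" "y : D" "z : D" for x y z
    using b_add[of "x - y" y z] Ddiff that by simp
   have bm2: "b z (x - y)=b z x - b z y" if "x : D" "y : D" "z : D" for x y z
    using bm[OF that] b_cnj[OF Ddiff[OF that(1,2)] that(3)] b_cnj[OF that(1,3)] b_cnj[OF that(2,3)] by simp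
   show ?thesis using f PD Ddiff[OF f PD] by (simp add: bm bm2 bPf bPP bfP)
  qed
  have ineq: "?L k+lam (Suc k) * (nsq f - s f k) - (C+lam (Suc k)) * nsq (f - P N f) <= Re (b f f)" if N: "N >= k" for N
  proof -
   have un: "{1..N}={1..k} \<union> {Suc k..N}" "{1..k} \<inter> {Suc k..N}={}" using N by auto
   have LN: "?L N=?L k+(\<Sum>j=Suc k..N. lam j * (cmod (c f j))\<^sup>2)"
    unfolding un(1) by (rule sum.union_disjoint) (use un(2) in auto)
   have sN: "s f N=s f k+(\<Sum>j=Suc k..N. (cmod (c f j))\<^sup>2)"
    unfolding s_def un(1) by (rule sum.union_disjoint) (use un(2) in auto)
   have "lam (Suc k) * (\<Sum>j=Suc k..N. (cmod (c f j))\<^sup>2) <= (\<Sum>j=Suc k..N. lam j * (cmod (c f j))\<^sup>2)"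
    unfolding sum_distrib_left by (intro sum_mono mult_right_mono lam_mono_le) auto
   then have "?L k+lam (Suc k) * (s f N - s f k) <= ?L N" using LN sN by simp
   moreover have "- C * nsq (f - P N f) <= Re (b f f) - ?L N" using b_lower[OF Ddiff[OF f PD], of N f] q[of N] by simp
   moreover have "s f N=nsq f - nsq (f - P N f)" using ng[OF fH, of N] by simp
   ultimately show ?thesis by (simp add: algebra_simps)
  qed
  have "(%N. ?L k + lam (Suc k) * (nsq f - s f k) - (C + lam (Suc k)) * nsq (f - P N f))
   ~~> ?L k + lam (Suc k) * (nsq f - s f k) - (C + lam (Suc k)) * 0"
   by (intro tendsto_intros complete_basis[OF fH])
  from LIMSEQ_le_const2[OF this] ineq show ?thesis by auto
 qed
 have "\<forall>j\<ge>1. u j : D & nsq (u j)=1" using uD on by (simp add: nsq_def)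
 moreover have "\<forall>f\<in>D. \<forall>k. (\<Sum>j=1..k. lam j * (cmod (ip f (u j)))\<^sup>2)
    + lam (Suc k) * (nsq f - (\<Sum>j=1..k. (cmod (ip f (u j)))\<^sup>2)) <= Re (b f f)"
  using main unfolding s_def c_def by blast
 ultimately show ?thesis by blast
qed

end

section \<open>A Bessel inequality for the Fourier transform\<close>

lemma gaussian_fourier_1:
 assumes "e > 0"
 shows "integ (%t::real. cof (exp (- (e * t\<^sup>2))) * iexp (t * z))"
  "(LINT t|lborel. cof (exp (- (e * t\<^sup>2))) * iexp (t * z))=cof (sqrt (pi / e) * exp (- (z\<^sup>2 / (4 * e))))"
proof -
 define c where "c=sqrt (2 * e)"
 have c: "c > 0" "c\<^sup>2=2 * e" using assms by (simp_all add: c_def)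
 let ?f = "%x::real. std_normal_density x *\<^sub>R iexp (x * (z / c))"
 have si: "integ (%x. std_normal_density x)" by (rule integrable_normal_density) simp
 have fi: "integ ?f"
 proof (rule Bochner_Integration.integrable_bound[OF si])
  show "?f : bmeas lborel" by measurable
 qed (simp add: normal_density_nonneg)
 have fv: "(LINT x|lborel. ?f x)=cof (exp (- (z / c)\<^sup>2 / 2))"
 proof -
  have "(LINT x|lborel. ?f x)=(LINT x|std_normal_distribution. iexp (x * (z / c)))"
   by (subst integral_density) (simp_all add: normal_density_nonneg)
  also have "...=char std_normal_distribution (z / c)" unfolding char_def by (simp add: mult.commute)
  also have "...=cof (exp (- (z / c)\<^sup>2 / 2))" by (simp add: char_std_normal_distribution)
  finally show ?thesis .
 qed
 let ?g = "%t::real. cof (exp (- (e * t\<^sup>2))) * iexp (t * z)"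
 have fg: "?f (0+c * t)=cof (1 / sqrt (2 * pi)) * ?g t" for t
 proof -
  have "std_normal_density (c * t)=1 / sqrt (2 * pi) * exp (- (e * t\<^sup>2))"
   unfolding std_normal_density_def using c(2) by (simp add: power_mult_distrib)
  moreover have "c * t * (z / c)=t * z" using c(1) by simp
  ultimately show ?thesis by (simp add: scaleR_conv_of_real)
 qed
 have "integ (%t. ?f (0+c * t))"
  using lborel_integrable_real_affine[OF fi, of c 0] c(1) by simp
 then have "integ (%t. cof (1 / sqrt (2 * pi)) * ?g t)" by (simp only: fg)
 then have "integ (%t. cof (sqrt (2 * pi)) * (cof (1 / sqrt (2 * pi)) * ?g t))"
  by (rule integrable_mult_right)
 moreover have ab: "cof (sqrt (2 * pi)) * cof (1 / sqrt (2 * pi))=1"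
  unfolding of_real_mult[symmetric] by simp
 ultimately show gi: "integ ?g" by (simp only: mult.assoc[symmetric] ab mult_1)
 have "(LINT x|lborel. ?f x)=\<bar>c\<bar> *\<^sub>R (LINT t|lborel. ?f (0+c * t))"
  by (rule lborel_integral_real_affine) (use c(1) in simp)
 also have "...=cof (c / sqrt (2 * pi)) * (LINT t|lborel. ?g t)"
  unfolding fg using c(1) gi by (simp add: scaleR_conv_of_real)
 finally have "cof (exp (- (z / c)\<^sup>2 / 2))=cof (c / sqrt (2 * pi)) * (LINT t|lborel. ?g t)" unfolding fv .
 then have "complex_of_real (sqrt (2 * pi) / c) * complex_of_real (exp (- (z / c)\<^sup>2 / 2))
  = complex_of_real (sqrt (2 * pi) / c) * (complex_of_real (c / sqrt (2 * pi)) * (LINT t|lborel. ?g t))" by simp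
 also have "...=(LINT t|lborel. ?g t)"
 proof -
  have "cof (sqrt (2 * pi) / c) * cof (c / sqrt (2 * pi))=1"
   unfolding of_real_mult[symmetric] using c(1) by simp
  then show ?thesis by (simp only: mult.assoc[symmetric] mult_1)
 qed
 finally have "(LINT t|lborel. ?g t)=cof (sqrt (2 * pi) / c * exp (- (z / c)\<^sup>2 / 2))" by simp
 moreover have "sqrt (2 * pi) / c=sqrt (pi / e)"
  unfolding c_def real_sqrt_divide[symmetric] using assms by simp
 moreover have "- (z / c)\<^sup>2 / 2=- (z\<^sup>2 / (4 * e))" using c(2) assms by (simp add: power_divide field_simps)
 ultimately show "(LINT t|lborel. ?g t)=cof (sqrt (pi / e) * exp (- (z\<^sup>2 / (4 * e))))" by simp
qed

lemma lborel_integral_prod_Basis: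
 fixes f :: "'a::euclidean_space => real => complex"
 assumes "!!b. b : Basis ==> integ (f b)"
 shows "integ (%x::'a. \<Prod>b\<in>Basis. f b (x \<bullet> b))"
  "(LINT x|lborel. (\<Prod>b\<in>Basis. f b ((x::'a) \<bullet> b)))=(\<Prod>b\<in>Basis. LINT t|lborel. f b t)"
proof -
 interpret product_sigma_finite "%_::'a. lborel :: real measure" by standard
 let ?T = "%g. \<Sum>b\<in>Basis. g b *\<^sub>R (b::'a)"
 have LB: "(lborel :: 'a measure)=distr (\<Pi>\<^sub>M b\<in>Basis. lborel) borel ?T" by (rule lborel_eq)
 have T: "?T : measurable (\<Pi>\<^sub>M b\<in>Basis. lborel) borel" by measurable
 have m: "(%x::'a. \<Prod>b\<in>Basis. f b (x \<bullet> b)) : bmeas borel"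
  using assms by (intro borel_measurable_prod measurable_compose[OF _ borel_measurable_integrable[of lborel "f _"], simplified]) auto
 have eq: "(\<Prod>b\<in>Basis. f b (?T g \<bullet> b))=(\<Prod>b\<in>Basis. f b (g b))" for g
  by (rule prod.cong) (simp_all add: inner_sum_left inner_Basis if_distrib sum.delta cong: if_cong)
 have i: "integrable (\<Pi>\<^sub>M b\<in>(Basis::'a set). lborel) (%g. \<Prod>b\<in>Basis. f b (g b))"
  by (rule product_integrable_prod) (use assms in simp_all)
 show "integ (%x::'a. \<Prod>b\<in>Basis. f b (x \<bullet> b))"
  unfolding LB using i T m by (subst integrable_distr_eq) (simp_all add: eq)
 have "(LINT x|lborel. (\<Prod>b\<in>Basis. f b ((x::'a) \<bullet> b)))=(LINT g|(\<Pi>\<^sub>M b\<in>(Basis::'a set). lborel). (\<Prod>b\<in>Basis. f b (g b)))"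
  unfolding LB using T m by (subst integral_distr) (simp_all add: eq)
 also have "...=(\<Prod>b\<in>Basis. LINT t|lborel. f b t)"
  by (rule product_integral_prod) (use assms in simp_all)
 finally show "(LINT x|lborel. (\<Prod>b\<in>Basis. f b ((x::'a) \<bullet> b)))=(\<Prod>b\<in>Basis. LINT t|lborel. f b t)" .
qed

lemma norm_sq_sum: "(norm (x::'a::euclidean_space))\<^sup>2=(\<Sum>b\<in>Basis. (x \<bullet> b)\<^sup>2)"
 unfolding power2_norm_eq_inner by (subst euclidean_inner) (simp add: power2_eq_square)

lemma gaussian_fourier:
 fixes z :: "'a::euclidean_space"
 assumes "e > 0"
 shows "integ (%xi::'a. cof (exp (- (e * (norm xi)\<^sup>2))) * iexp (xi \<bullet> z))"
  "(LINT xi|lborel. complex_of_real (exp (- (e * (norm xi)\<^sup>2))) * iexp (xi \<bullet> z))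
   = complex_of_real (sqrt (pi / e) ^ DIM('a) * exp (- ((norm z)\<^sup>2 / (4 * e))))"
proof -
 let ?f = "%b (t::real). cof (exp (- (e * t\<^sup>2))) * iexp (t * (z \<bullet> b))"
 have eq: "cof (exp (- (e * (norm xi)\<^sup>2))) * iexp (xi \<bullet> z)=(\<Prod>b\<in>Basis. ?f b (xi \<bullet> b))" for xi :: 'a
 proof -
  have "(\<Prod>b\<in>Basis. ?f b (xi \<bullet> b))=(\<Prod>b\<in>Basis. cof (exp (- (e * (xi \<bullet> b)\<^sup>2)))) * (\<Prod>b\<in>Basis. iexp ((xi \<bullet> b) * (z \<bullet> b)))"
   by (rule prod.distrib)
  also have "(\<Prod>b\<in>Basis. cof (exp (- (e * (xi \<bullet> b)\<^sup>2))))=cof (exp (\<Sum>b\<in>Basis. - (e * (xi \<bullet> b)\<^sup>2)))"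
   by (simp only: exp_sum[OF finite_Basis] of_real_prod)
  also have "(\<Sum>b\<in>Basis. - (e * (xi \<bullet> b)\<^sup>2))=- (e * (norm xi)\<^sup>2)"
   by (simp add: norm_sq_sum sum_negf sum_distrib_left)
  also have "(\<Prod>b\<in>Basis. iexp ((xi \<bullet> b) * (z \<bullet> b)))=exp (\<Sum>b\<in>Basis. \<i> * cof ((xi \<bullet> b) * (z \<bullet> b)))"
   by (simp only: exp_sum[OF finite_Basis])
  also have "(\<Sum>b\<in>Basis. \<i> * cof ((xi \<bullet> b) * (z \<bullet> b)))=\<i> * cof (xi \<bullet> z)"
   by (subst euclidean_inner[of xi z]) (simp only: sum_distrib_left[symmetric] of_real_sum)
  finally show ?thesis by simp
 qed
 show "integ (%xi::'a. cof (exp (- (e * (norm xi)\<^sup>2))) * iexp (xi \<bullet> z))"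
  unfolding eq by (rule lborel_integral_prod_Basis(1)[where f="?f"]) (rule gaussian_fourier_1(1)[OF assms])
 have "(LINT xi|lborel. cof (exp (- (e * (norm xi)\<^sup>2))) * iexp (xi \<bullet> z))=(\<Prod>b\<in>Basis. LINT t|lborel. ?f b t)"
  unfolding eq by (rule lborel_integral_prod_Basis(2)[where f="?f"]) (rule gaussian_fourier_1(1)[OF assms])
 also have "...=(\<Prod>b\<in>(Basis::'a set). cof (sqrt (pi / e)) * cof (exp (- ((z \<bullet> b)\<^sup>2 / (4 * e)))))"
  by (rule prod.cong[OF refl], subst gaussian_fourier_1(2)[OF assms], rule of_real_mult)
 also have "...=cof (sqrt (pi / e)) ^ DIM('a) * cof (exp (\<Sum>b\<in>(Basis::'a set). - ((z \<bullet> b)\<^sup>2 / (4 * e))))"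
  by (simp only: prod.distrib prod_constant exp_sum[OF finite_Basis] of_real_prod)
 also have "(\<Sum>b\<in>(Basis::'a set). - ((z \<bullet> b)\<^sup>2 / (4 * e)))=- ((norm z)\<^sup>2 / (4 * e))"
  by (simp only: norm_sq_sum sum_negf sum_divide_distrib)
 finally show "(LINT xi|lborel. complex_of_real (exp (- (e * (norm xi)\<^sup>2))) * iexp (xi \<bullet> z))
   = complex_of_real (sqrt (pi / e) ^ DIM('a) * exp (- ((norm z)\<^sup>2 / (4 * e))))" by simp
qed

lemma gaussian_integral:
 assumes "e > 0"
 shows "integ (%xi::'a::euclidean_space. exp (- (e * (norm xi)\<^sup>2)))"
  "(LINT xi|lborel. exp (- (e * (norm (xi::'a))\<^sup>2)))=sqrt (pi / e) ^ DIM('a)"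
proof -
 have i: "integ (%xi::'a. cof (exp (- (e * (norm xi)\<^sup>2))))"
  using gaussian_fourier(1)[OF assms, of 0] by simp
 then show "integ (%xi::'a. exp (- (e * (norm xi)\<^sup>2)))"
  by (rule complex_of_real_integrable_eq[THEN iffD1])
 have "cof (LINT xi|lborel. exp (- (e * (norm (xi::'a))\<^sup>2)))=cof (sqrt (pi / e) ^ DIM('a))"
 proof -
  have "cof (LINT xi|lborel. exp (- (e * (norm (xi::'a))\<^sup>2)))=(LINT xi|lborel. cof (exp (- (e * (norm (xi::'a))\<^sup>2))))"
   by (rule integral_complex_of_real[symmetric])
  also have "...=(LINT xi|lborel. cof (exp (- (e * (norm (xi::'a))\<^sup>2))) * iexp (xi \<bullet> 0))"
   by (simp only: inner_zero_right of_real_0 mult_zero_right exp_zero mult_1_right)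
  also have "...=cof (sqrt (pi / e) ^ DIM('a) * exp (- ((norm (0::'a))\<^sup>2 / (4 * e))))"
   by (rule gaussian_fourier(2)[OF assms])
  finally show ?thesis by simp
 qed
 then show "(LINT xi|lborel. exp (- (e * (norm (xi::'a))\<^sup>2)))=sqrt (pi / e) ^ DIM('a)"
  by (simp only: of_real_eq_iff)
qed

lemma cnj_borel_measurable[measurable]: "cnj : bmeas borel"
 by (rule borel_measurable_continuous_onI) (rule continuous_on_cnj[OF continuous_on_id])

definition fourier :: "('a::euclidean_space => complex) => 'a => complex" where
 "fourier u xi=(LINT x|lborel. iexp (xi \<bullet> x) * cnj (u x))"

lemma fourier_measurable:
 assumes "u : bmeas borel"
 shows "fourier u : bmeas (borel :: 'a::euclidean_space measure)"
proof -
 have "(%(xi::'a, x). iexp (xi \<bullet> x) * cnj (u x)) : bmeas (lborel \<Otimes>\<^sub>M lborel)"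
  using assms by measurable
 from lborel.borel_measurable_lebesgue_integral[OF this] show ?thesis unfolding fourier_def[abs_def] by simp
qed

text \<open>The weight \<open>exp (- e * |xi|\<^sup>2)\<close> turns the integral of \<open>|fourier u|\<^sup>2\<close> into a double integral of
 \<open>u\<close> against a Gaussian convolution kernel of total mass \<open>(2 * pi) ^ d\<close>, bounded by Schur's test.\<close>

lemma fourier_weighted_bessel:
 fixes u :: "'a::euclidean_space => complex"
 assumes e: "e > 0" and u: "integ u" and u2: "integ (%x. (cmod (u x))\<^sup>2)"
 shows "integ (%xi. exp (- (e * (norm xi)\<^sup>2)) * (cmod (fourier u xi))\<^sup>2)"
  "(LINT xi|lborel. exp (- (e * (norm xi)\<^sup>2)) * (cmod (fourier u xi))\<^sup>2) <= (2 * pi) ^ DIM('a) * (LINT x|lborel. (cmod (u x))\<^sup>2)"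
proof -
 have um[measurable]: "u : bmeas borel" using u by simp
 let ?w = "%xi::'a. exp (- (e * (norm xi)\<^sup>2))"
 define K where "K z=sqrt (pi / e) ^ DIM('a) * exp (- ((norm (z::'a))\<^sup>2 / (4 * e)))" for z
 have K0: "K z >= 0" for z unfolding K_def using e by simp
 have Km[measurable]: "K : bmeas borel" unfolding K_def[abs_def] by measurable
 have fm: "fourier u : bmeas borel" by (rule fourier_measurable[OF um])
 have wi: "integ ?w" by (rule gaussian_integral(1)[OF e])
 have iu: "integ (%x. iexp (xi \<bullet> x) * cnj (u x))" for xi :: 'a
  by (rule Bochner_Integration.integrable_bound[OF u]) (measurable, simp add: norm_mult)
 define N1 where "N1=(LINT x|lborel. norm (u x))"
 have fb: "cmod (fourier u xi) <= N1" for xi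
  unfolding fourier_def N1_def using integral_norm_bound[of lborel "%x. iexp (xi \<bullet> x) * cnj (u x)"] by (simp add: norm_mult)
 show int: "integ (%xi. ?w xi * (cmod (fourier u xi))\<^sup>2)"
 proof (rule Bochner_Integration.integrable_bound[of lborel "%xi. ?w xi * N1\<^sup>2"])
  show "integ (%xi. ?w xi * N1\<^sup>2)" using wi by simp
  show "AE xi in lborel. norm (?w xi * (cmod (fourier u xi))\<^sup>2) <= norm (?w xi * N1\<^sup>2)"
   by (intro AE_I2) (simp add: abs_mult power_mono[OF fb])
  show "(%xi. ?w xi * (cmod (fourier u xi))\<^sup>2) : bmeas lborel" using fm by measurable
 qed
 define F where "F xi x y=cof (?w xi) * ((iexp (xi \<bullet> x) * cnj (u x)) * cnj (iexp (xi \<bullet> y) * cnj (u y)))" for xi x y :: 'a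
 have sq: "cof (?w xi * (cmod (fourier u xi))\<^sup>2)=(LINT x|lborel. LINT y|lborel. F xi x y)" for xi
 proof -
  have "cof (?w xi * (cmod (fourier u xi))\<^sup>2)=cof (?w xi) * (fourier u xi * cnj (fourier u xi))"
   by (simp only: of_real_mult complex_norm_square)
  also have "...=(LINT x|lborel. LINT y|lborel. F xi x y)"
   using iu[of xi] by (simp add: F_def fourier_def integral_cnj[symmetric] del: complex_cnj_mult)
  finally show ?thesis .
 qed
 have Fn: "norm (F xi x y)=?w xi * (norm (u x) * norm (u y))" for xi x y by (simp add: F_def norm_mult)
 have Fm1: "(%(xi, p). F xi (fst p) (snd p)) : bmeas (lborel \<Otimes>\<^sub>M (lborel \<Otimes>\<^sub>M lborel))"
  unfolding F_def by measurable
 interpret P: pair_sigma_finite "lborel :: 'a measure" "lborel \<Otimes>\<^sub>M lborel :: ('a \<times> 'a) measure"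
  by (rule pair_sigma_finite.intro) (simp_all add: lborel_prod sigma_finite_lborel)
 have uu: "integrable (lborel \<Otimes>\<^sub>M lborel) (%p::'a \<times> 'a. norm (u (fst p)) * norm (u (snd p)))"
 proof (rule lborel_pair.Fubini_integrable)
  show "(%p::'a \<times> 'a. norm (u (fst p)) * norm (u (snd p))) : bmeas (lborel \<Otimes>\<^sub>M lborel)" by measurable
 qed (use u in simp_all)
 have Fi: "integrable (lborel \<Otimes>\<^sub>M (lborel \<Otimes>\<^sub>M lborel)) (%(xi, p). F xi (fst p) (snd p))"
 proof (rule P.Fubini_integrable[OF Fm1])
  show "integ (%xi. LINT p|(lborel \<Otimes>\<^sub>M lborel). norm (case (xi, p) of (xi, p) => F xi (fst p) (snd p)))"
   using wi by (simp add: Fn)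
  show "AE xi in lborel. integrable (lborel \<Otimes>\<^sub>M lborel) (%p. case (xi, p) of (xi, p) => F xi (fst p) (snd p))"
  proof (rule AE_I2)
   fix xi :: 'a
   have "integrable (lborel \<Otimes>\<^sub>M lborel) (%p. F xi (fst p) (snd p))"
   proof (rule Bochner_Integration.integrable_bound[OF integrable_mult_right[OF uu, of "?w xi"]])
    show "(%p. F xi (fst p) (snd p)) : bmeas (lborel \<Otimes>\<^sub>M lborel)" unfolding F_def by measurable
   qed (simp add: Fn)
   then show "integrable (lborel \<Otimes>\<^sub>M lborel) (%p. case (xi, p) of (xi, p) => F xi (fst p) (snd p))" by simp
  qed
 qed
 have Fip: "integrable (lborel \<Otimes>\<^sub>M lborel) (%p. F xi (fst p) (snd p))" for xi
 proof (rule Bochner_Integration.integrable_bound[OF integrable_mult_right[OF uu, of "?w xi"]])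
  show "(%p. F xi (fst p) (snd p)) : bmeas (lborel \<Otimes>\<^sub>M lborel)" unfolding F_def by measurable
 qed (simp add: Fn)
 have it: "(LINT x|lborel. LINT y|lborel. F xi x y)=(LINT p|(lborel \<Otimes>\<^sub>M lborel). F xi (fst p) (snd p))" for xi
  using lborel_pair.integral_fst'[OF Fip[of xi]] by simp
 have inner: "(LINT xi|lborel. F xi x y)=cof (K (x - y)) * (cnj (u x) * u y)" for x y
 proof -
  have ie: "iexp (xi \<bullet> (x - y))=iexp (xi \<bullet> x) * cnj (iexp (xi \<bullet> y))" for xi
   by (simp add: inner_diff_right exp_cnj right_diff_distrib exp_diff exp_minus divide_inverse)
  have "F xi x y=(cof (?w xi) * iexp (xi \<bullet> (x - y))) * (cnj (u x) * u y)" for xi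
   by (simp only: F_def ie complex_cnj_mult complex_cnj_cnj ac_simps)
  then have "(LINT xi|lborel. F xi x y)=(LINT xi|lborel. cof (?w xi) * iexp (xi \<bullet> (x - y))) * (cnj (u x) * u y)"
   by (simp only: integral_mult_left_zero)
  then show ?thesis by (simp only: gaussian_fourier(2)[OF e] K_def)
 qed
 let ?G = "%p. cof (K (fst p - snd p)) * (cnj (u (fst p)) * u (snd p))"
 have "cof (LINT xi|lborel. ?w xi * (cmod (fourier u xi))\<^sup>2)=(LINT xi|lborel. LINT p|(lborel \<Otimes>\<^sub>M lborel). F xi (fst p) (snd p))"
  unfolding integral_complex_of_real[symmetric] sq it ..
 also have "...=(LINT p|(lborel \<Otimes>\<^sub>M lborel). LINT xi|lborel. F xi (fst p) (snd p))"
  using P.Fubini_integral[OF Fi] by simp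
 also have "...=(LINT p|(lborel \<Otimes>\<^sub>M lborel). ?G p)" by (simp only: inner)
 finally have eq: "cof (LINT xi|lborel. ?w xi * (cmod (fourier u xi))\<^sup>2)=(LINT p|(lborel \<Otimes>\<^sub>M lborel). ?G p)" .
 have Kint: "integ K" "(LINT z|lborel. K z)=(2 * pi) ^ DIM('a)"
 proof -
  have e4: "1 / (4 * e) > 0" using e by simp
  have Keq: "K z=sqrt (pi / e) ^ DIM('a) * exp (- (1 / (4 * e) * (norm z)\<^sup>2))" for z by (simp add: K_def)
  show "integ K" unfolding Keq[abs_def] by (rule integrable_mult_right[OF gaussian_integral(1)[OF e4]])
  have "(LINT z|lborel. K z)=sqrt (pi / e) ^ DIM('a) * sqrt (pi / (1 / (4 * e))) ^ DIM('a)"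
   unfolding Keq by (simp only: integral_mult_right_zero gaussian_integral(2)[OF e4])
  also have "...=(sqrt (pi / e) * sqrt (pi * (4 * e))) ^ DIM('a)" by (simp add: power_mult_distrib)
  also have "sqrt (pi / e) * sqrt (pi * (4 * e))=sqrt ((2 * pi)\<^sup>2)"
   unfolding real_sqrt_mult[symmetric] using e by (simp add: power2_eq_square field_simps)
  also have "sqrt ((2 * pi)\<^sup>2)=2 * pi" by (rule real_sqrt_unique) simp_all
  finally show "(LINT z|lborel. K z)=(2 * pi) ^ DIM('a)" .
 qed
 let ?h = "%p. K (fst p - snd p) * ((cmod (u (fst p)))\<^sup>2 / 2)+K (fst p - snd p) * ((cmod (u (snd p)))\<^sup>2 / 2)"
 have Kl: "integ (%y. K (x - y))" "(LINT y|lborel. K (x - y))=(2 * pi) ^ DIM('a)" for x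
 proof -
  have "K (x - y)=K (y+(- x))" for y by (simp add: K_def norm_minus_commute)
  then show "integ (%y. K (x - y))" "(LINT y|lborel. K (x - y))=(2 * pi) ^ DIM('a)"
   using integrable_lborel_shift[OF Kint(1), of "- x"] integral_lborel_shift[of K "- x"] Kint(2) by simp_all
 qed
 have h1: "integrable (lborel \<Otimes>\<^sub>M lborel) (%p. K (fst p - snd p) * ((cmod (u (fst p)))\<^sup>2 / 2))"
  "(LINT p|(lborel \<Otimes>\<^sub>M lborel). K (fst p - snd p) * ((cmod (u (fst p)))\<^sup>2 / 2))=(2 * pi) ^ DIM('a) * (LINT x|lborel. (cmod (u x))\<^sup>2) / 2"
 proof -
  show i: "integrable (lborel \<Otimes>\<^sub>M lborel) (%p. K (fst p - snd p) * ((cmod (u (fst p)))\<^sup>2 / 2))"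
  proof (rule lborel_pair.Fubini_integrable)
   show "(%p. K (fst p - snd p) * ((cmod (u (fst p)))\<^sup>2 / 2)) : bmeas (lborel \<Otimes>\<^sub>M lborel)" by measurable
   show "integ (%x. LINT y|lborel. norm (K (fst (x, y) - snd (x, y)) * ((cmod (u (fst (x, y))))\<^sup>2 / 2)))"
    using u2 Kl(2) K0 by (simp add: abs_mult)
  qed (use Kl(1) in simp)
  show "(LINT p|(lborel \<Otimes>\<^sub>M lborel). K (fst p - snd p) * ((cmod (u (fst p)))\<^sup>2 / 2))=(2 * pi) ^ DIM('a) * (LINT x|lborel. (cmod (u x))\<^sup>2) / 2"
   using lborel_pair.integral_fst'[OF i] Kl(2) by simp
 qed
 have h2: "integrable (lborel \<Otimes>\<^sub>M lborel) (%p. K (fst p - snd p) * ((cmod (u (snd p)))\<^sup>2 / 2))"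
  "(LINT p|(lborel \<Otimes>\<^sub>M lborel). K (fst p - snd p) * ((cmod (u (snd p)))\<^sup>2 / 2))=(2 * pi) ^ DIM('a) * (LINT x|lborel. (cmod (u x))\<^sup>2) / 2"
 proof -
  have s: "K (x - y)=K (y - x)" for x y by (simp add: K_def norm_minus_commute)
  let ?f = "%p. K (fst p - snd p) * ((cmod (u (fst p)))\<^sup>2 / 2)"
  show "integrable (lborel \<Otimes>\<^sub>M lborel) (%p. K (fst p - snd p) * ((cmod (u (snd p)))\<^sup>2 / 2))"
   using lborel_pair.integrable_product_swap[OF h1(1)] by (simp add: case_prod_unfold s)
  have fm: "?f : bmeas (lborel \<Otimes>\<^sub>M lborel)" by measurable
  show "(LINT p|(lborel \<Otimes>\<^sub>M lborel). K (fst p - snd p) * ((cmod (u (snd p)))\<^sup>2 / 2))=(2 * pi) ^ DIM('a) * (LINT x|lborel. (cmod (u x))\<^sup>2) / 2"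
   using lborel_pair.integral_product_swap[OF fm] h1(2) by (simp add: case_prod_unfold s)
 qed
 have "(LINT xi|lborel. ?w xi * (cmod (fourier u xi))\<^sup>2) <= cmod (LINT p|(lborel \<Otimes>\<^sub>M lborel). ?G p)"
  unfolding eq[symmetric] by simp
 also have "... <= (LINT p|(lborel \<Otimes>\<^sub>M lborel). norm (?G p))" by (rule integral_norm_bound)
 also have "... <= (LINT p|(lborel \<Otimes>\<^sub>M lborel). ?h p)"
 proof (rule integral_mono')
  show "integrable (lborel \<Otimes>\<^sub>M lborel) ?h" by (rule Bochner_Integration.integrable_add[OF h1(1) h2(1)])
  fix p :: "'a \<times> 'a"
  have "cmod (u (fst p)) * cmod (u (snd p)) <= (cmod (u (fst p)))\<^sup>2 / 2+(cmod (u (snd p)))\<^sup>2 / 2"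
   using sum_squares_bound[of "cmod (u (fst p))" "cmod (u (snd p))"] by simp
  from mult_left_mono[OF this K0[of "fst p - snd p"]]
  show "norm (?G p) <= ?h p" using K0 by (simp add: norm_mult distrib_left)
  show "0 <= ?h p" using K0 by simp
 qed
 also have "...=(2 * pi) ^ DIM('a) * (LINT x|lborel. (cmod (u x))\<^sup>2)"
  using h1 h2 by simp
 finally show "(LINT xi|lborel. ?w xi * (cmod (fourier u xi))\<^sup>2) <= (2 * pi) ^ DIM('a) * (LINT x|lborel. (cmod (u x))\<^sup>2)" .
qed

text \<open>On the ball the Gaussian weight tends to \<open>1\<close>.\<close>

theorem fourier_bessel_ball:
 fixes u :: "'a::euclidean_space => complex"
 assumes u: "integ u" and u2: "integ (%x. (cmod (u x))\<^sup>2)"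
 shows "integ (%xi. indicator (cball 0 R) xi * (cmod (fourier u xi))\<^sup>2)"
  "(LINT xi|lborel. indicator (cball 0 R) xi * (cmod (fourier u xi))\<^sup>2) <= (2 * pi) ^ DIM('a) * (LINT x|lborel. (cmod (u x))\<^sup>2)"
proof -
 have um: "u : bmeas borel" using u by simp
 note fm[measurable] = fourier_measurable[OF um]
 have dom: "indicator (cball 0 R) xi * (cmod (fourier u xi))\<^sup>2 <= exp (e * R\<^sup>2) * (exp (- (e * (norm xi)\<^sup>2)) * (cmod (fourier u xi))\<^sup>2)"
  if e: "e > 0" for e xi
 proof (cases "xi : cball 0 R")
  case True
  then have "(norm xi)\<^sup>2 <= R\<^sup>2" by (intro power_mono) simp_all
  then have "1 <= exp (e * R\<^sup>2 - e * (norm xi)\<^sup>2)" using e by simp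
  also have "...=exp (e * R\<^sup>2) * exp (- (e * (norm xi)\<^sup>2))" by (simp add: exp_diff exp_minus divide_inverse)
  finally have "1 * (cmod (fourier u xi))\<^sup>2 <= (exp (e * R\<^sup>2) * exp (- (e * (norm xi)\<^sup>2))) * (cmod (fourier u xi))\<^sup>2"
   by (rule mult_right_mono) simp
  then show ?thesis using True by (simp add: mult.assoc)
 qed simp
 let ?f = "%xi. indicator (cball 0 R) xi * (cmod (fourier u xi))\<^sup>2"
 show "integ ?f"
 proof (rule Bochner_Integration.integrable_bound[OF integrable_mult_right[OF fourier_weighted_bessel(1)[OF zero_less_one u u2], of "exp (1 * R\<^sup>2)"]])
  have cm: "cball (0::'a) R : sets borel" by simp
  show "?f : bmeas lborel" using fm cm by measurable
  show "AE xi in lborel. norm (?f xi) <= norm (exp (1 * R\<^sup>2) * (exp (- (1 * (norm xi)\<^sup>2)) * (cmod (fourier u xi))\<^sup>2))"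
   using dom[of 1] by (intro AE_I2) simp
 qed
 have bd: "(LINT xi|lborel. ?f xi) <= exp (e * R\<^sup>2) * ((2 * pi) ^ DIM('a) * (LINT x|lborel. (cmod (u x))\<^sup>2))" if e: "e > 0" for e
 proof -
  have "(LINT xi|lborel. ?f xi) <= (LINT xi|lborel. exp (e * R\<^sup>2) * (exp (- (e * (norm xi)\<^sup>2)) * (cmod (fourier u xi))\<^sup>2))"
   by (rule integral_mono'[OF integrable_mult_right[OF fourier_weighted_bessel(1)[OF e u u2]] dom[OF e]]) simp
  also have "...=exp (e * R\<^sup>2) * (LINT xi|lborel. exp (- (e * (norm xi)\<^sup>2)) * (cmod (fourier u xi))\<^sup>2)" by simp
  also have "... <= exp (e * R\<^sup>2) * ((2 * pi) ^ DIM('a) * (LINT x|lborel. (cmod (u x))\<^sup>2))"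
   by (rule mult_left_mono[OF fourier_weighted_bessel(2)[OF e u u2]]) simp
  finally show ?thesis .
 qed
 have "(%n. exp (inverse (real (Suc n)) * R\<^sup>2) * ((2 * pi) ^ DIM('a) * (LINT x|lborel. (cmod (u x))\<^sup>2)))
  ~~> exp (0 * R\<^sup>2) * ((2 * pi) ^ DIM('a) * (LINT x|lborel. (cmod (u x))\<^sup>2))"
  by (intro tendsto_intros LIMSEQ_inverse_real_of_nat)
 from LIMSEQ_le_const[OF this] bd show "(LINT xi|lborel. ?f xi) <= (2 * pi) ^ DIM('a) * (LINT x|lborel. (cmod (u x))\<^sup>2)"
  by simp
qed

section \<open>The second moment of a ball\<close>

text \<open>Layer cake in the radius.\<close>

lemma ball_second_moment:
 assumes R: "R > 0"
 shows "(LINT xi|lborel. indicator (cball 0 R) xi * (norm (xi::'a::euclidean_space))\<^sup>2)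
  = unit_ball_vol (real DIM('a)) * (real DIM('a) / (real DIM('a) + 2)) * R ^ (DIM('a) + 2)"
proof -
 let ?d = "DIM('a)"
 define \<omega> where "\<omega>=unit_ball_vol (real ?d)"
 have \<omega>0: "\<omega> >= 0" by (simp add: \<omega>_def)
 have i1: "integ (%xi::'a. indicator (cball 0 R) xi * (norm xi)\<^sup>2)"
  using borel_integrable_compact[of "cball (0::'a) R" "%xi. (norm xi)\<^sup>2"] by (simp add: continuous_intros)

 let ?g = "%xi::'a. indicator (cball 0 R) xi * (R\<^sup>2 - (norm xi)\<^sup>2)"
 have i2: "integ ?g"
  using borel_integrable_compact[of "cball (0::'a) R" "%xi. R\<^sup>2 - (norm xi)\<^sup>2"] by (simp add: continuous_intros)
 have g0: "?g xi >= 0" for xi using R by (auto simp: indicator_def intro: power_mono)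
 \<comment> \<open>layer cake: \<open>R\<^sup>2 - |xi|\<^sup>2\<close> is the integral of \<open>2 * t\<close> over \<open>|xi| <= t <= R\<close>\<close>
 have layer: "ennreal (?g xi)=(\<integral>\<^sup>+t. ennreal (2 * t) * indicator {0..R} t * indicator {0..t} (norm xi) \<partial>lborel)" for xi
 proof (cases "xi : cball 0 R")
  case True
  have "(\<integral>\<^sup>+t. ennreal (2 * t) * indicator {norm xi..R} t \<partial>lborel)=ennreal (R\<^sup>2 - (norm xi)\<^sup>2)"
  proof (rule nn_integral_FTC_Icc[where F="%t. t\<^sup>2"])
   show "((%t. t\<^sup>2) has_real_derivative 2 * t) (at t)" for t :: real
    by (auto intro!: derivative_eq_intros)
   show "norm xi <= R" using True by simp
   show "0 <= 2 * t" if "t : {norm xi..R}" for t :: real using order_trans[OF norm_ge_zero[of xi], of t] that by simp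
  qed simp
  moreover have "ennreal (2 * t) * indicator {0..R} t * indicator {0..t} (norm xi)=ennreal (2 * t) * indicator {norm xi..R} t" for t :: real
   using order_trans[OF norm_ge_zero[of xi], of t] by (auto simp: indicator_def)
  ultimately show ?thesis using True by simp
 next
  case False
  then have z: "ennreal (2 * t) * indicator {0..R} t * indicator {0..t} (norm xi)=0" for t :: real by (auto simp: indicator_def)
  show ?thesis unfolding z using False by simp
 qed
 have "ennreal (LINT xi|lborel. ?g xi)=(\<integral>\<^sup>+xi. ennreal (?g xi) \<partial>lborel)"
  by (rule nn_integral_eq_integral[symmetric, OF i2]) (use g0 in simp)
 also have "...=(\<integral>\<^sup>+xi. (\<integral>\<^sup>+t. ennreal (2 * t) * indicator {0..R} t * indicator {0..t} (norm (xi::'a)) \<partial>lborel) \<partial>lborel)"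
  by (simp only: layer)
 also have "...=(\<integral>\<^sup>+t. (\<integral>\<^sup>+xi. ennreal (2 * t) * indicator {0..R} t * indicator {0..t} (norm (xi::'a)) \<partial>lborel) \<partial>lborel)"
 proof (rule lborel_pair.Fubini'[symmetric])
  have "(%p::'a \<times> real. ennreal (2 * snd p) * indicator {0..R} (snd p) * indicator {p. 0 <= norm (fst p) & norm (fst p) <= snd p} p) : bmeas (lborel \<Otimes>\<^sub>M lborel)"
   by measurable
  then show "(%(xi::'a, t). ennreal (2 * t) * indicator {0..R} t * indicator {0..t} (norm xi)) : bmeas (lborel \<Otimes>\<^sub>M lborel)"
   by (rule measurable_cong[THEN iffD1, rotated]) (auto simp: indicator_def)
 qed
 also have "...=(\<integral>\<^sup>+t. ennreal (2 * \<omega> * t ^ (?d+1)) * indicator {0..R} t \<partial>lborel)"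
 proof (rule nn_integral_cong)
  fix t :: real
  show "(\<integral>\<^sup>+xi. ennreal (2 * t) * indicator {0..R} t * indicator {0..t} (norm (xi::'a)) \<partial>lborel)=ennreal (2 * \<omega> * t ^ (?d+1)) * indicator {0..R} t"
  proof (cases "t : {0..R}")
   case True
   have "indicator {0..t} (norm xi)=(indicator (cball 0 t) xi :: ennreal)" for xi :: 'a by (auto simp: indicator_def)
   then have "(\<integral>\<^sup>+xi. ennreal (2 * t) * indicator {0..R} t * indicator {0..t} (norm (xi::'a)) \<partial>lborel)=ennreal (2 * t) * emeasure lborel (cball (0::'a) t)"
    using True by (simp add: nn_integral_cmult_indicator)
   also have "emeasure lborel (cball (0::'a) t)=ennreal (\<omega> * t ^ ?d)" using True by (simp add: emeasure_cball \<omega>_def)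
   also have "ennreal (2 * t) * ennreal (\<omega> * t ^ ?d)=ennreal (2 * \<omega> * t ^ (?d+1))"
    using True \<omega>0 by (subst ennreal_mult[symmetric]) (simp_all add: ac_simps)
   finally show ?thesis using True by simp
  qed simp
 qed
 also have "...=ennreal (2 * \<omega> / real (?d+2) * R ^ (?d+2) - 2 * \<omega> / real (?d+2) * 0 ^ (?d+2))"
 proof (rule nn_integral_FTC_Icc[where F="%t. 2 * \<omega> / real (?d+2) * t ^ (?d+2)"])
  fix t :: real
  have "((%t. t ^ (?d+2)) has_real_derivative real (?d+2) * t ^ (?d+2 - Suc 0)) (at t)"
   by (rule DERIV_pow)
  from DERIV_cmult[OF this, of "2 * \<omega> / real (?d+2)"]
  have "((%t. 2 * \<omega> / real (?d+2) * t ^ (?d+2)) has_real_derivative 2 * \<omega> * t ^ (?d+1)) (at t)"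
   by (simp add: mult.assoc)
  then show "((%t. 2 * \<omega> / real (?d+2) * t ^ (?d+2)) has_real_derivative 2 * \<omega> * t ^ (?d+1)) (at t)" .
  show "t : {0..R} ==> 0 <= 2 * \<omega> * t ^ (?d+1)" using \<omega>0 by simp
 qed (use R in simp_all)
 finally have "ennreal (LINT xi|lborel. ?g xi)=ennreal (2 * \<omega> / real (?d+2) * R ^ (?d+2))" by simp
 moreover have "0 <= (LINT xi|lborel. ?g xi)" by (rule Bochner_Integration.integral_nonneg) (rule g0)
 moreover have "0 <= 2 * \<omega> / real (?d+2) * R ^ (?d+2)" using R \<omega>0 by simp
 ultimately have g: "(LINT xi|lborel. ?g xi)=2 * \<omega> / real (?d+2) * R ^ (?d+2)" by simp
 have i0: "integ (indicator (cball (0::'a) R) :: 'a => real)"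
  using emeasure_compact_finite[of "cball (0::'a) R"] by (simp add: integrable_indicator_iff)
 have v: "(LINT xi|lborel. indicator (cball (0::'a) R) xi :: real)=\<omega> * R ^ ?d"
  using R by (simp add: content_cball \<omega>_def)
 have "indicator (cball 0 R) xi * (norm xi)\<^sup>2=R\<^sup>2 * indicator (cball 0 R) xi - ?g xi" for xi :: 'a by (auto simp: indicator_def)
 then have "(LINT xi|lborel. indicator (cball 0 R) xi * (norm (xi::'a))\<^sup>2)=(LINT xi|lborel. R\<^sup>2 * indicator (cball (0::'a) R) xi - ?g xi)" by simp
 also have "...=(LINT xi|lborel. R\<^sup>2 * indicator (cball (0::'a) R) xi) - (LINT xi|lborel. ?g xi)"
  by (rule Bochner_Integration.integral_diff[OF integrable_mult_right[OF i0] i2])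
 also have "...=R\<^sup>2 * (\<omega> * R ^ ?d) - 2 * \<omega> / real (?d+2) * R ^ (?d+2)" using v g by simp
 also have "...=\<omega> * (real ?d / (real ?d+2)) * R ^ (?d+2)" by (simp add: field_simps power_add power2_eq_square)
 finally show ?thesis by (simp only: \<omega>_def)
qed

section \<open>The eigenvalues of the Robin operator\<close>

text \<open>The integrand is odd.\<close>

lemma ball_first_moment:
 "(LINT xi|lborel. indicator (cball 0 R) xi * (xi \<bullet> (a::'a::euclidean_space)))=(0::real)"
proof -
 let ?f = "%xi. indicator (cball 0 R) xi * (xi \<bullet> a) :: real"
 have m: "distr lborel borel (%x::'a. - x)=lborel"
  by (subst (2) lborel_affine[of "-1" 0]) (simp_all add: density_1 one_ennreal_def[symmetric])
 have "(LINT xi|lborel. ?f xi)=(LINT xi|distr lborel borel (%x. - x). ?f xi)" by (simp only: m)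
 also have "...=(LINT xi|lborel. ?f (- xi))"
 proof (rule integral_distr)
  have "(%xi. xi \<bullet> a) : bmeas borel" by (intro borel_measurable_continuous_onI continuous_intros)
  then show "?f : bmeas borel" by (intro borel_measurable_times borel_measurable_indicator) simp_all
 qed simp
 also have "...=(LINT xi|lborel. - ?f xi)"
  by (rule Bochner_Integration.integral_cong) (simp_all add: indicator_def)
 also have "...=- (LINT xi|lborel. ?f xi)" by simp
 finally show ?thesis by simp
qed

lemma measure_open_pos:
 assumes "open S" "bounded S" "S ~= {}" shows "measure lebesgue (S :: 'a::euclidean_space set) > 0"
proof -
 have "emeasure lebesgue S ~= 0"
  using open_not_negligible[OF assms(1,3)] negligible_iff_emeasure0[of S] assms(1) by auto
 moreover have "emeasure lebesgue S=emeasure lborel S" using assms(1) by simp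
 moreover have "emeasure lborel S < \<infinity>" by (rule emeasure_bounded_finite[OF assms(2)])
 ultimately show ?thesis unfolding measure_def by (simp add: enn2real_positive_iff zero_less_iff_neq_zero)
qed

lemma sum_fun_apply: "(\<Sum>j\<in>I. f j) x=(\<Sum>j\<in>I. f j x)" for f :: "'i => 'a => 'b::comm_monoid_add"
 by (induction I rule: infinite_finite_induct) simp_all

lemma L2_inner_self:
 assumes "f : L2 M" shows "L2_inner M f f=cof (LINT x|M. (cmod (f x))\<^sup>2)"
proof -
 have "f x * cnj (f x)=cof ((cmod (f x))\<^sup>2)" for x using complex_norm_square[of "f x"] by simp
 then show ?thesis unfolding L2_inner_def by (simp only: integral_complex_of_real)
qed

lemma L2_semi_hilbert: "semi_hilbert (%c f x. c * f x) (L2 M) (L2_inner M)"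
proof unfold_locales
 fix a b :: complex and f g h :: "'a => complex" and X :: "nat => 'a => complex"
 show "(%x. a * (f+g) x)=(%x. a * f x)+(%x. a * g x)" "(%x. (a+b) * f x)=(%x. a * f x)+(%x. b * f x)"
  "(%x. a * (b * f x))=(%x. a * b * f x)" "(%x. 1 * f x)=f"
  by (simp_all add: fun_eq_iff algebra_simps)
 show "0 : L2 M" unfolding zero_fun_def L2_iff by simp
 assume f: "f : L2 M"
 show "(%x. a * f x) : L2 M" by (rule L2_cmult[OF f])
 show "0 <= Re (L2_inner M f f)" unfolding L2_inner_self[OF f] by (simp add: Bochner_Integration.integral_nonneg)
 assume g: "g : L2 M"
 show "f+g : L2 M" unfolding plus_fun_def by (rule L2_add[OF f g])
 show "L2_inner M (%x. a * f x) g=a * L2_inner M f g" unfolding L2_inner_def by (simp add: mult.assoc)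
 have "g x * cnj (f x)=cnj (f x * cnj (g x))" for x by (simp add: mult.commute)
 then show "L2_inner M g f=cnj (L2_inner M f g)" unfolding L2_inner_def by (simp only: Bochner_Integration.integral_cnj)
 assume h: "h : L2 M"
 show "L2_inner M (f+g) h=L2_inner M f h+L2_inner M g h"
  unfolding L2_inner_def using L2_inner_integrable[OF f h] L2_inner_integrable[OF g h] by (simp add: distrib_right)
next
 fix X :: "nat => 'a => complex"
 assume X: "!!n. X n : L2 M"
  and c: "!!e. e > 0 ==> EX N. \<forall>m\<ge>N. \<forall>n\<ge>N. Re (L2_inner M (X m - X n) (X m - X n)) < e"
 have e: "Re (L2_inner M (f - g) (f - g))=(LINT x|M. (cmod (f x - g x))\<^sup>2)" if "f : L2 M" "g : L2 M" for f g
  using L2_inner_self[OF L2_diff[OF that]] by (simp add: fun_diff_def)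
 have "\<exists>x\<in>L2 M. (%n. LINT t|M. (cmod (X n t - x t))\<^sup>2) ~~> 0"
  by (rule L2_complete[OF X]) (use c in "simp add: e[OF X X]")
 then show "\<exists>x\<in>L2 M. (%n. Re (L2_inner M (X n - x) (X n - x))) ~~> 0" using e[OF X] by auto
qed

text \<open>A finite supremum of natural numbers is attained.\<close>

lemma L2_dim_eq_enat:
 fixes M :: "'a measure" and E :: "('a => complex) set" and c :: nat
 defines "ind m \<equiv> EX u::nat => 'a => complex. (\<forall>j<m. u j : E) \<and>
  (\<forall>c. (AE x in M. (\<Sum>j<m. c j * u j x) = 0) --> (\<forall>j<m. c j = 0))"
 assumes "L2_dim M E=enat c"
 shows "ind c" "ind m ==> m <= c"
proof -
 have S: "Sup {enat m |m. ind m}=enat c" using assms(2) unfolding L2_dim_def ind_def .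
 show le: "m <= c" if "ind m" for m
 proof -
  have "enat m <= Sup {enat m |m. ind m}" by (rule Sup_upper) (use that in blast)
  then show ?thesis unfolding S by simp
 qed
 show "ind c"
 proof (rule ccontr)
  assume n: "\<not> ind c"
  have "ind 0" unfolding ind_def by simp
  then have c0: "c > 0" using n by (cases c) auto
  have "Sup {enat m |m. ind m} <= enat (c - 1)"
  proof (rule Sup_least)
   fix z assume "z : {enat m |m. ind m}"
   then obtain m where m: "z=enat m" "ind m" by blast
   then have "m <= c" "m ~= c" using le n by auto
   then show "z <= enat (c - 1)" using m by simp
  qed
  then show False unfolding S using c0 by simp
 qed
qed

locale robin_spectrum = robin_setting Om A V \<sigma> for Om :: "(real^'n) set" and A V \<sigma> +
 fixes lam :: "nat => real"
 assumes \<sigma>_neg: "AE x in surface_measure Om. \<sigma> x < 0" and nonempty: "Om ~= {}"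
  and resolvent: "compact_resolvent (lebesgue_on Om) (robin_operator Om A V \<sigma>)"
  and enumeration: "eigenvalue_enumeration (lebesgue_on Om) (robin_operator Om A V \<sigma>) lam"
  and lam_1: "0 < lam 1"
begin

abbreviation "T \<equiv> robin_operator Om A V \<sigma>"

sublocale L2: semi_hilbert "%c f x. c * f x" "L2 M" "L2_inner M" by (rule L2_semi_hilbert)

lemma nsq_eq: "f : L2 M ==> L2.nsq f=(LINT x|M. (cmod (f x))\<^sup>2)"
 by (simp add: L2.nsq_def L2_inner_self)

lemma nsq_zero_iff: "f : L2 M ==> L2.nsq f=0 \<longleftrightarrow> (AE x in M. f x=0)"
 using integral_nonneg_eq_0_iff_AE[OF L2_integrable_sq[of f M]] by (simp add: nsq_eq)

lemma T_D: "T u f ==> u : D" "T u f ==> f : L2 M" using robin_operator_iff by blast+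

lemma nsq_lincomb_zero_iff:
 assumes "!!j. j < m ==> us j : L2 M"
 shows "L2.nsq (\<Sum>j<m. (%x. c j * us j x))=0 \<longleftrightarrow> (AE x in M. (\<Sum>j<m. c j * us j x)=0)"
 by (subst nsq_zero_iff[OF L2.Hsum]) (use assms in "simp_all add: L2_cmult sum_fun_apply")

lemma robin_form_operator:
 "EX C. form_operator_compact (%c f x. c * f x) (L2 M) (L2_inner M) D B C T lam"
proof -
 obtain C where C: "!!u. u : D ==> N u / 2 <= R u u+C * (LINT x|M. (cmod (u x))\<^sup>2)" using R_lower by blast
 have CR: "!!f. f : L2 M ==> EX u. T u (%x. f x - u x)" "!!u. T u (%x. - u x) ==> AE x in M. u x=0"
  "!!f u. (\<forall>n::nat. f n : L2 M & T (u n) (%x. f n x - u n x)) & (EX C::real. \<forall>n. L2_normsq M (f n) <= ennreal C) ==>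
    \<exists>r w. strict_mono r & w : L2 M & L2_tendsto M (%n. u (r n)) w"
  using resolvent unfolding compact_resolvent_def by blast+
 have EE: "!!j. 1 <= j ==> lam j <= lam (Suc j)" "!!mu. finite {j. 1 <= j & lam j=mu}"
  "!!mu. L2_dim M (eigenspace T mu)=enat (card {j. 1 <= j & lam j=mu})"
  using enumeration unfolding eigenvalue_enumeration_def by blast+
 have "form_operator_compact (%c f x. c * f x) (L2 M) (L2_inner M) D B C T lam"
 proof (intro form_operator_compact.intro[OF L2_semi_hilbert] form_operator_compact_axioms.intro)
  fix u v w :: "real^'n => complex" and c :: complex
  assume u: "u : D"
  show "u : L2 M" by (rule D_L2[OF u])
  show "(%x. c * u x) : D" by (rule D_cmult[OF u])
  have "0 <= N u" by (simp add: Bochner_Integration.integral_nonneg)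
  then have "0 <= R u u+C * (LINT x|M. (cmod (u x))\<^sup>2)" using C[OF u] by linarith
  then show "- C * L2.nsq u <= Re (B u u)" unfolding B_self[OF u] nsq_eq[OF D_L2[OF u]] by simp
  show "w : D ==> B (%x. c * u x) w=c * B u w" by (rule B_scl[OF u])
  assume v: "v : D"
  show "u+v : D" unfolding plus_fun_def using D_lincomb[OF u v, of 1 1] by simp
  show "w : D ==> B (u+v) w=B u w+B v w" unfolding plus_fun_def by (rule B_add[OF u v])
  show "B v u=cnj (B u v)" by (rule B_cnj[OF u v])
  show "L2.nsq u=0 ==> B u v=0" unfolding nsq_eq[OF D_L2[OF u]] by (rule B_null[OF u v])
 next
  fix f :: "real^'n => complex" assume f: "f : L2 M"
  show "EX u. T u (f - u)" using CR(1)[OF f] by (simp add: fun_diff_def)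
  assume "!!v. v : D ==> L2_inner M f v=0"
  then show "L2.nsq f=0" unfolding nsq_eq[OF f] by (rule D_dense[OF f])
 next
  show "T u f \<longleftrightarrow> u : D & f : L2 M & (\<forall>v\<in>D. B u v=L2_inner M f v)" for u f by (rule robin_operator_iff)
 next
  fix u assume t: "T u (- u)"
  then have "AE x in M. u x=0" using CR(2)[of u] by (simp add: fun_Compl_def)
  then show "L2.nsq u=0" using nsq_zero_iff[OF D_L2[OF T_D(1)[OF t]]] by simp
 next
  fix fs us :: "nat => real^'n => complex" and K
  assume fs: "!!n. fs n : L2 M" and us: "!!n. T (us n) (fs n - us n)" and K: "!!n. L2.nsq (fs n) <= K"
  have "L2_normsq M (fs n) <= ennreal K" for n
   using K[of n] unfolding L2_normsq_eq[OF fs] nsq_eq[OF fs] by (rule ennreal_leI)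
  then have "(\<forall>n::nat. fs n : L2 M & T (us n) (%x. fs n x - us n x)) & (EX C::real. \<forall>n. L2_normsq M (fs n) <= ennreal C)"
   using fs us by (auto simp: fun_diff_def)
  from CR(3)[OF this] obtain r w where r: "strict_mono r" "w : L2 M" "L2_tendsto M (%n. us (r n)) w" by blast
  note uL = D_L2[OF T_D(1)[OF us]]
  have "(%n. L2.nsq (us (r n) - w)) ~~> 0"
   using r(3) unfolding L2_tendsto_iff[OF uL r(2)] fun_diff_def nsq_eq[OF L2_diff[OF uL r(2)]] .
  then show "\<exists>r w. strict_mono (r::nat => nat) & w : L2 M & (%n. L2.nsq (us (r n) - w)) ~~> 0" using r by blast
 next
  show "1 <= j ==> lam j <= lam (Suc j)" for j by (rule EE(1))
  show "0 < lam 1" by (rule lam_1)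
  show "finite {j. 1 <= j & lam j=mu}" for mu by (rule EE(2))
 next
  fix mu
  let ?c = "card {j. 1 <= j & lam j=mu}"
  obtain u where u: "!!j. j < ?c ==> u j : eigenspace T mu"
   "!!c. (AE x in M. (\<Sum>j<?c. c j * u j x)=0) ==> \<forall>j<?c. c j=0"
   using L2_dim_eq_enat(1)[OF EE(3)[of mu]] by blast
  have t: "T (u j) (%x. of_real mu * u j x)" if "j < ?c" for j using u(1)[OF that] unfolding eigenspace_def by simp
  have z: "\<forall>j<?c. c j=0" if "L2.nsq (\<Sum>j<?c. (%x. c j * u j x))=0" for c
   by (rule u(2)) (use that nsq_lincomb_zero_iff[of ?c u c] D_L2[OF T_D(1)[OF t]] in blast)
  show "EX u. (\<forall>j<?c. T (u j) (%x. of_real mu * u j x)) \<and>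
   (\<forall>c. L2.nsq (\<Sum>j<?c. (%x. c j * u j x)) = 0 --> (\<forall>j<?c. c j = 0))"
   by (rule exI[of _ u]) (use t z in blast)
 next
  fix m mu and us :: "nat => real^'n => complex"
  assume t: "!!j. j < m ==> T (us j) (%x. of_real mu * us j x)"
   and z: "!!cs. L2.nsq (\<Sum>j<m. (%x. cs j * us j x))=0 ==> \<forall>j<m. cs j=0"
  have a: "us j : eigenspace T mu" if "j < m" for j using t[OF that] unfolding eigenspace_def by simp
  have b: "\<forall>j<m. c j=0" if "AE x in M. (\<Sum>j<m. c j * us j x)=0" for c
   by (rule z) (use that nsq_lincomb_zero_iff[of m us c] D_L2[OF T_D(1)[OF t]] in blast)
  show "m <= card {j. 1 <= j & lam j=mu}"
   by (rule L2_dim_eq_enat(2)[OF EE(3)[of mu]], rule exI[of _ us]) (use a b in blast)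
 qed
 then show ?thesis by blast
qed

abbreviation "vol \<equiv> measure lebesgue Om"

lemma vol_M: "(LINT x|M. 1::real)=vol" and measure_M: "measure M Om=vol"
proof -
 show m: "measure M Om=vol" by (rule measure_restrict_space[OF Om_sets]) simp
 show "(LINT x|M. 1::real)=vol"
  using m lebesgue_integral_const[of M "1::real"] by (simp only: space_M real_scaleR_def mult_1_right)
qed

lemma vol_pos: "vol > 0" by (rule measure_open_pos[OF Om nonempty])

lemma eigenfunction_inequality:
 assumes "k >= 1"
 shows "EX U. (\<forall>j. integrable lborel (U j) & integrable lborel (%x. (cmod (U j x))\<^sup>2)) \<and>
  (\<forall>j\<in>{1..k}. (LINT x|lborel. (cmod (U j x))\<^sup>2) = 1) \<and>
  (\<forall>xi::real^'n. (\<Sum>j=1..k. lam j * (cmod (fourier (U j) xi))\<^sup>2) + lam (Suc k) * (vol - (\<Sum>j=1..k. (cmod (fourier (U j) xi))\<^sup>2))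
   <= (LINT x|M. (norm (xi - A x))\<^sup>2) + (LINT x|M. V x))"
proof -
 obtain C where "form_operator_compact (%c f x. c * f x) (L2 M) (L2_inner M) D B C T lam" using robin_form_operator by blast
 then interpret F: form_operator_compact "%c f x. c * f x" "L2 M" "L2_inner M" D B C T lam .
 obtain u :: "nat => real^'n => complex" where u: "!!j. j >= 1 ==> u j : D" "!!j. j >= 1 ==> L2.nsq (u j)=1"
  and ineq: "!!f k. f : D ==> (\<Sum>j=1..k. lam j * (cmod (L2_inner M f (u j)))\<^sup>2)
    + lam (Suc k) * (L2.nsq f - (\<Sum>j=1..k. (cmod (L2_inner M f (u j)))\<^sup>2)) <= Re (B f f)"
  using F.eigenvalue_inequality by blast
 have "EX U. integrable lborel U & integrable lborel (%x. (cmod (U x))\<^sup>2) \<and>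
  (j >= 1 --> (LINT x|lborel. (cmod (U x))\<^sup>2) = 1 & (\<forall>xi::real^'n. L2_inner M (%x. iexp (xi \<bullet> x)) (u j) = fourier U xi))" for j
 proof (cases "j >= 1")
  case True
  note L = D_L2[OF u(1)[OF True]]
  obtain U where U: "U : bmeas borel" "!!x. x ~: Om ==> U x=0" "AE x in M. u j x=U x"
   using lebesgue_borel_representative[OF L2_measurable[OF L] Om(1)] by blast
  have sm: "(%x. (cmod (u j x))\<^sup>2) : bmeas M" "(%x. (cmod (U x))\<^sup>2) : bmeas borel" using L2_measurable[OF L] U(1) by simp_all
  have sa: "AE x in M. (cmod (u j x))\<^sup>2=(cmod (U x))\<^sup>2" using U(3) by eventually_elim simp
  note t = lebesgue_on_transfer[OF L2_measurable[OF L] Om(1) U]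
  note t2 = lebesgue_on_transfer[OF sm(1) Om(1) sm(2) _ sa]
  have i: "integ U" "integ (%x. (cmod (U x))\<^sup>2)" "(LINT x|lborel. (cmod (U x))\<^sup>2)=1"
   using t(2) t2 L2_imp_integrable[OF M_finite L] L2_integrable_sq[OF L] U(2) u(2)[OF True] nsq_eq[OF L] by simp_all
  have "L2_inner M (%x. iexp (xi \<bullet> x)) (u j)=fourier U xi" for xi :: "real^'n"
   unfolding L2_inner_def fourier_def
  proof (rule lebesgue_on_transfer(1)[OF _ Om(1)])
   note e = L2_measurable[OF D_L2[OF plane_wave(1)[OF \<sigma>_neg]]]
   have eb: "(%x. iexp (xi \<bullet> x)) : bmeas borel" by measurable
   show "(%x. iexp (xi \<bullet> x) * cnj (u j x)) : bmeas M"
    by (rule borel_measurable_times[OF e cnj_measurable_compose[OF L2_measurable[OF L]]])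
   show "(%x. iexp (xi \<bullet> x) * cnj (U x)) : bmeas borel"
    by (rule borel_measurable_times[OF eb cnj_measurable_compose[OF U(1)]])
   show "AE x in M. iexp (xi \<bullet> x) * cnj (u j x)=iexp (xi \<bullet> x) * cnj (U x)" using U(3) by eventually_elim simp
  qed (simp add: U(2))
  then show ?thesis using i by blast
 next
  case False
  then show ?thesis by (intro exI[of _ "%x. 0"]) simp
 qed
 then have "\<forall>j. EX U. integrable lborel U & integrable lborel (%x. (cmod (U x))\<^sup>2) \<and>
  (j >= 1 --> (LINT x|lborel. (cmod (U x))\<^sup>2) = 1 & (\<forall>xi::real^'n. L2_inner M (%x. iexp (xi \<bullet> x)) (u j) = fourier U xi))" ..
 from choice[OF this] obtain U where U: "!!j. integ (U j)" "!!j. integ (%x. (cmod (U j x))\<^sup>2)"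
  "!!j. j >= 1 ==> (LINT x|lborel. (cmod (U j x))\<^sup>2)=1"
  "!!j xi. j >= 1 ==> L2_inner M (%x. iexp (xi \<bullet> x)) (u j)=fourier (U j) xi" by blast
 have "(\<Sum>j=1..k. lam j * (cmod (fourier (U j) xi))\<^sup>2) + lam (Suc k) * (vol - (\<Sum>j=1..k. (cmod (fourier (U j) xi))\<^sup>2))
   <= (LINT x|M. (norm (xi - A x))\<^sup>2) + (LINT x|M. V x)" for xi :: "real^'n"
 proof -
  let ?e = "%x. iexp (xi \<bullet> x)"
  note p = plane_wave[OF \<sigma>_neg, of xi]
  have "L2.nsq ?e=vol" unfolding nsq_eq[OF D_L2[OF p(1)]] by (simp add: space_M measure_M)
  moreover have "(\<Sum>j=1..k. lam j * (cmod (L2_inner M ?e (u j)))\<^sup>2)=(\<Sum>j=1..k. lam j * (cmod (fourier (U j) xi))\<^sup>2)"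
   "(\<Sum>j=1..k. (cmod (L2_inner M ?e (u j)))\<^sup>2)=(\<Sum>j=1..k. (cmod (fourier (U j) xi))\<^sup>2)"
   by (intro sum.cong refl; simp add: U(4))+
  ultimately show ?thesis using ineq[OF p(1), of k] p(2) unfolding B_self[OF p(1)] by simp
 qed
 then show ?thesis using U(1,2,3) by (intro exI[of _ U]) auto
qed

lemma kroeger_radius:
 fixes k n :: nat and c :: real
 assumes k: "k >= 1" and n: "n >= 1" and c: "c > 0"
 shows "\<exists>r>0. c * r ^ n = real k * (2 * pi) ^ n \<and>
  real k * r\<^sup>2 = (2 * pi)\<^sup>2 * c powr (- 2 / real n) * real k powr (1 + 2 / real n)"
proof (intro exI conjI)
 define s where "s=real k * (2 * pi) ^ n / c"
 define r where "r=s powr (1 / real n)"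
 have s: "s > 0" using k c by (simp add: s_def)
 show r: "r > 0" using s by (simp add: r_def)
 have "r ^ n=r powr real n" using r by (simp add: powr_realpow)
 also have "...=s" using s n by (simp add: r_def powr_powr)
 finally show "c * r ^ n=real k * (2 * pi) ^ n" using c by (simp add: s_def)
 have "r\<^sup>2=r powr 2" using r by (simp add: powr_numeral)
 also have "...=s powr (2 / real n)" by (simp add: r_def powr_powr)
 also have "...=real k powr (2 / real n) * ((2 * pi) ^ n) powr (2 / real n) / c powr (2 / real n)"
  using k c by (simp add: s_def powr_divide powr_mult)
 also have "((2 * pi) ^ n) powr (2 / real n)=(2 * pi) powr 2"
 proof -
  have h: "(2 * pi) powr real n=(2 * pi) ^ n" by (rule powr_realpow) simp
  show ?thesis unfolding h[symmetric] powr_powr using n by simp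
 qed
 also have "(2 * pi) powr 2=(2 * pi)\<^sup>2" by (simp add: powr_numeral)
 finally have r2: "r\<^sup>2=real k powr (2 / real n) * (2 * pi)\<^sup>2 * c powr (- 2 / real n)"
  using c by (simp add: powr_minus_divide)
 have "real k powr (1+2 / real n)=real k * real k powr (2 / real n)" using k by (simp add: powr_add)
 then show "real k * r\<^sup>2=(2 * pi)\<^sup>2 * c powr (- 2 / real n) * real k powr (1+2 / real n)" unfolding r2 by simp
qed

text \<open>The radius of \<open>kroeger_radius\<close> makes the coefficient of \<open>lam (k + 1)\<close> vanish.\<close>

theorem eigenvalue_sum_bound:
 assumes k: "k >= 1"
 shows "(\<Sum>j=1..k. lam j) <= kroeger_const Om k+real k * ((LINT x|M. (norm (A x))\<^sup>2)+(LINT x|M. V x)) / vol"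
proof -
 define d where "d=CARD('n)"
 have dD: "DIM(real^'n)=d" by (simp add: d_def)
 define \<omega> where "\<omega>=unit_ball_vol (real d)"
 have \<omega>: "\<omega> > 0" by (simp add: \<omega>_def)
 obtain r where r: "r > 0" "\<omega> * vol * r ^ d=real k * (2 * pi) ^ d"
  "real k * r\<^sup>2=(2 * pi)\<^sup>2 * (\<omega> * vol) powr (- 2 / real d) * real k powr (1+2 / real d)"
  using kroeger_radius[OF k, of d "\<omega> * vol"] card \<omega> vol_pos unfolding d_def by auto
 obtain U where U: "!!j. integ (U j)" "!!j. integ (%x. (cmod (U j x))\<^sup>2)"
  "!!j. j : {1..k} ==> (LINT x|lborel. (cmod (U j x))\<^sup>2)=1"
  and ineq: "!!xi::real^'n. (\<Sum>j=1..k. lam j * (cmod (fourier (U j) xi))\<^sup>2) + lam (Suc k) * (vol - (\<Sum>j=1..k. (cmod (fourier (U j) xi))\<^sup>2))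
   <= (LINT x|M. (norm (xi - A x))\<^sup>2) + (LINT x|M. V x)" using eigenfunction_inequality[OF k] by blast
 define L where "L=lam (Suc k)"
 have mono: "lam i <= lam (Suc i)" if "i >= 1" for i using enumeration that unfolding eigenvalue_enumeration_def by blast
 have le: "lam j <= L" if "j : {1..k}" for j
 proof -
  have "lam j <= lam (j+i)" for i using that by (induction i) (auto intro: order_trans[OF _ mono])
  from this[of "Suc k - j"] show ?thesis using that by (simp add: L_def)
 qed
 define a where "a=(LINT x|M. A x)"
 define \<alpha> where "\<alpha>=(LINT x|M. (norm (A x))\<^sup>2)"
 define v where "v=(LINT x|M. V x)"
 have Ai: "integrable M A" by (rule L2_imp_integrable[OF M_finite A])
 interpret fM: finite_measure M by (rule finite_measureI) (use M_finite in simp)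
 have expand: "(LINT x|M. (norm (xi - A x))\<^sup>2)=(norm xi)\<^sup>2 * vol - 2 * (xi \<bullet> a)+\<alpha>" for xi
 proof -
  have "(norm (xi - A x))\<^sup>2=(norm xi)\<^sup>2 * 1 - 2 * (xi \<bullet> A x)+(norm (A x))\<^sup>2" for x
   by (simp add: power2_norm_eq_inner inner_diff inner_commute)
  then have "(LINT x|M. (norm (xi - A x))\<^sup>2)=(LINT x|M. (norm xi)\<^sup>2 * 1 - 2 * (xi \<bullet> A x)+(norm (A x))\<^sup>2)" by simp
  also have "...=(norm xi)\<^sup>2 * vol - 2 * (xi \<bullet> a)+\<alpha>"
  proof -
   have "integrable M (%x. (norm xi)\<^sup>2 * (1::real))" "integrable M (%x. 2 * (xi \<bullet> A x))" "integrable M (%x. (norm (A x))\<^sup>2)"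
    using Ai L2_integrable_sq[OF A] by simp_all
   moreover have "(LINT x|M. (norm xi)\<^sup>2 * (1::real))=(norm xi)\<^sup>2 * vol"
    by (simp only: Bochner_Integration.integral_mult_right_zero vol_M)
   moreover have "(LINT x|M. 2 * (xi \<bullet> A x))=2 * (xi \<bullet> a)" unfolding a_def using Ai by simp
   ultimately show ?thesis unfolding \<alpha>_def by (simp only: Bochner_Integration.integral_add Bochner_Integration.integral_diff Bochner_Integration.integrable_diff)
  qed
  finally show ?thesis .
 qed
 let ?I = "%xi. indicator (cball 0 r) xi :: real"
 define P where "P j=(LINT xi|lborel. ?I xi * (cmod (fourier (U j) xi))\<^sup>2)" for j
 have Pi: "integ (%xi. ?I xi * (cmod (fourier (U j) xi))\<^sup>2)" for j by (rule fourier_bessel_ball(1)[OF U(1,2)])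
 have P: "P j <= (2 * pi) ^ d" if "j : {1..k}" for j
  unfolding P_def using fourier_bessel_ball(2)[OF U(1,2), of r j] U(3)[OF that] dD by simp
 have Ii: "integ (%xi::real^'n. ?I xi)"
  using emeasure_compact_finite[of "cball (0::real^'n) r"] by (simp add: integrable_indicator_iff)
 have bv: "(LINT xi|lborel. indicator (cball (0::real^'n) r) xi :: real)=\<omega> * r ^ d"
  using r(1) by (simp add: content_cball \<omega>_def d_def)
 have nI: "integ (%xi::real^'n. ?I xi * (norm xi)\<^sup>2)" "integ (%xi. ?I xi * (xi \<bullet> a))"
  using borel_integrable_compact[of "cball (0::real^'n) r" "%xi. (norm xi)\<^sup>2"] borel_integrable_compact[of "cball (0::real^'n) r" "%xi. xi \<bullet> a"]
  by (simp_all add: continuous_intros)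
 have ptw: "(\<Sum>j=1..k. (lam j - L) * (?I xi * (cmod (fourier (U j) xi))\<^sup>2)) + (L * vol) * ?I xi
  <= vol * (?I xi * (norm xi)\<^sup>2) - 2 * (?I xi * (xi \<bullet> a)) + (\<alpha> + v) * ?I xi" for xi
 proof -
  have "(\<Sum>j=1..k. lam j * (cmod (fourier (U j) xi))\<^sup>2) + lam (Suc k) * (vol - (\<Sum>j=1..k. (cmod (fourier (U j) xi))\<^sup>2))
   = (\<Sum>j=1..k. (lam j - L) * (cmod (fourier (U j) xi))\<^sup>2) + L * vol"
   by (simp add: L_def left_diff_distrib right_diff_distrib sum_subtractf sum_distrib_left)
  then have "(\<Sum>j=1..k. (lam j - L) * (cmod (fourier (U j) xi))\<^sup>2)+L * vol <= (norm xi)\<^sup>2 * vol - 2 * (xi \<bullet> a)+\<alpha>+v"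
   using ineq[of xi] unfolding expand v_def by simp
  then show ?thesis by (auto simp: indicator_def algebra_simps)
 qed
 have "(\<Sum>j=1..k. (lam j - L) * (2 * pi) ^ d) <= (\<Sum>j=1..k. (lam j - L) * P j)"
  by (intro sum_mono mult_left_mono_neg P) (use le in "simp_all")
 then have "(\<Sum>j=1..k. (lam j - L) * (2 * pi) ^ d)+(L * vol) * (\<omega> * r ^ d) <= (\<Sum>j=1..k. (lam j - L) * P j)+(L * vol) * (\<omega> * r ^ d)" by simp
 also have "...=(LINT xi|lborel. (\<Sum>j=1..k. (lam j - L) * (?I xi * (cmod (fourier (U j) xi))\<^sup>2))+(L * vol) * ?I xi)"
 proof -
  have i: "integ (%xi. \<Sum>j=1..k. (lam j - L) * (?I xi * (cmod (fourier (U j) xi))\<^sup>2))" using Pi by simp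
  have "(LINT xi|lborel. (\<Sum>j=1..k. (lam j - L) * (?I xi * (cmod (fourier (U j) xi))\<^sup>2)))=(\<Sum>j=1..k. (lam j - L) * P j)"
   using Pi by (simp add: P_def)
  moreover have "(LINT xi|lborel. (L * vol) * indicator (cball (0::real^'n) r) xi)=(L * vol) * (\<omega> * r ^ d)"
   by (simp only: integral_mult_right_zero bv)
  ultimately show ?thesis using Bochner_Integration.integral_add[OF i integrable_mult_right[OF Ii, of "L * vol"]] by (simp only:)
 qed
 also have "... <= (LINT xi|lborel. vol * (?I xi * (norm xi)\<^sup>2) - 2 * (?I xi * (xi \<bullet> a))+(\<alpha>+v) * ?I xi)"
  by (rule integral_mono) (use Pi Ii nI ptw in simp_all)
 also have "...=vol * (LINT xi|lborel. ?I xi * (norm (xi::real^'n))\<^sup>2) - 2 * (LINT xi|lborel. ?I xi * (xi \<bullet> a))+(\<alpha>+v) * (LINT xi|lborel. indicator (cball (0::real^'n) r) xi)"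
  using Ii nI by simp
 also have "...=vol * (\<omega> * (real d / (real d+2)) * r ^ (d+2))+(\<alpha>+v) * (\<omega> * r ^ d)"
  unfolding ball_first_moment ball_second_moment[OF r(1)] bv dD \<omega>_def by simp
 finally have fin: "(\<Sum>j=1..k. (lam j - L) * (2 * pi) ^ d) + L * (\<omega> * vol * r ^ d)
  <= (\<omega> * vol * r ^ d) * (real d / (real d + 2)) * r\<^sup>2 + (\<alpha> + v) * ((\<omega> * vol * r ^ d) / vol)"
  using vol_pos by (simp add: power_add power2_eq_square algebra_simps)
 define p where "p=(2 * pi) ^ d"
 have p: "p > 0" by (simp add: p_def)
 have "(\<Sum>j=1..k. (lam j - L) * p)=p * (\<Sum>j=1..k. lam j) - real k * L * p"
  unfolding sum_distrib_right[symmetric] sum_subtractf by (simp add: algebra_simps)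
 with fin have "p * (\<Sum>j=1..k. lam j) <= p * ((real d / (real d+2)) * (real k * r\<^sup>2)+real k * (\<alpha>+v) / vol)"
  unfolding r(2) p_def[symmetric] by (simp add: algebra_simps)
 then have "(\<Sum>j=1..k. lam j) <= (real d / (real d+2)) * (real k * r\<^sup>2)+real k * (\<alpha>+v) / vol" using p by simp
 also have "(real d / (real d+2)) * (real k * r\<^sup>2)=kroeger_const Om k"
  unfolding r(3) kroeger_const_def Let_def d_def[symmetric] \<omega>_def by (simp add: mult.assoc)
 finally show ?thesis unfolding \<alpha>_def v_def .
qed

end

theorem theorem3p8:
  fixes \<Omega> :: "(real^'n) set"
    and A :: "real^'n \<Rightarrow> real^'n"
    and V \<sigma> :: "real^'n \<Rightarrow> real"
    and lam :: "nat \<Rightarrow> real"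
    and k :: nat
  assumes "CARD('n) \<ge> 2"
    and "open \<Omega>" "connected \<Omega>" "\<Omega> \<noteq> {}" "bounded \<Omega>" "smooth_boundary \<Omega>"
    and "A \<in> L2_loc \<Omega>"
    and "V \<in> L1_loc \<Omega>" "AE x in lebesgue_on \<Omega>. 0 \<le> V x"
    and "\<sigma> \<in> L_infty (surface_measure \<Omega>)"
    and "AE x in surface_measure \<Omega>. \<sigma> x < 0"
    and "compact_resolvent (lebesgue_on \<Omega>) (robin_operator \<Omega> A V \<sigma>)"
    and "eigenvalue_enumeration (lebesgue_on \<Omega>) (robin_operator \<Omega> A V \<sigma>) lam"
    and "0 < lam 1" "lam 1 < lam 2" "\<forall>j\<ge>2. lam j \<le> lam (Suc j)"
    and "k \<ge> 1"
  shows "ereal (\<Sum>j=1..k. lam j)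
         \<le> ereal (kroeger_const \<Omega> k)
           + (real k)\<^sup>2 * enn2ereal (L2_normsq (lebesgue_on \<Omega>) A) / measure lebesgue \<Omega>
           + real k * enn2ereal (L1_norm (lebesgue_on \<Omega>) V) / measure lebesgue \<Omega>"
proof -
  let ?M = "lebesgue_on \<Omega>"
  interpret trace_domain \<Omega> by (rule trace_domain.intro) (use assms in blast)+
  have vol: "measure lebesgue \<Omega> > 0" by (rule measure_open_pos[OF assms(2,5,4)])
  define X where "X = L2_normsq ?M A"
  define Y where "Y = L1_norm ?M V"
  have k0: "real k > 0" using assms(17) by simp
  show ?thesis
  proof (cases "X = \<infinity> \<or> Y = \<infinity>")
    case True
    have "0 \<le> enn2ereal X" "0 \<le> enn2ereal Y" by simp_all
    with True have inf: "ereal ((real k)\<^sup>2) * enn2ereal X / ereal (measure lebesgue \<Omega>) + ereal (real k) * enn2ereal Y / ereal (measure lebesgue \<Omega>) = \<infinity>"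
      using k0 vol by (cases "enn2ereal X"; cases "enn2ereal Y") (auto simp: divide_ereal_def)
    show ?thesis unfolding X_def[symmetric] Y_def[symmetric] add.assoc inf by simp
  next
    case False
    then have fin: "X < \<infinity>" "Y < \<infinity>" by (simp_all add: less_top)
    have A: "A \<in> L2 ?M" using assms(7) fin(1) unfolding L2_def L2_loc_def X_def by blast
    have V: "integrable ?M V" by (rule integrableI_bounded) (use assms(8) fin(2) in \<open>simp_all add: L1_loc_def Y_def L1_norm_def\<close>)
    interpret robin_spectrum \<Omega> A V \<sigma> lam
      by unfold_locales (use assms A V in blast)+
    define \<alpha> where "\<alpha> = (LINT x|?M. (norm (A x))\<^sup>2)"
    define v where "v = (LINT x|?M. V x)"
    have \<alpha>0: "\<alpha> \<ge> 0" by (simp add: \<alpha>_def Bochner_Integration.integral_nonneg)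
    have X: "X = ennreal \<alpha>" unfolding X_def \<alpha>_def by (rule L2_normsq_eq[OF A])
    have vn: "v = (LINT x|?M. norm (V x))" unfolding v_def
      by (rule integral_cong_AE) (use V assms(9) in auto)
    then have v0: "v \<ge> 0" by (simp add: Bochner_Integration.integral_nonneg)
    have Y: "Y = ennreal v" unfolding Y_def vn by (rule L1_norm_eq[OF V])
    have "(\<Sum>j=1..k. lam j) \<le> kroeger_const \<Omega> k + real k * (\<alpha> + v) / measure lebesgue \<Omega>"
      unfolding \<alpha>_def v_def by (rule eigenvalue_sum_bound[OF assms(17)])
    also have "\<dots> \<le> kroeger_const \<Omega> k + (real k)\<^sup>2 * \<alpha> / measure lebesgue \<Omega> + real k * v / measure lebesgue \<Omega>"
    proof -
      have "real k * 1 \<le> real k * real k" by (rule mult_left_mono) (use assms(17) in simp_all)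
      then have "real k * \<alpha> \<le> (real k)\<^sup>2 * \<alpha>" by (intro mult_right_mono \<alpha>0) (simp add: power2_eq_square)
      then have "real k * \<alpha> / measure lebesgue \<Omega> \<le> (real k)\<^sup>2 * \<alpha> / measure lebesgue \<Omega>" by (rule divide_right_mono) (use vol in simp)
      then show ?thesis by (simp add: distrib_left add_divide_distrib)
    qed
    finally have "ereal (\<Sum>j=1..k. lam j) \<le> ereal (kroeger_const \<Omega> k + (real k)\<^sup>2 * \<alpha> / measure lebesgue \<Omega> + real k * v / measure lebesgue \<Omega>)" by simp
    then show ?thesis unfolding X_def[symmetric] Y_def[symmetric] X Y using \<alpha>0 v0 vol by simp
  qed
qed

end
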